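(* Assume the Riemann hypothesis. Then for every fixed real $x>0$, $$\lim_{\tau\to\infty}\frac1\tau\left\{\sum_{T<t_0(n)<\varphi_1^{-1}(T)}Z^2(t_0(n))\,[\xi_2(n)-\xi_1(n)]\right\}=x,\qquad\text{where } T=\frac{x}{1-c}\,\tau,$$ and where $$\gamma_n<\xi_1(n)<t_0(n)<\xi_2(n)<\gamma_{n+1},\qquad n=1,\dots,N(T).$$ Here $c$ is Euler's constant, $\varphi_1$ is Jacob's ladder, $\gamma_1<\dots<\gamma_{N(T)+1}$ are the zeros of $Z$ in $(T,\varphi_1^{-1}(T))$, $t_0(n)$ is the maximum point of $Z^2$ between $\gamma_n$ and $\gamma_{n+1}$, $\xi_1(n),\xi_2(n)$ are the corresponding Bonnet points, and the sum runs over $n=1,\dots,N(T)$.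
   Context: $Z(t)=e^{i\vartheta(t)}\zeta(\tfrac12+it)$ is Riemann's real function, with $\vartheta(t)=-\tfrac t2\ln\pi+\operatorname{Im}\ln\Gamma(\tfrac14+\tfrac{it}{2})$, so $|Z(t)|=|\zeta(\tfrac12+it)|$. $c$ denotes Euler's constant. Jacob's ladder: fix a smooth function $\mu$ increasing to $+\infty$ with $\mu(y)\ge 7y\ln y$. For all sufficiently large $T$ let $\varphi(T)$ be the (unique, large) solution $X=\varphi(T)$ of $\int_0^{\mu(X)}Z^2(t)e^{-2t/X}\,dt=\int_0^TZ^2(t)\,dt$, and put $\varphi_1(T)=\tfrac12\varphi(T)$. The function $\varphi_1$ is continuous and strictly increasing to $+\infty$, and $\varphi_1^{-1}$ is its inverse, defined for all large $T$; one has $\varphi_1^{-1}(T)>T$. Zeros: for large $T$, $\gamma_1<\gamma_2<\dots<\gamma_N<\gamma_{N+1}$, $N=N(T)$, are all the distinct zeros of $Z$ (equivalently of $\zeta(\tfrac12+it)$) lying in the open interval $(T,\varphi_1^{-1}(T))$, in increasing order (the index $n$ is relative to $T$). For $n=1,\dots,N(T)$, $t_0=t_0(n)\in(\gamma_n,\gamma_{n+1})$ is the point with $Z'(t_0)=0$ and $Z^2(t_0)=\max_{\gamma_n\le t\le\gamma_{n+1}}Z^2(t)$ (on the Riemann hypothesis, for $T$ sufficiently large, $Z'$ has exactly one zero in $(\gamma_n,\gamma_{n+1})$). The Bonnet points are $$\xi_1(n)=t_0-\frac1{Z^2(t_0)}\int_{\gamma_n}^{t_0}Z^2(t)\,dt,\qquad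 \xi_2(n)=t_0+\frac1{Z^2(t_0)}\int_{t_0}^{\gamma_{n+1}}Z^2(t)\,dt .$$ The sum over $T<t_0(n)<\varphi_1^{-1}(T)$ means the sum over $n=1,\dots,N(T)$. All statements involving $T$ are for sufficiently large $T$. *)

theory Defs
  imports "HOL-Complex_Analysis.Complex_Analysis"
begin

(* The analytic continuation of the Dirichlet series to the plane without the pole at 1.
   The value at the pole is irrelevant; it is fixed only to make the function unique. *)
definition zeta :: "complex \<Rightarrow> complex" where
  "zeta = (THE f. f holomorphic_on (- {1}) \<and> f 1 = 0 \<and>
             (\<forall>s. Re s > 1 \<longrightarrow> (\<lambda>n. 1 / of_nat (Suc n) powr s) sums f s))"

definition riemann_hypothesis :: bool where
  "riemann_hypothesis \<longleftrightarrow> (\<forall>s. 0 < Re s \<and> Re s < 1 \<and> zeta s = 0 \<longrightarrow> Re s = 1 / 2)"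

(* ln_Gamma is the branch of log Gamma that is holomorphic off the nonpositive real axis and
   real on the positive one; theta is therefore continuous in t with theta 0 = 0. *)
definition rs_theta :: "real \<Rightarrow> real" where
  "rs_theta t = - t / 2 * ln pi + Im (ln_Gamma (Complex (1 / 4) (t / 2)))"

(* The complex number under Re is real by the functional equation, so Re only changes the type. *)
definition hardy_Z :: "real \<Rightarrow> real" where
  "hardy_Z t = Re (exp (\<i> * of_real (rs_theta t)) * zeta (Complex (1 / 2) t))"

(* Admissible functions are given on a ray y > y0 with y0 >= 0. *)
definition admissible :: "real \<Rightarrow> (real \<Rightarrow> real) \<Rightarrow> bool" where
  "admissible y0 \<mu> \<longleftrightarrow>
     (\<forall>k. \<forall>y>y0. (deriv ^^ k) \<mu> field_differentiable at y) \<and>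
     mono_on {y0<..} \<mu> \<and>
     filterlim \<mu> at_top at_top \<and>
     (\<forall>y>y0. \<mu> y \<ge> 7 * y * ln y)"

(* The left-hand side is strictly increasing and continuous in X wherever it is positive, and
   unbounded, so for every sufficiently large T there is exactly one solution X > y0. *)
definition ladder_phi :: "real \<Rightarrow> (real \<Rightarrow> real) \<Rightarrow> real \<Rightarrow> real" where
  "ladder_phi y0 \<mu> T = (THE X. X > y0 \<and>
     integral {0..\<mu> X} (\<lambda>t. (hardy_Z t)\<^sup>2 * exp (- 2 * t / X)) = integral {0..T} (\<lambda>t. (hardy_Z t)\<^sup>2))"

definition ladder_phi1 :: "real \<Rightarrow> (real \<Rightarrow> real) \<Rightarrow> real \<Rightarrow> real" where
  "ladder_phi1 y0 \<mu> T = ladder_phi y0 \<mu> T / 2"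

(* Meaningful for large T: those U > 0 for which the ladder equation has no solution share
   a single junk value of ladder_phi1, which no sufficiently large T equals. *)
definition ladder_phi1_inv :: "real \<Rightarrow> (real \<Rightarrow> real) \<Rightarrow> real \<Rightarrow> real" where
  "ladder_phi1_inv y0 \<mu> T = (THE U. U > 0 \<and> ladder_phi1 y0 \<mu> U = T)"

definition Z_zeros :: "real \<Rightarrow> (real \<Rightarrow> real) \<Rightarrow> real \<Rightarrow> real set" where
  "Z_zeros y0 \<mu> T = {t. T < t \<and> t < ladder_phi1_inv y0 \<mu> T \<and> hardy_Z t = 0}"

(* The zeros are gamma_1 < ... < gamma_{N+1}, so N is one less than their number. *)
definition num_gaps :: "real \<Rightarrow> (real \<Rightarrow> real) \<Rightarrow> real \<Rightarrow> nat" where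
  "num_gaps y0 \<mu> T = card (Z_zeros y0 \<mu> T) - 1"

(* Indexed from 1. *)
definition Z_zero :: "real \<Rightarrow> (real \<Rightarrow> real) \<Rightarrow> real \<Rightarrow> nat \<Rightarrow> real" where
  "Z_zero y0 \<mu> T n = sorted_list_of_set (Z_zeros y0 \<mu> T) ! (n - 1)"

definition is_max_point :: "real \<Rightarrow> real \<Rightarrow> real \<Rightarrow> bool" where
  "is_max_point a b t \<longleftrightarrow> a < t \<and> t < b \<and> (hardy_Z has_real_derivative 0) (at t) \<and>
     (\<forall>s\<in>{a..b}. (hardy_Z s)\<^sup>2 \<le> (hardy_Z t)\<^sup>2)"

definition bonnet_left :: "real \<Rightarrow> real \<Rightarrow> real" where
  "bonnet_left a t = t - 1 / (hardy_Z t)\<^sup>2 * integral {a..t} (\<lambda>s. (hardy_Z s)\<^sup>2)"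

definition bonnet_right :: "real \<Rightarrow> real \<Rightarrow> real" where
  "bonnet_right t b = t + 1 / (hardy_Z t)\<^sup>2 * integral {t..b} (\<lambda>s. (hardy_Z s)\<^sup>2)"

end

theory Submission
  imports Defs "HOL-Probability.Probability" "HOL-Real_Asymp.Real_Asymp"
begin

text \<open>
  By the definition of \<open>\<xi>\<^sub>1\<close> and \<open>\<xi>\<^sub>2\<close> each summand is the integral of \<open>Z\<^sup>2\<close> over the gap, so the sum telescopes to
  the integral of \<open>Z\<^sup>2\<close> over the range from the first to the last zero in the window \<open>(T, U)\<close>, \<open>U = \<phi>\<^sub>1\<^sup>-\<^sup>1(T)\<close>.
  With \<open>I(T)\<close> the integral of \<open>Z\<^sup>2\<close> over \<open>[0, T]\<close>, it therefore suffices that \<open>I(U) - I(T) \<sim> (1 - c) T\<close>,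
  that \<open>I(T + 2) - I(T) = o(T)\<close>, and that there are zeros within distance 2 of both ends of the window.

  The first two facts follow from \<open>I(T) = T ln T + C T + o(T)\<close>: the ladder equation says
  \<open>I(U) = \<integral> Z\<^sup>2(t) e\<^bsup>-t/T\<^esup> dt + o(T)\<close>, which by partial integration is \<open>\<integral> I(T u) e\<^bsup>-u\<^esup> du + o(T)\<close>, and
  \<open>\<integral> u ln u e\<^bsup>-u\<^esup> du = 1 - c\<close>.

  For the mean value, Mellin inversion represents \<open>M(z) = \<integral> \<Gamma>(s) \<zeta>(s)\<^sup>2 z\<^bsup>-s\<^esup>\<close>, taken over \<open>Re s = 1/2\<close>, as a
  Lambert series in \<open>e\<^bsup>-z\<^esup>\<close> minus the residue at \<open>s = 1\<close>. The series has period \<open>2\<pi>\<i>\<close>, and at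
  \<open>z = 2\<pi>\<i> e\<^bsup>-\<i>p\<^esup>\<close> the function \<open>M\<close> is the Laplace transform of \<open>Z\<^sup>2\<close> at \<open>p\<close> up to a bounded error. Shifting
  by the period to a point near 0, where \<open>M\<close> is small, leaves only residues, namely \<open>(C' - ln p) / p\<close>. Since this holds for
  complex \<open>p\<close> with a power saving, the Perron formula yields the asymptotics of \<open>\<integral> (T - t) Z\<^sup>2(t) dt\<close>, and monotonicity
  those of \<open>I\<close>.

  For the zeros, suppose that \<open>Z\<close> has none in \<open>(T - 1, T + 1)\<close> for arbitrarily large \<open>T\<close>. Under the Riemann hypothesis the
  functions \<open>\<zeta>(z + \<i>T)\<close> then vanish nowhere on a fixed rectangle and grow at most polynomially in \<open>T\<close>, so the powers
  \<open>\<zeta>(z + \<i>T)\<^bsup>1/ln T\<^esup>\<close> form a normal family. A limit has modulus 1 for \<open>Re z > 2\<close>, hence is constant, but modulus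
  greater than 1 at \<open>z = -1\<close> by the functional equation.
\<close>

section \<open>Parametric integrals and integration over the half line\<close>

text \<open>The terms \<open>T ln T\<close> of \<open>I(T)\<close> and of its exponentially weighted
  mean agree, and so do the terms \<open>C T\<close>; what remains of the difference is
  \<open>(1 - c) T\<close>, where \<open>1 - c\<close> is the derivative of \<open>Gamma\<close> at
  2. So \<open>I(T)\<close> is needed with error \<open>o(T)\<close>, and the behaviour of the
  Laplace transform at real \<open>p\<close> alone does not give that precision. Along
  \<open>Re p = 1/T\<close> the error is small for \<open>|p|\<close> up to
  \<open>T^(1/8) / T\<close>; beyond that a bound of size \<open>ln T\<close> suffices against the
  decay of the Perron kernel.

  The exponent \<open>1/ln T\<close> is the one under which powers of \<open>T\<close> become
  constants: \<open>|zeta(-1 + iT)|\<close> is at least a multiple of \<open>T\<close>, and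
  \<open>T^(1/ln T) = e\<close>. The Riemann hypothesis speaks of the open strip only, so zeros with
  \<open>Re s >= 1\<close> or \<open>Re s <= 0\<close> off the real axis have to be excluded
  unconditionally.

  \<open>zeta\<close> is defined by a description, so nothing is known about it until a continuation
  has been constructed; it is assembled from a Mellin integral and a functional equation.\<close>

lemma holomorphic_on_integral:
  fixes f :: "complex \<Rightarrow> 'a \<Rightarrow> complex"
  assumes "open S"
    and hol: "\<And>x. x \<in> space M \<Longrightarrow> (\<lambda>s. f s x) holomorphic_on S"
    and meas: "\<And>s. s \<in> S \<Longrightarrow> f s \<in> borel_measurable M"
    and dom: "\<And>s0. s0 \<in> S \<Longrightarrow> \<exists>r>0. \<exists>g. integrable M g \<and>
           (\<forall>s\<in>ball s0 r. s \<in> S \<longrightarrow> (\<forall>x\<in>space M. norm (f s x) \<le> g x))"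
  shows "(\<lambda>s. \<integral>x. f s x \<partial>M) holomorphic_on S"
proof -
  have "(\<lambda>s. \<integral>x. f s x \<partial>M) field_differentiable (at s0)" if s0: "s0 \<in> S" for s0
  proof -
    obtain r g where r: "r > 0" and g: "integrable M g"
      and bd: "\<And>s x. s \<in> ball s0 r \<Longrightarrow> s \<in> S \<Longrightarrow> x \<in> space M \<Longrightarrow> norm (f s x) \<le> g x"
      using dom[OF s0] by blast
    obtain r' where r': "r' > 0" "ball s0 r' \<subseteq> S" using \<open>open S\<close> s0 openE by blast
    define R where "R = min r r' / 2"
    have R: "R > 0" "cball s0 R \<subseteq> S" "cball s0 R \<subseteq> ball s0 r"
      using r r' by (auto simp: R_def subset_iff dist_norm)
    define f' where "f' = (\<lambda>x. deriv (\<lambda>s. f s x) s0)"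
    have intf: "integrable M (f s)" if "s \<in> cball s0 R" for s
      by (rule Bochner_Integration.integrable_bound[OF g meas])
         (use that R bd in \<open>force+\<close>)
    have der: "((\<lambda>s. f s x) has_field_derivative f' x) (at s0)" if "x \<in> space M" for x
      unfolding f'_def using holomorphic_derivI[OF hol[OF that] \<open>open S\<close> s0] by blast
    \<comment> \<open>The majorant of the integrand also controls its difference quotients: Cauchy's
      inequality on discs of radius \<open>R/2\<close>, which stay inside \<open>cball s0 R\<close>,
      bounds the derivative by \<open>2 / R * g x\<close>.\<close>
    have qb: "norm ((f s x - f s0 x) / (s - s0)) \<le> 2 / R * g x"
      if s: "s \<in> ball s0 (R/2)" "s \<noteq> s0" and x: "x \<in> space M" for s x
    proof -
      have gx: "g x \<ge> 0" by (rule order_trans[OF norm_ge_zero bd[OF _ s0 x]]) (use r in simp)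
      have "norm (f s x - f s0 x) \<le> (2 / R * g x) * norm (s - s0)"
      proof (rule field_differentiable_bound[where S="ball s0 (R/2)" and f="\<lambda>s. f s x" and B="2 / R * g x" and f'="\<lambda>w. deriv (\<lambda>s. f s x) w"])
        show "convex (ball s0 (R/2))" by simp
        fix w assume w: "w \<in> ball s0 (R/2)"
        have wS: "w \<in> S" using w R by (auto simp: subset_iff)
        show "((\<lambda>s. f s x) has_field_derivative deriv (\<lambda>s. f s x) w) (at w within ball s0 (R/2))"
          using holomorphic_derivI[OF hol[OF x] \<open>open S\<close> wS] .
        have sub: "cball w (R/2) \<subseteq> cball s0 R"
        proof
          fix v assume "v \<in> cball w (R/2)"
          thus "v \<in> cball s0 R" using w dist_triangle[of s0 v w] by (auto simp: dist_commute)
        qed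
        have "norm ((deriv ^^ 1) (\<lambda>s. f s x) w) \<le> fact 1 * g x / (R/2)^1"
        proof (rule Cauchy_inequality)
          show "(\<lambda>s. f s x) holomorphic_on ball w (R/2)"
            by (rule holomorphic_on_subset[OF hol[OF x]]) (use sub R ball_subset_cball in blast)
          show "continuous_on (cball w (R/2)) (\<lambda>s. f s x)"
            by (rule holomorphic_on_imp_continuous_on, rule holomorphic_on_subset[OF hol[OF x]]) (use sub R in auto)
          show "0 < R/2" using R by simp
          fix v assume v: "norm (w - v) = R/2"
          have "v \<in> cball s0 R" using sub v by (auto simp: dist_norm)
          thus "norm (f v x) \<le> g x" using bd R x by blast
        qed
        thus "norm (deriv (\<lambda>s. f s x) w) \<le> 2 / R * g x" by (simp add: mult.commute)
      qed (use s R in auto)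
      thus ?thesis using s R(1) by (simp add: norm_divide divide_simps)
    qed
    have "((\<lambda>s. (\<integral>x. f s x \<partial>M)) has_field_derivative (\<integral>x. f' x \<partial>M)) (at s0)"
      unfolding has_field_derivative_iff
    proof (subst tendsto_at_iff_sequentially, intro allI impI)
      fix X assume X: "\<forall>i. X i \<in> UNIV - {s0}" "X \<longlonglongrightarrow> s0"
      then obtain N where N: "\<And>n. n \<ge> N \<Longrightarrow> X n \<in> ball s0 (R/2)"
        using R by (metis (no_types, lifting) dist_commute half_gt_zero lim_sequentially mem_ball)
      define Y where "Y = (\<lambda>n. X (n + N))"
      have Y: "Y n \<in> ball s0 (R/2)" "Y n \<noteq> s0" for n using N X by (auto simp: Y_def)
      have Yl: "Y \<longlonglongrightarrow> s0" unfolding Y_def using X LIMSEQ_ignore_initial_segment by blast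
      have YS: "Y n \<in> S" for n using Y[of n] R by (auto simp: subset_iff)
      have lim: "(\<lambda>n. (f (Y n) x - f s0 x) / (Y n - s0)) \<longlonglongrightarrow> f' x" if "x \<in> space M" for x
        using der[OF that] Y Yl unfolding has_field_derivative_iff tendsto_at_iff_sequentially
        by (auto simp: o_def)
      have mq: "(\<lambda>x. (f (Y n) x - f s0 x) / (Y n - s0)) \<in> borel_measurable M" for n
        using meas[OF YS[of n]] meas[OF s0] by measurable
      have "(\<lambda>n. \<integral>x. (f (Y n) x - f s0 x) / (Y n - s0) \<partial>M) \<longlonglongrightarrow> (\<integral>x. f' x \<partial>M)"
      proof (rule integral_dominated_convergence[where w="\<lambda>x. 2 / R * g x"])
        show "f' \<in> borel_measurable M"
          by (rule borel_measurable_LIMSEQ_metric[OF mq lim])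
        show "AE x in M. (\<lambda>n. (f (Y n) x - f s0 x) / (Y n - s0)) \<longlonglongrightarrow> f' x"
          using lim by auto
        show "integrable M (\<lambda>x. 2 / R * g x)" using g by simp
        show "AE x in M. norm ((f (Y n) x - f s0 x) / (Y n - s0)) \<le> 2 / R * g x" for n
          using qb Y by auto
      qed (rule mq)
      moreover have "(\<integral>x. (f (Y n) x - f s0 x) / (Y n - s0) \<partial>M) =
          ((\<integral>x. f (Y n) x \<partial>M) - (\<integral>x. f s0 x \<partial>M)) / (Y n - s0)" for n
        using intf[of "Y n"] intf[of s0] Y[of n] R by (simp add: Bochner_Integration.integral_diff)
      ultimately have "(\<lambda>n. ((\<integral>x. f (Y n) x \<partial>M) - (\<integral>x. f s0 x \<partial>M)) / (Y n - s0)) \<longlonglongrightarrow> (\<integral>x. f' x \<partial>M)"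
        by (simp add: Y(2))
      hence "(\<lambda>n. ((\<lambda>y. ((\<integral>x. f y x \<partial>M) - (\<integral>x. f s0 x \<partial>M)) / (y - s0)) \<circ> X) (n + N)) \<longlonglongrightarrow> (\<integral>x. f' x \<partial>M)"
        by (simp add: Y_def o_def)
      thus "((\<lambda>y. ((\<integral>x. f y x \<partial>M) - (\<integral>x. f s0 x \<partial>M)) / (y - s0)) \<circ> X) \<longlonglongrightarrow> (\<integral>x. f' x \<partial>M)"
        by (rule LIMSEQ_offset)
    qed
    thus ?thesis by (auto simp: field_differentiable_def)
  qed
  thus ?thesis using \<open>open S\<close> by (auto simp: holomorphic_on_def field_differentiable_at_within)
qed

lemma (in pair_sigma_finite) integrable_pair_mult:
  fixes f g :: "_ \<Rightarrow> 'c::{real_normed_field, banach, second_countable_topology}"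
  assumes f: "integrable M1 f" and g: "integrable M2 g"
  shows "integrable (M1 \<Otimes>\<^sub>M M2) (\<lambda>(x, y). f x * g y)"
proof (rule Fubini_integrable)
  have [measurable]: "f \<in> borel_measurable M1" "g \<in> borel_measurable M2" using f g by auto
  show "(\<lambda>(x, y). f x * g y) \<in> borel_measurable (M1 \<Otimes>\<^sub>M M2)" by measurable
  show "integrable M1 (\<lambda>x. \<integral>y. norm (case (x, y) of (x, y) \<Rightarrow> f x * g y) \<partial>M2)"
    using f by (simp add: norm_mult)
qed (use g in auto)

text \<open>Gaussian summability. The factor \<open>exp (-(e * eta)^2 / 2)\<close> makes the double
  integral absolutely convergent, and after Fubini the inner integral is the characteristic function
  of the normal distribution. What remains is a mean of \<open>f\<close> against a Gaussian of width
  \<open>e\<close> around 0. Integrability of \<open>F\<close> on one side, continuity and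
  boundedness of \<open>f\<close> on the other, allow \<open>e -> 0\<close>.\<close>

lemma Fourier_inversion_at_0:
  fixes f :: "real \<Rightarrow> complex"
  assumes f: "integrable lborel f" and cont: "continuous_on UNIV f"
    and bd: "\<And>x. norm (f x) \<le> B"
    and F: "\<And>\<eta>. F \<eta> = (\<integral>y. f y * exp (\<i> * of_real (\<eta> * y)) \<partial>lborel)"
    and Fint: "integrable lborel F"
  shows "(\<integral>\<eta>. F \<eta> \<partial>lborel) = 2 * of_real pi * f 0"
proof -
  let ?g = "\<lambda>e \<eta>. complex_of_real (exp (-(e * \<eta>)\<^sup>2 / 2))"
  let ?n = "\<lambda>x. std_normal_density x"
  have fm[measurable]: "f \<in> borel_measurable borel" using cont by (rule borel_measurable_continuous_onI)
  have Fm[measurable]: "F \<in> borel_measurable borel" using Fint by auto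
  have gauss: "(\<integral>x. complex_of_real (?n x) * exp (\<i> * of_real (t * x)) \<partial>lborel) = of_real (exp (-(t\<^sup>2)/2))" for t
  proof -
    have "char std_normal_distribution t = (CLINT x|lborel. ?n x *\<^sub>R exp (\<i> * complex_of_real (t * x)))"
      unfolding char_def by (subst integral_density) auto
    thus ?thesis by (simp add: char_std_normal_distribution scaleR_conv_of_real)
  qed
  have nint: "integrable lborel ?n" by (simp add: integrable_normal_density)
  have ni: "(\<integral>x. ?n x \<partial>lborel) = 1" by (simp add: integral_normal_density)
  have key: "(\<integral>x. F x * ?g e x \<partial>lborel) = 2 * of_real pi * (\<integral>x. of_real (?n x) * f (- e * x) \<partial>lborel)"
    if e: "e > 0" for e
  proof -
    have gn: "?g e \<eta> = of_real (sqrt (2 * pi)) * of_real (?n (e * \<eta>))" for \<eta>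
    proof -
      have "exp (-(e * \<eta>)\<^sup>2 / 2) = sqrt (2 * pi) * ?n (e * \<eta>)"
        by (simp add: std_normal_density_def)
      thus ?thesis by (simp only: of_real_mult)
    qed
    have int1: "integrable lborel (\<lambda>\<eta>. ?n (e * \<eta>))"
      using lborel_integrable_real_affine[OF nint, of e 0] e by simp
    have inner: "(\<integral>\<eta>. of_real (?n (e * \<eta>)) * exp (\<i> * of_real (\<eta> * y)) \<partial>lborel)
       = of_real (1/e) * of_real (exp (-((y/e)\<^sup>2)/2))" for y
    proof -
      have "(\<integral>x. complex_of_real (?n x) * exp (\<i> * of_real ((y/e) * x)) \<partial>lborel) =
        \<bar>e\<bar> *\<^sub>R (\<integral>\<eta>. complex_of_real (?n (0 + e * \<eta>)) * exp (\<i> * of_real ((y/e) * (0 + e * \<eta>))) \<partial>lborel)"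
        by (rule lborel_integral_real_affine) (use e in simp)
      thus ?thesis using e by (simp only: gauss) (simp add: scaleR_conv_of_real field_simps mult_ac)
    qed
    have i2: "integrable (lborel \<Otimes>\<^sub>M lborel)
       (\<lambda>(\<eta>, y). of_real (?n (e * \<eta>)) * (f y * exp (\<i> * of_real (\<eta> * y))))"
    proof -
      have "integrable (lborel \<Otimes>\<^sub>M lborel) (\<lambda>(\<eta>, y). complex_of_real (?n (e * \<eta>)) * f y)"
        using int1 f by (intro lborel_pair.integrable_pair_mult) auto
      thus ?thesis
        by (rule Bochner_Integration.integrable_bound) (auto simp: norm_mult split_beta')
    qed
    have "(\<integral>x. F x * ?g e x \<partial>lborel) = of_real (sqrt (2 * pi)) *
       (\<integral>\<eta>. (\<integral>y. of_real (?n (e * \<eta>)) * (f y * exp (\<i> * of_real (\<eta> * y))) \<partial>lborel) \<partial>lborel)"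
    proof -
      have "F \<eta> * ?g e \<eta> = of_real (sqrt (2 * pi)) *
         (\<integral>y. of_real (?n (e * \<eta>)) * (f y * exp (\<i> * of_real (\<eta> * y))) \<partial>lborel)" for \<eta>
        unfolding integral_mult_right_zero F[symmetric] gn by (simp only: mult_ac)
      thus ?thesis by simp
    qed
    also have "\<dots> = of_real (sqrt (2 * pi)) *
       (\<integral>y. (\<integral>\<eta>. of_real (?n (e * \<eta>)) * (f y * exp (\<i> * of_real (\<eta> * y))) \<partial>lborel) \<partial>lborel)"
      using lborel_pair.Fubini_integral[OF i2] by simp
    also have "\<dots> = of_real (sqrt (2 * pi)) *
       (\<integral>y. f y * (of_real (1/e) * of_real (exp (-((y/e)\<^sup>2)/2))) \<partial>lborel)"
    proof -
      have "(\<integral>\<eta>. of_real (?n (e * \<eta>)) * (f y * exp (\<i> * of_real (\<eta> * y))) \<partial>lborel)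
          = f y * (of_real (1/e) * of_real (exp (-((y/e)\<^sup>2)/2)))" for y
        unfolding inner[symmetric] integral_mult_right_zero[symmetric] by (simp only: mult_ac)
      thus ?thesis by simp
    qed
    also have "\<dots> = of_real (sqrt (2 * pi)) * (\<bar>-e\<bar> *\<^sub>R
       (\<integral>x. f (0 + -e * x) * (of_real (1/e) * of_real (exp (-(((0 + -e * x)/e)\<^sup>2)/2))) \<partial>lborel))"
      by (subst lborel_integral_real_affine[where c="-e" and t=0]) (use e in auto)
    also have "\<dots> = of_real (sqrt (2 * pi)) * (\<integral>x. f (- e * x) * of_real (exp (-(x\<^sup>2)/2)) \<partial>lborel)"
      using e by (simp add: scaleR_conv_of_real mult_ac)
    also have "\<dots> = of_real (sqrt (2 * pi)) * (\<integral>x. of_real (sqrt (2*pi)) * (of_real (?n x) * f (- e * x)) \<partial>lborel)"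
    proof -
      have "complex_of_real (exp (-(x\<^sup>2)/2)) = of_real (sqrt (2*pi)) * of_real (?n x)" for x
        unfolding of_real_mult[symmetric] by (simp add: std_normal_density_def)
      thus ?thesis by (simp only: mult_ac)
    qed
    also have "\<dots> = 2 * of_real pi * (\<integral>x. of_real (?n x) * f (- e * x) \<partial>lborel)"
    proof -
      have "complex_of_real (sqrt (2*pi)) * of_real (sqrt (2*pi)) = 2 * of_real pi"
        unfolding of_real_mult[symmetric] by simp
      thus ?thesis by (simp only: integral_mult_right_zero) (simp only: mult.assoc[symmetric])
    qed
    finally show ?thesis .
  qed
  define E where "E = (\<lambda>n. 1 / real (Suc n))"
  have E0: "E \<longlonglongrightarrow> 0" unfolding E_def by (rule LIMSEQ_Suc[OF lim_1_over_n])
  have L1: "(\<lambda>n. \<integral>x. F x * ?g (E n) x \<partial>lborel) \<longlonglongrightarrow> (\<integral>x. F x \<partial>lborel)"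
  proof (rule integral_dominated_convergence[where w="\<lambda>x. norm (F x)"])
    show "AE x in lborel. (\<lambda>n. F x * ?g (E n) x) \<longlonglongrightarrow> F x"
    proof (rule AE_I2)
      fix x
      have "(\<lambda>n. F x * ?g (E n) x) \<longlonglongrightarrow> F x * of_real (exp (-(0 * x)\<^sup>2 / 2))"
        by (intro tendsto_intros E0) simp
      thus "(\<lambda>n. F x * ?g (E n) x) \<longlonglongrightarrow> F x" by simp
    qed
  qed (use Fint in \<open>auto simp: norm_mult mult_left_le\<close>)
  have L2: "(\<lambda>n. \<integral>x. of_real (?n x) * f (- E n * x) \<partial>lborel) \<longlonglongrightarrow> (\<integral>x. of_real (?n x) * f 0 \<partial>lborel)"
  proof (rule integral_dominated_convergence[where w="\<lambda>x. ?n x * B"])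
    show "AE x in lborel. (\<lambda>n. of_real (?n x) * f (- E n * x)) \<longlonglongrightarrow> of_real (?n x) * f 0"
    proof (rule AE_I2)
      fix x
      have "(\<lambda>n. f (- E n * x)) \<longlonglongrightarrow> f (- 0 * x)"
        by (rule continuous_on_tendsto_compose[OF cont tendsto_mult[OF tendsto_minus[OF E0] tendsto_const]]) auto
      thus "(\<lambda>n. of_real (?n x) * f (- E n * x)) \<longlonglongrightarrow> of_real (?n x) * f 0"
        by (intro tendsto_intros) simp
    qed
  qed (use nint bd in \<open>auto simp: norm_mult intro!: mult_left_mono\<close>)
  have "(\<integral>x. of_real (?n x) * f 0 \<partial>lborel) = f 0"
    by (simp add: ni)
  hence "(\<lambda>n. 2 * of_real pi * (\<integral>x. of_real (?n x) * f (- E n * x) \<partial>lborel)) \<longlonglongrightarrow> 2 * of_real pi * f 0"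
    using tendsto_mult_left[OF L2] by simp
  moreover have "E n > 0" for n by (simp add: E_def)
  ultimately have "(\<lambda>n. \<integral>x. F x * ?g (E n) x \<partial>lborel) \<longlonglongrightarrow> 2 * of_real pi * f 0"
    by (simp only: key)
  with L1 show ?thesis using LIMSEQ_unique by blast
qed

section \<open>Integration over the positive half line and its substitutions\<close>

abbreviation hl :: "real measure" where "hl \<equiv> restrict_space lborel {0<..}"

lemma space_hl [simp]: "space hl = {0<..}"
  by (simp add: space_restrict_space)

lemma hl_measurable: "continuous_on {0<..} f \<Longrightarrow> f \<in> borel_measurable hl"
  using borel_measurable_continuous_on_restrict[of "{0<..}" f]
  by (subst measurable_cong_sets[OF _ refl, of _ "restrict_space borel {0<..}"])
     (auto intro!: sets_restrict_space_cong)

lemma hl_measurable_borel [measurable (raw)]: "f \<in> borel_measurable borel \<Longrightarrow> f \<in> borel_measurable hl"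
  by (rule measurable_restrict_space1) simp

lemma hl_integrable_iff:
  fixes f :: "real \<Rightarrow> 'a::{banach, second_countable_topology}"
  shows "integrable hl f \<longleftrightarrow> set_integrable lborel {0<..} f"
  unfolding set_integrable_def by (subst integrable_restrict_space) auto

lemma hl_integral:
  fixes f :: "real \<Rightarrow> 'a::{banach, second_countable_topology}"
  shows "(\<integral>x. f x \<partial>hl) = (LINT x:{0<..}|lborel. f x)"
  unfolding set_lebesgue_integral_def by (subst integral_restrict_space) auto

interpretation hl: sigma_finite_measure hl
  by (rule sigma_finite_measure_restrict_space) (auto intro: lborel.sigma_finite_measure_axioms)

interpretation lborel_hl: pair_sigma_finite lborel hl ..

interpretation hl_hl: pair_sigma_finite hl hl ..

text \<open>Passes from absolute gauge integrability, which lives on the completed Lebesgue measure,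
  to the Bochner integral over Borel sets; Borel measurability therefore has to be supplied
  separately.\<close>

lemma hl_absolutely_integrable:
  fixes f :: "real \<Rightarrow> 'a::euclidean_space"
  assumes "f absolutely_integrable_on {0<..}" and "f \<in> borel_measurable hl"
  shows "integrable hl f"
proof -
  have "(\<lambda>x. indicator {0<..} x *\<^sub>R f x) \<in> borel_measurable lborel"
    using assms(2) by (subst (asm) borel_measurable_restrict_space_iff) auto
  thus ?thesis
    using assms(1) unfolding hl_integrable_iff set_integrable_def
    by (subst (asm) integrable_completion) auto
qed

lemma hl_integral_eq_integral:
  fixes f :: "real \<Rightarrow> 'a::euclidean_space"
  assumes "integrable hl f"
  shows "f integrable_on {0<..}" "(\<integral>x. f x \<partial>hl) = integral {0<..} f"
  using set_borel_integral_eq_integral[of "{0<..}" f] assms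
  by (auto simp: hl_integrable_iff hl_integral)

lemma hl_scale:
  fixes f :: "real \<Rightarrow> 'a::{banach, second_countable_topology}"
  assumes "c > 0"
  shows "(\<integral>x. f x \<partial>hl) = c *\<^sub>R (\<integral>x. f (c * x) \<partial>hl)"
    and "integrable hl (\<lambda>x. f (c * x)) \<longleftrightarrow> integrable hl f"
proof -
  have ind: "indicator {0<..} (c * x) = (indicator {0<..} x :: real)" for x :: real
    using assms by (auto simp: indicator_def zero_less_mult_iff)
  show "(\<integral>x. f x \<partial>hl) = c *\<^sub>R (\<integral>x. f (c * x) \<partial>hl)"
    unfolding hl_integral set_lebesgue_integral_def
    using lborel_integral_real_affine[of c "\<lambda>x. indicator {0<..} x *\<^sub>R f x" 0] assms by (simp add: ind)
  show "integrable hl (\<lambda>x. f (c * x)) \<longleftrightarrow> integrable hl f"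
    unfolding hl_integrable_iff set_integrable_def
    using lborel_integrable_real_affine_iff[of c "\<lambda>x. indicator {0<..} x *\<^sub>R f x" 0] assms by (simp add: ind)
qed

text \<open>With \<open>x = exp u\<close> a Mellin integral becomes a Fourier integral over the
  whole line, to which \<open>Fourier_inversion_at_0\<close> applies.\<close>

lemma hl_exp_subst:
  fixes f :: "real \<Rightarrow> complex"
  assumes "integrable hl f"
  shows "integrable lborel (\<lambda>u. exp u *\<^sub>R f (exp u))"
    and "(\<integral>u. exp u *\<^sub>R f (exp u) \<partial>lborel) = (\<integral>x. f x \<partial>hl)"
proof -
  have rng: "range exp = ({0<..} :: real set)" by (auto simp: image_iff) (metis exp_ln)
  have [measurable]: "(\<lambda>x. indicator {0<..} x *\<^sub>R f x) \<in> borel_measurable borel"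
    using assms unfolding hl_integrable_iff set_integrable_def by auto
  have "(\<lambda>u. exp u *\<^sub>R (indicator {0<..} (exp u) *\<^sub>R f (exp u))) \<in> borel_measurable borel"
    by measurable
  hence m: "(\<lambda>u. exp u *\<^sub>R f (exp u)) \<in> borel_measurable borel" by simp
  have ai: "f absolutely_integrable_on {0<..}"
    using assms unfolding hl_integrable_iff set_integrable_def
    by (subst integrable_completion) auto
  have "(\<lambda>x. \<bar>exp x\<bar> *\<^sub>R f (exp x)) absolutely_integrable_on UNIV \<and>
      integral UNIV (\<lambda>x. \<bar>exp x\<bar> *\<^sub>R f (exp x)) = integral {0<..} f"
    by (subst has_absolute_integral_change_of_variables_real[where g=exp and h=exp])
       (use ai in \<open>auto simp: rng inj_on_def intro!: derivative_eq_intros\<close>)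
  hence 1: "(\<lambda>x. exp x *\<^sub>R f (exp x)) absolutely_integrable_on UNIV"
      "integral UNIV (\<lambda>x. exp x *\<^sub>R f (exp x)) = integral {0<..} f" by auto
  show i: "integrable lborel (\<lambda>u. exp u *\<^sub>R f (exp u))"
    using 1(1) m unfolding set_integrable_def by (subst (asm) integrable_completion) auto
  show "(\<integral>u. exp u *\<^sub>R f (exp u) \<partial>lborel) = (\<integral>x. f x \<partial>hl)"
    using set_borel_integral_eq_integral(2)[of UNIV "\<lambda>u. exp u *\<^sub>R f (exp u)"] i 1(2)
      hl_integral_eq_integral(2)[OF assms]
    by (simp add: set_integrable_def set_lebesgue_integral_def)
qed

section \<open>The Gamma function on vertical lines\<close>

text \<open>The identity theorem, with the positive reals accumulating at 1. It carries formulas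
  obtained by real scaling over to complex parameters.\<close>

lemma right_half_plane_eqI:
  assumes f: "f holomorphic_on {w. Re w > 0}" and g: "g holomorphic_on {w. Re w > 0}"
    and eq: "\<And>a. a > 0 \<Longrightarrow> f (of_real a) = g (of_real a)" and w: "Re w > 0"
  shows "f w = g w"
proof -
  have "f w - g w = 0"
  proof (rule analytic_continuation[where f="\<lambda>w. f w - g w" and w=w and S="{w. Re w > 0}" and U="of_real ` {0<..}" and \<xi>=1])
    show "(\<lambda>w. f w - g w) holomorphic_on {w. Re w > 0}" using f g by (intro holomorphic_intros)
    show "open {w. Re w > 0}" by (rule open_halfspace_Re_gt)
    show "connected {w. Re w > 0}" by (intro convex_connected convex_halfspace_Re_gt)
    show "(1::complex) islimpt of_real ` {0<..}"
      unfolding islimpt_approachable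
    proof (intro allI impI)
      fix e :: real assume "e > 0"
      thus "\<exists>x'\<in>complex_of_real ` {0<..}. x' \<noteq> 1 \<and> dist x' 1 < e"
        by (intro bexI[OF _ imageI[of "1 + e/2"]]) (auto simp: dist_norm)
    qed
  qed (use eq w in auto)
  thus ?thesis by simp
qed

lemma powr_hl_measurable [measurable]: "(\<lambda>x. complex_of_real x powr s) \<in> borel_measurable hl"
  by (rule hl_measurable) (auto intro!: continuous_intros)

lemma Gamma_integrand_integrable:
  assumes "Re s > 0" "Re w > 0"
  shows "integrable hl (\<lambda>x. of_real x powr (s - 1) * exp (- (w * of_real x)))"
proof (rule Bochner_Integration.integrable_bound)
  show "integrable hl (\<lambda>t. complex_of_real t powr (s - 1) / of_real (exp (Re w * t)))"
    by (rule hl_absolutely_integrable[OF absolutely_integrable_Gamma_integral[OF assms]]) measurable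
qed (auto intro!: AE_I2 simp: norm_mult norm_divide exp_minus divide_simps)

text \<open>For real \<open>w\<close> this is the scaling \<open>x -> w x\<close>. Both sides are
  holomorphic in \<open>w\<close>, so no contour has to be rotated.\<close>

lemma Gamma_integral_rotated:
  assumes s: "Re s > 0" and w: "Re w > 0"
  shows "(\<integral>x. of_real x powr (s - 1) * exp (- (w * of_real x)) \<partial>hl) = Gamma s * w powr (- s)"
proof (rule right_half_plane_eqI[where w=w and f="\<lambda>w. \<integral>x. of_real x powr (s - 1) * exp (- (w * of_real x)) \<partial>hl"])
  show "(\<lambda>w. \<integral>x. of_real x powr (s - 1) * exp (- (w * of_real x)) \<partial>hl) holomorphic_on {w. Re w > 0}"
  proof (rule holomorphic_on_integral)
    show "open {w. Re w > 0}" by (rule open_halfspace_Re_gt)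
    fix w0 :: complex assume w0: "w0 \<in> {w. Re w > 0}"
    show "\<exists>r>0. \<exists>g. integrable hl g \<and> (\<forall>w\<in>ball w0 r. w \<in> {w. Re w > 0} \<longrightarrow>
        (\<forall>x\<in>space hl. norm (of_real x powr (s - 1) * exp (- (w * of_real x))) \<le> g x))"
    proof (intro exI[of _ "Re w0 / 2"] exI[of _ "\<lambda>x. norm (of_real x powr (s - 1) * exp (- (of_real (Re w0 / 2) * of_real x)))"] conjI ballI impI)
      show "integrable hl (\<lambda>x. norm (of_real x powr (s - 1) * exp (- (of_real (Re w0 / 2) * of_real x))))"
        by (intro integrable_norm Gamma_integrand_integrable) (use s w0 in auto)
      fix w x assume wx: "w \<in> ball w0 (Re w0 / 2)" "x \<in> space hl"
      have "Re w0 / 2 \<le> Re w"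
        using wx(1) abs_Re_le_cmod[of "w0 - w"] by (auto simp: dist_norm)
      thus "norm (of_real x powr (s - 1) * exp (- (w * of_real x)))
          \<le> norm (of_real x powr (s - 1) * exp (- (of_real (Re w0 / 2) * of_real x)))"
        using wx(2) by (auto simp: norm_mult intro!: mult_left_mono)
    qed (use w0 in auto)
  qed (auto intro!: holomorphic_intros)
  show "(\<lambda>w. Gamma s * w powr (- s)) holomorphic_on {w. Re w > 0}"
    by (auto intro!: holomorphic_intros simp: complex_nonpos_Reals_iff)
  fix a :: real assume a: "a > 0"
  have "integral {0<..} (\<lambda>t. complex_of_real t powr (s - 1) / of_real (exp t)) = Gamma s"
    using Gamma_integral_complex'[OF s] by (rule integral_unique)
  moreover have "integrable hl (\<lambda>t. complex_of_real t powr (s - 1) / of_real (exp t))"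
    by (rule hl_absolutely_integrable[OF absolutely_integrable_Gamma_integral'[OF s]]) measurable
  ultimately have "Gamma s = (\<integral>x. complex_of_real x powr (s - 1) / of_real (exp x) \<partial>hl)"
    by (simp add: hl_integral_eq_integral)
  also have "\<dots> = a *\<^sub>R (\<integral>x. complex_of_real (a * x) powr (s - 1) / of_real (exp (a * x)) \<partial>hl)"
    by (rule hl_scale(1)[OF a])
  also have "\<dots> = a *\<^sub>R (\<integral>x. of_real a powr (s - 1) * (of_real x powr (s - 1) * exp (- (of_real a * of_real x))) \<partial>hl)"
  proof -
    have "complex_of_real (a * x) powr (s - 1) / of_real (exp (a * x)) =
        of_real a powr (s - 1) * (of_real x powr (s - 1) * exp (- (of_real a * of_real x)))" if "x > 0" for x
      using a that by (simp add: powr_times_real exp_minus field_simps flip: exp_of_real)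
    thus ?thesis by (intro arg_cong2[where f=scaleR] Bochner_Integration.integral_cong refl) auto
  qed
  also have "\<dots> = of_real a powr s * (\<integral>x. of_real x powr (s - 1) * exp (- (of_real a * of_real x)) \<partial>hl)"
  proof -
    have "of_real a * complex_of_real a powr (s - 1) = of_real a powr s" using a by (simp add: powr_diff)
    thus ?thesis by (simp only: scaleR_conv_of_real integral_mult_right_zero) (simp only: mult.assoc[symmetric])
  qed
  finally show "(\<integral>x. of_real x powr (s - 1) * exp (- (of_real a * of_real x)) \<partial>hl) = Gamma s * of_real a powr (- s)"
    using a by (simp add: powr_minus field_simps)
qed (use w in auto)

text \<open>Rotating the ray of integration of the Gamma integral by the angle \<open>\<phi>\<close>.\<close>

lemma norm_Gamma_le_rotated:
  assumes s: "Re s > 0" and \<phi>: "0 \<le> \<phi>" "\<phi> < pi / 2"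
  shows "norm (Gamma s) \<le> Gamma (Re s) * cos \<phi> powr (- Re s) * exp (- \<phi> * \<bar>Im s\<bar>)"
proof -
  have main: "norm (Gamma s) * exp (\<psi> * Im s) \<le> Gamma (Re s) * cos \<psi> powr (- Re s)"
    if \<psi>: "\<bar>\<psi>\<bar> < pi / 2" for \<psi>
  proof -
    have cp: "cos \<psi> > 0" using \<psi> by (intro cos_gt_zero_pi) auto
    let ?w = "cis \<psi>"
    have Lnw: "Ln ?w = \<i> * \<psi>"
      unfolding cis_conv_exp by (rule Ln_exp) (use \<psi> in auto)
    have "norm (Gamma s) * exp (\<psi> * Im s) = norm (Gamma s * ?w powr (- s))"
      by (simp add: norm_mult powr_def Lnw)
    also have "\<dots> \<le> (\<integral>x. norm (of_real x powr (s - 1) * exp (- (?w * of_real x))) \<partial>hl)"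
      using cp s by (subst Gamma_integral_rotated[symmetric]) (auto intro: integral_norm_bound)
    also have "\<dots> = (\<integral>x. norm (complex_of_real x powr (of_real (Re s) - 1) * exp (- (of_real (cos \<psi>) * of_real x))) \<partial>hl)"
      by (intro Bochner_Integration.integral_cong refl) (auto simp: norm_mult norm_powr_real_powr)
    finally have le: "norm (Gamma s) * exp (\<psi> * Im s) \<le>
      (\<integral>x. norm (complex_of_real x powr (of_real (Re s) - 1) * exp (- (of_real (cos \<psi>) * of_real x))) \<partial>hl)" .
    have "complex_of_real (\<integral>x. norm (complex_of_real x powr (of_real (Re s) - 1) * exp (- (of_real (cos \<psi>) * of_real x))) \<partial>hl) = (\<integral>x. of_real x powr (of_real (Re s) - 1) * exp (- (of_real (cos \<psi>) * of_real x)) \<partial>hl)"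
    proof (subst integral_complex_of_real[symmetric], intro Bochner_Integration.integral_cong refl)
      fix x assume "x \<in> space hl"
      hence "x > 0" by auto
      thus "complex_of_real (norm (of_real x powr (complex_of_real (Re s) - 1) * exp (- (complex_of_real (cos \<psi>) * of_real x))))
          = of_real x powr (of_real (Re s) - 1) * exp (- (of_real (cos \<psi>) * of_real x))"
        by (simp add: norm_mult norm_powr_real_powr powr_of_real[symmetric] flip: exp_of_real)
    qed
    also have "\<dots> = Gamma (of_real (Re s)) * of_real (cos \<psi>) powr (- of_real (Re s))"
      using cp s by (subst Gamma_integral_rotated) auto
    also have "\<dots> = of_real (Gamma (Re s) * cos \<psi> powr (- Re s))"
      using cp by (simp add: Gamma_complex_of_real powr_of_real flip: of_real_minus)
    finally show ?thesis using le by (simp only: of_real_eq_iff)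
  qed
  define \<psi> where "\<psi> = (if Im s \<ge> 0 then \<phi> else -\<phi>)"
  have "\<psi> * Im s = \<phi> * \<bar>Im s\<bar>" "cos \<psi> = cos \<phi>" "\<bar>\<psi>\<bar> < pi / 2" using \<phi> by (auto simp: \<psi>_def)
  with main[of \<psi>] show ?thesis by (simp add: exp_minus field_simps)
qed

lemma Gamma_nonzero_Re_pos: "Re s > 0 \<Longrightarrow> Gamma s \<noteq> 0"
  by (auto simp: Gamma_eq_zero_iff nonpos_Ints_def)

lemma Gamma_line_continuous:
  assumes "c > 0"
  shows "continuous_on A (\<lambda>t. Gamma (Complex c t))"
proof -
  have "continuous_on A (\<lambda>t. Complex c t)" unfolding Complex_eq by (intro continuous_intros)
  moreover have "Complex c t \<notin> \<int>\<^sub>\<le>\<^sub>0" for t using assms by (auto simp: nonpos_Ints_def complex_eq_iff)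
  ultimately show ?thesis
    by (intro continuous_on_compose2[OF continuous_on_Gamma[of "- \<int>\<^sub>\<le>\<^sub>0"]]) auto
qed

section \<open>Inversion on vertical lines: the Cahen-Mellin integral and the Perron kernel\<close>

lemma integrable_exp_abs:
  assumes "b > 0"
  shows "integrable lborel (\<lambda>t::real. exp (- b * \<bar>t\<bar>))"
proof -
  have "integrable hl (\<lambda>x. norm (of_real x powr (1 - 1) * exp (- (complex_of_real b * of_real x))))"
    by (intro integrable_norm Gamma_integrand_integrable) (use assms in auto)
  hence i: "integrable hl (\<lambda>x. exp (- b * x))" by (rule Bochner_Integration.integrable_bound) (auto simp: norm_mult)
  hence "integrable lborel (\<lambda>x. indicator {0<..} x * exp (- b * x))"
    by (simp add: hl_integrable_iff set_integrable_def)
  moreover from lborel_integrable_real_affine[OF this, of "-1" 0]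
  have "integrable lborel (\<lambda>x. indicator {0<..} (-x) * exp (b * x))" by simp
  ultimately have "integrable lborel (\<lambda>x. indicator {0<..} x * exp (- b * x) + indicator {0<..} (-x) * exp (b * x))"
    by (rule Bochner_Integration.integrable_add)
  moreover have "AE x in lborel. x \<noteq> (0::real)" by (rule AE_lborel_singleton)
  ultimately show ?thesis
    by (subst integrable_cong_AE[of _ _ "\<lambda>x. indicator {0<..} x * exp (- b * x) + indicator {0<..} (-x) * exp (b * x)"])
       (auto simp: indicator_def elim!: eventually_mono)
qed

text \<open>The Gamma integral is rotated by the angle halfway between \<open>\<phi>\<close> and
  \<open>pi/2\<close>. One half of the gap pays for the growth \<open>exp (\<phi> * |Im s|)\<close>
  of \<open>z powr (- s)\<close>, the other half is left as decay.\<close>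

lemma norm_Gamma_powr_le:
  assumes c: "Re s > 0" and z: "Re z > 0" and \<phi>: "\<bar>Im (Ln z)\<bar> \<le> \<phi>" "\<phi> < pi / 2"
  shows "norm (Gamma s * z powr (- s)) \<le>
    Gamma (Re s) * cos ((\<phi> + pi/2) / 2) powr (- Re s) * norm z powr (- Re s) * exp (- ((pi/2 - \<phi>) / 2) * \<bar>Im s\<bar>)"
proof -
  let ?f = "(\<phi> + pi/2) / 2"
  have z0: "z \<noteq> 0" using z by auto
  have "norm (z powr (- s)) = norm z powr (- Re s) * exp (Im s * Im (Ln z))"
    using z0 by (simp add: norm_powr_complex Arg_eq_Im_Ln)
  also have "Im s * Im (Ln z) \<le> \<bar>Im s\<bar> * \<bar>Im (Ln z)\<bar>" by (simp flip: abs_mult)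
  also have "\<dots> \<le> \<bar>Im s\<bar> * \<phi>" using \<phi> by (intro mult_left_mono) auto
  finally have 1: "norm (z powr (- s)) \<le> norm z powr (- Re s) * exp (\<bar>Im s\<bar> * \<phi>)"
    by (simp add: mult_left_mono)
  have 2: "norm (Gamma s) \<le> Gamma (Re s) * cos ?f powr (- Re s) * exp (- ?f * \<bar>Im s\<bar>)"
    by (rule norm_Gamma_le_rotated) (use \<phi> c in auto)
  have "norm (Gamma s * z powr (- s)) \<le> (Gamma (Re s) * cos ?f powr (- Re s) * exp (- ?f * \<bar>Im s\<bar>)) *
      (norm z powr (- Re s) * exp (\<bar>Im s\<bar> * \<phi>))"
    unfolding norm_mult by (intro mult_mono 1 2) (use c in \<open>auto intro!: mult_nonneg_nonneg Gamma_real_nonneg\<close>)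
  also have "\<dots> = Gamma (Re s) * cos ?f powr (- Re s) * norm z powr (- Re s) *
       (exp (- ?f * \<bar>Im s\<bar>) * exp (\<bar>Im s\<bar> * \<phi>))" by (simp only: mult_ac)
  also have "exp (- ?f * \<bar>Im s\<bar>) * exp (\<bar>Im s\<bar> * \<phi>) = exp (- ((pi/2 - \<phi>) / 2) * \<bar>Im s\<bar>)"
    by (simp add: field_simps flip: exp_add)
  finally show ?thesis .
qed

lemma Im_Ln_less_pi_half: "Re z > 0 \<Longrightarrow> \<bar>Im (Ln z)\<bar> < pi / 2"
  using Re_Ln_pos_lt[of z] by (cases "z = 0") auto

lemma Gamma_powr_line_integrable:
  assumes c: "c > 0" and z: "Re z > 0"
  shows "integrable lborel (\<lambda>t. Gamma (Complex c t) * z powr (- Complex c t))"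
proof -
  let ?\<phi> = "\<bar>Im (Ln z)\<bar>"
  let ?K = "Gamma c * cos ((?\<phi> + pi/2) / 2) powr (- c) * norm z powr (- c)"
  show ?thesis
  proof (rule Bochner_Integration.integrable_bound)
    show "integrable lborel (\<lambda>t. ?K * exp (- ((pi/2 - ?\<phi>) / 2) * \<bar>t\<bar>))"
      using Im_Ln_less_pi_half[OF z] by (intro integrable_mult_right integrable_exp_abs) auto
    have "continuous_on UNIV (\<lambda>t. Complex c t)" unfolding Complex_eq by (intro continuous_intros)
    hence "continuous_on UNIV (\<lambda>t. Gamma (Complex c t) * z powr (- Complex c t))"
      using z by (intro continuous_intros Gamma_line_continuous c) (auto simp: complex_nonpos_Reals_iff)
    thus "(\<lambda>t. Gamma (Complex c t) * z powr (- Complex c t)) \<in> borel_measurable lborel"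
      by (simp add: borel_measurable_continuous_onI)
    have "norm (Gamma (Complex c t) * z powr (- Complex c t)) \<le> ?K * exp (- ((pi/2 - ?\<phi>) / 2) * \<bar>t\<bar>)" for t
      using norm_Gamma_powr_le[of "Complex c t" z ?\<phi>] c z Im_Ln_less_pi_half[OF z] by simp
    thus "AE t in lborel. norm (Gamma (Complex c t) * z powr (- Complex c t)) \<le> norm (?K * exp (- ((pi/2 - ?\<phi>) / 2) * \<bar>t\<bar>))"
      by (auto intro: order_trans[OF _ abs_ge_self])
  qed
qed

text \<open>After \<open>x = exp u\<close> the rotated Gamma integral exhibits
  \<open>Gamma s * z powr (- s)\<close> as the Fourier transform of
  \<open>exp (c u) * exp (- z exp u)\<close>. Inversion at \<open>u = 0\<close> returns
  \<open>exp (- z)\<close>.\<close>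

lemma Cahen_Mellin:
  assumes c: "c > 0" and z: "Re z > 0"
  shows "(\<integral>t. Gamma (Complex c t) * z powr (- Complex c t) \<partial>lborel) = 2 * of_real pi * exp (- z)"
proof -
  define f where "f = (\<lambda>u. of_real (exp (c * u)) * exp (- (z * of_real (exp u))))"
  have sub: "exp y *\<^sub>R (of_real (exp y) powr (s - 1) * exp (- (z * of_real (exp y)))) =
     exp (s * of_real y) * exp (- (z * of_real (exp y)))" for s y
  proof -
    have "of_real (exp y) * of_real (exp y) powr (s - 1) = exp (s * of_real y)"
      by (simp add: powr_def Ln_of_real exp_of_real[symmetric] exp_add[symmetric] algebra_simps)
    thus ?thesis by (simp only: scaleR_conv_of_real mult.assoc[symmetric])
  qed
  have F: "Gamma (Complex c \<eta>) * z powr (- Complex c \<eta>) = (\<integral>y. f y * exp (\<i> * of_real (\<eta> * y)) \<partial>lborel)" for \<eta>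
  proof -
    have "exp (Complex c \<eta> * of_real y) * exp (- (z * of_real (exp y))) = f y * exp (\<i> * of_real (\<eta> * y))" for y
      by (simp add: f_def Complex_eq algebra_simps flip: exp_of_real exp_add)
    thus ?thesis
      using hl_exp_subst(2)[OF Gamma_integrand_integrable, of "Complex c \<eta>" z] c z
      by (simp add: Gamma_integral_rotated sub)
  qed
  have fi: "integrable lborel f"
    using hl_exp_subst(1)[OF Gamma_integrand_integrable, of "of_real c" z] c z
    unfolding sub by (simp add: f_def flip: exp_of_real)
  have nf: "norm (f u) = exp (c * u) * exp (- (Re z * exp u))" for u
    by (simp add: f_def norm_mult)
  have "\<exists>B. \<forall>u. norm (f u) \<le> B"
  proof -
    have "exp (c * u) * exp (- (Re z * exp u)) \<le> exp (c * (c / Re z))" for u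
    proof -
      \<comment> \<open>Follows from \<open>u <= 2 exp (u/2)\<close> by completing the square in
        \<open>exp (u/2)\<close>. Only independence of \<open>u\<close> matters.\<close>
      have "c * u - Re z * exp u \<le> c * (c / Re z)"
      proof -
        have "u \<le> exp (u/2) * 2" using exp_ge_add_one_self[of "u/2"] by linarith
        hence "c * u \<le> c * (exp (u/2) * 2)" using c by simp
        also have "\<dots> \<le> Re z * exp u + c * c / Re z"
        proof -
          have "0 \<le> (Re z * exp (u/2) - c)\<^sup>2 / Re z" using z by simp
          also have "\<dots> = Re z * (exp (u/2))\<^sup>2 - 2 * c * exp (u/2) + c * c / Re z"
            using z by (simp add: power2_eq_square field_simps)
          also have "(exp (u/2))\<^sup>2 = exp u" by (simp add: power2_eq_square flip: exp_add)
          finally show ?thesis by simp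
        qed
        finally show ?thesis by simp
      qed
      thus ?thesis by (simp flip: exp_add)
    qed
    thus ?thesis unfolding nf by blast
  qed
  then obtain B where B: "\<And>u. norm (f u) \<le> B" by blast
  have "continuous_on UNIV f" unfolding f_def by (intro continuous_intros)
  from Fourier_inversion_at_0[OF fi this B F Gamma_powr_line_integrable[OF c z]]
  show ?thesis by (simp add: f_def)
qed

lemma hl_power_exp:
  assumes w: "Re w > 0"
  shows "integrable hl (\<lambda>x. of_real x ^ k * exp (- (w * of_real x)))"
    and "(\<integral>x. of_real x ^ k * exp (- (w * of_real x)) \<partial>hl) = fact k / w ^ (k + 1)"
proof -
  have eq: "of_real x powr (of_nat (k + 1) - 1) * exp (- (w * of_real x)) = of_real x ^ k * exp (- (w * of_real x))"
    if "x \<in> space hl" for x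
    using that by (simp add: powr_nat')
  have i: "integrable hl (\<lambda>x. of_real x powr (of_nat (k + 1) - 1) * exp (- (w * of_real x)))"
    by (rule Gamma_integrand_integrable) (use w in auto)
  thus "integrable hl (\<lambda>x. of_real x ^ k * exp (- (w * of_real x)))"
    by (rule Bochner_Integration.integrable_cong[THEN iffD1, rotated -1]) (use eq in auto)
  have "(\<integral>x. of_real x ^ k * exp (- (w * of_real x)) \<partial>hl) =
    (\<integral>x. of_real x powr (of_nat (k + 1) - 1) * exp (- (w * of_real x)) \<partial>hl)"
    by (rule Bochner_Integration.integral_cong) (use eq in auto)
  also have "\<dots> = Gamma (of_nat (k + 1)) * w powr (- of_nat (k + 1))"
    by (rule Gamma_integral_rotated) (use w in auto)
  also have "\<dots> = fact k / w ^ (k + 1)"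
  proof -
    have "w powr (- of_nat (k + 1)) = inverse (w ^ (k + 1))"
      using w by (subst powr_minus, subst powr_nat') auto
    moreover have "Gamma (of_nat (k + 1)) = (fact k :: complex)"
      using Gamma_fact[of k, where 'a=complex] by (simp add: add_ac)
    ultimately show ?thesis by (simp only: divide_inverse)
  qed
  finally show "(\<integral>x. of_real x ^ k * exp (- (w * of_real x)) \<partial>hl) = fact k / w ^ (k + 1)" .
qed

lemma Complex_1_nonzero: "Complex 1 v \<noteq> 0"
  by (simp add: complex_eq_iff)

lemma continuous_on_Complex [continuous_intros]:
  "continuous_on A f \<Longrightarrow> continuous_on A g \<Longrightarrow> continuous_on A (\<lambda>x. Complex (f x) (g x))"
  unfolding Complex_eq by (intro continuous_intros)

lemma norm_Complex_1: "1 \<le> norm (Complex 1 v)" "\<bar>v\<bar> \<le> norm (Complex 1 v)"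
  using abs_Re_le_cmod[of "Complex 1 v"] abs_Im_le_cmod[of "Complex 1 v"] by auto

lemma integrable_inverse_1_plus_square_lborel: "integrable lborel (\<lambda>v::real. 1 / (1 + v\<^sup>2))"
  using integrable_inverse_1_plus_square
  by (simp add: set_integrable_def interval_lebesgue_integrable_def einterval_def divide_inverse)

text \<open>Up to the factor \<open>exp Y\<close> the integrand is the Fourier transform of
  \<open>y -> h (Y - y)\<close>, where \<open>h x = x^k exp (- x) / k!\<close> on the positive axis
  and 0 elsewhere; inversion at 0 yields \<open>h Y\<close>. For \<open>k = 0\<close> the function
  \<open>h\<close> would jump at 0 and the kernel would not be absolutely integrable.\<close>

lemma Perron_kernel:
  assumes k: "k > 0"
  shows "integrable lborel (\<lambda>v. exp (of_real Y * Complex 1 v) / Complex 1 v ^ (k + 1))"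
    and "(\<integral>v. exp (of_real Y * Complex 1 v) / Complex 1 v ^ (k + 1) \<partial>lborel)
       = 2 * of_real pi * of_real (max 0 Y ^ k / fact k)"
proof -
  define h where "h = (\<lambda>x::real. complex_of_real (max 0 x ^ k / fact k * exp (- (max 0 x))))"
  define f where "f = (\<lambda>y. h (Y - y))"
  have ind: "h x = indicator {0<..} x *\<^sub>R (of_real x ^ k * exp (- (1 * of_real x))) / fact k" for x
    using k by (auto simp: h_def indicator_def max_def simp flip: exp_of_real)
  have hi: "integrable lborel h"
    using hl_power_exp(1)[of 1 k] unfolding hl_integrable_iff set_integrable_def ind[abs_def]
    by (simp add: integrable_divide)
  have fi: "integrable lborel f"
    using lborel_integrable_real_affine[OF hi, of "-1" Y] by (simp add: f_def)
  define F where "F = (\<lambda>\<eta>. exp (of_real Y * (\<i> * of_real \<eta>)) / Complex 1 \<eta> ^ (k + 1))"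
  have F: "F \<eta> = (\<integral>y. f y * exp (\<i> * of_real (\<eta> * y)) \<partial>lborel)" for \<eta>
  proof -
    have "(\<integral>y. f y * exp (\<i> * of_real (\<eta> * y)) \<partial>lborel) = (\<integral>x. h x * exp (\<i> * of_real (\<eta> * (Y - x))) \<partial>lborel)"
      using lborel_integral_real_affine[of "-1" "\<lambda>y. f y * exp (\<i> * of_real (\<eta> * y))" Y]
      by (simp add: f_def)
    also have "\<dots> = (\<integral>x. indicator {0<..} x *\<^sub>R ((exp (of_real Y * (\<i> * of_real \<eta>)) / fact k) *
         (of_real x ^ k * exp (- (Complex 1 \<eta> * of_real x)))) \<partial>lborel)"
    proof (rule Bochner_Integration.integral_cong)
      fix x
      have "exp (- (1 * complex_of_real x)) * exp (\<i> * of_real (\<eta> * (Y - x))) =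
        exp (of_real Y * (\<i> * of_real \<eta>)) * exp (- (Complex 1 \<eta> * of_real x))"
        by (simp add: Complex_eq algebra_simps flip: exp_add)
      thus "h x * exp (\<i> * of_real (\<eta> * (Y - x))) = indicator {0<..} x *\<^sub>R ((exp (of_real Y * (\<i> * of_real \<eta>)) / fact k) *
         (of_real x ^ k * exp (- (Complex 1 \<eta> * of_real x))))"
        unfolding ind by (simp add: indicator_def mult_ac)
    qed auto
    also have "\<dots> = (exp (of_real Y * (\<i> * of_real \<eta>)) / fact k) * (\<integral>x. of_real x ^ k * exp (- (Complex 1 \<eta> * of_real x)) \<partial>hl)"
      unfolding hl_integral set_lebesgue_integral_def by (subst integral_mult_right_zero[symmetric]) auto
    also have "\<dots> = F \<eta>" by (subst hl_power_exp(2)) (auto simp: F_def)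
    finally show ?thesis by simp
  qed
  have Fi: "integrable lborel F"
  proof (rule Bochner_Integration.integrable_bound[OF integrable_inverse_1_plus_square_lborel])
    have "continuous_on UNIV F" unfolding F_def
      by (intro continuous_intros) (simp_all add: Complex_1_nonzero)
    thus "F \<in> borel_measurable lborel" by (simp add: borel_measurable_continuous_onI)
    have "norm (F v) \<le> 1 / (1 + v\<^sup>2)" for v
    proof -
      have "1 + v\<^sup>2 = norm (Complex 1 v) ^ 2" by (simp add: cmod_power2)
      also have "\<dots> \<le> norm (Complex 1 v) ^ (k + 1)"
        using k by (intro power_increasing norm_Complex_1) auto
      finally have "1 + v\<^sup>2 \<le> norm (Complex 1 v) ^ (k + 1)" .
      thus ?thesis
        by (simp add: F_def norm_divide norm_power norm_mult divide_simps add_nonneg_eq_0_iff del: power_Suc)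
           (smt (verit) zero_le_power2)
    qed
    thus "AE v in lborel. norm (F v) \<le> norm (1 / (1 + v\<^sup>2))"
      by (auto intro: order_trans[OF _ abs_ge_self])
  qed
  have "norm (f y) \<le> 1" for y
  proof -
    have "x ^ k / fact k \<le> exp x" if "x \<ge> 0" for x :: real
    proof -
      have "(\<Sum>n\<in>{k}. inverse (fact n) * x ^ n) \<le> (\<Sum>n. inverse (fact n) * x ^ n)"
        by (rule sum_le_suminf[OF summable_exp]) (use that in auto)
      thus ?thesis by (simp add: exp_def divide_inverse scaleR_conv_of_real mult.commute)
    qed
    from this[of "max 0 (Y - y)"] show ?thesis
      unfolding f_def h_def norm_of_real by (simp add: exp_minus divide_simps mult.commute)
  qed
  moreover have "continuous_on UNIV f" unfolding f_def h_def
    by (intro continuous_intros) auto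
  ultimately have F0: "(\<integral>\<eta>. F \<eta> \<partial>lborel) = 2 * of_real pi * f 0"
    using Fourier_inversion_at_0[OF fi _ _ F Fi] by blast
  have e: "exp (of_real Y * Complex 1 v) / Complex 1 v ^ (k + 1) = of_real (exp Y) * F v" for v
    by (simp add: F_def Complex_eq exp_add distrib_left flip: exp_of_real)
  show "integrable lborel (\<lambda>v. exp (of_real Y * Complex 1 v) / Complex 1 v ^ (k + 1))"
    unfolding e using Fi by simp
  have "exp Y * (max 0 Y ^ k / fact k * exp (- (max 0 Y))) = max 0 Y ^ k / fact k"
    using k by (cases "Y > 0") (auto simp: max_def exp_minus)
  hence "of_real (exp Y) * f 0 = of_real (max 0 Y ^ k / fact k)"
    by (simp only: f_def h_def of_real_mult[symmetric] diff_zero)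
  thus "(\<integral>v. exp (of_real Y * Complex 1 v) / Complex 1 v ^ (k + 1) \<partial>lborel)
       = 2 * of_real pi * of_real (max 0 Y ^ k / fact k)"
    unfolding e integral_mult_right_zero F0 by (metis mult.left_commute)
qed

section \<open>Analytic continuation and the functional equation of zeta\<close>

lemma hl_square_subst:
  fixes f :: "real \<Rightarrow> complex"
  assumes "integrable hl f"
  shows "integrable hl (\<lambda>u. (2 * u) *\<^sub>R f (u\<^sup>2))"
    and "(\<integral>u. (2 * u) *\<^sub>R f (u\<^sup>2) \<partial>hl) = (\<integral>x. f x \<partial>hl)"
proof -
  have rng: "(\<lambda>u. u\<^sup>2) ` {0<..} = ({0<..} :: real set)"
  proof safe
    fix x :: real assume "x > 0"
    thus "x \<in> (\<lambda>u. u\<^sup>2) ` {0<..}" by (intro image_eqI[of _ _ "sqrt x"]) auto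
  qed auto
  have fm: "(\<lambda>x. indicator {0<..} x *\<^sub>R f x) \<in> borel_measurable borel"
    using assms unfolding hl_integrable_iff set_integrable_def by auto
  have "(\<lambda>u. (2 * u) *\<^sub>R (indicator {0<..} (u\<^sup>2) *\<^sub>R f (u\<^sup>2))) \<in> borel_measurable borel"
    using fm by measurable
  hence "(\<lambda>u. (2 * u) *\<^sub>R (indicator {0<..} (u\<^sup>2) *\<^sub>R f (u\<^sup>2))) \<in> borel_measurable hl" by measurable
  also have "?this \<longleftrightarrow> (\<lambda>u. (2 * u) *\<^sub>R f (u\<^sup>2)) \<in> borel_measurable hl"
    by (intro measurable_cong) auto
  finally have m: "(\<lambda>u. (2 * u) *\<^sub>R f (u\<^sup>2)) \<in> borel_measurable hl" .
  have ai: "f absolutely_integrable_on {0<..}"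
    using assms fm unfolding hl_integrable_iff set_integrable_def
    by (subst integrable_completion) auto
  have "(\<lambda>x. \<bar>2 * x\<bar> *\<^sub>R f (x\<^sup>2)) absolutely_integrable_on {0<..} \<and>
      integral {0<..} (\<lambda>x. \<bar>2 * x\<bar> *\<^sub>R f (x\<^sup>2)) = integral {0<..} f"
    by (subst has_absolute_integral_change_of_variables_real[where g="\<lambda>u. u\<^sup>2" and h="\<lambda>u. 2 * u"])
       (use ai in \<open>auto simp: rng inj_on_def intro!: derivative_eq_intros\<close>)
  moreover have "(\<lambda>x. \<bar>2 * x\<bar> *\<^sub>R f (x\<^sup>2)) absolutely_integrable_on {0<..} \<longleftrightarrow>
      (\<lambda>x. (2 * x) *\<^sub>R f (x\<^sup>2)) absolutely_integrable_on {0<..}"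
    by (intro set_integrable_cong refl) auto
  moreover have "integral {0<..} (\<lambda>x. \<bar>2 * x\<bar> *\<^sub>R f (x\<^sup>2)) = integral {0<..} (\<lambda>x. (2 * x) *\<^sub>R f (x\<^sup>2))"
    by (intro integral_cong) auto
  ultimately have 1: "(\<lambda>x. (2 * x) *\<^sub>R f (x\<^sup>2)) absolutely_integrable_on {0<..}"
      "integral {0<..} (\<lambda>x. (2 * x) *\<^sub>R f (x\<^sup>2)) = integral {0<..} f" by auto
  show i: "integrable hl (\<lambda>u. (2 * u) *\<^sub>R f (u\<^sup>2))"
    by (rule hl_absolutely_integrable[OF 1(1) m])
  show "(\<integral>u. (2 * u) *\<^sub>R f (u\<^sup>2) \<partial>hl) = (\<integral>x. f x \<partial>hl)"
    by (simp only: hl_integral_eq_integral(2)[OF i] hl_integral_eq_integral(2)[OF assms] 1(2))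
qed

text \<open>Write \<open>1 / (1 + u^2)\<close> as the integral of \<open>exp (- v (1 + u^2))\<close>
  over \<open>v > 0\<close> and exchange the integrals. The \<open>u\<close>-integral is a Gamma
  integral after \<open>x = u^2\<close>, and so is the remaining \<open>v\<close>-integral.\<close>

lemma Mellin_inverse_1_plus_square:
  assumes s: "-1 < Re s" "Re s < 1"
  shows "integrable hl (\<lambda>u. of_real u powr s / of_real (1 + u\<^sup>2))"
    and "(\<integral>u. of_real u powr s / of_real (1 + u\<^sup>2) \<partial>hl) = Gamma ((1 + s) / 2) * Gamma ((1 - s) / 2) / 2"
proof -
  define F where "F = (\<lambda>s v u. of_real u powr s * exp (- (of_real v * of_real (1 + u\<^sup>2))) :: complex)"
  have F1: "integrable hl (F s v) \<and> (\<integral>u. F s v u \<partial>hl) = exp (- of_real v) * (Gamma ((1 + s) / 2) * of_real v powr (- ((1 + s) / 2))) / 2"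
    if v: "v > 0" and s: "-1 < Re s" for v s
  proof -
    let ?g = "\<lambda>x. of_real x powr ((1 + s) / 2 - 1) * exp (- (of_real v * complex_of_real x))"
    have gi: "integrable hl ?g" by (rule Gamma_integrand_integrable) (use s v in auto)
    have eq: "(2 * u) *\<^sub>R ?g (u\<^sup>2) = 2 * exp (of_real v) * F s v u" if "u \<in> space hl" for u
    proof -
      have "complex_of_real u * of_real (u\<^sup>2) powr ((1 + s) / 2 - 1) = of_real u powr s"
      proof -
        have "of_real u = exp (complex_of_real (ln u))" using that by (simp add: exp_of_real)
        moreover have "Ln (of_real (u\<^sup>2)) = 2 * of_real (ln u)" using that by (subst Ln_of_real) (auto simp: ln_realpow)
        moreover have "Ln (of_real u) = of_real (ln u)" using that by (subst Ln_of_real) auto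
        ultimately show ?thesis using that
          by (simp add: powr_def exp_add[symmetric] field_simps del: of_real_power)
      qed
      moreover have "exp (- (of_real v * complex_of_real (u\<^sup>2))) = exp (of_real v) * exp (- (of_real v * complex_of_real (1 + u\<^sup>2)))"
        by (simp add: algebra_simps flip: exp_add)
      ultimately show ?thesis
        unfolding F_def scaleR_conv_of_real
        by (metis (no_types, lifting) mult.assoc mult.left_commute of_real_mult of_real_numeral)
    qed
    have "integrable hl (\<lambda>u. 2 * exp (of_real v) * F s v u)"
      using hl_square_subst(1)[OF gi] by (rule Bochner_Integration.integrable_cong[THEN iffD1, rotated -1]) (use eq in auto)
    from integrable_mult_right[OF this, of "inverse (2 * exp (of_real v))"]
    have i: "integrable hl (F s v)" by (simp add: mult.assoc[symmetric])
    have "(\<integral>u. 2 * exp (of_real v) * F s v u \<partial>hl) = (\<integral>u. (2 * u) *\<^sub>R ?g (u\<^sup>2) \<partial>hl)"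
      by (intro Bochner_Integration.integral_cong refl) (use eq in auto)
    also have "\<dots> = Gamma ((1 + s) / 2) * of_real v powr (- ((1 + s) / 2))"
      unfolding hl_square_subst(2)[OF gi] by (rule Gamma_integral_rotated) (use s v in auto)
    finally have "(\<integral>u. F s v u \<partial>hl) = exp (- of_real v) * (Gamma ((1 + s) / 2) * of_real v powr (- ((1 + s) / 2))) / 2"
      by (simp add: exp_minus field_simps)
    with i show ?thesis by simp
  qed
  have F2: "integrable hl (\<lambda>v. F s v u) \<and> (\<integral>v. F s v u \<partial>hl) = of_real u powr s / of_real (1 + u\<^sup>2)" for u
  proof -
    have "1 + u\<^sup>2 > 0" by (simp add: add_pos_nonneg)
    thus ?thesis
      using hl_power_exp[of "of_real (1 + u\<^sup>2)" 0] unfolding F_def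
      by (simp add: mult.commute)
  qed
  have m: "(\<lambda>(v, u). F s v u) \<in> borel_measurable (hl \<Otimes>\<^sub>M hl)"
  proof -
    have [measurable]: "(\<lambda>x. x) \<in> borel_measurable hl" by (rule hl_measurable_borel) simp
    have [measurable]: "fst \<in> borel_measurable (hl \<Otimes>\<^sub>M hl)" "snd \<in> borel_measurable (hl \<Otimes>\<^sub>M hl)"
      using measurable_compose[OF measurable_fst, of "\<lambda>x. x" hl borel hl]
        measurable_compose[OF measurable_snd, of "\<lambda>x. x" hl borel hl] by simp_all
    have [measurable]: "(\<lambda>p. complex_of_real (snd p) powr s) \<in> borel_measurable (hl \<Otimes>\<^sub>M hl)"
      by (rule measurable_compose[OF measurable_snd powr_hl_measurable])
    show ?thesis unfolding F_def split_beta' by measurable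
  qed
  have ii: "integrable (hl \<Otimes>\<^sub>M hl) (\<lambda>(v, u). F s v u)"
  proof (rule hl_hl.Fubini_integrable[OF m])
    \<comment> \<open>The norm of the integrand is the same integrand at the real exponent
      \<open>Re s\<close>, so absolute integrability is the evaluation \<open>F1\<close> at that
      exponent.\<close>
    let ?r = "complex_of_real (Re s)"
    have nF: "norm (F s v u) = Re (F ?r v u)" if "v > 0" "u > 0" for v u
      using that by (simp add: F_def norm_mult norm_powr_real_powr powr_of_real Re_exp)
    have ex: "(1 - w) / 2 - 1 = - ((1 + w) / 2)" for w :: complex by (simp add: field_simps)
    let ?h = "\<lambda>v. Re (exp (- of_real v) * (Gamma ((1 + ?r) / 2) * of_real v powr (- ((1 + ?r) / 2))) / 2)"
    have "integrable hl (\<lambda>v. Gamma ((1 + ?r) / 2) / 2 * (of_real v powr ((1 - ?r) / 2 - 1) * exp (- (1 * of_real v))))"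
      by (intro integrable_mult_right Gamma_integrand_integrable) (use s in auto)
    hence "integrable hl ?h"
      unfolding ex by (intro integrable_Re) (simp add: mult_ac)
    also have "?this \<longleftrightarrow> integrable hl (\<lambda>v. \<integral>u. norm (case (v, u) of (v, u) \<Rightarrow> F s v u) \<partial>hl)"
    proof (intro Bochner_Integration.integrable_cong refl)
      fix v assume v: "v \<in> space hl"
      have "(\<integral>u. norm (case (v, u) of (v, u) \<Rightarrow> F s v u) \<partial>hl) = (\<integral>u. Re (F ?r v u) \<partial>hl)"
        by (intro Bochner_Integration.integral_cong refl) (use v nF in auto)
      also have "\<dots> = Re (\<integral>u. F ?r v u \<partial>hl)" using F1[of v ?r] v s by (subst integral_Re) auto
      also have "\<dots> = ?h v"
        by (intro arg_cong[where f=Re] conjunct2[OF F1]) (use v s in auto)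
      finally show "?h v = (\<integral>u. norm (case (v, u) of (v, u) \<Rightarrow> F s v u) \<partial>hl)" by simp
    qed
    finally show "integrable hl (\<lambda>v. \<integral>u. norm (case (v, u) of (v, u) \<Rightarrow> F s v u) \<partial>hl)" .
    show "AE v in hl. integrable hl (\<lambda>u. case (v, u) of (v, u) \<Rightarrow> F s v u)"
      using F1 s by (intro AE_I2) auto
  qed
  from hl_hl.integrable_snd[OF ii]
  show "integrable hl (\<lambda>u. of_real u powr s / of_real (1 + u\<^sup>2))"
    using F2 by simp
  have "(\<integral>u. of_real u powr s / of_real (1 + u\<^sup>2) \<partial>hl) = (\<integral>u. (\<integral>v. F s v u \<partial>hl) \<partial>hl)"
    using F2 by simp
  also have "\<dots> = (\<integral>v. (\<integral>u. F s v u \<partial>hl) \<partial>hl)"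
    using hl_hl.Fubini_integral[OF ii] by simp
  also have "\<dots> = (\<integral>v. Gamma ((1 + s) / 2) / 2 * (of_real v powr ((1 - s) / 2 - 1) * exp (- (1 * of_real v))) \<partial>hl)"
  proof (intro Bochner_Integration.integral_cong refl)
    fix v assume "v \<in> space hl"
    moreover have "(1 - s) / 2 - 1 = - ((1 + s) / 2)" by (simp add: field_simps)
    ultimately show "(\<integral>u. F s v u \<partial>hl) = Gamma ((1 + s) / 2) / 2 * (of_real v powr ((1 - s) / 2 - 1) * exp (- (1 * of_real v)))"
      using F1[of v s] s by (simp add: mult_ac)
  qed
  also have "\<dots> = Gamma ((1 + s) / 2) / 2 * Gamma ((1 - s) / 2)"
    by (subst integral_mult_right_zero, subst Gamma_integral_rotated) (use s in auto)
  finally show "(\<integral>u. of_real u powr s / of_real (1 + u\<^sup>2) \<partial>hl) = Gamma ((1 + s) / 2) * Gamma ((1 - s) / 2) / 2"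
    by simp
qed

section \<open>Partial fractions of the hyperbolic cotangent and the associated Mellin
  integral\<close>

lemma Digamma_reflection:
  fixes z :: complex
  assumes z: "z \<notin> \<int>"
  shows "Digamma (1 - z) - Digamma z = of_real pi * cot (of_real pi * z)"
proof -
  have z1: "1 - z \<notin> \<int>" using z by (metis Ints_1 Ints_diff diff_diff_eq2 add_diff_cancel_left')
  have nz: "z \<notin> \<int>\<^sub>\<le>\<^sub>0" "1 - z \<notin> \<int>\<^sub>\<le>\<^sub>0" using z z1 nonpos_Ints_Int by auto
  have sn: "sin (of_real pi * z) \<noteq> 0"
  proof
    assume "sin (of_real pi * z) = 0"
    then obtain n :: int where "of_real pi * z = of_real n * of_real pi" by (auto simp: sin_eq_0)
    hence "z = of_int n" by (simp add: mult.commute)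
    thus False using z by simp
  qed
  have "((\<lambda>z. Gamma z * Gamma (1 - z)) has_field_derivative
      (Gamma z * Digamma z * Gamma (1 - z) - Gamma z * (Gamma (1 - z) * Digamma (1 - z)))) (at z)"
    by (rule derivative_eq_intros refl nz | simp)+
  moreover have "((\<lambda>z. of_real pi / sin (of_real pi * z)) has_field_derivative
      - (of_real pi * (of_real pi * cos (of_real pi * z))) / (sin (of_real pi * z))\<^sup>2) (at z)"
    by (rule derivative_eq_intros refl sn | simp add: power2_eq_square)+
  ultimately have eq: "Gamma z * Digamma z * Gamma (1 - z) - Gamma z * (Gamma (1 - z) * Digamma (1 - z))
     = - (of_real pi * (of_real pi * cos (of_real pi * z))) / (sin (of_real pi * z))\<^sup>2"
    using Gamma_reflection_complex by (auto intro: DERIV_unique)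
  have "Gamma z * Gamma (1 - z) * (Digamma (1 - z) - Digamma z) = (of_real pi / sin (of_real pi * z)) * (of_real pi * cot (of_real pi * z))"
    using eq sn by (simp add: cot_def power2_eq_square field_simps)
  thus ?thesis using sn Gamma_reflection_complex[of z] by simp
qed

text \<open>The sum is half the hyperbolic cotangent of \<open>x/2\<close>, minus
  \<open>1/x\<close>. At \<open>z = i x / (2 pi)\<close> the Digamma series at \<open>1 + z\<close>
  and \<open>1 - z\<close> differ termwise by the partial fractions, up to scaling, and the
  reflection formula evaluates the difference through \<open>cot (pi z)\<close>.\<close>

lemma coth_partial_fractions:
  fixes x :: real
  assumes x: "x > 0"
  shows "(\<lambda>n. 2 * x / (x\<^sup>2 + (2 * pi * real (Suc n))\<^sup>2)) sums (1 / (exp x - 1) - 1 / x + 1 / 2)"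
proof -
  define y where "y = x / (2 * pi)"
  have y: "y > 0" using x by (simp add: y_def)
  define z where "z = Complex 0 y"
  have zI: "z \<notin> \<int>" using y by (auto simp: z_def Ints_def complex_eq_iff)
  have z0: "z \<noteq> 0" using y by (auto simp: z_def complex_eq_iff)
  have S: "(\<lambda>k. inverse (of_nat (Suc k)) - inverse (w + of_nat k)) sums (Digamma w + euler_mascheroni)" if "w \<noteq> 0" for w :: complex
    using summable_Digamma[OF that] by (simp add: Digamma_def summable_sums)
  have "1 + z \<noteq> 0" "1 - z \<noteq> 0" by (auto simp: z_def complex_eq_iff)
  from sums_diff[OF S[OF this(1)] S[OF this(2)]]
  have "(\<lambda>k. inverse (1 - z + of_nat k) - inverse (1 + z + of_nat k)) sums (Digamma (1 + z) - Digamma (1 - z))"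
    by simp
  also have "Digamma (1 + z) - Digamma (1 - z) = 1 / z - of_real pi * cot (of_real pi * z)"
    using Digamma_reflection[OF zI] Digamma_plus1[OF z0] by (simp add: algebra_simps)
  finally have "(\<lambda>k. Im (inverse (1 - z + of_nat k) - inverse (1 + z + of_nat k))) sums
     Im (1 / z - of_real pi * cot (of_real pi * z))" by (rule sums_Im)
  also have "Im (1 / z - of_real pi * cot (of_real pi * z)) = pi * ((exp x + 1) / (exp x - 1)) - 1 / y"
  proof -
    have pz: "\<i> * (of_real pi * z) = of_real (- (x/2))" by (simp add: z_def Complex_eq y_def)
    have e: "exp (\<i> * (of_real pi * z)) = of_real (exp (- (x/2)))" "exp (- (\<i> * (of_real pi * z))) = of_real (exp (x/2))"
      unfolding pz by (simp_all flip: exp_of_real)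
    have c: "cos (of_real pi * z) = of_real ((exp (x/2) + exp (- (x/2))) / 2)"
      unfolding cos_exp_eq e by (simp add: add.commute)
    have s: "sin (of_real pi * z) = \<i> * of_real ((exp (x/2) - exp (- (x/2))) / 2)"
      unfolding sin_exp_eq e by (simp add: field_simps)
    have ne: "exp (x/2) - exp (- (x/2)) > 0" using x by simp
    have "cot (of_real pi * z) = - \<i> * of_real ((exp (x/2) + exp (- (x/2))) / (exp (x/2) - exp (- (x/2))))"
      unfolding cot_def c s using ne by (simp add: field_simps)
    moreover have "(exp (x/2) + exp (- (x/2))) / (exp (x/2) - exp (- (x/2))) = (exp x + 1) / (exp x - 1)"
    proof -
      have "exp x = exp (x/2) * exp (x/2)" by (simp flip: exp_add)
      thus ?thesis using ne x by (simp add: exp_minus field_simps)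
    qed
    moreover have "1 / z = - \<i> * of_real (1 / y)" using y by (simp add: z_def Complex_eq field_simps)
    ultimately show ?thesis by simp
  qed
  also have "(\<lambda>k. Im (inverse (1 - z + of_nat k) - inverse (1 + z + of_nat k))) = (\<lambda>k. 2 * y / (y\<^sup>2 + (real (Suc k))\<^sup>2))"
    by (rule ext) (simp add: z_def inverse_complex.sel add.commute)
  finally have "(\<lambda>k. 1 / (2 * pi) * (2 * y / (y\<^sup>2 + (real (Suc k))\<^sup>2))) sums (1 / (2 * pi) * (pi * ((exp x + 1) / (exp x - 1)) - 1 / y))"
    by (rule sums_mult)
  also have "1 / (2 * pi) * (pi * ((exp x + 1) / (exp x - 1)) - 1 / y) = 1 / (exp x - 1) - 1 / x + 1 / 2"
    using x by (simp add: y_def field_simps)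
  also have "(\<lambda>k. 1 / (2 * pi) * (2 * y / (y\<^sup>2 + (real (Suc k))\<^sup>2))) = (\<lambda>n. 2 * x / (x\<^sup>2 + (2 * pi * real (Suc n))\<^sup>2))"
  proof (rule ext)
    fix k
    have "x\<^sup>2 + (2 * pi * real (Suc k))\<^sup>2 = (2 * pi)\<^sup>2 * (y\<^sup>2 + (real (Suc k))\<^sup>2)"
      by (simp add: y_def power_mult_distrib power_divide distrib_left del: of_nat_Suc)
    moreover have "x = 2 * pi * y" by (simp add: y_def)
    ultimately show "1 / (2 * pi) * (2 * y / (y\<^sup>2 + (real (Suc k))\<^sup>2)) = 2 * x / (x\<^sup>2 + (2 * pi * real (Suc k))\<^sup>2)"
      by (simp add: power2_eq_square del: of_nat_Suc)
  qed
  finally show ?thesis .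
qed

text \<open>The function \<open>1 / (exp x - 1)\<close> without the first two terms
  \<open>1/x - 1/2\<close> of its expansion at 0. It is of order \<open>x\<close> there, so its
  Mellin integral, damped at infinity, converges for \<open>Re s > -1\<close> instead of
  \<open>Re s > 1\<close>.\<close>

definition coth_kernel :: "real \<Rightarrow> real" where
  "coth_kernel x = 1 / (exp x - 1) - 1 / x + 1 / 2"

text \<open>All partial fractions are positive, and dropping \<open>x^2\<close> in their
  denominators leaves the series of inverse squares, which even gives the bound
  \<open>x / 12\<close>.\<close>

lemma coth_kernel_bounds:
  assumes "x > 0"
  shows "0 \<le> coth_kernel x" "coth_kernel x \<le> x"
proof -
  have S: "(\<lambda>n. 2 * x / (x\<^sup>2 + (2 * pi * real (Suc n))\<^sup>2)) sums coth_kernel x"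
    using coth_partial_fractions[OF assms] by (simp add: coth_kernel_def)
  show "0 \<le> coth_kernel x" by (rule sums_le[OF _ sums_zero S]) (use assms in auto)
  have "(\<lambda>n. x / (2 * pi\<^sup>2) * (1 / real (Suc n) ^ 2)) sums (x / (2 * pi\<^sup>2) * (pi\<^sup>2 / 6))"
    using inverse_squares_sums by (intro sums_mult) simp
  hence S2: "(\<lambda>n. x / (2 * pi\<^sup>2) * (1 / real (Suc n) ^ 2)) sums (x / 12)" by (simp del: of_nat_Suc)
  have "coth_kernel x \<le> x / 12"
  proof (rule sums_le[OF _ S S2])
    fix n
    have "2 * x / (x\<^sup>2 + (2 * pi * real (Suc n))\<^sup>2) \<le> 2 * x / (2 * pi * real (Suc n))\<^sup>2"
      using assms by (intro divide_left_mono mult_pos_pos) (auto intro: add_nonneg_pos simp del: of_nat_Suc)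
    also have "\<dots> = x / (2 * pi\<^sup>2) * (1 / real (Suc n) ^ 2)"
      by (simp add: power_mult_distrib del: of_nat_Suc)
    finally show "2 * x / (x\<^sup>2 + (2 * pi * real (Suc n))\<^sup>2) \<le> x / (2 * pi\<^sup>2) * (1 / real (Suc n) ^ 2)" .
  qed
  thus "coth_kernel x \<le> x" using assms by simp
qed

lemma coth_kernel_measurable [measurable]: "coth_kernel \<in> borel_measurable borel"
  unfolding coth_kernel_def by measurable

lemma powr_between:
  fixes x a b c :: real
  assumes "x > 0" "a \<le> b" "b \<le> c"
  shows "x powr b \<le> x powr a + x powr c"
proof (cases "x \<ge> 1")
  case True
  hence "x powr b \<le> x powr c" using assms by (intro powr_mono) auto
  thus ?thesis using powr_ge_zero[of x a] by linarith
next
  case False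
  hence "x powr b \<le> x powr a" using assms by (intro powr_mono') auto
  thus ?thesis using powr_ge_zero[of x c] by linarith
qed

text \<open>The remainder in the continuation of a zeta series that starts at \<open>a\<close>.
  Raising \<open>a\<close> by 1 changes it by an elementary term, \<open>a = 1\<close> belongs to
  \<open>zeta\<close>, and \<open>a -> 0\<close> removes the exponential and leads to the functional
  equation.\<close>

definition Mellin_coth :: "real \<Rightarrow> complex \<Rightarrow> complex" where
  "Mellin_coth a s = (\<integral>x. of_real x powr (s - 1) * of_real (exp (- (a * x)) * coth_kernel x) \<partial>hl)"

lemma powr_times_measurable:
  "g \<in> borel_measurable borel \<Longrightarrow> (\<lambda>x. of_real x powr s * complex_of_real (g x)) \<in> borel_measurable hl"
  by (intro borel_measurable_times powr_hl_measurable hl_measurable_borel) simp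

lemma Mellin_coth_measurable:
  "(\<lambda>x. of_real x powr (s - 1) * complex_of_real (exp (- (a * x)) * coth_kernel x)) \<in> borel_measurable hl"
  by (rule powr_times_measurable) measurable

lemma powr_exp_integrable_hl:
  assumes "\<sigma> > -1" "a > 0"
  shows "integrable hl (\<lambda>x. x powr \<sigma> * exp (- (a * x)))"
proof -
  have "integrable hl (\<lambda>x. norm (of_real x powr (of_real (\<sigma> + 1) - 1) * exp (- (complex_of_real a * of_real x))))"
    by (intro integrable_norm Gamma_integrand_integrable) (use assms in auto)
  thus ?thesis
    by (rule Bochner_Integration.integrable_cong[THEN iffD1, rotated -1])
       (auto simp: norm_mult norm_powr_real_powr)
qed

lemma Mellin_coth_bound:
  assumes "x > 0" "b \<le> a" "\<sigma>1 \<le> Re s" "Re s \<le> \<sigma>2"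
  shows "norm (of_real x powr (s - 1) * of_real (exp (- (a * x)) * coth_kernel x))
     \<le> x powr \<sigma>1 * exp (- (b * x)) + x powr \<sigma>2 * exp (- (b * x))"
proof -
  have "norm (of_real x powr (s - 1) * of_real (exp (- (a * x)) * coth_kernel x)) =
     x powr (Re s - 1) * (exp (- (a * x)) * coth_kernel x)"
    using assms coth_kernel_bounds[of x] by (simp add: norm_mult norm_powr_real_powr)
  also have "\<dots> \<le> x powr (Re s - 1) * (exp (- (b * x)) * x)"
    using assms coth_kernel_bounds[of x] by (intro mult_left_mono mult_mono) auto
  also have "\<dots> = x powr Re s * exp (- (b * x))" using assms by (simp add: powr_diff)
  also have "\<dots> \<le> (x powr \<sigma>1 + x powr \<sigma>2) * exp (- (b * x))"
    using assms by (intro mult_right_mono powr_between) auto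
  finally show ?thesis by (simp add: distrib_right)
qed

lemma Mellin_coth_integrable:
  assumes "a > 0" "Re s > -1"
  shows "integrable hl (\<lambda>x. of_real x powr (s - 1) * of_real (exp (- (a * x)) * coth_kernel x))"
proof (rule Bochner_Integration.integrable_bound[OF _ Mellin_coth_measurable])
  show "integrable hl (\<lambda>x. x powr Re s * exp (- (a * x)) + x powr Re s * exp (- (a * x)))"
    using assms by (intro Bochner_Integration.integrable_add powr_exp_integrable_hl) auto
  show "AE x in hl. norm (of_real x powr (s - 1) * of_real (exp (- (a * x)) * coth_kernel x))
     \<le> norm (x powr Re s * exp (- (a * x)) + x powr Re s * exp (- (a * x)))"
    using Mellin_coth_bound[of _ a a "Re s" s "Re s"] by (intro AE_I2) (auto intro: order_trans[OF _ abs_ge_self])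
qed

lemma Mellin_coth_holomorphic:
  assumes "a > 0"
  shows "Mellin_coth a holomorphic_on {s. Re s > -1}"
  unfolding Mellin_coth_def[abs_def]
proof (rule holomorphic_on_integral[OF _ _ Mellin_coth_measurable])
  show "open {s. Re s > -1}" by (rule open_halfspace_Re_gt)
  fix s0 :: complex assume s0: "s0 \<in> {s. Re s > -1}"
  define r where "r = (Re s0 + 1) / 2"
  have r: "r > 0" "Re s0 - r > -1" using s0 by (auto simp: r_def field_simps)
  let ?g = "\<lambda>x. x powr (Re s0 - r) * exp (- (a * x)) + x powr (Re s0 + r) * exp (- (a * x))"
  show "\<exists>r>0. \<exists>g. integrable hl g \<and> (\<forall>s\<in>ball s0 r. s \<in> {s. Re s > -1} \<longrightarrow>
     (\<forall>x\<in>space hl. norm (of_real x powr (s - 1) * of_real (exp (- (a * x)) * coth_kernel x)) \<le> g x))"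
  proof (intro exI[of _ r] exI[of _ ?g] conjI ballI impI)
    show "integrable hl ?g"
      using r assms by (intro Bochner_Integration.integrable_add powr_exp_integrable_hl) auto
    fix s x assume "s \<in> ball s0 r" "x \<in> space hl"
    moreover from this have "\<bar>Re s0 - Re s\<bar> \<le> r"
      using abs_Re_le_cmod[of "s0 - s"] by (auto simp: dist_norm)
    ultimately show "norm (of_real x powr (s - 1) * of_real (exp (- (a * x)) * coth_kernel x)) \<le> ?g x"
      by (intro Mellin_coth_bound) auto
  qed (use r in auto)
qed (auto intro!: holomorphic_intros)

text \<open>The error of the trapezoidal rule for the integral of \<open>x\<^bsup>-s\<^esup>\<close> over \<open>[a, a + 1]\<close>.\<close>

definition EM_term :: "real \<Rightarrow> complex \<Rightarrow> complex" where
  "EM_term a s = (of_real a powr (- s) + of_real (a + 1) powr (- s)) / 2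
     + (of_real (a + 1) powr (1 - s) - of_real a powr (1 - s)) / (s - 1)"

lemma connected_Re_gt_minus: "connected ({s. Re s > b} - {c})"
  by (intro connected_open_delete open_halfspace_Re_gt convex_connected convex_halfspace_Re_gt) simp

text \<open>The factor \<open>1 - exp (- x)\<close> clears the denominator of the kernel:
  \<open>coth_kernel x * (1 - exp (- x)) = (1 + exp (- x)) / 2 - (1 - exp (- x)) / x\<close>. For
  \<open>Re s > 1\<close> this leaves four Gamma integrals; both sides are holomorphic on the
  punctured half plane, so the identity extends.\<close>

lemma Mellin_coth_diff:
  assumes a: "a > 0" and s: "Re s > -1" "s \<noteq> 1"
  shows "rGamma s * (Mellin_coth a s - Mellin_coth (a + 1) s) = EM_term a s"
proof (rule analytic_continuation_open[of "{s. Re s > 1}" "{s. Re s > -1} - {1}"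
      "\<lambda>s. rGamma s * (Mellin_coth a s - Mellin_coth (a + 1) s)" "EM_term a"])
  show "open {s. Re s > 1}" "open ({s. Re s > -1} - {1})"
    by (auto intro!: open_halfspace_Re_gt open_delete)
  show "{s. 1 < Re s} \<noteq> {}" by (auto intro!: exI[of _ 2])
  show "connected ({s. Re s > -1} - {1})" by (rule connected_Re_gt_minus)
  show "(\<lambda>s. rGamma s * (Mellin_coth a s - Mellin_coth (a + 1) s)) holomorphic_on {s. Re s > -1} - {1}"
    using a by (intro holomorphic_intros holomorphic_on_subset[OF Mellin_coth_holomorphic]) auto
  show "EM_term a holomorphic_on {s. Re s > -1} - {1}"
    unfolding EM_term_def[abs_def] by (intro holomorphic_intros) auto
  fix s :: complex assume "s \<in> {s. Re s > 1}"
  hence s: "Re s > 1" by simp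
  have "s \<noteq> 1" using s by auto
  let ?G = "\<lambda>b s x. of_real x powr (s - 1) * exp (- (complex_of_real b * of_real x))"
  have G: "integrable hl (?G b w)" "(\<integral>x. ?G b w x \<partial>hl) = Gamma w * of_real b powr (- w)" if "b > 0" "Re w > 0" for b w
    using that by (auto intro: Gamma_integrand_integrable Gamma_integral_rotated)
  have "Mellin_coth a s - Mellin_coth (a + 1) s = (\<integral>x. of_real x powr (s - 1) * of_real (exp (- (a * x)) * coth_kernel x) -
       of_real x powr (s - 1) * of_real (exp (- ((a + 1) * x)) * coth_kernel x) \<partial>hl)"
    unfolding Mellin_coth_def using a s by (intro Bochner_Integration.integral_diff[symmetric] Mellin_coth_integrable) auto
  also have "\<dots> = (\<integral>x. (?G a s x + ?G (a + 1) s x) / 2 - (?G a (s - 1) x - ?G (a + 1) (s - 1) x) \<partial>hl)"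
  proof (intro Bochner_Integration.integral_cong refl)
    fix x assume "x \<in> space hl"
    hence x: "x > 0" by simp
    have E: "exp (- (complex_of_real (a + 1) * of_real x)) = of_real (exp (- (a * x)) * exp (- x))"
      "exp (- (complex_of_real a * of_real x)) = of_real (exp (- (a * x)))"
      "exp (- ((a + 1) * x)) = exp (- (a * x)) * exp (- x)"
      by (simp_all add: ring_distribs flip: exp_of_real exp_add)
    \<comment> \<open>The factor \<open>1/x\<close> lowers the exponent from \<open>s\<close> to
      \<open>s - 1\<close>, and the resulting Gamma integral needs \<open>Re s > 1\<close>. This is
      why the computation is done there.\<close>
    have P: "complex_of_real x powr (s - 1 - 1) = of_real x powr (s - 1) / of_real x"
      using x by (simp add: powr_diff power2_eq_square)
    have K: "exp (- (a * x)) * coth_kernel x - exp (- (a * x)) * exp (- x) * coth_kernel x =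
      (exp (- (a * x)) + exp (- (a * x)) * exp (- x)) / 2 - (exp (- (a * x)) - exp (- (a * x)) * exp (- x)) / x"
    proof -
      have "1 / (exp x - 1) = exp (- x) / (1 - exp (- x))" using x by (simp add: exp_minus field_simps)
      hence "coth_kernel x * (1 - exp (- x)) = (1 + exp (- x)) / 2 - (1 - exp (- x)) / x"
      proof -
        have "((1 - d) / d - 1 / x + 1 / 2) * d = (2 - d) / 2 - d / x" if "d \<noteq> 0" for d
          using that x by (simp add: field_simps)
        from this[of "1 - exp (- x)"] show ?thesis
          using x \<open>1 / (exp x - 1) = exp (- x) / (1 - exp (- x))\<close> by (simp add: coth_kernel_def)
      qed
      hence "exp (- (a * x)) * (coth_kernel x * (1 - exp (- x))) =
        exp (- (a * x)) * ((1 + exp (- x)) / 2 - (1 - exp (- x)) / x)" by simp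
      thus ?thesis by (simp add: ring_distribs mult_ac diff_divide_distrib add_divide_distrib)
    qed
    have "of_real x powr (s - 1) * of_real (exp (- (a * x)) * coth_kernel x) -
       of_real x powr (s - 1) * of_real (exp (- ((a + 1) * x)) * coth_kernel x) =
       of_real x powr (s - 1) * of_real (exp (- (a * x)) * coth_kernel x - exp (- (a * x)) * exp (- x) * coth_kernel x)"
      unfolding E by (simp add: algebra_simps)
    also have "\<dots> = (?G a s x + ?G (a + 1) s x) / 2 - (?G a (s - 1) x - ?G (a + 1) (s - 1) x)"
      unfolding K E P using x by (simp add: field_simps)
    finally show "of_real x powr (s - 1) * of_real (exp (- (a * x)) * coth_kernel x) -
       of_real x powr (s - 1) * of_real (exp (- ((a + 1) * x)) * coth_kernel x) =
       (?G a s x + ?G (a + 1) s x) / 2 - (?G a (s - 1) x - ?G (a + 1) (s - 1) x)" .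
  qed
  also have "\<dots> = (Gamma s * of_real a powr (- s) + Gamma s * of_real (a + 1) powr (- s)) / 2
       - (Gamma (s - 1) * of_real a powr (- (s - 1)) - Gamma (s - 1) * of_real (a + 1) powr (- (s - 1)))"
  proof -
    have i: "integrable hl (?G a s)" "integrable hl (?G (a+1) s)" "integrable hl (?G a (s - 1))" "integrable hl (?G (a+1) (s - 1))"
      by (rule G(1); use a s in simp)+
    have v: "(\<integral>x. ?G a s x \<partial>hl) = Gamma s * of_real a powr (- s)"
        "(\<integral>x. ?G (a+1) s x \<partial>hl) = Gamma s * of_real (a + 1) powr (- s)"
        "(\<integral>x. ?G a (s - 1) x \<partial>hl) = Gamma (s - 1) * of_real a powr (- (s - 1))"
        "(\<integral>x. ?G (a+1) (s - 1) x \<partial>hl) = Gamma (s - 1) * of_real (a + 1) powr (- (s - 1))"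
      by (rule G(2); use a s in simp)+
    show ?thesis
      by (subst Bochner_Integration.integral_diff Bochner_Integration.integral_add integral_divide_zero
            | intro integrable_divide Bochner_Integration.integrable_add Bochner_Integration.integrable_diff i
            | simp only: v)+
  qed
  finally have *: "Mellin_coth a s - Mellin_coth (a + 1) s = \<dots>" .
  have "Gamma s = (s - 1) * Gamma (s - 1)"
  proof -
    have "s - 1 \<notin> \<int>\<^sub>\<le>\<^sub>0" using s by (auto simp: nonpos_Ints_def complex_eq_iff)
    from Gamma_plus1[OF this] show ?thesis by simp
  qed
  hence g1: "Gamma (s - 1) = Gamma s / (s - 1)" using \<open>s \<noteq> 1\<close> by simp
  have rg: "rGamma s * Gamma s = 1" using Gamma_nonzero_Re_pos[of s] s by (simp add: rGamma_inverse_Gamma)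
  have "rGamma s * (Mellin_coth a s - Mellin_coth (a + 1) s) = (rGamma s * Gamma s) * EM_term a s"
    unfolding * g1 EM_term_def by (simp add: algebra_simps add_divide_distrib diff_divide_distrib)
  thus "rGamma s * (Mellin_coth a s - Mellin_coth (a + 1) s) = EM_term a s" by (simp add: rg)
qed (use s in auto)

text \<open>Serves two limits of the parameter: to infinity, where \<open>h = 0\<close>, and to
  1.\<close>

lemma Mellin_coth_tendsto:
  assumes b: "b > 0" "\<And>n. X n \<ge> b" and s: "Re s > -1"
    and lim: "\<And>x. x > 0 \<Longrightarrow> (\<lambda>n. exp (- (X n * x))) \<longlonglongrightarrow> h x"
    and [measurable]: "h \<in> borel_measurable borel"
  shows "(\<lambda>n. Mellin_coth (X n) s) \<longlonglongrightarrow> (\<integral>x. of_real x powr (s - 1) * of_real (h x * coth_kernel x) \<partial>hl)"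
  unfolding Mellin_coth_def
proof (rule integral_dominated_convergence[where w="\<lambda>x. x powr Re s * exp (- (b * x)) + x powr Re s * exp (- (b * x))"])
  show "integrable hl (\<lambda>x. x powr Re s * exp (- (b * x)) + x powr Re s * exp (- (b * x)))"
    using b s by (intro Bochner_Integration.integrable_add powr_exp_integrable_hl) auto
  show "AE x in hl. norm (of_real x powr (s - 1) * of_real (exp (- (X n * x)) * coth_kernel x))
     \<le> x powr Re s * exp (- (b * x)) + x powr Re s * exp (- (b * x))" for n
    using b by (intro AE_I2 Mellin_coth_bound) auto
  show "AE x in hl. (\<lambda>n. of_real x powr (s - 1) * of_real (exp (- (X n * x)) * coth_kernel x)) \<longlonglongrightarrow>
     of_real x powr (s - 1) * of_real (h x * coth_kernel x)"
    using lim by (intro AE_I2 tendsto_intros) auto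
qed (auto intro!: powr_times_measurable)

text \<open>Telescoping of \<open>Mellin_coth_diff\<close>; the remainder at
  \<open>a = N + 1\<close> tends to 0 by dominated convergence.\<close>

lemma EM_sums:
  assumes s: "Re s > -1" "s \<noteq> 1"
  shows "(\<lambda>n. EM_term (real (Suc n)) s) sums (rGamma s * Mellin_coth 1 s)"
proof -
  have "(\<Sum>n<N. EM_term (real (Suc n)) s) = rGamma s * (Mellin_coth 1 s - Mellin_coth (real (Suc N)) s)" for N
  proof (induction N)
    case (Suc N)
    thus ?case using Mellin_coth_diff[OF _ s, of "real (Suc N)"] by (simp add: algebra_simps)
  qed auto
  moreover have "(\<lambda>N. Mellin_coth (real (Suc N)) s) \<longlonglongrightarrow>
     (\<integral>x. of_real x powr (s - 1) * of_real ((\<lambda>_. 0) x * coth_kernel x) \<partial>hl)"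
  proof (rule Mellin_coth_tendsto[where b=1])
    fix x :: real assume "x > 0"
    thus "(\<lambda>n. exp (- (real (Suc n) * x))) \<longlonglongrightarrow> 0" by real_asymp
  qed (use s in auto)
  hence "(\<lambda>N. Mellin_coth (real (Suc N)) s) \<longlonglongrightarrow> 0" by simp
  hence "(\<lambda>N. rGamma s * (Mellin_coth 1 s - Mellin_coth (real (Suc N)) s)) \<longlonglongrightarrow> rGamma s * (Mellin_coth 1 s - 0)"
    by (intro tendsto_intros)
  ultimately show ?thesis by (simp add: sums_def)
qed

text \<open>Comes from \<open>1 / (exp x - 1) = exp (- x) * (coth_kernel x + 1/x + 1/2)\<close>: the
  Mellin integrals of the last two terms are \<open>Gamma (s - 1)\<close> and
  \<open>Gamma s / 2\<close>, which after division by \<open>Gamma s\<close> give the rational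
  part.\<close>

definition zeta_strip :: "complex \<Rightarrow> complex" where
  "zeta_strip s = 1 / (s - 1) + 1 / 2 + rGamma s * Mellin_coth 1 s"

text \<open>The factor in \<open>zeta s = chi s * zeta (1 - s)\<close>. With \<open>rGamma\<close>
  in place of a quotient it is holomorphic on all of \<open>Re s < 1\<close>.\<close>

definition zeta_chi :: "complex \<Rightarrow> complex" where
  "zeta_chi s = of_real pi powr (s - 1 / 2) * rGamma (s / 2) * Gamma ((1 - s) / 2)"

lemma tendsto_powr_neg_complex:
  assumes "Re s > 0"
  shows "(\<lambda>n. complex_of_real (real (Suc n)) powr (- s)) \<longlonglongrightarrow> 0"
proof (rule tendsto_norm_zero_cancel)
  have "(\<lambda>n. real (Suc n) powr (- Re s)) \<longlonglongrightarrow> 0"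
    using assms by (intro tendsto_neg_powr filterlim_compose[OF filterlim_real_sequentially filterlim_Suc]) auto
  thus "(\<lambda>n. norm (complex_of_real (real (Suc n)) powr (- s))) \<longlonglongrightarrow> 0"
    by (simp add: norm_powr_real_powr del: of_nat_Suc)
qed

text \<open>The trapezoidal rule gives interior integers weight 1 and the two end points weight 1/2;
  the \<open>1/2\<close> and the term at \<open>N + 1\<close> correct the ends.\<close>

lemma sum_EM_term:
  assumes "s \<noteq> 1"
  shows "(\<Sum>n<N. 1 / of_nat (Suc n) powr s) = (\<Sum>n<N. EM_term (real (Suc n)) s) + 1 / 2
     - of_real (real (Suc N)) powr (- s) / 2 - (of_real (real (Suc N)) powr (1 - s) - 1) / (s - 1)"
proof (induction N)
  case 0
  show ?case by simp
next
  case (Suc N)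
  have "1 / of_nat (Suc N) powr s = complex_of_real (real (Suc N)) powr (- s)"
    by (simp add: powr_minus divide_inverse)
  moreover have "real (Suc N) + 1 = real (Suc (Suc N))" by simp
  moreover have "S + 1/2 - P / 2 - (Q - 1) / d + P = S + ((P + P') / 2 + (Q' - Q) / d) + 1 / 2 - P' / 2 - (Q' - 1) / d"
    for S P Q P' Q' d :: complex
    by (simp add: add_divide_distrib diff_divide_distrib)
  ultimately show ?case
    unfolding sum.lessThan_Suc Suc.IH EM_term_def by (simp only:)
qed

lemma zeta_strip_sums:
  assumes s: "Re s > 1"
  shows "(\<lambda>n. 1 / of_nat (Suc n) powr s) sums zeta_strip s"
proof -
  have s1: "s \<noteq> 1" using s by auto
  have "(\<lambda>N. (\<Sum>n<N. EM_term (real (Suc n)) s) + 1 / 2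
     - of_real (real (Suc N)) powr (- s) / 2 - (of_real (real (Suc N)) powr (- (s - 1)) - 1) / (s - 1))
     \<longlonglongrightarrow> rGamma s * Mellin_coth 1 s + 1 / 2 - 0 / 2 - (0 - 1) / (s - 1)"
    using EM_sums[of s] s s1
    by (intro tendsto_intros tendsto_powr_neg_complex) (auto simp: sums_def)
  thus ?thesis unfolding sums_def sum_EM_term[OF s1]
    by (simp add: zeta_strip_def add_ac del: of_nat_Suc)
qed

lemma zeta_strip_holomorphic: "zeta_strip holomorphic_on {s. Re s > -1} - {1}"
  unfolding zeta_strip_def[abs_def]
  by (intro holomorphic_intros holomorphic_on_subset[OF Mellin_coth_holomorphic]) auto

text \<open>Without the exponential the partial fractions can be integrated term by term. Scaling by
  \<open>c n = 2 pi (n + 1)\<close> reduces every term to the same integral, and the powers of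
  \<open>c n\<close> left over sum to \<open>zeta_strip (1 - s)\<close>. The integral needs
  \<open>-1 < Re s\<close>, the sum needs \<open>Re s < 0\<close>.\<close>

lemma Mellin_coth_0:
  assumes s: "-1 < Re s" "Re s < 0"
  shows "integrable hl (\<lambda>x. of_real x powr (s - 1) * of_real (coth_kernel x))"
    and "(\<integral>x. of_real x powr (s - 1) * of_real (coth_kernel x) \<partial>hl) =
      of_real (2 * pi) powr (s - 1) * Gamma ((1 + s) / 2) * Gamma ((1 - s) / 2) * zeta_strip (1 - s)"
proof -
  define c where "c = (\<lambda>n. 2 * pi * real (Suc n))"
  have c: "c n > 0" for n by (simp add: c_def)
  define T where "T = (\<lambda>n x. of_real x powr (s - 1) * complex_of_real (2 * x / (x\<^sup>2 + (c n)\<^sup>2)))"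
  define W where "W = (\<lambda>u. of_real u powr s / complex_of_real (1 + u\<^sup>2))"
  have W: "integrable hl W" "(\<integral>u. W u \<partial>hl) = Gamma ((1 + s) / 2) * Gamma ((1 - s) / 2) / 2"
    unfolding W_def using Mellin_inverse_1_plus_square[of s] s by auto
  have TW: "T n (c n * u) = 2 * of_real (c n) powr (s - 2) * W u" if "u \<in> space hl" for n u
  proof -
    have u: "u > 0" using that by simp
    have a: "complex_of_real (c n * u) powr (s - 1) = of_real (c n) powr (s - 2) * of_real (c n) * of_real u powr (s - 1)"
    proof -
      have "of_real (c n) powr (s - 2) * complex_of_real (c n) = of_real (c n) powr (s - 1)"
        using c[of n] powr_add[of "complex_of_real (c n)" "s - 2" 1] by simp
      thus ?thesis using u c[of n] by (simp add: powr_times_real)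
    qed
    have b: "complex_of_real u powr (s - 1) = of_real u powr s / of_real u" using u by (simp add: powr_diff)
    have d: "2 * (c n * u) / ((c n * u)\<^sup>2 + (c n)\<^sup>2) = 2 * u / (c n * (1 + u\<^sup>2))"
    proof -
      have "(c n * u)\<^sup>2 + (c n)\<^sup>2 = c n * (c n * (1 + u\<^sup>2))" by (simp add: power2_eq_square algebra_simps)
      thus ?thesis using c[of n] by simp
    qed
    define D where "D = complex_of_real (1 + u\<^sup>2)"
    have "1 + u\<^sup>2 \<noteq> 0" by (smt (verit) zero_le_power2)
    hence "D \<noteq> 0" unfolding D_def by (simp only: of_real_eq_0_iff not_False_eq_True)
    moreover have "complex_of_real (2 * u / (c n * (1 + u\<^sup>2))) = 2 * of_real u / (of_real (c n) * D)"
      by (simp add: D_def)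
    ultimately show ?thesis unfolding T_def W_def a b d D_def[symmetric] using u c[of n] by (simp add: field_simps)
  qed
  have Ti: "integrable hl (T n)" for n
  proof -
    have "integrable hl (\<lambda>u. T n (c n * u)) \<longleftrightarrow> integrable hl (\<lambda>u. 2 * of_real (c n) powr (s - 2) * W u)"
      by (intro Bochner_Integration.integrable_cong refl TW)
    thus ?thesis using W(1) hl_scale(2)[OF c[of n], of "T n"] by simp
  qed
  have cc: "complex_of_real (c n) * of_real (c n) powr (s - 2) = of_real (2 * pi) powr (s - 1) * (1 / of_nat (Suc n) powr (1 - s))" for n
  proof -
    have "complex_of_real (c n) * of_real (c n) powr (s - 2) = of_real (c n) powr (s - 1)"
      using c[of n] powr_add[of "complex_of_real (c n)" "1" "s - 2"] by simp
    also have "\<dots> = of_real (2 * pi) powr (s - 1) * of_real (real (Suc n)) powr (s - 1)"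
      unfolding c_def of_real_mult[of "2 * pi"] by (subst powr_times_real) auto
    also have "complex_of_real (real (Suc n)) powr (s - 1) = 1 / of_nat (Suc n) powr (1 - s)"
      using powr_minus[of "of_nat (Suc n)" "1 - s"] by (simp add: divide_inverse del: of_nat_Suc)
    finally show ?thesis .
  qed
  have Tv: "(\<integral>x. T n x \<partial>hl) = 2 * of_real (2 * pi) powr (s - 1) * (\<integral>u. W u \<partial>hl) * (1 / of_nat (Suc n) powr (1 - s))" for n
  proof -
    have "(\<integral>x. T n x \<partial>hl) = c n *\<^sub>R (\<integral>u. T n (c n * u) \<partial>hl)" by (rule hl_scale(1)[OF c])
    also have "(\<integral>u. T n (c n * u) \<partial>hl) = 2 * of_real (c n) powr (s - 2) * (\<integral>u. W u \<partial>hl)"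
      unfolding integral_mult_right_zero[symmetric]
      by (intro Bochner_Integration.integral_cong refl TW)
    also have "c n *\<^sub>R (2 * of_real (c n) powr (s - 2) * (\<integral>u. W u \<partial>hl)) =
        2 * (of_real (c n) * of_real (c n) powr (s - 2)) * (\<integral>u. W u \<partial>hl)"
      by (simp only: scaleR_conv_of_real mult_ac)
    finally show ?thesis unfolding cc by (simp only: mult_ac)
  qed
  have Tn: "(\<integral>x. norm (T n x) \<partial>hl) = 2 * (2 * pi) powr (Re s - 1) * (\<integral>u. norm (W u) \<partial>hl) * real (Suc n) powr (Re s - 1)" for n
  proof -
    have "(\<integral>x. norm (T n x) \<partial>hl) = c n *\<^sub>R (\<integral>u. norm (T n (c n * u)) \<partial>hl)" by (rule hl_scale(1)[OF c])
    also have "(\<integral>u. norm (T n (c n * u)) \<partial>hl) = 2 * c n powr (Re s - 2) * (\<integral>u. norm (W u) \<partial>hl)"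
      unfolding integral_mult_right_zero[symmetric]
      by (intro Bochner_Integration.integral_cong refl)
         (use TW c[of n] in \<open>simp add: norm_mult norm_powr_real_powr\<close>)
    also have "c n *\<^sub>R (2 * c n powr (Re s - 2) * (\<integral>u. norm (W u) \<partial>hl)) = 2 * c n powr (Re s - 1) * (\<integral>u. norm (W u) \<partial>hl)"
      using c[of n] powr_add[of "c n" 1 "Re s - 2"] by simp
    also have "c n powr (Re s - 1) = (2 * pi) powr (Re s - 1) * real (Suc n) powr (Re s - 1)"
      unfolding c_def by (subst powr_mult) auto
    finally show ?thesis by (simp add: mult_ac del: of_nat_Suc)
  qed
  have sm: "summable (\<lambda>n. \<integral>x. norm (T n x) \<partial>hl)"
  proof -
    have "summable (\<lambda>n. real n powr (Re s - 1))" using s by (simp add: summable_real_powr_iff)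
    hence "summable (\<lambda>n. real (Suc n) powr (Re s - 1))" by (subst summable_Suc_iff)
    thus ?thesis unfolding Tn by (rule summable_mult)
  qed
  have pf: "(\<lambda>n. 2 * x / (x\<^sup>2 + (c n)\<^sup>2)) sums coth_kernel x" if "x > 0" for x
    using coth_partial_fractions[OF that] by (simp add: coth_kernel_def c_def)
  have ptw: "AE x in hl. summable (\<lambda>n. norm (T n x))"
  proof (rule AE_I2)
    fix x assume "x \<in> space hl"
    hence x: "x > 0" by simp
    have "norm (T n x) = x powr (Re s - 1) * (2 * x / (x\<^sup>2 + (c n)\<^sup>2))" for n
      using x by (simp add: T_def norm_mult norm_divide norm_powr_real_powr flip: of_real_power of_real_add)
    moreover have "summable (\<lambda>n. x powr (Re s - 1) * (2 * x / (x\<^sup>2 + (c n)\<^sup>2)))"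
      using pf[OF x] by (intro summable_mult) (simp add: sums_iff)
    ultimately show "summable (\<lambda>n. norm (T n x))" by (simp only:)
  qed
  have Ts: "(\<Sum>n. T n x) = of_real x powr (s - 1) * of_real (coth_kernel x)" if "x \<in> space hl" for x
  proof -
    have "(\<lambda>n. complex_of_real (2 * x / (x\<^sup>2 + (c n)\<^sup>2))) sums of_real (coth_kernel x)"
      using pf[of x] that by (subst sums_of_real_iff) simp
    hence "(\<lambda>n. T n x) sums (of_real x powr (s - 1) * of_real (coth_kernel x))"
      unfolding T_def by (rule sums_mult)
    thus ?thesis by (rule sums_unique[symmetric])
  qed
  have "integrable hl (\<lambda>x. \<Sum>n. T n x)" by (rule integrable_suminf[OF Ti ptw sm])
  thus "integrable hl (\<lambda>x. of_real x powr (s - 1) * of_real (coth_kernel x))"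
    by (rule Bochner_Integration.integrable_cong[THEN iffD1, rotated -1]) (use Ts in auto)
  have "(\<integral>x. of_real x powr (s - 1) * of_real (coth_kernel x) \<partial>hl) = (\<integral>x. (\<Sum>n. T n x) \<partial>hl)"
    by (intro Bochner_Integration.integral_cong refl) (use Ts in auto)
  also have "\<dots> = (\<Sum>n. \<integral>x. T n x \<partial>hl)" by (rule integral_suminf[OF Ti ptw sm])
  also have "\<dots> = 2 * of_real (2 * pi) powr (s - 1) * (\<integral>u. W u \<partial>hl) * zeta_strip (1 - s)"
    unfolding Tv using s by (intro sums_unique[symmetric] sums_mult zeta_strip_sums) simp
  finally show "(\<integral>x. of_real x powr (s - 1) * of_real (coth_kernel x) \<partial>hl) =
      of_real (2 * pi) powr (s - 1) * Gamma ((1 + s) / 2) * Gamma ((1 - s) / 2) * zeta_strip (1 - s)"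
    unfolding W(2) by simp
qed

text \<open>The limit \<open>a -> 0\<close> of \<open>Mellin_coth_diff\<close>. For
  \<open>Re s < 0\<close> both \<open>a powr (- s)\<close> and \<open>a powr (1 - s)\<close> vanish
  in the limit, so the trapezoidal term tends to \<open>1/2 + 1/(s - 1)\<close>, exactly the
  rational part of \<open>zeta_strip\<close>.\<close>

lemma zeta_strip_Mellin:
  assumes s: "-1 < Re s" "Re s < 0"
  shows "zeta_strip s = rGamma s * (\<integral>x. of_real x powr (s - 1) * of_real (coth_kernel x) \<partial>hl)"
proof -
  define a where "a = (\<lambda>n. 1 / real (Suc n))"
  have a: "a n > 0" "a n \<le> 1" for n by (auto simp: a_def)
  have a0: "a \<longlonglongrightarrow> 0" unfolding a_def by (rule LIMSEQ_Suc[OF lim_1_over_n])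
  have s1: "s \<noteq> 1" using s by auto
  define A where "A = (\<integral>x. of_real x powr (s - 1) * complex_of_real (coth_kernel x) \<partial>hl)"
  have L1: "(\<lambda>n. Mellin_coth (a n) s) \<longlonglongrightarrow> A"
    unfolding Mellin_coth_def A_def
  proof (rule integral_dominated_convergence[where w="\<lambda>x. norm (of_real x powr (s - 1) * complex_of_real (coth_kernel x))"])
    show "integrable hl (\<lambda>x. norm (of_real x powr (s - 1) * complex_of_real (coth_kernel x)))"
      by (intro integrable_norm Mellin_coth_0 s)
    show "AE x in hl. norm (of_real x powr (s - 1) * of_real (exp (- (a n * x)) * coth_kernel x))
       \<le> norm (of_real x powr (s - 1) * complex_of_real (coth_kernel x))" for n
    proof (rule AE_I2)
      fix x assume "x \<in> space hl"
      hence "exp (- (a n * x)) * \<bar>coth_kernel x\<bar> \<le> 1 * \<bar>coth_kernel x\<bar>"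
        using a[of n] by (intro mult_right_mono) auto
      thus "norm (of_real x powr (s - 1) * of_real (exp (- (a n * x)) * coth_kernel x))
         \<le> norm (of_real x powr (s - 1) * complex_of_real (coth_kernel x))"
        by (simp add: norm_mult abs_mult mult_left_mono)
    qed
    show "AE x in hl. (\<lambda>n. of_real x powr (s - 1) * of_real (exp (- (a n * x)) * coth_kernel x))
        \<longlonglongrightarrow> of_real x powr (s - 1) * complex_of_real (coth_kernel x)"
    proof (rule AE_I2)
      fix x
      have "(\<lambda>n. of_real x powr (s - 1) * of_real (exp (- (a n * x)) * coth_kernel x))
        \<longlonglongrightarrow> of_real x powr (s - 1) * complex_of_real (exp (- (0 * x)) * coth_kernel x)"
        by (intro tendsto_intros a0)
      thus "(\<lambda>n. of_real x powr (s - 1) * of_real (exp (- (a n * x)) * coth_kernel x))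
        \<longlonglongrightarrow> of_real x powr (s - 1) * complex_of_real (coth_kernel x)" by simp
    qed
  qed (auto intro!: powr_times_measurable)
  have L2: "(\<lambda>n. Mellin_coth (a n + 1) s) \<longlonglongrightarrow> Mellin_coth 1 s"
  proof -
    have "(\<lambda>n. Mellin_coth (a n + 1) s) \<longlonglongrightarrow> (\<integral>x. of_real x powr (s - 1) * of_real (exp (- (1 * x)) * coth_kernel x) \<partial>hl)"
    proof (rule Mellin_coth_tendsto[where b=1])
      fix x :: real
      have "(\<lambda>n. exp (- ((a n + 1) * x))) \<longlonglongrightarrow> exp (- ((0 + 1) * x))" by (intro tendsto_intros a0)
      thus "(\<lambda>n. exp (- ((a n + 1) * x))) \<longlonglongrightarrow> exp (- (1 * x))" by simp
    qed (use a s in \<open>auto intro: less_imp_le\<close>)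
    thus ?thesis by (simp add: Mellin_coth_def)
  qed
  have L3: "(\<lambda>n. of_real (a n) powr w) \<longlonglongrightarrow> 0" if "Re w > 0" for w
  proof -
    have "of_real (a n) powr w = of_real (real (Suc n)) powr (- w)" for n
    proof -
      have "Ln (complex_of_real (a n)) = of_real (- ln (real (Suc n)))"
        using a[of n] by (subst Ln_of_real) (auto simp: a_def ln_div simp del: of_nat_Suc)
      moreover have "Ln (complex_of_real (real (Suc n))) = of_real (ln (real (Suc n)))"
        by (subst Ln_of_real) auto
      ultimately show ?thesis using a[of n] by (simp add: powr_def del: of_nat_Suc)
    qed
    thus ?thesis using tendsto_powr_neg_complex[OF that] by simp
  qed
  have L4: "(\<lambda>n. of_real (a n + 1) powr w) \<longlonglongrightarrow> 1" for w :: complex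
  proof -
    have "(\<lambda>n. complex_of_real (a n + 1) powr w) \<longlonglongrightarrow> of_real (0 + 1) powr w"
      by (intro tendsto_powr_complex tendsto_intros a0) (auto simp: complex_nonpos_Reals_iff)
    thus ?thesis by simp
  qed
  have "(\<lambda>n. EM_term (a n) s) \<longlonglongrightarrow> (0 + 1) / 2 + (1 - 0) / (s - 1)"
    unfolding EM_term_def using s s1 by (intro tendsto_intros L3 L4) auto
  moreover have "(\<lambda>n. rGamma s * (Mellin_coth (a n) s - Mellin_coth (a n + 1) s)) \<longlonglongrightarrow> rGamma s * (A - Mellin_coth 1 s)"
    by (intro tendsto_intros L1 L2)
  ultimately have "rGamma s * (A - Mellin_coth 1 s) = (0 + 1) / 2 + (1 - 0) / (s - 1)"
    using Mellin_coth_diff[OF a(1) s(1) s1] by (simp add: LIMSEQ_unique)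
  thus ?thesis by (simp add: zeta_strip_def A_def algebra_simps)
qed

text \<open>The two evaluations of the Mellin integral of \<open>coth_kernel\<close> are compared.
  Legendre's duplication formula turns \<open>Gamma ((1 + s) / 2) / Gamma s\<close> into
  \<open>1 / Gamma (s / 2)\<close> and so produces the symmetric factor
  \<open>zeta_chi\<close>.\<close>

lemma zeta_strip_functional_equation:
  assumes s: "-1 < Re s" "Re s < 0"
  shows "zeta_strip s = zeta_chi s * zeta_strip (1 - s)"
proof -
  have n1: "s / 2 \<notin> \<int>\<^sub>\<le>\<^sub>0" "s / 2 + 1 / 2 \<notin> \<int>\<^sub>\<le>\<^sub>0" "s \<notin> \<int>\<^sub>\<le>\<^sub>0"
  proof -
    have "x \<notin> \<int>\<^sub>\<le>\<^sub>0" if "-1 < Re x" "Re x \<noteq> 0" for x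
    proof
      assume "x \<in> \<int>\<^sub>\<le>\<^sub>0"
      then obtain n :: nat where "x = - of_nat n" by (auto elim: nonpos_Ints_cases')
      thus False using that by (cases n) auto
    qed
    thus "s / 2 \<notin> \<int>\<^sub>\<le>\<^sub>0" "s / 2 + 1 / 2 \<notin> \<int>\<^sub>\<le>\<^sub>0" "s \<notin> \<int>\<^sub>\<le>\<^sub>0" using s by auto
  qed
  have dup: "Gamma (s / 2) * Gamma ((1 + s) / 2) = exp ((1 - s) * of_real (ln 2)) * of_real (sqrt pi) * Gamma s"
    using Gamma_legendre_duplication[OF n1(1,2)] by (simp add: field_simps add.commute)
  have g: "rGamma s * Gamma s = 1" "rGamma (s / 2) * Gamma (s / 2) = 1"
    using n1 by (auto simp: rGamma_inverse_Gamma Gamma_eq_zero_iff)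
  have P: "of_real (2 * pi) powr (s - 1) * (exp ((1 - s) * of_real (ln 2)) * of_real (sqrt pi)) = of_real pi powr (s - 1 / 2)"
  proof -
    have "complex_of_real (sqrt pi) = exp (of_real (ln pi) / 2)"
    proof -
      have "sqrt pi = exp (ln pi / 2)" by (simp add: ln_sqrt[symmetric])
      hence "complex_of_real (sqrt pi) = of_real (exp (ln pi / 2))" by (simp only:)
      thus ?thesis by (simp add: exp_of_real[symmetric])
    qed
    moreover have "Ln (of_real (2 * pi)) = of_real (ln 2) + of_real (ln pi)"
      by (subst Ln_of_real) (auto simp: ln_mult)
    moreover have "Ln (complex_of_real pi) = of_real (ln pi)" by (subst Ln_of_real) auto
    ultimately show ?thesis
      by (simp add: powr_def exp_add[symmetric] field_simps del: of_real_mult)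
  qed
  have "rGamma s * Gamma ((1 + s) / 2) = rGamma s * (rGamma (s / 2) * Gamma (s / 2)) * Gamma ((1 + s) / 2)"
    by (simp add: g)
  also have "\<dots> = rGamma s * rGamma (s / 2) * (Gamma (s / 2) * Gamma ((1 + s) / 2))" by (simp only: mult_ac)
  also have "\<dots> = (rGamma s * Gamma s) * rGamma (s / 2) * (exp ((1 - s) * of_real (ln 2)) * of_real (sqrt pi))"
    unfolding dup by (simp only: mult_ac)
  finally have R: "rGamma s * Gamma ((1 + s) / 2) = rGamma (s / 2) * (exp ((1 - s) * of_real (ln 2)) * of_real (sqrt pi))"
    by (simp add: g)
  have "zeta_strip s = (rGamma s * Gamma ((1 + s) / 2)) * of_real (2 * pi) powr (s - 1) * Gamma ((1 - s) / 2) * zeta_strip (1 - s)"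
    unfolding zeta_strip_Mellin[OF s] Mellin_coth_0(2)[OF s] by (simp only: mult_ac)
  also have "\<dots> = (of_real (2 * pi) powr (s - 1) * (exp ((1 - s) * of_real (ln 2)) * of_real (sqrt pi))) *
      rGamma (s / 2) * Gamma ((1 - s) / 2) * zeta_strip (1 - s)" unfolding R by (simp only: mult_ac)
  finally show ?thesis unfolding P zeta_chi_def .
qed

text \<open>Left of \<open>Re s > -1\<close> the functional equation serves as the definition. On
  the overlap \<open>-1 < Re s < 0\<close> both formulas agree, which makes the glued function
  holomorphic. The value at 1 is the one prescribed for \<open>zeta\<close>.\<close>

definition zeta_glue :: "complex \<Rightarrow> complex" where
  "zeta_glue s = (if s = 1 then 0 else if s \<in> {s. Re s > -1} - {1} then zeta_strip s
                  else zeta_chi s * zeta_strip (1 - s))"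

lemma half_minus_notin_nonpos_Ints: "Re s < 1 \<Longrightarrow> (1 - s) / 2 \<notin> \<int>\<^sub>\<le>\<^sub>0"
  by (auto elim!: nonpos_Ints_cases' simp: complex_eq_iff)

lemma zeta_chi_holomorphic: "zeta_chi holomorphic_on {s. Re s < 1}"
  unfolding zeta_chi_def[abs_def]
  by (intro holomorphic_intros half_minus_notin_nonpos_Ints) auto

lemma zeta_glue_holomorphic: "zeta_glue holomorphic_on - {1}"
proof -
  have "(\<lambda>s. if s \<in> {s. Re s > -1} - {1} then zeta_strip s else zeta_chi s * zeta_strip (1 - s))
     holomorphic_on (({s. Re s > -1} - {1}) \<union> {s. Re s < 0})"
  proof (rule holomorphic_on_If_Un[OF zeta_strip_holomorphic])
    show "(\<lambda>s. zeta_chi s * zeta_strip (1 - s)) holomorphic_on {s. Re s < 0}"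
    proof (intro holomorphic_on_mult holomorphic_on_subset[OF zeta_chi_holomorphic])
      have "zeta_strip \<circ> (\<lambda>s. 1 - s) holomorphic_on {s. Re s < 0}"
        by (rule holomorphic_on_compose_gen[OF _ zeta_strip_holomorphic]) (auto intro!: holomorphic_intros)
      thus "(\<lambda>s. zeta_strip (1 - s)) holomorphic_on {s. Re s < 0}" by (simp add: o_def)
    qed auto
    show "open ({s. Re s > -1} - {1})" "open {s. Re s < 0}"
      by (auto intro!: open_delete open_halfspace_Re_gt open_halfspace_Re_lt)
  qed (use zeta_strip_functional_equation in auto)
  also have "({s. Re s > -1} - {1}) \<union> {s. Re s < 0} = - {1::complex}" by auto
  finally show ?thesis
    by (rule holomorphic_transform) (auto simp: zeta_glue_def)
qed

lemma zeta_glue_sums: "Re s > 1 \<Longrightarrow> (\<lambda>n. 1 / of_nat (Suc n) powr s) sums zeta_glue s"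
  using zeta_strip_sums[of s] by (auto simp: zeta_glue_def simp del: of_nat_Suc)

lemma connected_minus_1: "connected (- {1 :: complex})"
  unfolding Compl_eq_Diff_UNIV by (intro connected_open_delete) (auto simp: convex_connected)

lemma holomorphic_eq_zeta_glue:
  assumes f: "f holomorphic_on - {1}" and sm: "\<And>s. Re s > 1 \<Longrightarrow> (\<lambda>n. 1 / of_nat (Suc n) powr s) sums f s"
    and s: "s \<noteq> 1"
  shows "f s = zeta_glue s"
proof (rule analytic_continuation_open[of "{s. Re s > 1}" "- {1}" f zeta_glue])
  show "{s. 1 < Re s} \<noteq> {}" by (auto intro!: exI[of _ 2])
  fix s :: complex assume "s \<in> {s. 1 < Re s}"
  thus "f s = zeta_glue s" using sm[of s] zeta_glue_sums[of s] sums_unique2 by auto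
qed (use assms zeta_glue_holomorphic connected_minus_1 in \<open>auto intro!: open_halfspace_Re_gt\<close>)

text \<open>Supplies the existence and uniqueness on which the description in the definition of
  \<open>zeta\<close> depends.\<close>

lemma zeta_eq_glue: "zeta = zeta_glue"
  unfolding zeta_def
proof (rule the_equality)
  fix f assume f: "f holomorphic_on - {1} \<and> f 1 = 0 \<and> (\<forall>s. Re s > 1 \<longrightarrow> (\<lambda>n. 1 / of_nat (Suc n) powr s) sums f s)"
  show "f = zeta_glue"
  proof
    fix s show "f s = zeta_glue s"
      using f holomorphic_eq_zeta_glue[of f s] by (cases "s = 1") (auto simp: zeta_glue_def)
  qed
qed (use zeta_glue_holomorphic zeta_glue_sums in \<open>auto simp: zeta_glue_def[of 1]\<close>)

lemma zeta_holomorphic: "zeta holomorphic_on - {1}"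
  using zeta_glue_holomorphic by (simp add: zeta_eq_glue)

lemma zeta_sums: "Re s > 1 \<Longrightarrow> (\<lambda>n. 1 / of_nat (Suc n) powr s) sums zeta s"
  using zeta_glue_sums by (simp add: zeta_eq_glue)

lemma zeta_eq_strip: "Re s > -1 \<Longrightarrow> s \<noteq> 1 \<Longrightarrow> zeta s = zeta_strip s"
  by (simp add: zeta_eq_glue zeta_glue_def)

lemma zeta_unique:
  assumes "f holomorphic_on - {1}" "\<And>s. Re s > 1 \<Longrightarrow> (\<lambda>n. 1 / of_nat (Suc n) powr s) sums f s" "s \<noteq> 1"
  shows "f s = zeta s"
  using holomorphic_eq_zeta_glue[OF assms] by (simp add: zeta_eq_glue)

text \<open>The point \<open>s = 0\<close> is excluded because the right-hand side would contain the
  conventional value of \<open>zeta\<close> at its pole.\<close>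

lemma zeta_functional_equation_chi:
  assumes s: "Re s < 1" "s \<noteq> 0"
  shows "zeta s = zeta_chi s * zeta (1 - s)"
proof (rule analytic_continuation_open[of "{s. Re s < 0}" "{s. Re s < 1} - {0}" zeta "\<lambda>s. zeta_chi s * zeta (1 - s)"])
  show "{s. Re s < 0} \<noteq> {}" by (auto intro!: exI[of _ "-1"])
  show "connected ({s. Re s < 1} - {0 :: complex})"
    by (intro connected_open_delete open_halfspace_Re_lt convex_connected convex_halfspace_Re_lt) simp
  show "(\<lambda>s. zeta_chi s * zeta (1 - s)) holomorphic_on {s. Re s < 1} - {0}"
  proof (intro holomorphic_on_mult holomorphic_on_subset[OF zeta_chi_holomorphic])
    have "zeta \<circ> (\<lambda>s. 1 - s) holomorphic_on {s. Re s < 1} - {0}"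
      by (rule holomorphic_on_compose_gen[OF _ zeta_holomorphic]) (auto intro!: holomorphic_intros)
    thus "(\<lambda>s. zeta (1 - s)) holomorphic_on {s. Re s < 1} - {0}" by (simp add: o_def)
  qed auto
  fix s :: complex assume "s \<in> {s. Re s < 0}"
  hence s: "Re s < 0" by simp
  have "zeta (1 - s) = zeta_strip (1 - s)" using s by (intro zeta_eq_strip) auto
  moreover have "zeta s = zeta_chi s * zeta_strip (1 - s)"
    using s zeta_strip_functional_equation[of s] by (auto simp: zeta_eq_glue zeta_glue_def)
  ultimately show "zeta s = zeta_chi s * zeta (1 - s)" by simp
qed (use s in \<open>auto intro!: open_halfspace_Re_lt open_delete holomorphic_on_subset[OF zeta_holomorphic]\<close>)

text \<open>The asymmetric form, by duplication and reflection. It isolates the cosine, whose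
  exponential growth in \<open>Im s\<close> is compared later with the decay of
  \<open>Gamma\<close>.\<close>

lemma zeta_chi_one_minus:
  assumes s: "Re s > 0"
  shows "zeta_chi (1 - s) = 2 * of_real (2 * pi) powr (- s) * cos (of_real pi * s / 2) * Gamma s"
proof -
  have n1: "s / 2 \<notin> \<int>\<^sub>\<le>\<^sub>0" "s / 2 + 1 / 2 \<notin> \<int>\<^sub>\<le>\<^sub>0"
    using s by (auto elim!: nonpos_Ints_cases' simp: complex_eq_iff)
  have dup: "Gamma (s / 2) * Gamma ((1 + s) / 2) = exp ((1 - s) * of_real (ln 2)) * of_real (sqrt pi) * Gamma s"
    using Gamma_legendre_duplication[OF n1] by (simp add: field_simps add.commute)
  have g: "Gamma ((1 + s) / 2) * rGamma ((1 + s) / 2) = 1"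
    using Gamma_nonzero_Re_pos[of "(1 + s) / 2"] s by (simp add: rGamma_inverse_Gamma)
  have refl: "rGamma ((1 + s) / 2) * rGamma ((1 - s) / 2) = cos (of_real pi * s / 2) / of_real pi"
  proof -
    have "rGamma ((1 + s) / 2) * rGamma (1 - (1 + s) / 2) = sin (of_real pi * ((1 + s) / 2)) / of_real pi"
      by (rule rGamma_reflection_complex)
    moreover have "1 - (1 + s) / 2 = (1 - s) / 2" by (simp add: field_simps)
    moreover have "of_real pi * ((1 + s) / 2) = of_real pi * s / 2 + of_real pi / 2" by (simp add: field_simps)
    ultimately show ?thesis by (simp only: sin_add) simp
  qed
  have sq: "complex_of_real (sqrt pi) = exp (of_real (ln pi) / 2)"
  proof -
    have "sqrt pi = exp (ln pi / 2)" by (simp add: ln_sqrt[symmetric])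
    hence "complex_of_real (sqrt pi) = of_real (exp (ln pi / 2))" by (simp only:)
    thus ?thesis by (simp add: exp_of_real[symmetric])
  qed
  have P: "of_real pi powr (1 / 2 - s) * (exp ((1 - s) * of_real (ln 2)) * of_real (sqrt pi)) / of_real pi = 2 * of_real (2 * pi) powr (- s)"
  proof -
    have "Ln (of_real (2 * pi)) = of_real (ln 2) + of_real (ln pi)"
      by (subst Ln_of_real) (auto simp: ln_mult)
    moreover have "Ln (complex_of_real pi) = of_real (ln pi)" by (subst Ln_of_real) auto
    moreover have e2: "exp (of_real (ln 2)) = (2 :: complex)" by (simp add: exp_of_real)
    moreover have "exp (of_real (ln pi)) = complex_of_real pi" by (simp add: exp_of_real)
    ultimately have "of_real pi powr (1 / 2 - s) * (exp ((1 - s) * of_real (ln 2)) * of_real (sqrt pi)) / of_real pi =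
      exp ((1 / 2 - s) * of_real (ln pi)) * (exp ((1 - s) * of_real (ln 2)) * exp (of_real (ln pi) / 2)) / exp (of_real (ln pi))"
      unfolding sq by (simp add: powr_def)
    also have "\<dots> = exp (of_real (ln 2)) * exp (- s * (of_real (ln 2) + of_real (ln pi)))"
    proof -
      have "(1 / 2 - s) * L + ((1 - s) * l + L / 2) - L = l + - s * (l + L)" for l L :: complex
        by (simp add: algebra_simps)
      thus ?thesis unfolding exp_diff[symmetric] exp_add[symmetric] by (simp only:)
    qed
    also have "\<dots> = 2 * of_real (2 * pi) powr (- s)"
      using \<open>Ln (of_real (2 * pi)) = of_real (ln 2) + of_real (ln pi)\<close> e2
      by (simp add: powr_def)
    finally show ?thesis .
  qed
  have "1 - s - 1 / 2 = 1 / 2 - s" by simp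
  have "Gamma (s / 2) = Gamma (s / 2) * (Gamma ((1 + s) / 2) * rGamma ((1 + s) / 2))" by (simp add: g)
  also have "\<dots> = exp ((1 - s) * of_real (ln 2)) * of_real (sqrt pi) * Gamma s * rGamma ((1 + s) / 2)"
    unfolding mult.assoc[symmetric] dup ..
  finally have G: "Gamma (s / 2) = exp ((1 - s) * of_real (ln 2)) * of_real (sqrt pi) * Gamma s * rGamma ((1 + s) / 2)" .
  have "zeta_chi (1 - s) = of_real pi powr (1 / 2 - s) * rGamma ((1 - s) / 2) * Gamma (s / 2)"
    by (simp add: zeta_chi_def algebra_simps)
  also have "\<dots> = of_real pi powr (1 / 2 - s) * (exp ((1 - s) * of_real (ln 2)) * of_real (sqrt pi)) * Gamma s *
      (rGamma ((1 + s) / 2) * rGamma ((1 - s) / 2))" unfolding G by (simp only: mult_ac)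
  also have "\<dots> = (of_real pi powr (1 / 2 - s) * (exp ((1 - s) * of_real (ln 2)) * of_real (sqrt pi)) / of_real pi) *
      cos (of_real pi * s / 2) * Gamma s"
    unfolding refl by simp
  finally show ?thesis unfolding P by simp
qed

lemma zeta_functional_equation:
  assumes s: "Re s > 0" "s \<noteq> 1"
  shows "zeta (1 - s) = 2 * of_real (2 * pi) powr (- s) * cos (of_real pi * s / 2) * Gamma s * zeta s"
  using zeta_functional_equation_chi[of "1 - s"] zeta_chi_one_minus[OF s(1)] s by simp

section \<open>Conjugation symmetry and the Hardy function\<close>

lemma zeta_cnj: "zeta (cnj s) = cnj (zeta s)"
proof (cases "s = 1")
  case False
  have "(cnj \<circ> zeta \<circ> cnj) s = zeta s"
  proof (rule zeta_unique)
    show "cnj \<circ> zeta \<circ> cnj holomorphic_on - {1}"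
      by (rule holomorphic_on_compose_cnj_cnj, rule holomorphic_on_subset[OF zeta_holomorphic]) (auto simp: complex_eq_iff)
    fix s assume "Re s > 1"
    hence "(\<lambda>n. cnj (1 / of_nat (Suc n) powr cnj s)) sums cnj (zeta (cnj s))"
      by (subst sums_cnj) (intro zeta_sums, simp)
    thus "(\<lambda>n. 1 / of_nat (Suc n) powr s) sums (cnj \<circ> zeta \<circ> cnj) s"
      by (simp add: cnj_powr del: of_nat_Suc)
  qed fact
  thus ?thesis by (simp add: o_def) (metis complex_cnj_cnj)
qed (simp add: zeta_eq_glue zeta_glue_def)

text \<open>On the critical line \<open>1 - s\<close> is the conjugate of \<open>s\<close> and
  \<open>zeta_chi s = exp (- 2 i theta)\<close>. The functional equation therefore says that the
  rotated value equals its own conjugate.\<close>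

lemma zeta_critical_line_real: "Im (exp (\<i> * of_real (rs_theta t)) * zeta (Complex (1 / 2) t)) = 0"
proof -
  let ?s = "Complex (1/2) t" and ?w = "Complex (1/4) (t/2)"
  have w: "?w \<notin> \<int>\<^sub>\<le>\<^sub>0" by (auto elim!: nonpos_Ints_cases' simp: complex_eq_iff)
  have G: "Gamma ?w = exp (ln_Gamma ?w)" using w by (simp add: Gamma_complex_altdef)
  have cw: "(1 - ?s) / 2 = cnj ?w" "?s / 2 = ?w" by (simp_all add: complex_eq_iff)
  have chi: "zeta_chi ?s = exp (- 2 * \<i> * of_real (rs_theta t))"
  proof -
    have "zeta_chi ?s = exp ((\<i> * of_real t) * of_real (ln pi)) * (cnj (Gamma ?w) / Gamma ?w)"
    proof -
      have "?s - 1/2 = \<i> * of_real t" by (simp add: complex_eq_iff)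
      moreover have "Ln (complex_of_real pi) = of_real (ln pi)" by (subst Ln_of_real) auto
      ultimately have "of_real pi powr (?s - 1 / 2) = exp ((\<i> * of_real t) * of_real (ln pi))" by (simp add: powr_def)
      hence "zeta_chi ?s = exp ((\<i> * of_real t) * of_real (ln pi)) * rGamma ?w * Gamma (cnj ?w)"
        by (simp only: zeta_chi_def cw)
      thus ?thesis unfolding rGamma_inverse_Gamma cnj_Gamma by (simp only: divide_inverse mult_ac)
    qed
    also have "cnj (Gamma ?w) / Gamma ?w = exp (cnj (ln_Gamma ?w) - ln_Gamma ?w)"
      unfolding G by (simp add: exp_cnj exp_diff)
    also have "cnj (ln_Gamma ?w) - ln_Gamma ?w = - 2 * \<i> * of_real (Im (ln_Gamma ?w))"
      by (simp add: complex_eq_iff)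
    finally show ?thesis
      unfolding rs_theta_def by (simp add: exp_add[symmetric] algebra_simps)
  qed
  have c1: "1 - ?s = cnj ?s" by (simp add: complex_eq_iff)
  have "zeta ?s = zeta_chi ?s * zeta (1 - ?s)"
    by (rule zeta_functional_equation_chi) (auto simp: complex_eq_iff)
  hence "zeta ?s = exp (- 2 * \<i> * of_real (rs_theta t)) * cnj (zeta ?s)"
    unfolding c1 chi zeta_cnj .
  hence "exp (\<i> * of_real (rs_theta t)) * zeta ?s = exp (\<i> * of_real (rs_theta t)) * exp (- 2 * \<i> * of_real (rs_theta t)) * cnj (zeta ?s)"
    by (metis mult.assoc)
  also have "\<dots> = cnj (exp (\<i> * of_real (rs_theta t)) * zeta ?s)"
    by (simp add: exp_cnj flip: exp_add)
  finally have "Im (exp (\<i> * of_real (rs_theta t)) * zeta ?s) = Im (cnj (exp (\<i> * of_real (rs_theta t)) * zeta ?s))"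
    by (rule arg_cong)
  thus ?thesis unfolding cnj.sel by linarith
qed

lemma abs_hardy_Z: "\<bar>hardy_Z t\<bar> = norm (zeta (Complex (1 / 2) t))"
proof -
  have "norm (exp (\<i> * of_real (rs_theta t)) * zeta (Complex (1 / 2) t)) = \<bar>hardy_Z t\<bar>"
    unfolding hardy_Z_def using zeta_critical_line_real[of t] by (simp add: cmod_eq_Re)
  thus ?thesis by (simp add: norm_mult)
qed

lemma hardy_Z_square: "(hardy_Z t)\<^sup>2 = (norm (zeta (Complex (1 / 2) t)))\<^sup>2"
  by (metis abs_hardy_Z power2_abs)

lemma hardy_Z_eq_0_iff: "hardy_Z t = 0 \<longleftrightarrow> zeta (Complex (1 / 2) t) = 0"
  using abs_hardy_Z[of t] by auto

section \<open>Continuity and growth of zeta\<close>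

lemma continuous_on_zeta_line: "a \<noteq> 1 \<Longrightarrow> continuous_on A (\<lambda>t. zeta (Complex a t))"
  by (rule continuous_on_compose2[OF holomorphic_on_imp_continuous_on[OF zeta_holomorphic]])
     (auto intro!: continuous_intros simp: complex_eq_iff)

text \<open>The mean value inequality is used twice: for \<open>w powr (- s)\<close>, and for its
  antiderivative after subtraction of the linear function with the slope at \<open>a\<close>. Each
  time the derivative costs a factor \<open>norm s\<close> and one power of
  \<open>a\<close>.\<close>

lemma norm_EM_term_le:
  assumes a: "a > 0" and s: "Re s > 0" "s \<noteq> 1"
  shows "norm (EM_term a s) \<le> 2 * norm s * a powr (- Re s - 1)"
proof -
  define B where "B = norm s * a powr (- Re s - 1)"
  have B: "B \<ge> 0" by (simp add: B_def)
  let ?S = "closed_segment (complex_of_real a) (of_real (a + 1))"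
  have S: "\<exists>x. w = of_real x \<and> a \<le> x \<and> x \<le> a + 1" if "w \<in> ?S" for w
    using that unfolding closed_segment_of_real by (auto simp: closed_segment_eq_real_ivl)
  have aS: "of_real a \<in> ?S" "of_real (a + 1) \<in> ?S" by (rule ends_in_segment)+
  have np: "w \<notin> \<real>\<^sub>\<le>\<^sub>0" if "w \<in> ?S" for w using S[OF that] a by (auto simp: complex_nonpos_Reals_iff)
  have d1: "norm (w powr (- s) - of_real a powr (- s)) \<le> B * norm (w - of_real a)" if w: "w \<in> ?S" for w
  proof (rule field_differentiable_bound[where f="\<lambda>w. w powr (- s)" and f'="\<lambda>w. - s * w powr (- s - 1)" and S="?S"])
    fix z assume z: "z \<in> ?S"
    show "((\<lambda>w. w powr (- s)) has_field_derivative - s * z powr (- s - 1)) (at z within ?S)"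
      by (rule DERIV_subset[OF has_field_derivative_powr[OF np[OF z]]]) simp
    from S[OF z] obtain x where x: "z = of_real x" "a \<le> x" by blast
    have "norm (- s * z powr (- s - 1)) = norm s * x powr (- Re s - 1)"
      using x a by (simp add: norm_mult norm_powr_real_powr)
    also have "x powr (- Re s - 1) \<le> a powr (- Re s - 1)" using x a s by (intro powr_mono2') auto
    finally show "norm (- s * z powr (- s - 1)) \<le> B" by (simp add: B_def mult_left_mono)
  qed (use w aS in auto)
  have d1': "norm (w powr (- s) - of_real a powr (- s)) \<le> B" if w: "w \<in> ?S" for w
  proof -
    from S[OF w] obtain x where "w = of_real x" "a \<le> x" "x \<le> a + 1" by blast
    hence "norm (w - of_real a) \<le> 1" by (simp flip: of_real_diff)
    hence "B * norm (w - of_real a) \<le> B * 1" using B by (intro mult_left_mono) auto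
    with d1[OF w] show ?thesis by simp
  qed
  have nz: "1 - s \<noteq> 0" using s by simp
  have "norm ((of_real (a + 1) powr (1 - s) / (1 - s) - of_real (a + 1) * of_real a powr (- s)) -
     (of_real a powr (1 - s) / (1 - s) - of_real a * of_real a powr (- s))) \<le> B * norm (of_real (a + 1) - complex_of_real a)"
  proof (rule field_differentiable_bound[where f="\<lambda>w. w powr (1 - s) / (1 - s) - w * of_real a powr (- s)"
        and f'="\<lambda>w. w powr (- s) - of_real a powr (- s)" and S="?S"])
    fix z assume z: "z \<in> ?S"
    have dp: "((\<lambda>w. w powr (1 - s)) has_field_derivative (1 - s) * z powr (1 - s - 1)) (at z within ?S)"
      by (rule DERIV_subset[OF has_field_derivative_powr[OF np[OF z]]]) simp
    show "((\<lambda>w. w powr (1 - s) / (1 - s) - w * of_real a powr (- s)) has_field_derivative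
        z powr (- s) - of_real a powr (- s)) (at z within ?S)"
      using DERIV_diff[OF DERIV_cdivide[OF dp, of "1 - s"] DERIV_cmult_right[OF DERIV_ident]] nz by simp
    show "norm (z powr (- s) - of_real a powr (- s)) \<le> B" by (rule d1'[OF z])
  qed (use aS in auto)
  hence d2: "norm ((of_real (a + 1) powr (1 - s) - of_real a powr (1 - s)) / (1 - s) - of_real a powr (- s)) \<le> B"
    by (simp add: algebra_simps diff_divide_distrib)
  have "EM_term a s = (of_real (a + 1) powr (- s) - of_real a powr (- s)) / 2 -
     ((of_real (a + 1) powr (1 - s) - of_real a powr (1 - s)) / (1 - s) - of_real a powr (- s))"
  proof -
    have "(P + Q) / 2 + R / (s - 1) = (Q - P) / 2 - (R / (1 - s) - P)" for P Q R :: complex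
    proof -
      have "R / (s - 1) = - (R / (1 - s))" by (metis minus_diff_eq minus_divide_right)
      thus ?thesis by (simp add: field_simps)
    qed
    thus ?thesis unfolding EM_term_def .
  qed
  also have "norm \<dots> \<le> norm ((of_real (a + 1) powr (- s) - of_real a powr (- s)) / 2) + B"
    by (rule order_trans[OF norm_triangle_ineq4 add_left_mono[OF d2]])
  also have "norm ((of_real (a + 1) powr (- s) - complex_of_real a powr (- s)) / 2) \<le> B / 2"
    using d1'[OF aS(2)] by (simp add: norm_divide)
  finally have "norm (EM_term a s) \<le> 2 * B" using B by simp
  thus ?thesis by (simp add: B_def)
qed

text \<open>For \<open>Re s >= 1/2\<close> the trapezoidal errors are at most
  \<open>2 * norm s * n powr (-(3/2))\<close>, a convergent series with a single factor
  \<open>norm s\<close>.\<close>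

lemma zeta_growth: "\<exists>C>0. \<forall>s. Re s \<ge> 1/2 \<and> s \<noteq> 1 \<longrightarrow> norm (zeta s - 1 / (s - 1)) \<le> C * (1 + norm s)"
proof -
  define S where "S = (\<Sum>n. real (Suc n) powr (-(3/2)))"
  have sm: "summable (\<lambda>n. real (Suc n) powr (-(3/2)))"
    by (subst summable_Suc_iff) (simp add: summable_real_powr_iff)
  have S0: "S \<ge> 0" unfolding S_def by (intro suminf_nonneg sm) auto
  have "norm (zeta s - 1 / (s - 1)) \<le> (1 + 2 * S) * (1 + norm s)" if s: "Re s \<ge> 1/2" "s \<noteq> 1" for s
  proof -
    have z: "zeta s - 1 / (s - 1) = 1/2 + (\<Sum>n. EM_term (real (Suc n)) s)"
      using s EM_sums[of s] zeta_eq_strip[of s] by (simp add: zeta_strip_def sums_iff)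
    have b: "norm (EM_term (real (Suc n)) s) \<le> 2 * norm s * real (Suc n) powr (-(3/2))" for n
    proof -
      have "norm (EM_term (real (Suc n)) s) \<le> 2 * norm s * real (Suc n) powr (- Re s - 1)"
        using s by (intro norm_EM_term_le) auto
      also have "\<dots> \<le> 2 * norm s * real (Suc n) powr (-(3/2))"
        using s by (intro mult_left_mono powr_mono) auto
      finally show ?thesis .
    qed
    have "norm (\<Sum>n. EM_term (real (Suc n)) s) \<le> (\<Sum>n. 2 * norm s * real (Suc n) powr (-(3/2)))"
      by (rule norm_suminf_le[OF b]) (intro summable_mult sm)
    also have "\<dots> = 2 * norm s * S" unfolding S_def by (rule suminf_mult[OF sm])
    finally have "norm (zeta s - 1 / (s - 1)) \<le> 1/2 + 2 * norm s * S"
      unfolding z by (intro order_trans[OF norm_triangle_ineq]) auto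
    also have "\<dots> \<le> (1 + 2 * S) * (1 + norm s)" using S0 by (simp add: algebra_simps)
    finally show ?thesis .
  qed
  thus ?thesis using S0 by (intro exI[of _ "1 + 2 * S"]) auto
qed

section \<open>The Mellin integral of the squared zeta function\<close>

lemma symmetric_integral_tendsto:
  fixes f :: "real \<Rightarrow> complex"
  assumes c: "continuous_on UNIV f" and i: "integrable lborel f"
  shows "(\<lambda>n. integral {- real n..real n} f) \<longlonglongrightarrow> (\<integral>t. f t \<partial>lborel)"
proof -
  have m[measurable]: "f \<in> borel_measurable borel" using c by (rule borel_measurable_continuous_onI)
  have si: "set_integrable lborel {- real n..real n} f" for n
    unfolding set_integrable_def using i by (intro integrable_mult_indicator) auto
  have "(\<lambda>n. \<integral>t. indicator {- real n..real n} t *\<^sub>R f t \<partial>lborel) \<longlonglongrightarrow> (\<integral>t. f t \<partial>lborel)"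
  proof (rule integral_dominated_convergence[where w="\<lambda>t. norm (f t)"])
    show "AE t in lborel. (\<lambda>n. indicator {- real n..real n} t *\<^sub>R f t) \<longlonglongrightarrow> f t"
    proof (rule AE_I2)
      fix t :: real
      obtain N where N: "\<bar>t\<bar> \<le> real N" using real_arch_simple by blast
      have "eventually (\<lambda>n. indicator {- real n..real n} t *\<^sub>R f t = f t) sequentially"
        using eventually_ge_at_top[of N] by eventually_elim (use N in \<open>auto simp: indicator_def abs_le_iff\<close>)
      thus "(\<lambda>n. indicator {- real n..real n} t *\<^sub>R f t) \<longlonglongrightarrow> f t" by (rule tendsto_eventually)
    qed
  qed (use i in \<open>auto simp: indicator_def\<close>)
  moreover have "(\<integral>t. indicator {- real n..real n} t *\<^sub>R f t \<partial>lborel) = integral {- real n..real n} f" for n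
    using set_borel_integral_eq_integral(2)[OF si[of n]] by (simp add: set_lebesgue_integral_def)
  ultimately show ?thesis by simp
qed

text \<open>The residue theorem on rectangles of growing height, whose horizontal sides vanish by
  the bound \<open>B\<close>. With the pole written as \<open>h s / (s - 1)^2\<close> the residue is
  \<open>deriv h 1\<close>. The abscissa \<open>a'\<close> leaves room to the left of the line at
  \<open>a\<close>.\<close>

lemma line_integral_shift_double_pole:
  fixes h :: "complex \<Rightarrow> complex" and B :: "real \<Rightarrow> real"
  assumes ab: "a' < a" "a < 1" "1 < b"
    and h: "h holomorphic_on {s. Re s > a'}"
  defines "F \<equiv> \<lambda>s. h s / (s - 1)\<^sup>2"
  assumes bd: "\<And>s. a \<le> Re s \<Longrightarrow> Re s \<le> b \<Longrightarrow> \<bar>Im s\<bar> \<ge> 1 \<Longrightarrow> norm (F s) \<le> B \<bar>Im s\<bar>"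
    and B: "(B \<longlongrightarrow> 0) at_top"
    and ia: "integrable lborel (\<lambda>t. F (Complex a t))" and ib: "integrable lborel (\<lambda>t. F (Complex b t))"
  shows "(\<integral>t. F (Complex b t) \<partial>lborel) - (\<integral>t. F (Complex a t) \<partial>lborel) = 2 * of_real pi * deriv h 1"
proof -
  let ?S = "{s. Re s > a'}"
  have oS: "open ?S" and cS: "connected ?S"
    by (auto intro: open_halfspace_Re_gt convex_connected convex_halfspace_Re_gt)
  have Fhol: "F holomorphic_on ?S - {1}"
    unfolding F_def by (intro holomorphic_intros holomorphic_on_subset[OF h]) auto
  have Fcont: "continuous_on A F" if "A \<subseteq> ?S - {1}" for A
    using holomorphic_on_imp_continuous_on[OF Fhol] that continuous_on_subset by blast
  have res: "residue F 1 = deriv h 1"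
    using residue_holomorphic_over_power[OF oS _ h, of 1 1] ab by (simp add: F_def numeral_2_eq_2)
  have Fline: "continuous_on UNIV (\<lambda>t. F (Complex c t))" if "c > a'" "c \<noteq> 1" for c
    by (rule continuous_on_compose2[OF Fcont[of "{s. Re s = c}"]]) (use that in \<open>auto intro!: continuous_intros\<close>)
  have main: "norm (\<i> * integral {- real n..real n} (\<lambda>t. F (Complex b t)) - \<i> * integral {- real n..real n} (\<lambda>t. F (Complex a t))
      - 2 * of_real pi * \<i> * deriv h 1) \<le> 2 * (B (real n) * (b - a))" if n: "n \<ge> 1" for n
  proof -
    define R where "R = real n"
    have R: "R \<ge> 1" using n by (simp add: R_def)
    define a1 a2 a3 a4 where "a1 = Complex a (-R)" and "a2 = Complex b (-R)" and "a3 = Complex b R" and "a4 = Complex a R"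
    have rp: "rectpath a1 a3 = linepath a1 a2 +++ linepath a2 a3 +++ linepath a3 a4 +++ linepath a4 a1"
      by (simp add: rectpath_def Let_def a1_def a2_def a3_def a4_def)
    have box: "1 \<in> box a1 a3" using ab R by (auto simp: in_box_complex_iff a1_def a3_def)
    have pim: "path_image (rectpath a1 a3) \<subseteq> ?S - {1}"
      using ab R by (subst path_image_rectpath) (auto simp: a1_def a3_def)
    have "contour_integral (rectpath a1 a3) F = 2 * pi * \<i> * (\<Sum>p\<in>{1}. winding_number (rectpath a1 a3) p * residue F p)"
    proof (rule Residue_theorem[OF oS cS _ Fhol _ _ pim])
      show "\<forall>z. z \<notin> ?S \<longrightarrow> winding_number (rectpath a1 a3) z = 0"
      proof (intro allI impI)
        fix z assume "z \<notin> ?S"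
        thus "winding_number (rectpath a1 a3) z = 0"
          using ab R by (intro winding_number_rectpath_outside) (auto simp: a1_def a3_def in_cbox_complex_iff)
      qed
    qed auto
    hence I: "contour_integral (rectpath a1 a3) F = 2 * of_real pi * \<i> * deriv h 1"
      using winding_number_rectpath[OF box] res by simp
    have segs: "closed_segment a1 a2 \<subseteq> ?S - {1}" "closed_segment a2 a3 \<subseteq> ?S - {1}"
      "closed_segment a3 a4 \<subseteq> ?S - {1}" "closed_segment a4 a1 \<subseteq> ?S - {1}"
      using pim unfolding rp by (auto simp: path_image_join)
    have ci: "F contour_integrable_on linepath a1 a2" "F contour_integrable_on linepath a2 a3"
      "F contour_integrable_on linepath a3 a4" "F contour_integrable_on linepath a4 a1"
      by (intro contour_integrable_continuous_linepath Fcont segs)+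
    have I2: "contour_integral (rectpath a1 a3) F = contour_integral (linepath a1 a2) F + contour_integral (linepath a2 a3) F
       + contour_integral (linepath a3 a4) F + contour_integral (linepath a4 a1) F"
      unfolding rp using ci by (simp add: contour_integral_join contour_integrable_joinI add_ac)
    have v1: "contour_integral (linepath a2 a3) F = \<i> * integral {-R..R} (\<lambda>t. F (Complex b t))"
      by (rule contour_integral_linepath_same_Re) (use R in \<open>auto simp: a2_def a3_def\<close>)
    have "contour_integral (linepath a4 a1) F = - contour_integral (linepath a1 a4) F"
      by (rule contour_integral_reverse_linepath[OF Fcont[OF segs(4)]])
    also have "contour_integral (linepath a1 a4) F = \<i> * integral {-R..R} (\<lambda>t. F (Complex a t))"
      by (rule contour_integral_linepath_same_Re) (use R in \<open>auto simp: a1_def a4_def\<close>)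
    finally have v2: "contour_integral (linepath a4 a1) F = - (\<i> * integral {-R..R} (\<lambda>t. F (Complex a t)))" .
    have B0: "B R \<ge> 0" using bd[of a4] ab R by (auto simp: a4_def intro: order_trans[OF norm_ge_zero])
    have h1: "norm (contour_integral (linepath a1 a2) F) \<le> B R * norm (a2 - a1)"
    proof (rule contour_integral_bound_linepath[OF ci(1) B0])
      fix x assume "x \<in> closed_segment a1 a2"
      hence "Re x \<in> {a..b}" "Im x = -R"
        using ab by (auto simp: a1_def a2_def closed_segment_same_Im closed_segment_eq_real_ivl)
      thus "norm (F x) \<le> B R" using bd[of x] R by simp
    qed
    have h2: "norm (contour_integral (linepath a3 a4) F) \<le> B R * norm (a4 - a3)"
    proof (rule contour_integral_bound_linepath[OF ci(3) B0])
      fix x assume "x \<in> closed_segment a3 a4"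
      hence "Re x \<in> {a..b}" "Im x = R"
        using ab by (auto simp: a3_def a4_def closed_segment_same_Im closed_segment_eq_real_ivl)
      thus "norm (F x) \<le> B R" using bd[of x] R by simp
    qed
    have nn: "norm (a2 - a1) = b - a" "norm (a4 - a3) = b - a"
    proof -
      have "a2 - a1 = of_real (b - a)" "a4 - a3 = - of_real (b - a)"
        by (auto simp: a1_def a2_def a3_def a4_def complex_eq_iff)
      thus "norm (a2 - a1) = b - a" "norm (a4 - a3) = b - a"
        using ab by (simp_all only: norm_minus_cancel norm_of_real)
    qed
    have "\<i> * integral {-R..R} (\<lambda>t. F (Complex b t)) - \<i> * integral {-R..R} (\<lambda>t. F (Complex a t)) - 2 * of_real pi * \<i> * deriv h 1 =
      - (contour_integral (linepath a1 a2) F + contour_integral (linepath a3 a4) F)"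
      using I unfolding I2 v1 v2 by (simp add: algebra_simps)
    also have "norm \<dots> \<le> norm (contour_integral (linepath a1 a2) F) + norm (contour_integral (linepath a3 a4) F)"
      unfolding norm_minus_cancel by (rule norm_triangle_ineq)
    also have "\<dots> \<le> 2 * (B R * (b - a))" using h1 h2 unfolding nn by simp
    finally show ?thesis unfolding R_def .
  qed
  define D where "D = (\<lambda>n. \<i> * integral {- real n..real n} (\<lambda>t. F (Complex b t)) - \<i> * integral {- real n..real n} (\<lambda>t. F (Complex a t))
      - 2 * of_real pi * \<i> * deriv h 1)"
  have "D \<longlonglongrightarrow> 0"
  proof (rule Lim_null_comparison)
    show "\<forall>\<^sub>F n in sequentially. norm (D n) \<le> 2 * (B (real n) * (b - a))"
      using eventually_ge_at_top[of 1] by eventually_elim (unfold D_def, rule main)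
    have "(\<lambda>n. 2 * (B (real n) * (b - a))) \<longlonglongrightarrow> 2 * (0 * (b - a))"
      by (intro tendsto_intros filterlim_compose[OF B filterlim_real_sequentially])
    thus "(\<lambda>n. 2 * (B (real n) * (b - a))) \<longlonglongrightarrow> 0" by simp
  qed
  moreover have "D \<longlonglongrightarrow> \<i> * (\<integral>t. F (Complex b t) \<partial>lborel) - \<i> * (\<integral>t. F (Complex a t) \<partial>lborel) - 2 * of_real pi * \<i> * deriv h 1"
    unfolding D_def using ab by (intro tendsto_intros symmetric_integral_tendsto Fline ia ib) auto
  ultimately have "\<i> * (\<integral>t. F (Complex b t) \<partial>lborel) - \<i> * (\<integral>t. F (Complex a t) \<partial>lborel) - 2 * of_real pi * \<i> * deriv h 1 = 0"
    using LIMSEQ_unique by blast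
  hence "\<i> * ((\<integral>t. F (Complex b t) \<partial>lborel) - (\<integral>t. F (Complex a t) \<partial>lborel) - 2 * of_real pi * deriv h 1) = 0"
    by (simp add: algebra_simps)
  thus ?thesis by simp
qed

section \<open>Bounds for the integrands on vertical lines\<close>

lemma integral_exp_abs:
  assumes "b > 0"
  shows "(\<integral>t. exp (- b * \<bar>t :: real\<bar>) \<partial>lborel) = 2 / b"
proof -
  have c: "integrable hl (\<lambda>x. complex_of_real x ^ 0 * exp (- (of_real b * of_real x)))"
    "(\<integral>x. complex_of_real x ^ 0 * exp (- (of_real b * of_real x)) \<partial>hl) = fact 0 / of_real b ^ (0 + 1)"
    by (rule hl_power_exp; use assms in simp)+
  have e: "complex_of_real x ^ 0 * exp (- (of_real b * of_real x)) = of_real (exp (- (b * x)))" for x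
    by (simp flip: exp_of_real)
  have i: "integrable hl (\<lambda>x. exp (- (b * x)))"
    using c(1) unfolding e by (simp only: complex_of_real_integrable_eq)
  have "complex_of_real (\<integral>x. exp (- (b * x)) \<partial>hl) = of_real (1 / b)"
    using c(2) unfolding e by simp
  hence v: "(\<integral>x. exp (- (b * x)) \<partial>hl) = 1 / b" by (simp only: of_real_eq_iff)
  let ?f = "\<lambda>x. indicator {0<..} x *\<^sub>R exp (- (b * x)) :: real"
  have fi: "integrable lborel ?f" using i by (simp add: hl_integrable_iff set_integrable_def)
  have fv: "(\<integral>x. ?f x \<partial>lborel) = 1 / b" using v by (simp add: hl_integral set_lebesgue_integral_def)
  have fi': "integrable lborel (\<lambda>x. ?f (0 + (-1) * x))" by (rule lborel_integrable_real_affine[OF fi]) simp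
  have fv': "(\<integral>x. ?f (0 + (-1) * x) \<partial>lborel) = 1 / b"
    using lborel_integral_real_affine[of "-1" ?f 0] fv by simp
  have "(\<integral>t. exp (- b * \<bar>t\<bar>) \<partial>lborel) = (\<integral>t. ?f t + ?f (0 + (-1) * t) \<partial>lborel)"
  proof (rule integral_cong_AE)
    have "AE t in lborel. t \<noteq> (0 :: real)" by (rule AE_lborel_singleton)
    thus "AE t in lborel. exp (- b * \<bar>t\<bar>) = ?f t + ?f (0 + (-1) * t)"
      by eventually_elim (auto simp: indicator_def)
  qed auto
  also have "\<dots> = 1 / b + 1 / b"
    using fv fv' Bochner_Integration.integral_add[OF fi fi'] by (simp only:)
  finally show ?thesis by simp
qed

lemma integrable_poly_exp_abs:
  assumes b: "b > 0"
  shows "integrable lborel (\<lambda>t. (1 + \<bar>t :: real\<bar>) ^ 2 * exp (- b * \<bar>t\<bar>))"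
    and "b \<le> 1 \<Longrightarrow> (\<integral>t. (1 + \<bar>t :: real\<bar>) ^ 2 * exp (- b * \<bar>t\<bar>) \<partial>lborel) \<le> 64 / b ^ 3"
proof -
  \<comment> \<open>Chosen so that \<open>1 + |t| <= c * exp (b/4 * |t|)\<close>. The square then
    costs half of the exponential decay.\<close>
  define c where "c = max 1 (4 / b)"
  have c: "c \<ge> 1" "c * b \<ge> 4" using b by (auto simp: c_def field_simps max_def)
  have le: "(1 + \<bar>t\<bar>) ^ 2 * exp (- b * \<bar>t\<bar>) \<le> c\<^sup>2 * exp (- (b/2) * \<bar>t\<bar>)" for t :: real
  proof -
    have "1 + \<bar>t\<bar> \<le> c + (c * b / 4) * \<bar>t\<bar>" using c mult_right_mono[OF c(2), of "\<bar>t\<bar>"] by simp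
    also have "\<dots> = c * (1 + b / 4 * \<bar>t\<bar>)" by (simp add: algebra_simps)
    also have "\<dots> \<le> c * exp (b / 4 * \<bar>t\<bar>)" using c by (intro mult_left_mono exp_ge_add_one_self) auto
    finally have "(1 + \<bar>t\<bar>)\<^sup>2 \<le> (c * exp (b / 4 * \<bar>t\<bar>))\<^sup>2" by (intro power_mono) auto
    also have "\<dots> = c\<^sup>2 * exp (b / 2 * \<bar>t\<bar>)" by (simp add: power_mult_distrib power2_eq_square flip: exp_add)
    finally have "(1 + \<bar>t\<bar>)\<^sup>2 * exp (- b * \<bar>t\<bar>) \<le> c\<^sup>2 * exp (b / 2 * \<bar>t\<bar>) * exp (- b * \<bar>t\<bar>)"
      by (intro mult_right_mono) auto
    also have "\<dots> = c\<^sup>2 * exp (- (b/2) * \<bar>t\<bar>)" by (simp add: mult.assoc flip: exp_add)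
    finally show ?thesis .
  qed
  have i: "integrable lborel (\<lambda>t. c\<^sup>2 * exp (- (b/2) * \<bar>t\<bar>))"
    using b by (intro integrable_mult_right integrable_exp_abs) auto
  show i2: "integrable lborel (\<lambda>t. (1 + \<bar>t :: real\<bar>) ^ 2 * exp (- b * \<bar>t\<bar>))"
    by (rule Bochner_Integration.integrable_bound[OF i]) (use le in auto)
  show "(\<integral>t. (1 + \<bar>t :: real\<bar>) ^ 2 * exp (- b * \<bar>t\<bar>) \<partial>lborel) \<le> 64 / b ^ 3" if "b \<le> 1"
  proof -
    have "c = 4 / b" using that b by (simp add: c_def max_def field_simps)
    have "(\<integral>t. (1 + \<bar>t :: real\<bar>) ^ 2 * exp (- b * \<bar>t\<bar>) \<partial>lborel) \<le> (\<integral>t. c\<^sup>2 * exp (- (b/2) * \<bar>t\<bar>) \<partial>lborel)"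
      by (rule Bochner_Integration.integral_mono[OF i2 i le])
    also have "\<dots> = c\<^sup>2 * (2 / (b/2))"
      by (subst integral_mult_right_zero, subst integral_exp_abs) (use b in auto)
    also have "\<dots> = 64 / b ^ 3" using b by (simp add: \<open>c = 4 / b\<close> field_simps power2_eq_square power3_eq_cube)
    finally show ?thesis .
  qed
qed

text \<open>This is \<open>(s - 1) \<zeta>(s)\<close> for \<open>Re s > -1\<close>, including the value 1 at the pole.\<close>

definition zeta_reg :: "complex \<Rightarrow> complex" where
  "zeta_reg s = 1 + (s - 1) * (1 / 2 + rGamma s * Mellin_coth 1 s)"

lemma zeta_reg_holomorphic: "zeta_reg holomorphic_on {s. Re s > -1}"
  unfolding zeta_reg_def[abs_def]
  by (intro holomorphic_intros holomorphic_on_subset[OF Mellin_coth_holomorphic]) auto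

lemma zeta_reg_eq: "Re s > -1 \<Longrightarrow> s \<noteq> 1 \<Longrightarrow> zeta_reg s = (s - 1) * zeta s"
  by (simp add: zeta_reg_def zeta_eq_strip zeta_strip_def field_simps)

lemma zeta_bound_strip:
  "\<exists>C>0. \<forall>s. 1/2 \<le> Re s \<and> Re s \<le> 3 \<and> norm (s - 1) \<ge> 1/2 \<longrightarrow> norm (zeta s) \<le> C * (1 + \<bar>Im s\<bar>)"
proof -
  obtain C where C: "C > 0" "\<And>s. Re s \<ge> 1/2 \<Longrightarrow> s \<noteq> 1 \<Longrightarrow> norm (zeta s - 1 / (s - 1)) \<le> C * (1 + norm s)"
    using zeta_growth by blast
  have "norm (zeta s) \<le> (2 + 4 * C) * (1 + \<bar>Im s\<bar>)" if s: "1/2 \<le> Re s" "Re s \<le> 3" "norm (s - 1) \<ge> 1/2" for s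
  proof -
    have s1: "s \<noteq> 1" using s by auto
    have "norm (zeta s) \<le> norm (1 / (s - 1)) + norm (zeta s - 1 / (s - 1))"
      by (metis add.commute diff_add_cancel norm_triangle_ineq)
    also have "norm (1 / (s - 1)) \<le> 2" using s by (simp add: norm_divide divide_simps)
    also have "norm (zeta s - 1 / (s - 1)) \<le> C * (1 + norm s)" using C s s1 by blast
    also have "norm s \<le> 3 + \<bar>Im s\<bar>" using cmod_le[of s] s by simp
    finally have "norm (zeta s) \<le> 2 + C * (1 + (3 + \<bar>Im s\<bar>))" using C(1) by (simp add: mult_left_mono)
    also have "\<dots> \<le> (2 + 4 * C) * (1 + \<bar>Im s\<bar>)" using C(1) by (simp add: algebra_simps)
    finally show ?thesis .
  qed
  thus ?thesis using C(1) by (intro exI[of _ "2 + 4 * C"]) auto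
qed

lemma zeta_critical_bound: "\<exists>C>0. \<forall>t. norm (zeta (Complex (1/2) t)) \<le> C * (1 + \<bar>t\<bar>)"
proof -
  obtain C where C: "C > 0" "\<And>s. 1/2 \<le> Re s \<Longrightarrow> Re s \<le> 3 \<Longrightarrow> norm (s - 1) \<ge> 1/2 \<Longrightarrow> norm (zeta s) \<le> C * (1 + \<bar>Im s\<bar>)"
    using zeta_bound_strip by blast
  have nb: "norm (Complex (1/2) t - 1) \<ge> 1/2" for t
    using abs_Re_le_cmod[of "Complex (1/2) t - 1"] by simp
  have "norm (zeta (Complex (1/2) t)) \<le> C * (1 + \<bar>t\<bar>)" for t
    using C(2)[OF _ _ nb[of t]] by simp
  thus ?thesis using C(1) by blast
qed

lemma Gamma_powr_strip_bound:
  assumes z: "Re z > 0"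
  shows "\<exists>K>0. \<forall>s. 1/2 \<le> Re s \<and> Re s \<le> 2 \<longrightarrow>
    norm (Gamma s * z powr (- s)) \<le> K * exp (- ((pi/2 - \<bar>Im (Ln z)\<bar>) / 2) * \<bar>Im s\<bar>)"
proof -
  let ?\<phi> = "\<bar>Im (Ln z)\<bar>"
  have \<phi>: "?\<phi> < pi/2" by (rule Im_Ln_less_pi_half[OF z])
  have cp: "cos ((?\<phi> + pi/2) / 2) > 0" using \<phi> by (intro cos_gt_zero_pi) auto
  let ?g = "\<lambda>\<sigma>. Gamma \<sigma> * cos ((?\<phi> + pi/2) / 2) powr (- \<sigma>) * norm z powr (- \<sigma>)"
  have "z \<noteq> 0" using z by auto
  have "continuous_on {1/2..2::real} ?g"
    using cp \<open>z \<noteq> 0\<close> by (intro continuous_intros) (auto elim!: nonpos_Ints_cases)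
  hence "compact (?g ` {1/2..2})" by (intro compact_continuous_image) auto
  then obtain K where K: "\<And>\<sigma>. 1/2 \<le> \<sigma> \<Longrightarrow> \<sigma> \<le> 2 \<Longrightarrow> \<bar>?g \<sigma>\<bar> \<le> K"
    using compact_imp_bounded[of "?g ` {1/2..2}"] unfolding bounded_iff by fastforce
  have "norm (Gamma s * z powr (- s)) \<le> (\<bar>K\<bar> + 1) * exp (- ((pi/2 - ?\<phi>) / 2) * \<bar>Im s\<bar>)"
    if s: "1/2 \<le> Re s" "Re s \<le> 2" for s
  proof -
    have "norm (Gamma s * z powr (- s)) \<le> ?g (Re s) * exp (- ((pi/2 - ?\<phi>) / 2) * \<bar>Im s\<bar>)"
      by (rule norm_Gamma_powr_le) (use s z \<phi> in auto)
    also have "\<dots> \<le> (\<bar>K\<bar> + 1) * exp (- ((pi/2 - ?\<phi>) / 2) * \<bar>Im s\<bar>)"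
      using K[OF s] by (intro mult_right_mono) auto
    finally show ?thesis .
  qed
  thus ?thesis by (intro exI[of _ "\<bar>K\<bar> + 1"]) auto
qed

text \<open>The function \<open>M\<close> of the overview, integrated with respect to
  \<open>t = Im s\<close>.\<close>

definition zeta2_line :: "complex \<Rightarrow> complex" where
  "zeta2_line z = (\<integral>t. Gamma (Complex (1/2) t) * z powr (- Complex (1/2) t) * (zeta (Complex (1/2) t))\<^sup>2 \<partial>lborel)"

lemma Gamma_powr_measurable: "c > 0 \<Longrightarrow> Re z > 0 \<Longrightarrow> (\<lambda>t. Gamma (Complex c t) * z powr (- Complex c t)) \<in> borel_measurable lborel"
  using Gamma_powr_line_integrable[of c z] by auto

lemma zeta_line_measurable: "c \<noteq> 1 \<Longrightarrow> (\<lambda>t. zeta (Complex c t)) \<in> borel_measurable lborel"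
  using continuous_on_zeta_line[of c UNIV] by (simp add: borel_measurable_continuous_onI)

lemma zeta2_line_integrable:
  assumes z: "Re z > 0"
  shows "integrable lborel (\<lambda>t. Gamma (Complex (1/2) t) * z powr (- Complex (1/2) t) * (zeta (Complex (1/2) t))\<^sup>2)"
proof -
  obtain C where C: "C > 0" "\<And>t. norm (zeta (Complex (1/2) t)) \<le> C * (1 + \<bar>t\<bar>)" using zeta_critical_bound by blast
  obtain K where K: "K > 0" "\<And>s. 1/2 \<le> Re s \<Longrightarrow> Re s \<le> 2 \<Longrightarrow>
    norm (Gamma s * z powr (- s)) \<le> K * exp (- ((pi/2 - \<bar>Im (Ln z)\<bar>) / 2) * \<bar>Im s\<bar>)"
    using Gamma_powr_strip_bound[OF z] by blast
  let ?b = "(pi/2 - \<bar>Im (Ln z)\<bar>) / 2"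
  have b: "?b > 0" using Im_Ln_less_pi_half[OF z] by simp
  show ?thesis
  proof (rule Bochner_Integration.integrable_bound)
    show "integrable lborel (\<lambda>t. K * C\<^sup>2 * ((1 + \<bar>t\<bar>) ^ 2 * exp (- ?b * \<bar>t\<bar>)))"
      by (intro integrable_mult_right integrable_poly_exp_abs b)
    have [measurable]: "(\<lambda>t. Gamma (Complex (1/2) t) * z powr (- Complex (1/2) t)) \<in> borel_measurable borel"
      using Gamma_powr_measurable[of "1/2" z] z by simp
    have [measurable]: "(\<lambda>t. zeta (Complex (1/2) t)) \<in> borel_measurable borel" using zeta_line_measurable[of "1/2"] by simp
    show "(\<lambda>t. Gamma (Complex (1/2) t) * z powr (- Complex (1/2) t) * (zeta (Complex (1/2) t))\<^sup>2) \<in> borel_measurable lborel"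
      by measurable
    have "norm (Gamma (Complex (1/2) t) * z powr (- Complex (1/2) t) * (zeta (Complex (1/2) t))\<^sup>2)
       \<le> (K * exp (- ?b * \<bar>t\<bar>)) * (C * (1 + \<bar>t\<bar>))\<^sup>2" for t
      unfolding norm_mult[of _ "(zeta (Complex (1/2) t))\<^sup>2"] norm_power
      using K(1) K(2)[of "Complex (1/2) t"] C(2)[of t] by (intro mult_mono power_mono) auto
    thus "AE t in lborel. norm (Gamma (Complex (1/2) t) * z powr (- Complex (1/2) t) * (zeta (Complex (1/2) t))\<^sup>2)
      \<le> norm (K * C\<^sup>2 * ((1 + \<bar>t\<bar>) ^ 2 * exp (- ?b * \<bar>t\<bar>)))"
      using K(1) by (intro AE_I2) (simp add: power_mult_distrib mult_ac abs_mult)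
  qed
qed

text \<open>On \<open>Re s = 2\<close> the Dirichlet series converges absolutely and uniformly in
  \<open>t\<close>, so it can be integrated term by term. The weight \<open>G\<close> is general in
  order that the lemma can be applied twice, once for each factor of the squared zeta
  function.\<close>

lemma zeta_line_suminf:
  assumes G: "integrable lborel G"
  shows "integrable lborel (\<lambda>t. zeta (Complex 2 t) * G t)"
    and "(\<integral>t. zeta (Complex 2 t) * G t \<partial>lborel) = (\<Sum>n. \<integral>t. of_nat (Suc n) powr (- Complex 2 t) * G t \<partial>lborel)"
    and "integrable lborel (\<lambda>t. of_nat (Suc n) powr (- Complex 2 t) * G t)"
proof -
  let ?f = "\<lambda>n t. complex_of_nat (Suc n) powr (- Complex 2 t) * G t"
  have nrm: "norm (complex_of_nat (Suc n) powr (- Complex 2 t)) = 1 / real (Suc n) ^ 2" for n t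
    using norm_powr_real_powr[of "complex_of_nat (Suc n)" "- Complex 2 t"] by (simp add: powr_minus divide_inverse del: of_nat_Suc)
  have [measurable]: "G \<in> borel_measurable borel" using G by auto
  have fi: "integrable lborel (?f n)" for n
  proof (rule Bochner_Integration.integrable_bound)
    show "integrable lborel (\<lambda>t. 1 / real (Suc n) ^ 2 * norm (G t))" using G by (intro integrable_mult_right integrable_norm)
    have "continuous_on UNIV (\<lambda>t. complex_of_nat (Suc n) powr (- Complex 2 t))"
      by (intro continuous_intros) (auto simp: complex_nonpos_Reals_iff simp del: of_nat_Suc)
    hence [measurable]: "(\<lambda>t. complex_of_nat (Suc n) powr (- Complex 2 t)) \<in> borel_measurable borel"
      by (rule borel_measurable_continuous_onI)
    show "?f n \<in> borel_measurable lborel" by measurable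
  qed (auto simp: norm_mult nrm simp del: of_nat_Suc)
  thus "integrable lborel (\<lambda>t. of_nat (Suc n) powr (- Complex 2 t) * G t)" .
  have "summable (\<lambda>n. 1 / real (Suc n) ^ 2)" using inverse_squares_sums by (simp add: sums_iff)
  note s2 = summable_mult2[OF this]
  have sm: "AE t in lborel. summable (\<lambda>n. norm (?f n t))" "summable (\<lambda>n. \<integral>t. norm (?f n t) \<partial>lborel)"
    unfolding norm_mult nrm integral_mult_right_zero by (intro AE_I2 s2)+
  have z: "(\<Sum>n. ?f n t) = zeta (Complex 2 t) * G t" for t
  proof -
    have "(\<lambda>n. ?f n t) sums (zeta (Complex 2 t) * G t)"
    proof (rule sums_mult2)
      have "complex_of_nat (Suc n) powr (- Complex 2 t) = 1 / of_nat (Suc n) powr Complex 2 t" for n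
        by (simp add: powr_minus divide_inverse del: of_nat_Suc)
      thus "(\<lambda>n. complex_of_nat (Suc n) powr (- Complex 2 t)) sums zeta (Complex 2 t)"
        using zeta_sums[of "Complex 2 t"] by simp
    qed
    thus ?thesis by (rule sums_unique[symmetric])
  qed
  show "integrable lborel (\<lambda>t. zeta (Complex 2 t) * G t)"
    using integrable_suminf[OF fi sm] by (simp only: z)
  show "(\<integral>t. zeta (Complex 2 t) * G t \<partial>lborel) = (\<Sum>n. \<integral>t. of_nat (Suc n) powr (- Complex 2 t) * G t \<partial>lborel)"
    using integral_suminf[OF fi sm] by (simp only: z)
qed

lemma zeta2_line_2:
  assumes z: "Re z > 0"
  shows "integrable lborel (\<lambda>t. Gamma (Complex 2 t) * z powr (- Complex 2 t) * (zeta (Complex 2 t))\<^sup>2)"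
    and "(\<integral>t. Gamma (Complex 2 t) * z powr (- Complex 2 t) * (zeta (Complex 2 t))\<^sup>2 \<partial>lborel) = (\<Sum>m. \<Sum>n. 2 * of_real pi * exp (- (of_nat (Suc m) * of_nat (Suc n) * z)))"
proof -
  let ?G = "\<lambda>t. Gamma (Complex 2 t) * z powr (- Complex 2 t)"
  have G: "integrable lborel ?G" by (rule Gamma_powr_line_integrable) (use z in auto)
  note G1 = zeta_line_suminf(1)[OF G]
  have eq: "Gamma (Complex 2 t) * z powr (- Complex 2 t) * (zeta (Complex 2 t))\<^sup>2 = zeta (Complex 2 t) * (zeta (Complex 2 t) * ?G t)" for t
    by (simp add: power2_eq_square)
  show "integrable lborel (\<lambda>t. Gamma (Complex 2 t) * z powr (- Complex 2 t) * (zeta (Complex 2 t))\<^sup>2)"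
    unfolding eq by (rule zeta_line_suminf(1)[OF G1])
  have val: "(\<integral>t. of_nat (Suc n) powr (- Complex 2 t) * (of_nat (Suc m) powr (- Complex 2 t) * ?G t) \<partial>lborel)
     = 2 * of_real pi * exp (- (of_nat (Suc m) * of_nat (Suc n) * z))" for m n
  proof -
    define N where "N = real (Suc m) * real (Suc n)"
    have N: "N > 0" by (simp add: N_def)
    have "of_nat (Suc n) powr w * (of_nat (Suc m) powr w * (g * z powr w)) = g * (of_real N * z) powr w" for w g :: complex
    proof -
      have "(of_real N * z) powr w = of_real N powr w * z powr w" using N by (intro powr_times_real_left) auto
      moreover have "complex_of_real N powr w = of_nat (Suc m) powr w * of_nat (Suc n) powr w"
        unfolding N_def of_real_mult by (subst powr_times_real) (auto simp del: of_nat_Suc)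
      ultimately show ?thesis by (simp only: mult_ac)
    qed
    hence "(\<integral>t. of_nat (Suc n) powr (- Complex 2 t) * (of_nat (Suc m) powr (- Complex 2 t) * ?G t) \<partial>lborel) =
      (\<integral>t. Gamma (Complex 2 t) * (of_real N * z) powr (- Complex 2 t) \<partial>lborel)" by (simp only:)
    also have "\<dots> = 2 * of_real pi * exp (- (of_real N * z))" by (rule Cahen_Mellin) (use N z in auto)
    finally show ?thesis by (simp only: N_def of_real_mult of_real_of_nat_eq)
  qed
  have "(\<integral>t. zeta (Complex 2 t) * (zeta (Complex 2 t) * ?G t) \<partial>lborel) = (\<Sum>m. \<integral>t. of_nat (Suc m) powr (- Complex 2 t) * (zeta (Complex 2 t) * ?G t) \<partial>lborel)"
    by (rule zeta_line_suminf(2)[OF G1])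
  also have "\<dots> = (\<Sum>m. \<integral>t. zeta (Complex 2 t) * (of_nat (Suc m) powr (- Complex 2 t) * ?G t) \<partial>lborel)"
    by (simp only: mult.left_commute)
  also have "\<dots> = (\<Sum>m. \<Sum>n. 2 * of_real pi * exp (- (of_nat (Suc m) * of_nat (Suc n) * z)))"
    unfolding zeta_line_suminf(2)[OF zeta_line_suminf(3)[OF G]] val ..
  finally show "(\<integral>t. Gamma (Complex 2 t) * z powr (- Complex 2 t) * (zeta (Complex 2 t))\<^sup>2 \<partial>lborel) = (\<Sum>m. \<Sum>n. 2 * of_real pi * exp (- (of_nat (Suc m) * of_nat (Suc n) * z)))"
    unfolding eq .
qed

text \<open>Chosen so that the residue of \<open>Gamma s * zeta s ^ 2 * z powr (- s)\<close> at the
  double pole is \<open>(zeta2_const - Ln z) / z\<close>.\<close>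

definition zeta2_const :: complex where
  "zeta2_const = deriv (\<lambda>s. Gamma s * (zeta_reg s)\<^sup>2) 1"

lemma zeta2_line_eq:
  assumes z: "Re z > 0"
  shows "zeta2_line z = (\<Sum>m. \<Sum>n. 2 * of_real pi * exp (- (of_nat (Suc m) * of_nat (Suc n) * z)))
     - 2 * of_real pi * ((zeta2_const - Ln z) / z)"
proof -
  define h where "h = (\<lambda>s. Gamma s * (zeta_reg s)\<^sup>2 * z powr (- s))"
  have z0: "z \<noteq> 0" using z by auto
  have Ph: "(\<lambda>s. Gamma s * (zeta_reg s)\<^sup>2) holomorphic_on {s. Re s > 0}"
    by (intro holomorphic_intros holomorphic_on_subset[OF zeta_reg_holomorphic]) (auto elim!: nonpos_Ints_cases)
  have h: "h holomorphic_on {s. Re s > 0}"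
    unfolding h_def by (intro holomorphic_on_mult Ph) (auto intro!: holomorphic_intros)
  have hF: "h s / (s - 1)\<^sup>2 = Gamma s * z powr (- s) * (zeta s)\<^sup>2" if "Re s > 0" "s \<noteq> 1" for s
    using that by (simp add: h_def zeta_reg_eq power_mult_distrib)
  obtain C where C: "C > 0" "\<And>s. 1/2 \<le> Re s \<Longrightarrow> Re s \<le> 3 \<Longrightarrow> norm (s - 1) \<ge> 1/2 \<Longrightarrow> norm (zeta s) \<le> C * (1 + \<bar>Im s\<bar>)"
    using zeta_bound_strip by blast
  obtain K where K: "K > 0" "\<And>s. 1/2 \<le> Re s \<Longrightarrow> Re s \<le> 2 \<Longrightarrow>
    norm (Gamma s * z powr (- s)) \<le> K * exp (- ((pi/2 - \<bar>Im (Ln z)\<bar>) / 2) * \<bar>Im s\<bar>)"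
    using Gamma_powr_strip_bound[OF z] by blast
  define b where "b = (pi/2 - \<bar>Im (Ln z)\<bar>) / 2"
  have b: "b > 0" using Im_Ln_less_pi_half[OF z] by (simp add: b_def)
  have cs: "h (Complex c t) / (Complex c t - 1)\<^sup>2 = Gamma (Complex c t) * z powr (- Complex c t) * (zeta (Complex c t))\<^sup>2"
    if "c > 0" "c \<noteq> 1" for c t
    by (rule hF) (use that in \<open>simp_all add: complex_eq_iff\<close>)
  have "(\<integral>t. h (Complex 2 t) / (Complex 2 t - 1)\<^sup>2 \<partial>lborel) - (\<integral>t. h (Complex (1/2) t) / (Complex (1/2) t - 1)\<^sup>2 \<partial>lborel) = 2 * of_real pi * deriv h 1"
  proof (rule line_integral_shift_double_pole[OF _ _ _ h])
    show "integrable lborel (\<lambda>t. h (Complex (1/2) t) / (Complex (1/2) t - 1)\<^sup>2)"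
      using zeta2_line_integrable[OF z] by (simp add: cs)
    show "integrable lborel (\<lambda>t. h (Complex 2 t) / (Complex 2 t - 1)\<^sup>2)"
      using zeta2_line_2(1)[OF z] by (simp add: cs)
    show "((\<lambda>t. (K * exp (- b * t)) * (C * (1 + t))\<^sup>2) \<longlongrightarrow> 0) at_top"
    proof -
      have "((\<lambda>t. exp (- b * t) * (1 + t)\<^sup>2) \<longlongrightarrow> 0) at_top" using b by real_asymp
      from tendsto_mult_left[OF this, of "K * C\<^sup>2"] show ?thesis
        by (simp add: power_mult_distrib mult_ac)
    qed
    fix s assume s: "1/2 \<le> Re s" "Re s \<le> 2" "\<bar>Im s\<bar> \<ge> 1"
    have "norm (s - 1) \<ge> 1/2" using abs_Im_le_cmod[of "s - 1"] s by simp
    hence zb: "norm (zeta s) \<le> C * (1 + \<bar>Im s\<bar>)" using C s by auto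
    have Gb: "norm (Gamma s * z powr (- s)) \<le> K * exp (- b * \<bar>Im s\<bar>)"
      unfolding b_def by (rule K(2)[OF s(1,2)])
    have "h s / (s - 1)\<^sup>2 = Gamma s * z powr (- s) * (zeta s)\<^sup>2" by (rule hF) (use s in auto)
    hence "norm (h s / (s - 1)\<^sup>2) = norm (Gamma s * z powr (- s)) * (norm (zeta s))\<^sup>2"
      by (simp only: norm_mult norm_power)
    also have "\<dots> \<le> (K * exp (- b * \<bar>Im s\<bar>)) * (C * (1 + \<bar>Im s\<bar>))\<^sup>2"
      by (intro mult_mono power_mono Gb zb mult_nonneg_nonneg) (use K(1) in auto)
    finally show "norm (h s / (s - 1)\<^sup>2) \<le> (K * exp (- b * \<bar>Im s\<bar>)) * (C * (1 + \<bar>Im s\<bar>))\<^sup>2" .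
  qed auto
  hence 1: "(\<Sum>m. \<Sum>n. 2 * of_real pi * exp (- (of_nat (Suc m) * of_nat (Suc n) * z))) - zeta2_line z = 2 * of_real pi * deriv h 1"
    using zeta2_line_2(2)[OF z] by (simp add: cs zeta2_line_def)
  have "((\<lambda>s. Gamma s * (zeta_reg s)\<^sup>2) has_field_derivative zeta2_const) (at 1)"
    unfolding zeta2_const_def by (rule holomorphic_derivI[OF Ph]) (auto intro: open_halfspace_Re_gt)
  moreover have "((\<lambda>s. z powr (- s)) has_field_derivative (Ln z * z powr (- 1)) * (- 1)) (at 1)"
    by (rule DERIV_chain2[OF has_field_derivative_powr_right[OF z0]]) (auto intro!: derivative_eq_intros)
  ultimately have "(h has_field_derivative (zeta2_const * z powr (- 1) + (Ln z * z powr (- 1)) * (- 1) * (Gamma 1 * (zeta_reg 1)\<^sup>2))) (at 1)"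
    unfolding h_def by (rule DERIV_mult)
  hence "deriv h 1 = zeta2_const * z powr (- 1) + (Ln z * z powr (- 1)) * (- 1) * (Gamma 1 * (zeta_reg 1)\<^sup>2)"
    by (rule DERIV_imp_deriv)
  also have "Gamma 1 * (zeta_reg 1)\<^sup>2 = 1" by (simp add: zeta_reg_def)
  also have "z powr (- 1) = inverse z" using z0 by (simp add: powr_minus)
  finally have 2: "deriv h 1 = (zeta2_const - Ln z) / z" by (simp add: divide_inverse left_diff_distrib)
  have "y = x - d" if "x - y = d" for x y d :: complex
    unfolding that[symmetric] by simp
  from this[OF 1] show ?thesis unfolding 2 .
qed

section \<open>The Laplace transform of the squared Hardy function\<close>

definition Zsq :: "real \<Rightarrow> real" where
  "Zsq t = (norm (zeta (Complex (1 / 2) t)))\<^sup>2"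

lemma Zsq_nonneg [simp]: "Zsq t \<ge> 0"
  by (simp add: Zsq_def)

lemma Zsq_continuous: "continuous_on A Zsq"
  unfolding Zsq_def[abs_def] by (intro continuous_intros continuous_on_zeta_line) simp

lemma Zsq_measurable [measurable]: "Zsq \<in> borel_measurable borel"
  by (intro borel_measurable_continuous_onI Zsq_continuous)

lemma Zsq_bound: "\<exists>C>0. \<forall>t. Zsq t \<le> C * (1 + \<bar>t\<bar>)\<^sup>2"
proof -
  obtain C where C: "C > 0" "\<And>t. norm (zeta (Complex (1/2) t)) \<le> C * (1 + \<bar>t\<bar>)" using zeta_critical_bound by blast
  have "Zsq t \<le> C\<^sup>2 * (1 + \<bar>t\<bar>)\<^sup>2" for t
    unfolding Zsq_def power_mult_distrib[symmetric] by (intro power_mono C(2)) simp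
  thus ?thesis using C(1) by (intro exI[of _ "C\<^sup>2"]) auto
qed

lemma Zsq_exp_abs_integrable:
  assumes "b > 0"
  shows "integrable lborel (\<lambda>t. Zsq t * exp (- b * \<bar>t\<bar>))"
proof -
  obtain C where C: "C > 0" "\<And>t. Zsq t \<le> C * (1 + \<bar>t\<bar>)\<^sup>2" using Zsq_bound by blast
  show ?thesis
  proof (rule Bochner_Integration.integrable_bound)
    show "integrable lborel (\<lambda>t. C * ((1 + \<bar>t\<bar>)\<^sup>2 * exp (- b * \<bar>t\<bar>)))"
      using assms by (intro integrable_mult_right integrable_poly_exp_abs)
    have "Zsq t * exp (- b * \<bar>t\<bar>) \<le> C * ((1 + \<bar>t\<bar>)\<^sup>2 * exp (- b * \<bar>t\<bar>))" for t
      unfolding mult.assoc[symmetric] by (intro mult_right_mono C(2)) simp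
    thus "AE t in lborel. norm (Zsq t * exp (- b * \<bar>t\<bar>)) \<le> norm (C * ((1 + \<bar>t\<bar>)\<^sup>2 * exp (- b * \<bar>t\<bar>)))"
      using C(1) by (auto simp: abs_mult)
  qed auto
qed

lemma Zsq_exp_integrable:
  assumes "d > 0"
  shows "integrable hl (\<lambda>t. Zsq t * exp (- (d * t)))"
proof -
  have "integrable lborel (\<lambda>t. indicator {0<..} t *\<^sub>R (Zsq t * exp (- d * \<bar>t\<bar>)))"
    by (rule integrable_mult_indicator[OF _ Zsq_exp_abs_integrable[OF assms]]) auto
  hence "integrable hl (\<lambda>t. Zsq t * exp (- d * \<bar>t\<bar>))"
    by (simp add: hl_integrable_iff set_integrable_def)
  thus ?thesis by (rule Bochner_Integration.integrable_cong[THEN iffD1, rotated -1]) auto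
qed

definition LapZ :: "complex \<Rightarrow> complex" where
  "LapZ p = (\<integral>t. of_real (Zsq t) * exp (- (p * of_real t)) \<partial>hl)"

lemma LapZ_integrable:
  assumes "Re p > 0"
  shows "integrable hl (\<lambda>t. of_real (Zsq t) * exp (- (p * of_real t)))"
proof (rule Bochner_Integration.integrable_bound[OF Zsq_exp_integrable[OF assms]])
  show "(\<lambda>t. of_real (Zsq t) * exp (- (p * of_real t))) \<in> borel_measurable hl"
    by (rule hl_measurable_borel) measurable
qed (auto simp: norm_mult)

text \<open>The point at which \<open>z\<^bsup>-s\<^esup>\<close> cancels the decay of \<open>\<Gamma>(s)\<close> on the upper half of the critical line.\<close>

definition zarg :: "complex \<Rightarrow> complex" where
  "zarg p = 2 * of_real pi * \<i> * exp (- (\<i> * p))"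

lemma exp_i_pi_half: "exp (\<i> * of_real (pi / 2)) = \<i>"
  unfolding cis_conv_exp[symmetric] by (rule cis_pi_half)

lemma zarg_exp: "zarg p = exp (of_real (ln (2 * pi)) + \<i> * of_real (pi / 2) - \<i> * p)"
  unfolding zarg_def exp_diff exp_add exp_i_pi_half exp_of_real
  by (simp add: exp_minus divide_inverse)

lemma zarg_Re: "Re (zarg p) = 2 * pi * exp (Im p) * sin (Re p)"
proof -
  have "cos (pi / 2 - Re p) = sin (Re p)" by (simp add: cos_diff)
  thus ?thesis unfolding zarg_exp Re_exp by (simp add: exp_add)
qed

lemma zarg_norm: "norm (zarg p) = 2 * pi * exp (Im p)"
  unfolding zarg_exp norm_exp_eq_Re by (simp add: exp_add)

lemma zarg_Re_pos: "0 < Re p \<Longrightarrow> Re p < pi \<Longrightarrow> Re (zarg p) > 0"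
  unfolding zarg_Re by (intro mult_pos_pos sin_gt_zero) auto

lemma Ln_zarg:
  assumes "0 < Re p" "Re p < pi"
  shows "Ln (zarg p) = of_real (ln (2 * pi)) + \<i> * of_real (pi / 2) - \<i> * p"
  unfolding zarg_exp using assms by (intro Ln_exp) auto

text \<open>On the critical line the functional equation expresses the conjugate of
  \<open>zeta s\<close> by \<open>Gamma\<close>, a cosine and \<open>zeta s\<close>, so
  \<open>Zsq\<close> becomes a multiple of \<open>Gamma s * zeta s ^ 2\<close>. The cosine enters
  through \<open>2 cos (pi s / 2) * exp (i pi s / 2) = 1 + i exp (- pi t)\<close>, which is almost 1
  for \<open>t > 0\<close> and suppresses the integrand for \<open>t < 0\<close>.\<close>

lemma zarg_integrand:
  assumes p: "0 < Re p" "Re p < pi"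
  shows "Gamma (Complex (1/2) t) * zarg p powr (- Complex (1/2) t) * (zeta (Complex (1/2) t))\<^sup>2 =
    exp (\<i> * p / 2) * (of_real (Zsq t) * exp (- (p * of_real t)) / (1 + \<i> * of_real (exp (- pi * t))))"
proof -
  let ?s = "Complex (1/2) t"
  have "zarg p \<noteq> 0" using zarg_Re_pos[OF p] by auto
  have c1: "1 - ?s = cnj ?s" by (simp add: complex_eq_iff)
  have FE: "cnj (zeta ?s) = 2 * of_real (2 * pi) powr (- ?s) * cos (of_real pi * ?s / 2) * Gamma ?s * zeta ?s"
    using zeta_functional_equation[of ?s] unfolding c1 zeta_cnj by (simp add: complex_eq_iff)
  have Z: "of_real (Zsq t) = zeta ?s * cnj (zeta ?s)"
    unfolding Zsq_def by (rule complex_norm_square)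
  have E: "exp (\<i> * of_real pi * ?s) = \<i> * of_real (exp (- pi * t))"
  proof -
    have "\<i> * of_real pi * ?s = \<i> * of_real (pi / 2) + of_real (- pi * t)" by (simp add: complex_eq_iff)
    thus ?thesis by (simp only: exp_add exp_of_real exp_i_pi_half)
  qed
  have nz: "1 + \<i> * of_real (exp (- pi * t)) \<noteq> (0 :: complex)" by (simp add: complex_eq_iff)
  have cs: "2 * cos (of_real pi * ?s / 2) * exp (\<i> * of_real (pi / 2) * ?s) = 1 + \<i> * of_real (exp (- pi * t))"
  proof -
    have a: "exp (\<i> * (of_real pi * ?s / 2)) * exp (\<i> * of_real (pi / 2) * ?s) = exp (\<i> * of_real pi * ?s)"
      unfolding exp_add[symmetric] by (rule arg_cong[where f=exp]) (simp add: field_simps)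
    have b: "exp (- (\<i> * (of_real pi * ?s / 2))) * exp (\<i> * of_real (pi / 2) * ?s) = 1"
      unfolding exp_add[symmetric] by (simp add: field_simps)
    have "2 * cos (of_real pi * ?s / 2) * exp (\<i> * of_real (pi / 2) * ?s) =
       exp (\<i> * (of_real pi * ?s / 2)) * exp (\<i> * of_real (pi / 2) * ?s) + exp (- (\<i> * (of_real pi * ?s / 2))) * exp (\<i> * of_real (pi / 2) * ?s)"
      unfolding cos_exp_eq by (simp add: distrib_right)
    thus ?thesis unfolding a b E by simp
  qed
  have pw: "zarg p powr (- ?s) = of_real (2 * pi) powr (- ?s) * exp (- (\<i> * of_real (pi / 2) * ?s)) * exp (\<i> * p * ?s)"
  proof -
    have "Ln (complex_of_real (2 * pi)) = of_real (ln (2 * pi))" by (rule Ln_of_real) simp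
    hence "of_real (2 * pi) powr (- ?s) = exp (- ?s * of_real (ln (2 * pi)))" by (simp add: powr_def)
    moreover have "zarg p powr (- ?s) = exp (- ?s * (of_real (ln (2 * pi)) + \<i> * of_real (pi / 2) - \<i> * p))"
      using \<open>zarg p \<noteq> 0\<close> Ln_zarg[OF p] by (simp add: powr_def)
    ultimately show ?thesis unfolding exp_add[symmetric]
      by (simp only:) (simp add: algebra_simps flip: exp_add)
  qed
  have ep: "exp (\<i> * p * ?s) = exp (\<i> * p / 2) * exp (- (p * of_real t))"
    unfolding exp_add[symmetric] by (rule arg_cong[where f=exp]) (simp add: Complex_eq algebra_simps)
  have em: "exp (- (\<i> * of_real (pi / 2) * ?s)) * exp (\<i> * of_real (pi / 2) * ?s) = 1"
    by (simp flip: exp_add)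
  let ?e = "exp (- (\<i> * of_real (pi / 2) * ?s))"
  have "(Gamma ?s * zarg p powr (- ?s) * (zeta ?s)\<^sup>2) * (1 + \<i> * of_real (exp (- pi * t))) =
    (?e * exp (\<i> * of_real (pi / 2) * ?s)) * exp (\<i> * p * ?s) * (zeta ?s * (2 * of_real (2 * pi) powr (- ?s) * cos (of_real pi * ?s / 2) * Gamma ?s * zeta ?s))"
    unfolding pw cs[symmetric] by (simp only: power2_eq_square mult_ac)
  also have "\<dots> = exp (\<i> * p / 2) * exp (- (p * of_real t)) * of_real (Zsq t)"
    unfolding em FE[symmetric] Z[symmetric] ep by simp
  finally show ?thesis using nz by (simp add: field_simps)
qed

text \<open>For \<open>t > 0\<close> the two integrands differ by a factor of size
  \<open>exp (- pi t)\<close>; for \<open>t <= 0\<close> only one is present and it is at most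
  \<open>Zsq t * exp ((pi - Re p) t)\<close>. As \<open>pi > 2\<close> and \<open>Re p <= 1\<close>,
  the weight \<open>exp (- |t|)\<close> dominates both, uniformly in \<open>p\<close>.\<close>

lemma LapZ_zeta2_line:
  "\<exists>C. \<forall>p. 0 < Re p \<and> Re p \<le> 1 \<longrightarrow> norm (exp (- (\<i> * p / 2)) * zeta2_line (zarg p) - LapZ p) \<le> C"
proof (intro exI[of _ "\<integral>t. Zsq t * exp (- 1 * \<bar>t\<bar>) \<partial>lborel"] allI impI)
  fix p assume p: "0 < Re p \<and> Re p \<le> 1"
  hence p': "0 < Re p" "Re p < pi" using pi_gt3 by auto
  let ?f = "\<lambda>t. of_real (Zsq t) * exp (- (p * of_real t)) / (1 + \<i> * complex_of_real (exp (- pi * t)))"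
  let ?g = "\<lambda>t. indicator {0<..} t *\<^sub>R (complex_of_real (Zsq t) * exp (- (p * of_real t)))"
  have ee: "exp (- (\<i> * p / 2)) * exp (\<i> * p / 2) = 1" by (simp flip: exp_add)
  have fe: "?f t = exp (- (\<i> * p / 2)) * (exp (\<i> * p / 2) * ?f t)" for t
    unfolding mult.assoc[symmetric] ee by simp
  have i0: "integrable lborel (\<lambda>t. exp (\<i> * p / 2) * ?f t)"
    using zeta2_line_integrable[OF zarg_Re_pos[OF p']] unfolding zarg_integrand[OF p'] .
  have fi: "integrable lborel ?f"
    by (subst fe) (intro integrable_mult_right i0)
  have f: "exp (- (\<i> * p / 2)) * zeta2_line (zarg p) = (\<integral>t. ?f t \<partial>lborel)"
    unfolding zeta2_line_def zarg_integrand[OF p'] integral_mult_right_zero[symmetric] fe[symmetric] ..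
  have gi: "integrable lborel ?g"
    using LapZ_integrable[OF p'(1)] by (simp add: hl_integrable_iff set_integrable_def)
  have g: "LapZ p = (\<integral>t. ?g t \<partial>lborel)"
    by (simp add: LapZ_def hl_integral set_lebesgue_integral_def)
  have le: "norm (?f t - ?g t) \<le> Zsq t * exp (- 1 * \<bar>t\<bar>)" for t
  proof -
    let ?E = "exp (- pi * t)"
    have n1: "norm (1 + \<i> * complex_of_real ?E) \<ge> 1" using abs_Re_le_cmod[of "1 + \<i> * complex_of_real ?E"] by simp
    have n2: "norm (1 + \<i> * complex_of_real ?E) \<ge> ?E" using abs_Im_le_cmod[of "1 + \<i> * complex_of_real ?E"] by simp
    have nz: "1 + \<i> * complex_of_real ?E \<noteq> 0" using n1 by auto
    show ?thesis
    proof (cases "t > 0")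
      case True
      have "?f t - ?g t = of_real (Zsq t) * exp (- (p * of_real t)) * (1 / (1 + \<i> * complex_of_real ?E) - 1)"
        using True by (simp add: algebra_simps)
      also have "1 / (1 + \<i> * complex_of_real ?E) - 1 = - (\<i> * of_real ?E) / (1 + \<i> * complex_of_real ?E)"
        using nz by (simp add: field_simps)
      also have "norm (of_real (Zsq t) * exp (- (p * of_real t)) * (- (\<i> * of_real ?E) / (1 + \<i> * complex_of_real ?E)))
         = Zsq t * exp (- Re p * t) * (?E / norm (1 + \<i> * complex_of_real ?E))"
        by (simp add: norm_mult norm_divide)
      also have "\<dots> \<le> Zsq t * 1 * ?E"
      proof (intro mult_mono)
        show "exp (- Re p * t) \<le> 1" using p' True by simp
        have "?E / norm (1 + \<i> * complex_of_real ?E) \<le> ?E / 1" using n1 by (intro divide_left_mono) auto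
        thus "?E / norm (1 + \<i> * complex_of_real ?E) \<le> ?E" by simp
      qed auto
      also have "?E \<le> exp (- 1 * \<bar>t\<bar>)" using True pi_gt3 by (simp add: mult_right_mono)
      finally show ?thesis by (simp add: mult_left_mono)
    next
      case False
      have "norm (?f t - ?g t) = Zsq t * (exp (- Re p * t) / norm (1 + \<i> * complex_of_real ?E))"
        using False by (simp add: norm_mult norm_divide)
      also have "\<dots> \<le> Zsq t * (exp (- Re p * t) / ?E)"
        using n1 n2 by (intro mult_left_mono divide_left_mono mult_pos_pos) auto
      also have "exp (- Re p * t) / ?E = exp ((pi - Re p) * t)"
        by (simp add: algebra_simps flip: exp_diff)
      also have "\<dots> \<le> exp (- 1 * \<bar>t\<bar>)"
      proof -
        have "1 * (-t) \<le> (pi - Re p) * (-t)" using False p pi_gt3 by (intro mult_right_mono) auto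
        thus ?thesis using False by simp
      qed
      finally show ?thesis by (simp add: mult_left_mono)
    qed
  qed
  define D where "D = (\<lambda>t. ?f t - ?g t)"
  define G where "G = (\<lambda>t. Zsq t * exp (- 1 * \<bar>t\<bar>))"
  have "exp (- (\<i> * p / 2)) * zeta2_line (zarg p) - LapZ p = (\<integral>t. D t \<partial>lborel)"
    unfolding f g D_def by (rule Bochner_Integration.integral_diff[OF fi gi, symmetric])
  also have "norm \<dots> \<le> (\<integral>t. G t \<partial>lborel)"
  proof (rule order_trans[OF integral_norm_bound Bochner_Integration.integral_mono])
    show "integrable lborel (\<lambda>t. norm (D t))" unfolding D_def by (rule integrable_norm, rule Bochner_Integration.integrable_diff[OF fi gi])
    show "integrable lborel G" unfolding G_def by (rule Zsq_exp_abs_integrable) simp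
    show "norm (D t) \<le> G t" for t unfolding D_def G_def by (rule le)
  qed
  finally show "norm (exp (- (\<i> * p / 2)) * zeta2_line (zarg p) - LapZ p) \<le> (\<integral>t. Zsq t * exp (- 1 * \<bar>t\<bar>) \<partial>lborel)"
    unfolding G_def .
qed

text \<open>The decay of \<open>Gamma s * q powr (- s)\<close> is governed by the gap
  \<open>\<beta>\<close> between the argument of \<open>q\<close> and \<open>pi/2\<close>, and
  \<open>sin \<beta> = \<rho>\<close> with \<open>\<rho> = Re q / norm q\<close>. One power of
  \<open>1 / \<rho>\<close> comes, generously, from the cosine in the Gamma bound and three come
  from integrating the quadratic growth against the decay.\<close>

lemma zeta2_line_bound:
  "\<exists>C>0. \<forall>q. Re q > 0 \<longrightarrow> norm (zeta2_line q) \<le> C * (norm q powr (-(1/2)) * (norm q / Re q) ^ 4)"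
proof -
  obtain C where C: "C > 0" "\<And>t. norm (zeta (Complex (1/2) t)) \<le> C * (1 + \<bar>t\<bar>)" using zeta_critical_bound by blast
  let ?G = "Gamma (1/2 :: real)"
  have G: "?G > 0" by simp
  have "norm (zeta2_line q) \<le> (?G * C\<^sup>2 * 1024) * (norm q powr (-(1/2)) * (norm q / Re q) ^ 4)" if q: "Re q > 0" for q
  proof -
    define \<rho> where "\<rho> = Re q / norm q"
    have q0: "norm q > 0" using q by auto
    have \<rho>: "0 < \<rho>" "\<rho> \<le> 1" using q q0 complex_Re_le_cmod[of q] by (auto simp: \<rho>_def)
    define \<phi> where "\<phi> = \<bar>Im (Ln q)\<bar>"
    have \<phi>: "0 \<le> \<phi>" "\<phi> < pi/2" using Im_Ln_less_pi_half[OF q] by (auto simp: \<phi>_def)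
    define \<beta> where "\<beta> = pi/2 - \<phi>"
    have \<beta>: "0 < \<beta>" "\<beta> \<le> pi/2" using \<phi> by (auto simp: \<beta>_def)
    have "Re q = norm q * cos (Im (Ln q))"
    proof -
      have "exp (Ln q) = q" using q by (intro exp_Ln) auto
      thus ?thesis using Re_exp[of "Ln q"] norm_exp_eq_Re[of "Ln q"] by simp
    qed
    hence "cos \<phi> = \<rho>" using q0 by (simp add: \<rho>_def \<phi>_def abs_if)
    hence sb: "sin \<beta> = \<rho>" by (simp add: \<beta>_def sin_diff)
    have b1: "\<rho> \<le> \<beta>" using sin_x_le_x[of \<beta>] \<beta> sb by simp
    have b2: "\<rho> / 2 \<le> sin (\<beta>/2)"
    proof -
      have "\<rho> = 2 * sin (\<beta>/2) * cos (\<beta>/2)" using sin_double[of "\<beta>/2"] sb by simp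
      also have "\<dots> \<le> 2 * sin (\<beta>/2) * 1" using \<beta> by (intro mult_left_mono) (auto intro: sin_ge_zero)
      finally show ?thesis by simp
    qed
    have cs: "cos ((\<phi> + pi/2) / 2) = sin (\<beta>/2)"
    proof -
      have "(\<phi> + pi/2) / 2 = pi/2 - \<beta>/2" by (simp add: \<beta>_def field_simps)
      thus ?thesis by (simp only: cos_diff cos_pi_half sin_pi_half mult_zero_left mult_1 add_0_left)
    qed
    define K where "K = ?G * (2 / \<rho>) * norm q powr (-(1/2)) * C\<^sup>2"
    have le: "norm (Gamma (Complex (1/2) t) * q powr (- Complex (1/2) t) * (zeta (Complex (1/2) t))\<^sup>2)
       \<le> K * ((1 + \<bar>t\<bar>)\<^sup>2 * exp (- (\<rho>/2) * \<bar>t\<bar>))" for t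
    proof -
      have "norm (Gamma (Complex (1/2) t) * q powr (- Complex (1/2) t)) \<le>
         ?G * sin (\<beta>/2) powr (-(1/2)) * norm q powr (-(1/2)) * exp (- (\<beta> / 2) * \<bar>t\<bar>)"
        using norm_Gamma_powr_le[of "Complex (1/2) t" q \<phi>] q \<phi> unfolding cs by (simp add: \<phi>_def \<beta>_def)
      also have "\<dots> \<le> ?G * (2 / \<rho>) * norm q powr (-(1/2)) * exp (- (\<rho> / 2) * \<bar>t\<bar>)"
      proof (intro mult_mono)
        have "sin (\<beta>/2) powr (-(1/2)) \<le> (\<rho>/2) powr (-(1/2))" using b2 \<rho> by (intro powr_mono2') auto
        also have "\<dots> \<le> (\<rho>/2) powr (-1)" using \<rho> by (intro powr_mono') auto
        finally show "sin (\<beta>/2) powr (-(1/2)) \<le> 2 / \<rho>" using \<rho> by (simp add: powr_minus)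
        show "exp (- (\<beta> / 2) * \<bar>t\<bar>) \<le> exp (- (\<rho> / 2) * \<bar>t\<bar>)" using b1 by (simp add: mult_right_mono)
      qed (use \<rho> G in auto)
      finally have g: "norm (Gamma (Complex (1/2) t) * q powr (- Complex (1/2) t)) \<le> ?G * (2 / \<rho>) * norm q powr (-(1/2)) * exp (- (\<rho> / 2) * \<bar>t\<bar>)" .
      have "norm (Gamma (Complex (1/2) t) * q powr (- Complex (1/2) t) * (zeta (Complex (1/2) t))\<^sup>2) =
         norm (Gamma (Complex (1/2) t) * q powr (- Complex (1/2) t)) * (norm (zeta (Complex (1/2) t)))\<^sup>2"
        by (simp only: norm_mult norm_power)
      also have "\<dots> \<le> (?G * (2 / \<rho>) * norm q powr (-(1/2)) * exp (- (\<rho> / 2) * \<bar>t\<bar>)) * (C * (1 + \<bar>t\<bar>))\<^sup>2"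
        by (intro mult_mono g power_mono C(2)) (use \<rho> G in auto)
      also have "\<dots> = K * ((1 + \<bar>t\<bar>)\<^sup>2 * exp (- (\<rho>/2) * \<bar>t\<bar>))"
        unfolding K_def power_mult_distrib by (simp only: mult_ac)
      finally show ?thesis .
    qed
    have K0: "K \<ge> 0" using G \<rho> by (auto simp: K_def)
    define D where "D = (\<lambda>t. Gamma (Complex (1/2) t) * q powr (- Complex (1/2) t) * (zeta (Complex (1/2) t))\<^sup>2)"
    define E where "E = (\<lambda>t. K * ((1 + \<bar>t\<bar>)\<^sup>2 * exp (- (\<rho>/2) * \<bar>t\<bar>)))"
    have "norm (\<integral>t. D t \<partial>lborel) \<le> (\<integral>t. E t \<partial>lborel)"
    proof (rule order_trans[OF integral_norm_bound Bochner_Integration.integral_mono])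
      show "integrable lborel (\<lambda>t. norm (D t))" unfolding D_def by (rule integrable_norm, rule zeta2_line_integrable[OF q])
      show "integrable lborel E" unfolding E_def using \<rho> by (intro integrable_mult_right integrable_poly_exp_abs) simp
      show "norm (D t) \<le> E t" for t unfolding D_def E_def by (rule le)
    qed
    hence "norm (zeta2_line q) \<le> (\<integral>t. K * ((1 + \<bar>t\<bar>)\<^sup>2 * exp (- (\<rho>/2) * \<bar>t\<bar>)) \<partial>lborel)"
      unfolding D_def E_def zeta2_line_def .
    also have "\<dots> \<le> K * (64 / (\<rho>/2) ^ 3)"
      unfolding integral_mult_right_zero using \<rho> K0 by (intro mult_left_mono integrable_poly_exp_abs(2)) auto
    also have "\<dots> = (?G * C\<^sup>2 * 1024) * (norm q powr (-(1/2)) * (1 / \<rho>) ^ 4)"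
      unfolding K_def using \<rho> by (simp add: field_simps power3_eq_cube power4_eq_xxxx)
    also have "1 / \<rho> = norm q / Re q" by (simp add: \<rho>_def)
    finally show ?thesis .
  qed
  thus ?thesis using G C(1) by (intro exI[of _ "?G * C\<^sup>2 * 1024"]) auto
qed

lemma zeta2_line_periodic:
  assumes "Re q > 0"
  shows "zeta2_line (q + 2 * of_real pi * \<i>) + 2 * of_real pi * ((zeta2_const - Ln (q + 2 * of_real pi * \<i>)) / (q + 2 * of_real pi * \<i>)) =
    zeta2_line q + 2 * of_real pi * ((zeta2_const - Ln q) / q)"
proof -
  have e: "exp (- (of_nat a * of_nat b * (q + 2 * of_real pi * \<i>))) = exp (- (of_nat a * of_nat b * q))" for a b :: nat
  proof -
    have "- (of_nat a * of_nat b * (q + 2 * of_real pi * \<i>)) = - (of_nat a * of_nat b * q) + \<i> * (of_int (- int (a * b)) * (of_real pi * 2))"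
      by (simp add: algebra_simps)
    thus ?thesis by (simp only: exp_plus_2pin)
  qed
  have "Re (q + 2 * of_real pi * \<i>) > 0" using assms by simp
  thus ?thesis unfolding zeta2_line_eq[OF assms] zeta2_line_eq[OF \<open>Re (q + 2 * of_real pi * \<i>) > 0\<close>] e by simp
qed

section \<open>The Laplace transform near the origin\<close>

lemma exp_minus_1_bounds:
  fixes z :: complex
  assumes "norm z \<le> 1/8"
  shows "norm (exp z - 1) \<le> 2 * norm z" "norm (exp z - 1 - z) \<le> 2 * (norm z)\<^sup>2"
proof -
  have e: "exp \<bar>Re z\<bar> \<le> 2"
  proof -
    have "exp \<bar>Re z\<bar> \<le> exp (1/8)" using abs_Re_le_cmod[of z] assms by simp
    also have "\<dots> \<le> 1 + 1/8 + (1/8)\<^sup>2" by (rule exp_bound) auto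
    finally show ?thesis by (simp add: power2_eq_square)
  qed
  have "norm (exp z - 1) \<le> exp \<bar>Re z\<bar> * norm z" using Taylor_exp[of z 0] by simp
  also have "\<dots> \<le> 2 * norm z" using e by (intro mult_right_mono) auto
  finally show "norm (exp z - 1) \<le> 2 * norm z" .
  have "norm (exp z - (1 + z)) \<le> exp \<bar>Re z\<bar> * (norm z)\<^sup>2" using Taylor_exp[of z 1] by (simp add: power2_eq_square)
  also have "\<dots> \<le> 2 * (norm z)\<^sup>2" using e by (intro mult_right_mono) auto
  finally show "norm (exp z - 1 - z) \<le> 2 * (norm z)\<^sup>2" by (simp add: diff_diff_eq)
qed

lemma norm_Ln_bound:
  assumes "Re z > 0"
  shows "norm (Ln z) \<le> \<bar>ln (norm z)\<bar> + 2"
proof -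
  have "norm (Ln z) \<le> \<bar>Re (Ln z)\<bar> + \<bar>Im (Ln z)\<bar>" by (rule cmod_le)
  moreover have "Re (Ln z) = ln (norm z)" using assms by (intro Re_Ln) auto
  moreover have "\<bar>Im (Ln z)\<bar> < 2" using Im_Ln_less_pi_half[OF assms] pi_less_4 by linarith
  ultimately show ?thesis by simp
qed

lemma abs_ln_le_powr:
  fixes x :: real
  assumes "0 < x" "x \<le> 1"
  shows "\<bar>ln x\<bar> \<le> 2 * x powr (-(1/2))"
proof -
  have "ln (x powr (-(1/2))) \<le> x powr (-(1/2)) - 1" using assms by (intro ln_le_minus_one) auto
  moreover have "ln (x powr (-(1/2))) = - (1/2) * ln x" using assms by (simp add: ln_powr)
  moreover have "ln x \<le> 0" using assms by simp
  ultimately show ?thesis by simp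
qed

text \<open>After removal of the period the argument is \<open>q = 2 pi p * E\<close> with
  \<open>E = 1 + O(p)\<close>, so \<open>q\<close> is comparable to \<open>p\<close> and
  \<open>Ln q = ln (2 pi) + Ln p + Ln E\<close>. Hence the residue term at \<open>q\<close> differs
  from \<open>(c - ln (2 pi) - Ln p) / p\<close> by a relative error \<open>O(p)\<close>, which
  cancels the pole.\<close>

lemma LapZ_main_terms:
  assumes p: "Re p > 0" "norm p \<le> 1/8"
  defines "q \<equiv> zarg p - 2 * of_real pi * \<i>"
  shows "Re q \<ge> Re p" "norm p \<le> norm q" "norm q \<le> 8 * norm p"
    and "norm (exp (- (\<i> * p / 2)) * (2 * of_real pi * ((c - Ln q) / q)) - (c - of_real (ln (2 * pi)) - Ln p) / p) \<le> 4 * (norm c + norm (Ln q)) + 4"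
proof -
  define E where "E = q / (2 * of_real pi * p)"
  have p0: "p \<noteq> 0" using p by auto
  have Rp: "0 < Re p" "Re p \<le> 1/8" "\<bar>Im p\<bar> \<le> 1/8"
    using p abs_Re_le_cmod[of p] abs_Im_le_cmod[of p] by auto
  have qE: "q = 2 * of_real pi * p * E" using p0 by (simp add: E_def)
  have E1: "E - 1 = \<i> * (exp (- (\<i> * p)) - 1 - (- (\<i> * p))) / p"
    using p0 by (simp add: E_def q_def zarg_def field_simps)
  have "norm (E - 1) = norm (exp (- (\<i> * p)) - 1 - (- (\<i> * p))) / norm p"
    unfolding E1 by (simp add: norm_divide norm_mult)
  also have "\<dots> \<le> 2 * (norm (- (\<i> * p)))\<^sup>2 / norm p"
    using p by (intro divide_right_mono exp_minus_1_bounds) (auto simp: norm_mult)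
  also have "\<dots> = 2 * norm p" using p0 by (simp add: norm_mult power2_eq_square)
  finally have E: "norm (E - 1) \<le> 2 * norm p" .
  have nE: "3/4 \<le> norm E" "norm E \<le> 5/4"
    using E p(2) norm_triangle_ineq2[of 1 "1 - E"] norm_triangle_ineq[of 1 "E - 1"] by (auto simp: norm_minus_commute)
  have E0: "E \<noteq> 0" using nE by auto
  have nq: "norm q = 2 * pi * norm p * norm E" unfolding qE by (simp add: norm_mult)
  have "1 * norm p \<le> (2 * pi * norm E) * norm p"
  proof (intro mult_right_mono)
    have "3 * (3/4) \<le> pi * norm E" using nE pi_gt3 by (intro mult_mono) auto
    thus "1 \<le> 2 * pi * norm E" by simp
  qed simp
  thus "norm p \<le> norm q" unfolding nq by (simp add: mult_ac)
  have "(2 * pi * norm E) * norm p \<le> 8 * norm p"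
  proof (intro mult_right_mono)
    have "pi * norm E \<le> 3.2 * (5/4)" using nE pi_approx by (intro mult_mono) auto
    thus "2 * pi * norm E \<le> 8" by simp
  qed simp
  thus "norm q \<le> 8 * norm p" unfolding nq by (simp add: mult_ac)
  show Rq: "Re q \<ge> Re p"
  proof -
    have "exp (Im p) \<ge> 7/8" using exp_ge_add_one_self[of "Im p"] Rp by linarith
    moreover have "sin (Re p) \<ge> Re p / 2"
    proof -
      obtain \<xi> where \<xi>: "0 < \<xi>" "\<xi> < Re p" "sin (Re p) - sin 0 = (Re p - 0) * cos \<xi>"
        using MVT2[of 0 "Re p" sin cos] Rp by (auto intro: DERIV_sin)
      have "cos (pi / 3) \<le> cos \<xi>" using \<xi> Rp pi_gt3 by (intro cos_monotone_0_pi_le) auto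
      hence "Re p * (1 / 2) \<le> Re p * cos \<xi>" using Rp by (intro mult_left_mono) (auto simp: cos_60)
      thus ?thesis using \<xi>(3) by simp
    qed
    ultimately have w: "7/8 * (Re p / 2) \<le> exp (Im p) * sin (Re p)" using Rp by (intro mult_mono) auto
    from w have "6 * (exp (Im p) * sin (Re p)) \<le> 2 * pi * (exp (Im p) * sin (Re p))"
      using Rp pi_gt3 by (intro mult_right_mono) auto
    moreover have "Re q = 2 * pi * (exp (Im p) * sin (Re p))" unfolding q_def using zarg_Re[of p] by simp
    ultimately show ?thesis using w Rp by linarith
  qed
  \<comment> \<open>Principal logarithms add here because \<open>p\<close> and \<open>E\<close> lie
    in the right half plane.\<close>
  have Lq: "Ln q = of_real (ln (2 * pi)) + Ln p + Ln E"
  proof -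
    have RE: "Re E > 0" using E p(2) abs_Re_le_cmod[of "E - 1"] by simp
    have "Ln (p * E) = Ln p + Ln E"
      using Im_Ln_less_pi_half[OF p(1)] Im_Ln_less_pi_half[OF RE] p0 E0 by (intro Ln_times_simple) auto
    moreover have "Ln (of_real (2 * pi) * (p * E)) = of_real (ln (2 * pi)) + Ln (p * E)"
    proof -
      have "Ln (complex_of_real (2 * pi)) = of_real (ln (2 * pi))" by (rule Ln_of_real) simp
      moreover have "Ln (of_real (2 * pi) * (p * E)) = Ln (of_real (2 * pi)) + Ln (p * E)"
        unfolding \<open>Ln (complex_of_real (2 * pi)) = of_real (ln (2 * pi))\<close>[symmetric]
        using p0 E0 mpi_less_Im_Ln[of "p * E"] Im_Ln_le_pi[of "p * E"] calculation
        by (intro Ln_times_simple) auto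
      ultimately show ?thesis by simp
    qed
    moreover have "of_real (2 * pi) * (p * E) = q" unfolding qE by simp
    ultimately show ?thesis by simp
  qed
  have LE: "norm (Ln E) \<le> 4 * norm p"
    using norm_Ln_le[of "E - 1"] E p(2) by simp
  define u where "u = exp (- (\<i> * p / 2))"
  have u: "norm (u - 1) \<le> norm p"
    using exp_minus_1_bounds(1)[of "- (\<i> * p / 2)"] p by (simp add: u_def norm_mult norm_divide)
  have "norm (u / E - 1) = norm ((u - 1) - (E - 1)) / norm E" using E0 by (simp add: field_simps flip: norm_divide)
  also have "\<dots> \<le> (norm p + 2 * norm p) / (3/4)"
  proof (rule frac_le)
    show "norm ((u - 1) - (E - 1)) \<le> norm p + 2 * norm p"
      using norm_triangle_ineq4[of "u - 1" "E - 1"] u E by linarith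
  qed (use nE in auto)
  finally have uE: "norm (u / E - 1) \<le> 4 * norm p" by simp
  have "u * (2 * of_real pi * ((c - Ln q) / q)) - (c - of_real (ln (2 * pi)) - Ln p) / p =
    ((u / E - 1) * (c - Ln q) - Ln E) / p"
  proof -
    have a: "2 * of_real pi * ((c - Ln q) / q) = (c - Ln q) / (p * E)"
    proof -
      have "2 * of_real pi * (X / (2 * of_real pi * p * E)) = X / (p * E)" for X :: complex by simp
      thus ?thesis unfolding qE .
    qed
    have b: "c - of_real (ln (2 * pi)) - Ln p = (c - Ln q) + Ln E" unfolding Lq by simp
    have "u * (X / (p * E)) - (X + L) / p = ((u / E - 1) * X - L) / p" for X L
      using p0 E0 by (simp add: field_simps)
    thus ?thesis unfolding a b .
  qed
  also have "norm \<dots> \<le> (4 * norm p * (norm c + norm (Ln q)) + 4 * norm p) / norm p"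
    unfolding norm_divide
    by (intro divide_right_mono order_trans[OF norm_triangle_ineq4] add_mono LE)
       (auto simp: norm_mult intro!: mult_mono uE norm_triangle_ineq4)
  also have "\<dots> = 4 * (norm c + norm (Ln q)) + 4" using p0 by (simp add: field_simps)
  finally show "norm (exp (- (\<i> * p / 2)) * (2 * of_real pi * ((c - Ln q) / q)) - (c - of_real (ln (2 * pi)) - Ln p) / p) \<le> 4 * (norm c + norm (Ln q)) + 4"
    unfolding u_def .
qed

definition LapZ_const :: complex where
  "LapZ_const = zeta2_const - of_real (ln (2 * pi))"

text \<open>By periodicity \<open>M(z)\<close> is \<open>M(q)\<close> plus the residue term at
  \<open>q\<close> minus the residue term at \<open>z\<close>. The first is small since
  \<open>q\<close> is comparable to \<open>p\<close>, the second is the main term, and the third is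
  bounded since \<open>z\<close> stays near \<open>2 pi i\<close>.\<close>

lemma LapZ_asymp:
  "\<exists>C>0. \<forall>p. Re p > 0 \<and> norm p \<le> 1/8 \<longrightarrow>
     norm (LapZ p - (LapZ_const - Ln p) / p) \<le> C * (norm p powr (-(1/2)) * (norm p / Re p) ^ 4)"
proof -
  obtain C1 where C1: "\<And>p. 0 < Re p \<Longrightarrow> Re p \<le> 1 \<Longrightarrow> norm (exp (- (\<i> * p / 2)) * zeta2_line (zarg p) - LapZ p) \<le> C1"
    using LapZ_zeta2_line by blast
  obtain C2 where C2: "C2 > 0" "\<And>q. Re q > 0 \<Longrightarrow> norm (zeta2_line q) \<le> C2 * (norm q powr (-(1/2)) * (norm q / Re q) ^ 4)"
    using zeta2_line_bound by blast
  let ?c = zeta2_const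
  define K where "K = \<bar>C1\<bar> + 2 * C2 * 8 ^ 4 + (4 * (norm ?c + 4) + 4) + 4 * (norm ?c + ln (2 * pi) + 3)"
  have lp: "ln (2 * pi) > 0" using pi_gt3 by simp
  have K: "K > 0" unfolding K_def using C2(1) lp by (intro add_nonneg_pos add_nonneg_nonneg) (auto intro: add_nonneg_pos)
  have "norm (LapZ p - (LapZ_const - Ln p) / p) \<le> K * (norm p powr (-(1/2)) * (norm p / Re p) ^ 4)"
    if p: "Re p > 0" "norm p \<le> 1/8" for p
  proof -
    define z q where "z = zarg p" and "q = z - 2 * of_real pi * \<i>"
    \<comment> \<open>\<open>P\<close> is at least \<open>norm p powr (-(1/2))\<close>, hence at
      least 1, so it absorbs all bounded errors and also \<open>Ln q\<close>.\<close>
    define P where "P = norm p powr (-(1/2)) * (norm p / Re p) ^ 4"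
    define u where "u = exp (- (\<i> * p / 2))"
    note m = LapZ_main_terms[OF p, folded z_def, folded q_def, folded u_def]
    have p0: "norm p > 0" using p by auto
    have Rp: "Re p \<le> 1/8" "\<bar>Im p\<bar> \<le> 1/8" using p abs_Re_le_cmod[of p] abs_Im_le_cmod[of p] by auto
    have "1 powr (-(1/2)) \<le> norm p powr (-(1/2))" using p0 p by (intro powr_mono2') auto
    hence h1: "1 \<le> norm p powr (-(1/2))" by simp
    have "1 \<le> norm p / Re p" using p complex_Re_le_cmod[of p] by simp
    hence r4: "1 \<le> (norm p / Re p) ^ 4" by (rule one_le_power)
    have P1: "norm p powr (-(1/2)) \<le> P" unfolding P_def
      using mult_left_mono[OF r4, of "norm p powr (-(1/2))"] by simp
    have P2: "1 \<le> P" using P1 h1 by linarith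
    have nu: "norm u \<le> 2"
    proof -
      have "norm (u - 1) \<le> 2 * norm (- (\<i> * p / 2))" unfolding u_def
        using p by (intro exp_minus_1_bounds) (auto simp: norm_mult norm_divide)
      hence "norm (u - 1) \<le> 1" using p by (simp add: norm_mult norm_divide)
      thus ?thesis using norm_triangle_ineq[of "u - 1" 1] by simp
    qed
    have Rq: "Re q > 0" using m(1) p by simp
    have q0: "norm q > 0" using Rq by auto
    have T1: "norm (u * zeta2_line q) \<le> 2 * C2 * 8 ^ 4 * P"
    proof -
      have "norm q powr (-(1/2)) \<le> norm p powr (-(1/2))" using m(2) p0 by (intro powr_mono2') auto
      moreover have "norm q / Re q \<le> 8 * (norm p / Re p)"
        using frac_le[of "8 * norm p" "norm q" "Re p" "Re q"] m(1,3) p by simp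
      hence "(norm q / Re q) ^ 4 \<le> (8 * (norm p / Re p)) ^ 4" using Rq by (intro power_mono) auto
      ultimately have "norm q powr (-(1/2)) * (norm q / Re q) ^ 4 \<le> norm p powr (-(1/2)) * (8 * (norm p / Re p)) ^ 4"
        by (intro mult_mono) auto
      also have "\<dots> = 8 ^ 4 * P" unfolding P_def power_mult_distrib by simp
      finally have "norm (zeta2_line q) \<le> C2 * (8 ^ 4 * P)"
        using C2(2)[OF Rq] C2(1) by (meson mult_left_mono less_imp_le order_trans)
      hence "norm u * norm (zeta2_line q) \<le> 2 * (C2 * (8 ^ 4 * P))" using nu by (intro mult_mono) auto
      thus ?thesis by (simp add: norm_mult)
    qed
    have LnqP: "norm (Ln q) \<le> 4 * P"
    proof -
      have q1: "norm q \<le> 1" using m(3) p by simp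
      have "norm (Ln q) \<le> \<bar>ln (norm q)\<bar> + 2" by (rule norm_Ln_bound[OF Rq])
      also have "\<bar>ln (norm q)\<bar> \<le> 2 * norm q powr (-(1/2))" by (rule abs_ln_le_powr[OF q0 q1])
      also have "norm q powr (-(1/2)) \<le> norm p powr (-(1/2))" using m(2) p0 by (intro powr_mono2') auto
      finally show ?thesis using P1 P2 by simp
    qed
    have T2: "norm (u * (2 * of_real pi * ((?c - Ln q) / q)) - (LapZ_const - Ln p) / p) \<le> (4 * (norm ?c + 4) + 4) * P"
    proof -
      have "norm (u * (2 * of_real pi * ((?c - Ln q) / q)) - (LapZ_const - Ln p) / p) \<le> 4 * (norm ?c + norm (Ln q)) + 4"
        using m(4)[of ?c] by (simp add: LapZ_const_def)
      also have "\<dots> \<le> 4 * (norm ?c * P + 4 * P) + 4 * P"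
        using LnqP P2 mult_left_mono[OF P2, of "norm ?c"] by simp
      finally show ?thesis by (simp add: algebra_simps)
    qed
    have T3: "norm (u * (2 * of_real pi * ((?c - Ln z) / z))) \<le> 4 * (norm ?c + ln (2 * pi) + 3) * P"
    proof -
      have "exp (Im p) \<ge> 7/8" using exp_ge_add_one_self[of "Im p"] Rp by linarith
      hence "2 * pi * (7/8) \<le> norm z" unfolding z_def zarg_norm by (intro mult_left_mono) auto
      hence nz: "pi \<le> norm z" using pi_gt_zero by linarith
      have "Ln z = of_real (ln (2 * pi)) + \<i> * of_real (pi / 2) - \<i> * p"
        unfolding z_def using p Rp pi_gt3 by (intro Ln_zarg) auto
      hence "norm (Ln z) \<le> norm (of_real (ln (2 * pi)) + \<i> * of_real (pi / 2)) + norm (\<i> * p)"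
        by (simp only: norm_triangle_ineq4)
      also have "\<dots> \<le> ln (2 * pi) + pi / 2 + norm p"
        using norm_triangle_ineq[of "of_real (ln (2 * pi))" "\<i> * of_real (pi / 2)"] lp
        by (simp only: norm_mult norm_of_real norm_ii) simp
      also have "\<dots> \<le> ln (2 * pi) + 3" using p pi_less_4 by simp
      finally have nL: "norm (Ln z) \<le> ln (2 * pi) + 3" .
      have "norm (?c - Ln z) \<le> norm ?c + (ln (2 * pi) + 3)"
        using norm_triangle_ineq4[of ?c "Ln z"] nL by linarith
      hence "norm (?c - Ln z) / norm z \<le> (norm ?c + (ln (2 * pi) + 3)) / pi"
        using nz lp by (intro frac_le) auto
      hence "norm u * (2 * pi * (norm (?c - Ln z) / norm z)) \<le> 2 * (2 * pi * ((norm ?c + (ln (2 * pi) + 3)) / pi))"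
        using nu by (intro mult_mono mult_left_mono) auto
      also have "\<dots> = 4 * (norm ?c + ln (2 * pi) + 3)" by (simp add: field_simps)
      also have "\<dots> \<le> 4 * (norm ?c + ln (2 * pi) + 3) * P" using P2 lp mult_left_mono[OF P2, of "4 * (norm ?c + ln (2 * pi) + 3)"] by simp
      finally show ?thesis by (simp add: norm_mult norm_divide)
    qed
    have "z = q + 2 * of_real pi * \<i>" by (simp add: q_def)
    hence per: "zeta2_line z = zeta2_line q + 2 * of_real pi * ((?c - Ln q) / q) - 2 * of_real pi * ((?c - Ln z) / z)"
      using zeta2_line_periodic[OF Rq] by (metis add_diff_cancel_right')
    have "LapZ p - (LapZ_const - Ln p) / p = - (u * zeta2_line z - LapZ p) + u * zeta2_line q +
       (u * (2 * of_real pi * ((?c - Ln q) / q)) - (LapZ_const - Ln p) / p) - u * (2 * of_real pi * ((?c - Ln z) / z))"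
      unfolding per by (simp add: algebra_simps)
    also have "norm \<dots> \<le> norm (- (u * zeta2_line z - LapZ p)) + norm (u * zeta2_line q) +
       norm (u * (2 * of_real pi * ((?c - Ln q) / q)) - (LapZ_const - Ln p) / p) + norm (u * (2 * of_real pi * ((?c - Ln z) / z)))"
    proof -
      have "norm (a + b + c' - d) \<le> norm a + norm b + norm c' + norm d" for a b c' d :: complex
        using norm_triangle_ineq4[of "a + b + c'" d] norm_triangle_ineq[of "a + b" c'] norm_triangle_ineq[of a b] by linarith
      thus ?thesis .
    qed
    also have "norm (- (u * zeta2_line z - LapZ p)) \<le> \<bar>C1\<bar> * P"
    proof -
      have "norm (- (u * zeta2_line z - LapZ p)) \<le> \<bar>C1\<bar> * 1"
        unfolding norm_minus_cancel u_def z_def using C1[of p] p Rp by simp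
      also have "\<dots> \<le> \<bar>C1\<bar> * P" using P2 by (intro mult_left_mono) auto
      finally show ?thesis .
    qed
    finally have "norm (LapZ p - (LapZ_const - Ln p) / p) \<le> \<bar>C1\<bar> * P + 2 * C2 * 8 ^ 4 * P + (4 * (norm ?c + 4) + 4) * P + 4 * (norm ?c + ln (2 * pi) + 3) * P"
      using T1 T2 T3 by linarith
    also have "\<dots> = K * P" unfolding K_def by (simp add: algebra_simps)
    finally show ?thesis unfolding P_def .
  qed
  thus ?thesis using K by blast
qed

section \<open>The mean value of the squared Hardy function\<close>

text \<open>A Riesz mean of order one. The weight \<open>T - t\<close> puts \<open>w^2\<close> into
  the denominator of the Perron kernel, which is what makes the inversion absolutely
  convergent.\<close>

definition Zint1 :: "real \<Rightarrow> real" where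
  "Zint1 T = (\<integral>t. max 0 (T - t) * Zsq t \<partial>hl)"

definition wline :: "real \<Rightarrow> complex" where "wline v = Complex 1 v"

lemma wline_simps [simp]: "Re (wline v) = 1" "wline v \<noteq> 0"
  by (simp_all add: wline_def complex_eq_iff)

lemma norm_wline_ge: "norm (wline v) \<ge> 1"
  by (simp add: wline_def norm_Complex_1)

lemma norm_wline_square: "(norm (wline v))\<^sup>2 = 1 + v\<^sup>2"
  by (simp add: wline_def cmod_power2)

lemma wline_continuous [continuous_intros]: "continuous_on A wline"
  unfolding wline_def[abs_def] by (intro continuous_intros)

lemma wline_measurable [measurable]: "wline \<in> borel_measurable borel"
  by (intro borel_measurable_continuous_onI wline_continuous)

lemma integrable_norm_wline_powr: "integrable lborel (\<lambda>v. norm (wline v) powr (-(3/2)))"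
proof -
  let ?h = "\<lambda>x. indicator {1..} x *\<^sub>R (x powr (-(3/2)) :: real)"
  have "((\<lambda>x::real. x powr (-(3/2))) has_integral -(1 powr (-(3/2) + 1)) / (-(3/2) + 1)) {1..}"
    by (rule has_integral_powr_to_inf) auto
  hence "(\<lambda>x::real. x powr (-(3/2))) absolutely_integrable_on {1..}"
    by (intro nonnegative_absolutely_integrable_1) (auto simp: has_integral_integrable)
  hence hi: "integrable lborel ?h"
    unfolding set_integrable_def by (subst (asm) integrable_completion) auto
  have hi': "integrable lborel (\<lambda>x. ?h (0 + (-1) * x))" by (rule lborel_integrable_real_affine[OF hi]) simp
  have bi: "integrable lborel (indicator {-1..1} :: real \<Rightarrow> real)"
    by (simp add: integrable_indicator_iff)
  show ?thesis
  proof (rule Bochner_Integration.integrable_bound[OF Bochner_Integration.integrable_add[OF bi Bochner_Integration.integrable_add[OF hi hi']]])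
    have "norm (wline v) powr (-(3/2)) \<le> indicator {-1..1} v + (?h v + ?h (0 + (-1) * v))" for v
    proof (cases "\<bar>v\<bar> \<le> 1")
      case True
      have "norm (wline v) powr (-(3/2)) \<le> 1 powr (-(3/2))" using norm_wline_ge[of v] by (intro powr_mono2') auto
      thus ?thesis using True by (auto simp: indicator_def)
    next
      case False
      have "norm (wline v) powr (-(3/2)) \<le> \<bar>v\<bar> powr (-(3/2))"
        using False norm_Complex_1(2)[of v] by (intro powr_mono2') (auto simp: wline_def)
      thus ?thesis using False by (auto simp: indicator_def abs_if split: if_splits)
    qed
    thus "AE v in lborel. norm (norm (wline v) powr (-(3/2))) \<le> norm (indicator {-1..1} v + (?h v + ?h (0 + (-1) * v)))"
      by (intro AE_I2) (simp add: order_trans[OF _ abs_ge_self])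
  qed measurable
qed

text \<open>With \<open>p = w / T\<close> the line \<open>Re p = 1/T\<close> becomes the fixed line
  \<open>Re w = 1\<close>. The weight is then of constant size and Fubini applies with the product
  majorant \<open>exp (- t / T) / (1 + v^2)\<close> times \<open>Zsq\<close>.\<close>

lemma Perron_Zint1:
  assumes T: "T > 0"
  shows "integrable lborel (\<lambda>v. LapZ (wline v / of_real T) * (exp (wline v) / wline v ^ 2))"
    and "(\<integral>v. LapZ (wline v / of_real T) * (exp (wline v) / wline v ^ 2) \<partial>lborel) = 2 * of_real pi * of_real (Zint1 T / T)"
proof -
  define F where "F = (\<lambda>v t. of_real (Zsq t) * (exp (of_real (1 - t / T) * wline v) / wline v ^ 2))"
  have meas: "(\<lambda>(v, t). F v t) \<in> borel_measurable (lborel \<Otimes>\<^sub>M hl)"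
  proof -
    have [measurable]: "fst \<in> borel_measurable (lborel \<Otimes>\<^sub>M hl)"
      using measurable_fst[of lborel hl] by (simp add: measurable_cong_sets[OF refl sets_lborel])
    have "(\<lambda>x. x) \<in> borel_measurable hl" by (rule hl_measurable_borel) simp
    from measurable_compose[OF measurable_snd this, of lborel]
    have [measurable]: "snd \<in> borel_measurable (lborel \<Otimes>\<^sub>M hl)" by simp
    show ?thesis unfolding F_def split_beta' by measurable
  qed
  have nF: "norm (F v t) = 1 / (1 + v\<^sup>2) * (exp 1 * (Zsq t * exp (- (1 / T * t))))" for v t
    by (simp add: F_def norm_mult norm_divide norm_power norm_wline_square exp_diff exp_minus field_simps)
  have prod: "integrable (lborel \<Otimes>\<^sub>M hl) (\<lambda>(v, t). 1 / (1 + v\<^sup>2) * (exp 1 * (Zsq t * exp (- (1 / T * t)))))"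
    using T by (intro lborel_hl.integrable_pair_mult integrable_inverse_1_plus_square_lborel integrable_mult_right Zsq_exp_integrable) auto
  have Fi: "integrable (lborel \<Otimes>\<^sub>M hl) (\<lambda>(v, t). F v t)"
    by (rule Bochner_Integration.integrable_bound[OF prod meas]) (auto simp: nF)
  have inner_t: "(\<integral>t. F v t \<partial>hl) = LapZ (wline v / of_real T) * (exp (wline v) / wline v ^ 2)" for v
  proof -
    have "F v t = (of_real (Zsq t) * exp (- (wline v / of_real T * of_real t))) * (exp (wline v) / wline v ^ 2)" for t
    proof -
      have "exp (of_real (1 - t / T) * wline v) = exp (- (wline v / of_real T * of_real t)) * exp (wline v)"
        unfolding exp_add[symmetric] by (rule arg_cong[where f=exp]) (simp add: algebra_simps)
      thus ?thesis by (simp add: F_def)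
    qed
    thus ?thesis by (simp only: LapZ_def integral_mult_left_zero)
  qed
  have inner_v: "(\<integral>v. F v t \<partial>lborel) = 2 * of_real pi * of_real (max 0 (T - t) * Zsq t / T)" for t
  proof -
    have "(\<integral>v. exp (of_real (1 - t / T) * wline v) / wline v ^ 2 \<partial>lborel) = 2 * of_real pi * of_real (max 0 (1 - t / T))"
      using Perron_kernel(2)[of 1 "1 - t / T"] by (simp add: wline_def numeral_2_eq_2)
    also have "max 0 (1 - t / T) = max 0 (T - t) / T"
      using T by (auto simp: max_def field_simps)
    finally show ?thesis unfolding F_def integral_mult_right_zero by simp
  qed
  show "integrable lborel (\<lambda>v. LapZ (wline v / of_real T) * (exp (wline v) / wline v ^ 2))"
    using lborel_hl.integrable_fst[OF Fi] by (simp only: inner_t)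
  have "(\<integral>v. LapZ (wline v / of_real T) * (exp (wline v) / wline v ^ 2) \<partial>lborel) = (\<integral>t. (\<integral>v. F v t \<partial>lborel) \<partial>hl)"
    using lborel_hl.Fubini_integral[OF Fi] by (simp only: inner_t)
  also have "\<dots> = 2 * of_real pi * (\<integral>t. of_real (max 0 (T - t) * Zsq t / T) \<partial>hl)"
    unfolding inner_v integral_mult_right_zero ..
  also have "(\<integral>t. complex_of_real (max 0 (T - t) * Zsq t / T) \<partial>hl) = of_real (Zint1 T / T)"
    unfolding integral_complex_of_real Zint1_def by simp
  finally show "(\<integral>v. LapZ (wline v / of_real T) * (exp (wline v) / wline v ^ 2) \<partial>lborel) = 2 * of_real pi * of_real (Zint1 T / T)" .
qed

lemma LapZ_crude: "Re p > 0 \<Longrightarrow> norm (LapZ p) \<le> norm (LapZ (of_real (Re p)))"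
proof -
  assume p: "Re p > 0"
  have "norm (LapZ p) \<le> (\<integral>t. norm (of_real (Zsq t) * exp (- (p * of_real t))) \<partial>hl)"
    unfolding LapZ_def by (rule integral_norm_bound)
  also have "\<dots> = (\<integral>t. Zsq t * exp (- (Re p * t)) \<partial>hl)" by (simp add: norm_mult)
  also have "\<dots> = norm (complex_of_real (\<integral>t. Zsq t * exp (- (Re p * t)) \<partial>hl))" by simp
  also have "complex_of_real (\<integral>t. Zsq t * exp (- (Re p * t)) \<partial>hl) = LapZ (of_real (Re p))"
    unfolding LapZ_def integral_complex_of_real[symmetric] by (simp flip: exp_of_real)
  finally show ?thesis .
qed

text \<open>Two ranges. For \<open>norm w <= T^(1/8)\<close> the asymptotics at \<open>w / T\<close>
  have error \<open>T^(-1/2) * norm w ^ (7/2)\<close>, at most a constant times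
  \<open>T^(-1/16)\<close>. Beyond it the crude bound \<open>O(ln T)\<close> is paid for by
  \<open>norm w ^ (1/2) >= T^(1/16)\<close>. This factor still leaves the kernel
  \<open>1 / w^2\<close> integrable.\<close>

lemma LapZ_line_error:
  "\<exists>M T0. M > 0 \<and> T0 \<ge> 3 \<and> (\<forall>T\<ge>T0. \<forall>v. norm (LapZ (wline v / of_real T) / of_real T - (LapZ_const + of_real (ln T) - Ln (wline v)) / wline v)
     \<le> M * ln T * T powr (-(1/16)) * norm (wline v) powr (1/2))"
proof -
  obtain C where C: "C > 0" "\<And>p. Re p > 0 \<Longrightarrow> norm p \<le> 1/8 \<Longrightarrow>
     norm (LapZ p - (LapZ_const - Ln p) / p) \<le> C * (norm p powr (-(1/2)) * (norm p / Re p) ^ 4)"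
    using LapZ_asymp by blast
  define c where "c = norm LapZ_const"
  have c: "c \<ge> 0" by (simp add: c_def)
  define e where "e = (\<lambda>T w. LapZ (w / of_real T) / of_real T - (LapZ_const + of_real (ln T) - Ln w) / w)"
  have near: "norm (e T w) \<le> C * (T powr (-(1/2)) * norm w powr (7/2))"
    if T: "T > 0" and w: "Re w = 1" "norm w \<le> T / 8" for T w
  proof -
    let ?p = "w / of_real T"
    have w0: "w \<noteq> 0" using w by auto
    have Rp: "Re ?p = 1 / T" using w T by simp
    have np: "norm ?p = norm w / T" using T by (simp add: norm_divide)
    have "Ln ?p = Ln w - of_real (ln T)"
    proof -
      have "Ln (of_real T * ?p) = of_real (ln T) + Ln ?p"
      proof -
        have "Ln (complex_of_real T) = of_real (ln T)" using T by (rule Ln_of_real)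
        moreover have "\<bar>Im (Ln ?p)\<bar> < pi / 2" by (rule Im_Ln_less_pi_half) (use Rp T in simp)
        ultimately show ?thesis
          using T w0 by (subst Ln_times_simple) auto
      qed
      moreover have "of_real T * ?p = w" using T by simp
      ultimately show ?thesis by (simp add: algebra_simps)
    qed
    hence "e T w = (LapZ ?p - (LapZ_const - Ln ?p) / ?p) / of_real T"
      using T w0 by (simp add: e_def diff_divide_distrib add_divide_distrib)
    hence "norm (e T w) = norm (LapZ ?p - (LapZ_const - Ln ?p) / ?p) / T"
      using T by (simp add: norm_divide)
    also have "\<dots> \<le> C * (norm ?p powr (-(1/2)) * (norm ?p / Re ?p) ^ 4) / T"
      using C(2)[of ?p] T w Rp np by (intro divide_right_mono) auto
    also have "norm ?p / Re ?p = norm w" using T w(1) by (simp add: Rp np)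
    also have "norm ?p powr (-(1/2)) = norm w powr (-(1/2)) * T powr (1/2)"
      unfolding np using T by (simp add: powr_divide powr_minus field_simps)
    also have "norm w ^ 4 = norm w powr 4" using w0 by simp
    also have "C * (norm w powr (-(1/2)) * T powr (1/2) * norm w powr 4) / T = C * ((T powr (1/2) / T) * (norm w powr (-(1/2)) * norm w powr 4))"
      by simp
    also have "norm w powr (-(1/2)) * norm w powr 4 = norm w powr (7/2)" by (subst powr_add[symmetric]) simp
    also have "T powr (1/2) / T = T powr (-(1/2))" using T powr_diff[of T "1/2" 1] by simp
    finally show ?thesis .
  qed
  \<comment> \<open>The near range at \<open>w = 1\<close> yields the value at the real point
    \<open>1/T\<close>, which dominates the whole line \<open>Re p = 1/T\<close> by
    \<open>LapZ_crude\<close>.\<close>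
  have LapT: "norm (LapZ (of_real (1 / T))) / T \<le> (c + C + 1) * ln T" if T: "T \<ge> 8" for T
  proof -
    have l1: "ln T \<ge> 1"
    proof -
      have "exp 1 \<le> T" using T exp_le by linarith
      thus ?thesis using T by (subst ln_ge_iff) auto
    qed
    have "norm (e T 1) \<le> C * (T powr (-(1/2)) * norm (1 :: complex) powr (7/2))"
      using T by (intro near) auto
    also have "T powr (-(1/2)) \<le> 1 powr (-(1/2))" using T by (intro powr_mono2') auto
    finally have e1: "norm (e T 1) \<le> C" using C(1) by (simp add: mult_left_mono)
    have "norm (LapZ (1 / of_real T) / of_real T) \<le> norm (e T 1) + norm (LapZ_const + of_real (ln T))"
      using norm_triangle_sub[of "LapZ (1 / of_real T) / of_real T" "LapZ_const + of_real (ln T)"] by (simp add: e_def add.commute)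
    also have "norm (LapZ_const + complex_of_real (ln T)) \<le> c + ln T"
      unfolding c_def using norm_triangle_ineq[of LapZ_const "of_real (ln T)"] l1 by simp
    finally have "norm (LapZ (1 / of_real T)) / T \<le> C + (c + ln T)" using e1 T by (simp add: norm_divide)
    also have "\<dots> \<le> (c + C + 1) * ln T"
      using mult_left_mono[OF l1, of "c + C"] c C(1) by (simp add: algebra_simps)
    finally show ?thesis by simp
  qed
  define D where "D = (c + C + 1) + (c + 1 + 3)"
  have crude: "norm (e T w) \<le> D * ln T" if T: "T \<ge> 8" and w: "Re w = 1" for T w
  proof -
    have l1: "ln T \<ge> 1"
    proof -
      have "exp 1 \<le> T" using T exp_le by linarith
      thus ?thesis using T by (subst ln_ge_iff) auto
    qed
    have w1: "norm w \<ge> 1" using complex_Re_le_cmod[of w] w by simp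
    have "norm (LapZ (w / of_real T)) \<le> norm (LapZ (of_real (Re (w / of_real T))))" by (rule LapZ_crude) (use w T in simp)
    hence "norm (LapZ (w / of_real T)) / T \<le> norm (LapZ (of_real (1 / T))) / T"
      using T w by (intro divide_right_mono) auto
    hence 1: "norm (LapZ (w / of_real T) / of_real T) \<le> (c + C + 1) * ln T"
      using LapT[OF T] T by (simp add: norm_divide)
    have Lw: "norm (Ln w) \<le> 3 * norm w"
    proof -
      have "norm (Ln w) \<le> \<bar>ln (norm w)\<bar> + 2" by (rule norm_Ln_bound) (use w in simp)
      moreover have "\<bar>ln (norm w)\<bar> \<le> norm w" using w1 ln_le_minus_one[of "norm w"] ln_ge_zero[of "norm w"] by linarith
      ultimately show ?thesis using w1 by linarith
    qed
    have "norm (LapZ_const + of_real (ln T) - Ln w) \<le> c + ln T + 3 * norm w"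
      using norm_triangle_ineq4[of "LapZ_const + of_real (ln T)" "Ln w"] norm_triangle_ineq[of LapZ_const "of_real (ln T)"] Lw l1
      unfolding c_def by simp
    hence "norm ((LapZ_const + of_real (ln T) - Ln w) / w) \<le> (c + ln T + 3 * norm w) / norm w"
      unfolding norm_divide by (intro divide_right_mono) auto
    also have "\<dots> = (c + ln T) / norm w + 3" using w1 by (auto simp: add_divide_distrib)
    also have "(c + ln T) / norm w \<le> (c + ln T) / 1" using w1 l1 c by (intro divide_left_mono) auto
    finally have "norm ((LapZ_const + of_real (ln T) - Ln w) / w) \<le> c + ln T + 3" by simp
    also have "\<dots> \<le> (c + 1 + 3) * ln T" using mult_left_mono[OF l1, of "c + 3"] c by (simp add: algebra_simps)
    finally have 2: "norm ((LapZ_const + of_real (ln T) - Ln w) / w) \<le> (c + 1 + 3) * ln T" .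
    have "norm (e T w) \<le> (c + C + 1) * ln T + (c + 1 + 3) * ln T"
      unfolding e_def using 1 2 norm_triangle_ineq4 by (meson add_mono order_trans)
    thus ?thesis by (simp add: D_def algebra_simps)
  qed
  have D: "D > 0" using c C(1) by (simp add: D_def)
  \<comment> \<open>Ensures that \<open>w / T\<close> stays in the disc of radius 1/8 on which
    \<open>LapZ_asymp\<close> holds.\<close>
  have "eventually (\<lambda>T::real. T powr (1/8) \<le> T / 8) at_top" by real_asymp
  then obtain T1 :: real where T1: "\<And>T. T \<ge> T1 \<Longrightarrow> T powr (1/8) \<le> T / 8" by (auto simp: eventually_at_top_linorder)
  define T0 where "T0 = max 8 T1"
  have "norm (e T w) \<le> (C + D) * ln T * T powr (-(1/16)) * norm w powr (1/2)" if T: "T \<ge> T0" and w: "Re w = 1" for T w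
  proof -
    have T8: "T \<ge> 8" "T > 0" using T by (auto simp: T0_def)
    have l1: "ln T \<ge> 1"
    proof -
      have "exp 1 \<le> T" using T8 exp_le by linarith
      thus ?thesis using T8 by (subst ln_ge_iff) auto
    qed
    have w1: "norm w \<ge> 1" using complex_Re_le_cmod[of w] w by simp
    have w2: "norm w powr (1/2) \<ge> 1" using w1 by (simp add: ge_one_powr_ge_zero)
    show ?thesis
    proof (cases "norm w \<le> T powr (1/8)")
      case True
      have "norm (e T w) \<le> C * (T powr (-(1/2)) * norm w powr (7/2))"
        using True T1[of T] T T8 w by (intro near) (auto simp: T0_def)
      also have "norm w powr (7/2) \<le> (T powr (1/8)) powr (7/2)" using True by (intro powr_mono2) auto
      also have "T powr (-(1/2)) * (T powr (1/8)) powr (7/2) = T powr (-(1/16))"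
        using T8 by (simp add: powr_powr flip: powr_add)
      finally have "norm (e T w) \<le> C * T powr (-(1/16))" using C(1) by (simp add: mult_left_mono)
      also have "\<dots> \<le> (C + D) * ln T * T powr (-(1/16)) * norm w powr (1/2)"
      proof -
        have "C * 1 \<le> (C + D) * ln T" using C(1) D l1 by (intro mult_mono) auto
        hence "C * T powr (-(1/16)) * 1 \<le> ((C + D) * ln T) * T powr (-(1/16)) * norm w powr (1/2)"
          using C(1) D l1 w2 by (intro mult_mono mult_nonneg_nonneg) auto
        thus ?thesis by simp
      qed
      finally show ?thesis .
    next
      case False
      have "T powr (1/16) = (T powr (1/8)) powr (1/2)" using T8 by (simp add: powr_powr)
      also have "\<dots> \<le> norm w powr (1/2)" using False by (intro powr_mono2) auto
      finally have "1 \<le> T powr (-(1/16)) * norm w powr (1/2)"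
        using T8 by (simp add: powr_minus field_simps)
      hence "D * ln T * 1 \<le> (C + D) * ln T * (T powr (-(1/16)) * norm w powr (1/2))"
        using C(1) D l1 by (intro mult_mono) auto
      thus ?thesis using crude[OF T8(1) w] by (simp add: mult.assoc)
    qed
  qed
  hence "\<forall>T\<ge>T0. \<forall>v. norm (e T (wline v)) \<le> (C + D) * ln T * T powr (-(1/16)) * norm (wline v) powr (1/2)" by simp
  thus ?thesis using C(1) D unfolding e_def by (intro exI[of _ "C + D"] exI[of _ T0]) (auto simp: T0_def)
qed

text \<open>The main term \<open>(LapZ_const + ln T - Ln w) / w\<close> is integrated against
  \<open>exp w / w^2\<close>. The kernel with \<open>k = 2\<close> at \<open>Y = 1\<close> has
  integral \<open>2 pi / 2!\<close>, which gives \<open>T^2 ln T / 2\<close>; everything independent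
  of \<open>T\<close>, including the integral of the logarithm, is collected in
  \<open>\<kappa>\<close>.\<close>

lemma Zint1_asymp:
  "\<exists>\<kappa> M T0. \<forall>T\<ge>T0. T0 \<ge> 3 \<and> \<bar>Zint1 T - (T\<^sup>2 * ln T / 2 + \<kappa> * T\<^sup>2)\<bar> \<le> M * (T\<^sup>2 * (ln T * T powr (-(1/16))))"
proof -
  obtain M T0 where M: "M > 0" "T0 \<ge> 3"
    and er: "\<And>T v. T \<ge> T0 \<Longrightarrow> norm (LapZ (wline v / of_real T) / of_real T - (LapZ_const + of_real (ln T) - Ln (wline v)) / wline v)
     \<le> M * ln T * T powr (-(1/16)) * norm (wline v) powr (1/2)"
    using LapZ_line_error by blast
  define k2 where "k2 = (\<lambda>v. exp (wline v) / wline v ^ 2)"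
  define k3 where "k3 = (\<lambda>v. exp (wline v) / wline v ^ 3)"
  have nk2: "norm (k2 v) = exp 1 / (norm (wline v))\<^sup>2" for v
    by (simp add: k2_def norm_divide norm_power)
  have k3: "integrable lborel k3" "(\<integral>v. k3 v \<partial>lborel) = of_real pi"
    using Perron_kernel[of 2 1] by (simp_all add: k3_def[abs_def] wline_def numeral_3_eq_3 numeral_2_eq_2)
  define L where "L = (\<lambda>v. Ln (wline v) * k3 v)"
  have Li: "integrable lborel L"
  proof (rule Bochner_Integration.integrable_bound)
    show "integrable lborel (\<lambda>v::real. 3 * exp 1 * (1 / (1 + v\<^sup>2)))"
      by (intro integrable_mult_right integrable_inverse_1_plus_square_lborel)
    have "continuous_on UNIV L" unfolding L_def k3_def
      by (intro continuous_intros) (auto simp: complex_nonpos_Reals_iff)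
    thus "L \<in> borel_measurable lborel" by (simp add: borel_measurable_continuous_onI)
    have "norm (L v) \<le> 3 * exp 1 * (1 / (1 + v\<^sup>2))" for v
    proof -
      have w1: "norm (wline v) \<ge> 1" by (rule norm_wline_ge)
      have "norm (Ln (wline v)) \<le> \<bar>ln (norm (wline v))\<bar> + 2" by (rule norm_Ln_bound) simp
      moreover have "\<bar>ln (norm (wline v))\<bar> \<le> norm (wline v)"
        using w1 ln_le_minus_one[of "norm (wline v)"] ln_ge_zero[of "norm (wline v)"] by linarith
      ultimately have "norm (Ln (wline v)) \<le> 3 * norm (wline v)" using w1 by linarith
      hence "norm (L v) \<le> 3 * norm (wline v) * (exp 1 / norm (wline v) ^ 3)"
        unfolding L_def k3_def norm_mult by (intro mult_mono) (auto simp: norm_divide norm_power)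
      also have "\<dots> = 3 * exp 1 * (1 / (norm (wline v))\<^sup>2)"
        using w1 by (simp add: power2_eq_square power3_eq_cube field_simps)
      finally show ?thesis by (simp add: norm_wline_square)
    qed
    thus "AE v in lborel. norm (L v) \<le> norm (3 * exp 1 * (1 / (1 + v\<^sup>2)))"
      by (intro AE_I2) (simp add: order_trans[OF _ abs_ge_self])
  qed
  define \<kappa> where "\<kappa> = Re ((LapZ_const * of_real pi - (\<integral>v. L v \<partial>lborel)) / (2 * of_real pi))"
  define B where "B = M * exp 1 * (\<integral>v. norm (wline v) powr (-(3/2)) \<partial>lborel)"
  have main: "\<bar>Zint1 T - (T\<^sup>2 * ln T / 2 + \<kappa> * T\<^sup>2)\<bar> \<le> B * (T\<^sup>2 * (ln T * T powr (-(1/16))))" if T: "T \<ge> T0" for T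
  proof -
    have T3: "T \<ge> 3" "T > 0" using T M by auto
    define A where "A = (\<lambda>v. LapZ (wline v / of_real T) * k2 v / of_real T)"
    define m where "m = (\<lambda>v. (LapZ_const + of_real (ln T)) * k3 v - L v)"
    have Ai: "integrable lborel A" "(\<integral>v. A v \<partial>lborel) = 2 * of_real pi * of_real (Zint1 T / T\<^sup>2)"
    proof -
      have P: "integrable lborel (\<lambda>v. LapZ (wline v / of_real T) * k2 v)"
        "(\<integral>v. LapZ (wline v / of_real T) * k2 v \<partial>lborel) = 2 * of_real pi * of_real (Zint1 T / T)"
        using Perron_Zint1[OF T3(2)] by (simp_all only: k2_def)
      show "integrable lborel A" unfolding A_def using P(1) by (rule integrable_divide)
      have "(\<integral>v. A v \<partial>lborel) = 2 * of_real pi * of_real (Zint1 T / T) / of_real T"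
        unfolding A_def integral_divide_zero P(2) ..
      thus "(\<integral>v. A v \<partial>lborel) = 2 * of_real pi * of_real (Zint1 T / T\<^sup>2)" by (simp add: power2_eq_square)
    qed
    have mi: "integrable lborel m" "(\<integral>v. m v \<partial>lborel) = (LapZ_const + of_real (ln T)) * of_real pi - (\<integral>v. L v \<partial>lborel)"
      unfolding m_def using k3 Li by (simp_all add: Bochner_Integration.integral_diff)
    have eq: "A v - m v = (LapZ (wline v / of_real T) / of_real T - (LapZ_const + of_real (ln T) - Ln (wline v)) / wline v) * k2 v" for v
    proof -
      have "k3 v = k2 v / wline v" by (simp add: k2_def k3_def power2_eq_square power3_eq_cube)
      thus ?thesis unfolding A_def m_def L_def by (simp add: algebra_simps diff_divide_distrib add_divide_distrib)
    qed
    have le: "norm (A v - m v) \<le> (M * exp 1 * (ln T * T powr (-(1/16)))) * norm (wline v) powr (-(3/2))" for v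
    proof -
      have "norm (A v - m v) \<le> (M * ln T * T powr (-(1/16)) * norm (wline v) powr (1/2)) * (exp 1 / (norm (wline v))\<^sup>2)"
        unfolding eq norm_mult nk2 by (intro mult_right_mono er T) auto
      also have "norm (wline v) powr (1/2) = norm (wline v) powr (-(3/2)) * (norm (wline v))\<^sup>2"
      proof -
        have "(norm (wline v))\<^sup>2 = norm (wline v) powr 2" using norm_wline_ge[of v] by simp
        thus ?thesis by (simp only: powr_add[symmetric]) simp
      qed
      finally show ?thesis using norm_wline_ge[of v] by (simp add: field_simps)
    qed
    have "norm ((\<integral>v. A v \<partial>lborel) - (\<integral>v. m v \<partial>lborel)) = norm (\<integral>v. A v - m v \<partial>lborel)"
      using Bochner_Integration.integral_diff[OF Ai(1) mi(1)] by simp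
    also have "\<dots> \<le> (\<integral>v. (M * exp 1 * (ln T * T powr (-(1/16)))) * norm (wline v) powr (-(3/2)) \<partial>lborel)"
    proof (rule order_trans[OF integral_norm_bound Bochner_Integration.integral_mono])
      show "integrable lborel (\<lambda>v. norm (A v - m v))"
        by (rule integrable_norm[OF Bochner_Integration.integrable_diff[OF Ai(1) mi(1)]])
      show "integrable lborel (\<lambda>v. (M * exp 1 * (ln T * T powr (-(1/16)))) * norm (wline v) powr (-(3/2)))"
        by (rule integrable_mult_right[OF integrable_norm_wline_powr])
      show "norm (A v - m v) \<le> (M * exp 1 * (ln T * T powr (-(1/16)))) * norm (wline v) powr (-(3/2))" for v by (rule le)
    qed
    also have "\<dots> = B * (ln T * T powr (-(1/16)))" unfolding B_def by simp
    finally have b: "norm ((\<integral>v. A v \<partial>lborel) - (\<integral>v. m v \<partial>lborel)) \<le> B * (ln T * T powr (-(1/16)))" .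
    have "Zint1 T / T\<^sup>2 - (ln T / 2 + \<kappa>) = Re (((\<integral>v. A v \<partial>lborel) - (\<integral>v. m v \<partial>lborel)) / (2 * of_real pi))"
    proof -
      have a: "((\<integral>v. A v \<partial>lborel) - (\<integral>v. m v \<partial>lborel)) / (2 * of_real pi) =
         of_real (Zint1 T / T\<^sup>2) - of_real (ln T / 2) - (LapZ_const * of_real pi - (\<integral>v. L v \<partial>lborel)) / (2 * of_real pi)"
        unfolding Ai mi by (simp add: field_simps)
      show ?thesis unfolding a minus_complex.sel Re_complex_of_real \<kappa>_def by simp
    qed
    also have "\<bar>\<dots>\<bar> \<le> norm (((\<integral>v. A v \<partial>lborel) - (\<integral>v. m v \<partial>lborel)) / (2 * of_real pi))" by (rule abs_Re_le_cmod)
    also have "\<dots> \<le> norm ((\<integral>v. A v \<partial>lborel) - (\<integral>v. m v \<partial>lborel)) / 1"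
      unfolding norm_divide using pi_gt3 by (intro divide_left_mono) (auto simp: norm_mult)
    finally have "\<bar>Zint1 T / T\<^sup>2 - (ln T / 2 + \<kappa>)\<bar> \<le> B * (ln T * T powr (-(1/16)))" using b by simp
    hence "T\<^sup>2 * \<bar>Zint1 T / T\<^sup>2 - (ln T / 2 + \<kappa>)\<bar> \<le> T\<^sup>2 * (B * (ln T * T powr (-(1/16))))" by (rule mult_left_mono) simp
    also have "T\<^sup>2 * \<bar>Zint1 T / T\<^sup>2 - (ln T / 2 + \<kappa>)\<bar> = \<bar>T\<^sup>2 * (Zint1 T / T\<^sup>2 - (ln T / 2 + \<kappa>))\<bar>" by (simp add: abs_mult)
    also have "T\<^sup>2 * (Zint1 T / T\<^sup>2 - (ln T / 2 + \<kappa>)) = Zint1 T - (T\<^sup>2 * ln T / 2 + \<kappa> * T\<^sup>2)"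
      using T3 by (simp add: algebra_simps)
    finally show ?thesis by (simp add: mult_ac)
  qed
  show ?thesis
    by (intro exI[of _ \<kappa>] exI[of _ B] exI[of _ T0]) (use main M in auto)
qed

section \<open>From the Riesz mean to the mean value\<close>

definition Zint :: "real \<Rightarrow> real" where
  "Zint T = integral {0..T} Zsq"

lemma Zsq_integrable_on: "Zsq integrable_on {a..b}"
  by (intro integrable_continuous_real Zsq_continuous)

lemma Zint_hl:
  assumes "T > 0"
  shows "integrable hl (\<lambda>t. indicator {..T} t * Zsq t)" "(\<integral>t. indicator {..T} t * Zsq t \<partial>hl) = Zint T"
proof -
  have si: "set_integrable lborel {0..T} Zsq"
    unfolding set_integrable_def by (rule borel_integrable_compact[OF compact_Icc Zsq_continuous])
  have e: "(\<lambda>t. indicator {0<..} t *\<^sub>R (indicator {..T} t * Zsq t)) = (\<lambda>t. indicator {0<..T} t *\<^sub>R Zsq t)"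
    by (auto simp: indicator_def)
  have si2: "set_integrable lborel {0<..T} Zsq" by (rule set_integrable_subset[OF si]) auto
  show "integrable hl (\<lambda>t. indicator {..T} t * Zsq t)"
    unfolding hl_integrable_iff set_integrable_def e using si2 unfolding set_integrable_def .
  have "(\<integral>t. indicator {..T} t * Zsq t \<partial>hl) = (LINT t:{0<..T}|lborel. Zsq t)"
    unfolding hl_integral set_lebesgue_integral_def e ..
  also have "\<dots> = integral {0<..T} Zsq" by (rule set_borel_integral_eq_integral(2)[OF si2])
  also have "\<dots> = integral {0..T} Zsq"
    by (rule integral_spike_set) (auto intro: negligible_subset[of "{0}"])
  finally show "(\<integral>t. indicator {..T} t * Zsq t \<partial>hl) = Zint T" by (simp add: Zint_def)
qed

lemma Zint1_integrable:
  assumes "T > 0"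
  shows "integrable hl (\<lambda>t. max 0 (T - t) * Zsq t)"
proof (rule Bochner_Integration.integrable_bound)
  show "integrable hl (\<lambda>t. T * (indicator {..T} t * Zsq t))" by (intro integrable_mult_right Zint_hl assms)
  show "(\<lambda>t. max 0 (T - t) * Zsq t) \<in> borel_measurable hl" by (rule hl_measurable_borel) measurable
  show "AE t in hl. norm (max 0 (T - t) * Zsq t) \<le> norm (T * (indicator {..T} t * Zsq t))"
    using assms by (intro AE_I2) (auto simp: indicator_def abs_mult max_def intro!: mult_right_mono)
qed

text \<open>\<open>Zint1\<close> is an antiderivative of the nondecreasing function
  \<open>Zint\<close>, so its difference quotients enclose values of \<open>Zint\<close>.\<close>

lemma Zint1_diff_bounds:
  assumes "T > 0" "h > 0"
  shows "h * Zint T \<le> Zint1 (T + h) - Zint1 T" "Zint1 (T + h) - Zint1 T \<le> h * Zint (T + h)"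
proof -
  have d: "Zint1 (T + h) - Zint1 T = (\<integral>t. max 0 (T + h - t) * Zsq t - max 0 (T - t) * Zsq t \<partial>hl)"
    unfolding Zint1_def using assms by (intro Bochner_Integration.integral_diff[symmetric] Zint1_integrable) auto
  have i: "integrable hl (\<lambda>t. max 0 (T + h - t) * Zsq t - max 0 (T - t) * Zsq t)"
    using assms by (intro Bochner_Integration.integrable_diff Zint1_integrable) auto
  have z: "h * Zint S = (\<integral>t. h * (indicator {..S} t * Zsq t) \<partial>hl)" "integrable hl (\<lambda>t. h * (indicator {..S} t * Zsq t))"
    if "S > 0" for S
    using Zint_hl[OF that] by (simp_all add: mult.assoc)
  show "h * Zint T \<le> Zint1 (T + h) - Zint1 T"
    unfolding d z(1)[OF assms(1)]
  proof (rule Bochner_Integration.integral_mono[OF z(2)[OF assms(1)] i])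
    fix t
    have "h * indicator {..T} t \<le> max 0 (T + h - t) - max 0 (T - t)" using assms by (auto simp: indicator_def max_def)
    from mult_right_mono[OF this Zsq_nonneg[of t]]
    show "h * (indicator {..T} t * Zsq t) \<le> max 0 (T + h - t) * Zsq t - max 0 (T - t) * Zsq t"
      by (simp add: algebra_simps)
  qed
  have Th: "T + h > 0" using assms by simp
  show "Zint1 (T + h) - Zint1 T \<le> h * Zint (T + h)"
    unfolding d z(1)[OF Th]
  proof (rule Bochner_Integration.integral_mono[OF i z(2)[OF Th]])
    fix t
    have "max 0 (T + h - t) - max 0 (T - t) \<le> h * indicator {..T + h} t" using assms by (auto simp: indicator_def max_def)
    from mult_right_mono[OF this Zsq_nonneg[of t]]
    show "max 0 (T + h - t) * Zsq t - max 0 (T - t) * Zsq t \<le> h * (indicator {..T + h} t * Zsq t)"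
      by (simp add: algebra_simps)
  qed
qed

theorem Zint_asymp: "\<exists>C. ((\<lambda>T. Zint T / T - ln T) \<longlongrightarrow> C) at_top"
proof -
  obtain \<kappa> M T0 where T0: "\<And>T. T \<ge> T0 \<Longrightarrow> \<bar>Zint1 T - (T\<^sup>2 * ln T / 2 + \<kappa> * T\<^sup>2)\<bar> \<le> M * (T\<^sup>2 * (ln T * T powr (-(1/16))))"
    using Zint1_asymp by blast
  define R where "R = (\<lambda>T. Zint1 T - (T\<^sup>2 * ln T / 2 + \<kappa> * T\<^sup>2))"
  \<comment> \<open>The remainder is \<open>O(T^(31/16) ln T)\<close>; the exponent 63/32 lies just
    above 31/16 and absorbs the logarithm.\<close>
  have Rlim: "((\<lambda>T. R T / T powr (63/32)) \<longlongrightarrow> 0) at_top"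
  proof (rule Lim_null_comparison)
    show "\<forall>\<^sub>F T in at_top. norm (R T / T powr (63/32)) \<le> M * (T\<^sup>2 * (ln T * T powr (-(1/16)))) / T powr (63/32)"
      using eventually_ge_at_top[of T0]
    proof eventually_elim
      case (elim T)
      thus ?case using T0[OF elim] by (simp add: R_def abs_divide divide_right_mono)
    qed
    have "((\<lambda>T::real. T\<^sup>2 * (ln T * T powr (-(1/16))) / T powr (63/32)) \<longlongrightarrow> 0) at_top" by real_asymp
    from tendsto_mult_left[OF this, of M]
    show "((\<lambda>T. M * (T\<^sup>2 * (ln T * T powr (-(1/16)))) / T powr (63/32)) \<longlongrightarrow> 0) at_top" by simp
  qed
  \<comment> \<open>The step must be large enough for \<open>T^(63/32) / (h T * T) -> 0\<close>,
    which removes the remainder, and small enough for \<open>h T * ln T / T -> 0\<close>, so that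
    the quotient of the main term tends to its derivative. The exponent 63/64 meets both
    demands.\<close>
  define h where "h = (\<lambda>T::real. T powr (63/64))"
  \<comment> \<open>The derivative of \<open>T^2 ln T / 2 + \<kappa> T^2\<close>, divided by
    \<open>T\<close>, is \<open>ln T + C\<close>.\<close>
  define C where "C = 1/2 + 2 * \<kappa>"
  define U where "U = (\<lambda>T. (Zint1 (T + h T) - Zint1 T) / (h T * T) - ln T)"
  define V where "V = (\<lambda>T. (Zint1 T - Zint1 (T - h T)) / (h T * T) - ln T)"
  have R1: "((\<lambda>T. R T / (h T * T)) \<longlongrightarrow> 0) at_top"
  proof -
    have "((\<lambda>T::real. T powr (63/32) / (h T * T)) \<longlongrightarrow> 0) at_top" unfolding h_def by real_asymp
    from tendsto_mult[OF Rlim this] have "((\<lambda>T. R T / T powr (63/32) * (T powr (63/32) / (h T * T))) \<longlongrightarrow> 0) at_top" by simp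
    moreover have "\<forall>\<^sub>F T in at_top. R T / T powr (63/32) * (T powr (63/32) / (h T * T)) = R T / (h T * T)"
      using eventually_gt_at_top[of 0] by eventually_elim simp
    ultimately show ?thesis by (rule Lim_transform_eventually)
  qed
  have R2: "((\<lambda>T. R (T + h T) / (h T * T)) \<longlongrightarrow> 0) at_top"
  proof -
    have l: "filterlim (\<lambda>T. T + h T) at_top at_top" unfolding h_def by real_asymp
    have "((\<lambda>T::real. (T + h T) powr (63/32) / (h T * T)) \<longlongrightarrow> 0) at_top" unfolding h_def by real_asymp
    from tendsto_mult[OF filterlim_compose[OF Rlim l] this]
    have "((\<lambda>T. R (T + h T) / (T + h T) powr (63/32) * ((T + h T) powr (63/32) / (h T * T))) \<longlongrightarrow> 0) at_top" by simp
    moreover have "\<forall>\<^sub>F T in at_top. R (T + h T) / (T + h T) powr (63/32) * ((T + h T) powr (63/32) / (h T * T)) = R (T + h T) / (h T * T)"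
      using filterlim_at_top_dense[THEN iffD1, OF l, rule_format, of 0] by eventually_elim simp
    ultimately show ?thesis by (rule Lim_transform_eventually)
  qed
  have R3: "((\<lambda>T. R (T - h T) / (h T * T)) \<longlongrightarrow> 0) at_top"
  proof -
    have l: "filterlim (\<lambda>T. T - h T) at_top at_top" unfolding h_def by real_asymp
    have "((\<lambda>T::real. (T - h T) powr (63/32) / (h T * T)) \<longlongrightarrow> 0) at_top" unfolding h_def by real_asymp
    from tendsto_mult[OF filterlim_compose[OF Rlim l] this]
    have "((\<lambda>T. R (T - h T) / (T - h T) powr (63/32) * ((T - h T) powr (63/32) / (h T * T))) \<longlongrightarrow> 0) at_top" by simp
    moreover have "\<forall>\<^sub>F T in at_top. R (T - h T) / (T - h T) powr (63/32) * ((T - h T) powr (63/32) / (h T * T)) = R (T - h T) / (h T * T)"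
      using filterlim_at_top_dense[THEN iffD1, OF l, rule_format, of 0] by eventually_elim simp
    ultimately show ?thesis by (rule Lim_transform_eventually)
  qed
  have a1: "((\<lambda>T. (((T + h T)\<^sup>2 * ln (T + h T) / 2) - T\<^sup>2 * ln T / 2) / (h T * T) - ln T) \<longlongrightarrow> 1/2) at_top"
    unfolding h_def by real_asymp
  have a2: "((\<lambda>T. ((T + h T)\<^sup>2 - T\<^sup>2) / (h T * T)) \<longlongrightarrow> 2) at_top"
    unfolding h_def by real_asymp
  have a3: "((\<lambda>T. (T\<^sup>2 * ln T / 2 - ((T - h T)\<^sup>2 * ln (T - h T) / 2)) / (h T * T) - ln T) \<longlongrightarrow> 1/2) at_top"
    unfolding h_def by real_asymp
  have a4: "((\<lambda>T. (T\<^sup>2 - (T - h T)\<^sup>2) / (h T * T)) \<longlongrightarrow> 2) at_top"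
    unfolding h_def by real_asymp
  have Ul: "(U \<longlongrightarrow> C) at_top"
  proof -
    have "U = (\<lambda>T. ((((T + h T)\<^sup>2 * ln (T + h T) / 2) - T\<^sup>2 * ln T / 2) / (h T * T) - ln T)
       + \<kappa> * (((T + h T)\<^sup>2 - T\<^sup>2) / (h T * T)) + (R (T + h T) / (h T * T) - R T / (h T * T)))"
      by (rule ext) (simp add: U_def R_def add_divide_distrib diff_divide_distrib right_diff_distrib)
    moreover have "(\<dots> \<longlongrightarrow> 1/2 + \<kappa> * 2 + (0 - 0)) at_top"
      by (intro tendsto_add tendsto_mult_left tendsto_diff[OF R2 R1] a1 a2)
    ultimately show ?thesis by (simp add: C_def mult.commute)
  qed
  have Vl: "(V \<longlongrightarrow> C) at_top"
  proof -
    have "V = (\<lambda>T. ((T\<^sup>2 * ln T / 2 - ((T - h T)\<^sup>2 * ln (T - h T) / 2)) / (h T * T) - ln T)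
       + \<kappa> * ((T\<^sup>2 - (T - h T)\<^sup>2) / (h T * T)) + (R T / (h T * T) - R (T - h T) / (h T * T)))"
      by (rule ext) (simp add: V_def R_def add_divide_distrib diff_divide_distrib right_diff_distrib)
    moreover have "(\<dots> \<longlongrightarrow> 1/2 + \<kappa> * 2 + (0 - 0)) at_top"
      by (intro tendsto_add tendsto_mult_left tendsto_diff[OF R1 R3] a3 a4)
    ultimately show ?thesis by (simp add: C_def mult.commute)
  qed
  have ev: "\<forall>\<^sub>F T in at_top. T > 0 \<and> h T > 0 \<and> T - h T > 0"
  proof -
    have "\<forall>\<^sub>F T::real in at_top. T - h T > 0" unfolding h_def by real_asymp
    thus ?thesis using eventually_gt_at_top[of 0] by eventually_elim (auto simp: h_def)
  qed
  have "((\<lambda>T. Zint T / T - ln T) \<longlongrightarrow> C) at_top"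
  proof (rule tendsto_sandwich[OF _ _ Vl Ul])
    show "\<forall>\<^sub>F T in at_top. V T \<le> Zint T / T - ln T"
      using ev
    proof eventually_elim
      case (elim T)
      have "Zint1 (T - h T + h T) - Zint1 (T - h T) \<le> h T * Zint (T - h T + h T)"
        using elim by (intro Zint1_diff_bounds) auto
      hence "(Zint1 T - Zint1 (T - h T)) / (h T * T) \<le> h T * Zint T / (h T * T)"
        using elim by (intro divide_right_mono) auto
      thus ?case using elim by (simp add: V_def)
    qed
    show "\<forall>\<^sub>F T in at_top. Zint T / T - ln T \<le> U T"
      using ev
    proof eventually_elim
      case (elim T)
      have "h T * Zint T \<le> Zint1 (T + h T) - Zint1 T" using elim by (intro Zint1_diff_bounds) auto
      hence "h T * Zint T / (h T * T) \<le> (Zint1 (T + h T) - Zint1 T) / (h T * T)"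
        using elim by (intro divide_right_mono) auto
      thus ?case using elim by (simp add: U_def)
    qed
  qed
  thus ?thesis by blast
qed

section \<open>The exponentially weighted mean\<close>

definition Zlap :: "real \<Rightarrow> real" where
  "Zlap T = (\<integral>t. Zsq t * exp (- (t / T)) \<partial>hl)"

lemma Zlap_integrable: "T > 0 \<Longrightarrow> integrable hl (\<lambda>t. Zsq t * exp (- (t / T)))"
  using Zsq_exp_integrable[of "1 / T"] by simp

lemma exp_neg_integrable_hl: "integrable hl (\<lambda>u. exp (- u))"
  using powr_exp_integrable_hl[of 0 1]
  by (rule Bochner_Integration.integrable_cong[THEN iffD1, rotated -1]) auto

lemma integral_exp_tail:
  assumes "a \<ge> 0"
  shows "integrable hl (\<lambda>u. indicator {a<..} u * exp (- u))" "(\<integral>u. indicator {a<..} u * exp (- u) \<partial>hl) = exp (- a)"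
proof -
  have "((\<lambda>x. exp (- 1 * x)) has_integral exp (- 1 * a) / 1) {a..}"
    by (rule has_integral_exp_minus_to_infinity) simp
  hence hi: "((\<lambda>x. exp (- x)) has_integral exp (- a)) {a..}" by simp
  have hi2: "((\<lambda>x. exp (- x)) has_integral exp (- a)) {a<..}"
    by (rule has_integral_spike_set_eq[THEN iffD1, OF _ _ hi]) (auto intro: negligible_subset[of "{a}"])
  hence "(\<lambda>x. exp (- x)) absolutely_integrable_on {a<..}"
    by (intro nonnegative_absolutely_integrable_1) (auto simp: has_integral_integrable)
  hence si: "set_integrable lborel {a<..} (\<lambda>x. exp (- x))"
    unfolding set_integrable_def by (subst (asm) integrable_completion) auto
  have e: "(\<lambda>u. indicator {0<..} u *\<^sub>R (indicator {a<..} u * exp (- u))) = (\<lambda>u. indicator {a<..} u *\<^sub>R exp (- u))"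
    using assms by (auto simp: indicator_def)
  show "integrable hl (\<lambda>u. indicator {a<..} u * exp (- u))"
    using si unfolding hl_integrable_iff set_integrable_def e .
  show "(\<integral>u. indicator {a<..} u * exp (- u) \<partial>hl) = exp (- a)"
    using set_borel_integral_eq_integral(2)[OF si] hi2
    unfolding hl_integral set_lebesgue_integral_def e by (simp add: integral_unique)
qed

text \<open>Partial integration in the form of Fubini: \<open>exp (- t / T)\<close> is the integral
  of \<open>exp (- u)\<close> over \<open>u > t / T\<close>.\<close>

lemma Zlap_eq:
  assumes T: "T > 0"
  shows "integrable hl (\<lambda>u. Zint (T * u) * exp (- u))" "Zlap T = (\<integral>u. Zint (T * u) * exp (- u) \<partial>hl)"
proof -
  define F where "F = (\<lambda>t u. Zsq t * (indicator {t / T<..} u * exp (- u)))"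
  have meas: "(\<lambda>(t, u). F t u) \<in> borel_measurable (hl \<Otimes>\<^sub>M hl)"
  proof -
    have "(\<lambda>x. x) \<in> borel_measurable hl" by (rule hl_measurable_borel) simp
    from measurable_compose[OF measurable_fst this, of hl] measurable_compose[OF measurable_snd this, of hl]
    have [measurable]: "fst \<in> borel_measurable (hl \<Otimes>\<^sub>M hl)" "snd \<in> borel_measurable (hl \<Otimes>\<^sub>M hl)" by simp_all
    have "(\<lambda>(t, u). F t u) = (\<lambda>p. Zsq (fst p) * ((if fst p / T < snd p then 1 else 0) * exp (- snd p)))"
      by (auto simp: F_def indicator_def)
    thus ?thesis by simp
  qed
  have Fn: "F t u \<ge> 0" for t u by (simp add: F_def)
  have i1: "(\<integral>u. F t u \<partial>hl) = Zsq t * exp (- (t / T))" "integrable hl (F t)" if "t \<in> space hl" for t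
    using integral_exp_tail[of "t / T"] that T by (simp_all add: F_def)
  have Fi: "integrable (hl \<Otimes>\<^sub>M hl) (\<lambda>(t, u). F t u)"
  proof (rule hl_hl.Fubini_integrable[OF meas])
    have "integrable hl (\<lambda>t. Zsq t * exp (- (t / T))) \<longleftrightarrow> integrable hl (\<lambda>t. \<integral>u. norm (case (t, u) of (t, u) \<Rightarrow> F t u) \<partial>hl)"
      by (intro Bochner_Integration.integrable_cong refl) (use i1 Fn in simp)
    thus "integrable hl (\<lambda>t. \<integral>u. norm (case (t, u) of (t, u) \<Rightarrow> F t u) \<partial>hl)" using Zlap_integrable[OF T] by simp
    show "AE t in hl. integrable hl (\<lambda>u. case (t, u) of (t, u) \<Rightarrow> F t u)" using i1(2) by (intro AE_I2) simp
  qed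
  have i2: "(\<integral>t. F t u \<partial>hl) = Zint (T * u) * exp (- u)" if "u \<in> space hl" for u
  proof -
    have Tu: "T * u > 0" using T that by simp
    have "(\<integral>t. F t u \<partial>hl) = (\<integral>t. (indicator {..T * u} t * Zsq t) * exp (- u) \<partial>hl)"
    proof (rule integral_cong_AE)
      have "AE t in lborel. t \<noteq> T * u" by (rule AE_lborel_singleton)
      hence "AE t in hl. t \<noteq> T * u" by (subst AE_restrict_space_iff) (auto elim!: eventually_mono)
      thus "AE t in hl. F t u = (indicator {..T * u} t * Zsq t) * exp (- u)"
        by eventually_elim (use T in \<open>auto simp: F_def indicator_def field_simps\<close>)
      show "(\<lambda>t. F t u) \<in> borel_measurable hl"
        using measurable_Pair1[OF meas that] by simp
      show "(\<lambda>t. (indicator {..T * u} t * Zsq t) * exp (- u)) \<in> borel_measurable hl"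
        by (rule hl_measurable_borel) measurable
    qed
    also have "\<dots> = Zint (T * u) * exp (- u)"
      unfolding integral_mult_left_zero Zint_hl(2)[OF Tu] ..
    finally show ?thesis .
  qed
  have "integrable hl (\<lambda>u. \<integral>t. F t u \<partial>hl)" by (rule hl_hl.integrable_snd[OF Fi])
  thus "integrable hl (\<lambda>u. Zint (T * u) * exp (- u))"
    by (rule Bochner_Integration.integrable_cong[THEN iffD1, rotated -1]) (use i2 in auto)
  have "Zlap T = (\<integral>t. (\<integral>u. F t u \<partial>hl) \<partial>hl)"
    unfolding Zlap_def by (intro Bochner_Integration.integral_cong refl) (use i1 in simp)
  also have "\<dots> = (\<integral>u. (\<integral>t. F t u \<partial>hl) \<partial>hl)" using hl_hl.Fubini_integral[OF Fi] by simp
  also have "\<dots> = (\<integral>u. Zint (T * u) * exp (- u) \<partial>hl)"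
    by (intro Bochner_Integration.integral_cong refl) (use i2 in simp)
  finally show "Zlap T = (\<integral>u. Zint (T * u) * exp (- u) \<partial>hl)" .
qed

lemma Zint_nonneg: "Zint T \<ge> 0"
  unfolding Zint_def by (intro Henstock_Kurzweil_Integration.integral_nonneg Zsq_integrable_on) simp

lemma Zint_diff: "0 \<le> a \<Longrightarrow> a \<le> b \<Longrightarrow> Zint b - Zint a = integral {a..b} Zsq"
  unfolding Zint_def using Henstock_Kurzweil_Integration.integral_combine[of 0 a b Zsq] Zsq_integrable_on by simp

lemma Zint_mono: "0 \<le> a \<Longrightarrow> a \<le> b \<Longrightarrow> Zint a \<le> Zint b"
  using Zint_diff[of a b] Henstock_Kurzweil_Integration.integral_nonneg[OF Zsq_integrable_on, of a b] by simp

lemma Zint_continuous: "continuous_on {0..b} Zint"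
  unfolding Zint_def[abs_def] by (intro indefinite_integral_continuous_1 Zsq_integrable_on)

lemma x_abs_ln_le:
  fixes u :: real
  assumes "u > 0"
  shows "u * \<bar>ln u\<bar> \<le> u\<^sup>2 + 1"
proof -
  have "ln u \<le> u" using ln_le_minus_one[OF assms] by simp
  moreover have "- ln u \<le> 1 / u" using ln_le_minus_one[of "1 / u"] assms by (simp add: ln_div)
  moreover have "0 < 1 / u" using assms by simp
  ultimately have "\<bar>ln u\<bar> \<le> u + 1 / u" using assms by linarith
  hence "u * \<bar>ln u\<bar> \<le> u * (u + 1 / u)" using assms by (intro mult_left_mono) auto
  thus ?thesis using assms by (simp add: power2_eq_square distrib_left)
qed

text \<open>A version of the asymptotics that holds down to 0, as needed for a majorant over all
  \<open>u > 0\<close>. Below the threshold everything is bounded by constants.\<close>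

lemma Zint_bound: "\<exists>K. \<forall>x>0. \<bar>Zint x - x * ln x\<bar> \<le> K * (1 + x)"
proof -
  obtain C where C: "((\<lambda>T. Zint T / T - ln T) \<longlongrightarrow> C) at_top" using Zint_asymp by blast
  have "eventually (\<lambda>T. dist (Zint T / T - ln T) C < 1) at_top"
    using C by (rule tendstoD) simp
  then obtain N where N: "\<And>T. T \<ge> N \<Longrightarrow> dist (Zint T / T - ln T) C < 1" by (auto simp: eventually_at_top_linorder)
  define m where "m = max N 1"
  define K where "K = (\<bar>C\<bar> + 1) + (Zint m + m\<^sup>2 + 1)"
  have "\<bar>Zint x - x * ln x\<bar> \<le> K * (1 + x)" if x: "x > 0" for x
  proof (cases "x \<ge> m")
    case True
    have "\<bar>Zint x / x - ln x\<bar> \<le> \<bar>C\<bar> + 1" using N[of x] True by (auto simp: m_def dist_real_def)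
    hence "x * \<bar>Zint x / x - ln x\<bar> \<le> x * (\<bar>C\<bar> + 1)" using x by (intro mult_left_mono) auto
    moreover have "x * \<bar>Zint x / x - ln x\<bar> = \<bar>Zint x - x * ln x\<bar>"
      using x by (simp add: abs_mult_pos' right_diff_distrib)
    moreover have "x * (\<bar>C\<bar> + 1) \<le> (1 + x) * K" using x Zint_nonneg[of m] by (intro mult_mono) (auto simp: K_def)
    ultimately show ?thesis by (simp add: mult.commute)
  next
    case False
    have "\<bar>x * ln x\<bar> \<le> x\<^sup>2 + 1" using x_abs_ln_le[OF x] x by (simp add: abs_mult)
    moreover have "x\<^sup>2 \<le> m\<^sup>2" using False x by (intro power_mono) auto
    moreover have "\<bar>Zint x\<bar> \<le> Zint m" using Zint_mono[of x m] Zint_nonneg[of x] False x by simp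
    ultimately have "\<bar>Zint x - x * ln x\<bar> \<le> Zint m + (m\<^sup>2 + 1)" by linarith
    hence "\<bar>Zint x - x * ln x\<bar> \<le> K * 1" unfolding K_def using abs_ge_zero[of C] by simp
    also have "\<dots> \<le> K * (1 + x)" using x Zint_nonneg[of m] by (intro mult_left_mono) (auto simp: K_def)
    finally show ?thesis .
  qed
  thus ?thesis by blast
qed

lemma powr_exp_hl_value:
  assumes "\<sigma> > -1"
  shows "integrable hl (\<lambda>x. x powr \<sigma> * exp (- x))" "(\<integral>x. x powr \<sigma> * exp (- x) \<partial>hl) = Gamma (\<sigma> + 1)"
proof -
  show i: "integrable hl (\<lambda>x. x powr \<sigma> * exp (- x))" using powr_exp_integrable_hl[OF assms, of 1] by simp
  have "complex_of_real (\<integral>x. x powr \<sigma> * exp (- x) \<partial>hl) = (\<integral>x. of_real x powr (of_real (\<sigma> + 1) - 1) * exp (- (1 * complex_of_real x)) \<partial>hl)"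
    unfolding integral_complex_of_real[symmetric]
    by (intro Bochner_Integration.integral_cong refl) (auto simp: powr_of_real simp flip: exp_of_real)
  also have "\<dots> = Gamma (of_real (\<sigma> + 1)) * 1 powr (- of_real (\<sigma> + 1))"
    by (rule Gamma_integral_rotated) (use assms in auto)
  also have "\<dots> = of_real (Gamma (\<sigma> + 1))" by (subst Gamma_complex_of_real) simp
  finally show "(\<integral>x. x powr \<sigma> * exp (- x) \<partial>hl) = Gamma (\<sigma> + 1)" by (simp only: of_real_eq_iff)
qed

text \<open>This is the derivative of \<open>Gamma\<close> at 2, namely \<open>Digamma 2\<close>.
  The inequalities \<open>(1 - u powr (- h)) / h <= ln u <= (u powr h - 1) / h\<close> enclose the
  integral between difference quotients of \<open>Gamma\<close> at 2, so nothing is differentiated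
  under the integral sign.\<close>

lemma integral_x_ln_x_exp:
  "integrable hl (\<lambda>u. u * ln u * exp (- u))" "(\<integral>u. u * ln u * exp (- u) \<partial>hl) = 1 - euler_mascheroni"
proof -
  have P2: "u powr 2 = u\<^sup>2" "u powr 1 = u" "u powr 0 = 1" if "u \<in> space hl" for u :: real using that by auto
  show i: "integrable hl (\<lambda>u. u * ln u * exp (- u))"
  proof (rule Bochner_Integration.integrable_bound)
    show "integrable hl (\<lambda>u. u powr 2 * exp (- u) + u powr 0 * exp (- u))"
      by (intro Bochner_Integration.integrable_add powr_exp_hl_value) auto
    show "(\<lambda>u. u * ln u * exp (- u)) \<in> borel_measurable hl" by (rule hl_measurable_borel) measurable
    show "AE u in hl. norm (u * ln u * exp (- u)) \<le> norm (u powr 2 * exp (- u) + u powr 0 * exp (- u))"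
    proof (rule AE_I2)
      fix u assume u: "u \<in> space hl"
      have "u * \<bar>ln u\<bar> * exp (- u) \<le> (u\<^sup>2 + 1) * exp (- u)" using u by (intro mult_right_mono x_abs_ln_le) auto
      thus "norm (u * ln u * exp (- u)) \<le> norm (u powr 2 * exp (- u) + u powr 0 * exp (- u))"
        using u by (simp add: P2[OF u] abs_mult distrib_right)
    qed
  qed
  define X where "X = (\<integral>u. u * ln u * exp (- u) \<partial>hl)"
  define h where "h = (\<lambda>n. 1 / real (n + 2))"
  have h: "0 < h n" "h n < 1" for n by (auto simp: h_def)
  have h0: "h \<longlonglongrightarrow> 0" unfolding h_def by real_asymp
  have up: "X \<le> (Gamma (2 + h n) - Gamma 2) / h n" for n
  proof -
    have "X \<le> (\<integral>u. (u powr (1 + h n) * exp (- u) - u powr 1 * exp (- u)) / h n \<partial>hl)"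
      unfolding X_def
    proof (rule integral_mono_AE[OF i])
      show "integrable hl (\<lambda>u. (u powr (1 + h n) * exp (- u) - u powr 1 * exp (- u)) / h n)"
        using h[of n] by (intro integrable_divide Bochner_Integration.integrable_diff powr_exp_hl_value) auto
      show "AE u in hl. u * ln u * exp (- u) \<le> (u powr (1 + h n) * exp (- u) - u powr 1 * exp (- u)) / h n"
      proof (rule AE_I2)
        fix u assume u: "u \<in> space hl"
        have "h n * ln u \<le> u powr h n - 1" using ln_le_minus_one[of "u powr h n"] u by (simp add: ln_powr)
        hence "ln u \<le> (u powr h n - 1) / h n" using h[of n] by (simp add: field_simps)
        hence "(u * exp (- u)) * ln u \<le> (u * exp (- u)) * ((u powr h n - 1) / h n)" using u by (intro mult_left_mono) auto
        thus "u * ln u * exp (- u) \<le> (u powr (1 + h n) * exp (- u) - u powr 1 * exp (- u)) / h n"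
          using u by (simp add: powr_add algebra_simps diff_divide_distrib)
      qed
    qed
    also have "\<dots> = (Gamma (2 + h n) - Gamma 2) / h n"
    proof -
      have "(\<integral>u. u powr (1 + h n) * exp (- u) - u powr 1 * exp (- u) \<partial>hl) = Gamma (1 + h n + 1) - Gamma (1 + 1)"
      proof -
        have v: "integrable hl (\<lambda>u. u powr (1 + h n) * exp (- u))" "(\<integral>u. u powr (1 + h n) * exp (- u) \<partial>hl) = Gamma (1 + h n + 1)"
          "integrable hl (\<lambda>u. u powr 1 * exp (- u))" "(\<integral>u. u powr 1 * exp (- u) \<partial>hl) = Gamma (1 + 1)"
          by (rule powr_exp_hl_value; use h[of n] in simp)+
        show ?thesis by (simp only: Bochner_Integration.integral_diff[OF v(1,3)] v(2,4))
      qed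
      thus ?thesis by (simp add: add_ac)
    qed
    finally show ?thesis .
  qed
  have lo: "(Gamma 2 - Gamma (2 + - h n)) / h n \<le> X" for n
  proof -
    have "(\<integral>u. (u powr 1 * exp (- u) - u powr (1 - h n) * exp (- u)) / h n \<partial>hl) \<le> X"
      unfolding X_def
    proof (rule integral_mono_AE[OF _ i])
      show "integrable hl (\<lambda>u. (u powr 1 * exp (- u) - u powr (1 - h n) * exp (- u)) / h n)"
        using h[of n] by (intro integrable_divide Bochner_Integration.integrable_diff powr_exp_hl_value) auto
      show "AE u in hl. (u powr 1 * exp (- u) - u powr (1 - h n) * exp (- u)) / h n \<le> u * ln u * exp (- u)"
      proof (rule AE_I2)
        fix u assume u: "u \<in> space hl"
        have "- h n * ln u \<le> u powr (- h n) - 1" using ln_le_minus_one[of "u powr (- h n)"] u by (simp add: ln_powr)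
        hence "(1 - u powr (- h n)) / h n \<le> ln u" using h[of n] by (simp add: field_simps)
        hence "(u * exp (- u)) * ((1 - u powr (- h n)) / h n) \<le> (u * exp (- u)) * ln u" using u by (intro mult_left_mono) auto
        moreover have "u powr (1 - h n) = u * u powr (- h n)" using u powr_add[of u 1 "- h n"] by simp
        ultimately show "(u powr 1 * exp (- u) - u powr (1 - h n) * exp (- u)) / h n \<le> u * ln u * exp (- u)"
          using u by (simp add: algebra_simps diff_divide_distrib)
      qed
    qed
    also have "(\<integral>u. (u powr 1 * exp (- u) - u powr (1 - h n) * exp (- u)) / h n \<partial>hl) = (Gamma 2 - Gamma (2 + - h n)) / h n"
    proof -
      have "(\<integral>u. u powr 1 * exp (- u) - u powr (1 - h n) * exp (- u) \<partial>hl) = Gamma (1 + 1) - Gamma (1 - h n + 1)"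
      proof -
        have v: "integrable hl (\<lambda>u. u powr (1 - h n) * exp (- u))" "(\<integral>u. u powr (1 - h n) * exp (- u) \<partial>hl) = Gamma (1 - h n + 1)"
          "integrable hl (\<lambda>u. u powr 1 * exp (- u))" "(\<integral>u. u powr 1 * exp (- u) \<partial>hl) = Gamma (1 + 1)"
          by (rule powr_exp_hl_value; use h[of n] in simp)+
        show ?thesis by (simp only: Bochner_Integration.integral_diff[OF v(3,1)] v(2,4))
      qed
      thus ?thesis by (simp add: algebra_simps)
    qed
    finally show ?thesis .
  qed
  have D: "(Gamma has_real_derivative (1 - euler_mascheroni)) (at (2 :: real))"
  proof -
    have "(Gamma has_real_derivative Gamma 2 * Digamma 2) (at (2 :: real))"
      by (rule has_field_derivative_Gamma) (auto elim: nonpos_Ints_cases)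
    moreover have "Gamma (2 :: real) = 1" using Gamma_fact[of 1, where 'a=real] by simp
    moreover have "Digamma (2 :: real) = 1 - euler_mascheroni" by (simp add: Digamma_numeral harm_def)
    ultimately show ?thesis by simp
  qed
  have lim: "(\<lambda>n. (Gamma (2 + k n) - Gamma 2) / k n) \<longlonglongrightarrow> 1 - euler_mascheroni"
    if "k \<longlonglongrightarrow> 0" "\<And>n. k n \<noteq> 0" for k :: "nat \<Rightarrow> real"
  proof -
    have "((\<lambda>x. (Gamma (2 + x) - Gamma 2) / x) \<longlongrightarrow> 1 - euler_mascheroni) (at (0 :: real))"
      using D by (simp add: DERIV_def)
    thus ?thesis by (rule filterlim_compose) (use that in \<open>auto simp: filterlim_at\<close>)
  qed
  have "X \<le> 1 - euler_mascheroni"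
    by (rule LIMSEQ_le_const[OF lim[OF h0]]) (use h up in \<open>auto simp: less_imp_neq[symmetric]\<close>)
  moreover have "1 - euler_mascheroni \<le> X"
  proof (rule LIMSEQ_le_const2[OF lim[of "\<lambda>n. - h n"]])
    show "(\<lambda>n. - h n) \<longlonglongrightarrow> 0" using tendsto_minus[OF h0] by simp
    show "\<exists>N. \<forall>n\<ge>N. (Gamma (2 + - h n) - Gamma 2) / - h n \<le> X"
      using lo by (auto simp: minus_divide_right[symmetric] minus_divide_left)
  qed (use h in \<open>auto simp: less_imp_neq[symmetric]\<close>)
  ultimately show "(\<integral>u. u * ln u * exp (- u) \<partial>hl) = 1 - euler_mascheroni" unfolding X_def by simp
qed

text \<open>Since \<open>u exp (- u)\<close> has integral 1, the term \<open>ln T\<close> can be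
  moved under the integral. The integrand \<open>(Zint (T u) / T - u ln T) exp (- u)\<close> then
  converges to \<open>(u ln u + C u) exp (- u)\<close>.\<close>

lemma Zlap_asymp:
  assumes C: "((\<lambda>T. Zint T / T - ln T) \<longlongrightarrow> C) at_top"
  shows "((\<lambda>T. Zlap T / T - ln T) \<longlongrightarrow> C + (1 - euler_mascheroni)) at_top"
proof (rule tendsto_at_topI_sequentially)
  fix X :: "nat \<Rightarrow> real" assume X: "filterlim X at_top sequentially"
  then obtain N where N: "\<And>n. n \<ge> N \<Longrightarrow> X n \<ge> 1" unfolding filterlim_at_top eventually_sequentially by blast
  \<comment> \<open>Dropping the first members gives \<open>Y n >= 1\<close>, so that the majorant
    used below does not depend on \<open>n\<close>.\<close>
  define Y where "Y = (\<lambda>n. X (n + N))"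
  have Y1: "Y n \<ge> 1" "Y n > 0" for n using N[of "n + N"] by (auto simp: Y_def)
  have Y: "filterlim Y at_top sequentially" unfolding Y_def
    by (rule filterlim_compose[OF X]) (rule filterlim_add_const_nat_at_top)
  obtain K where K: "\<And>x. x > 0 \<Longrightarrow> \<bar>Zint x - x * ln x\<bar> \<le> K * (1 + x)" using Zint_bound by blast
  have K0: "K \<ge> 0" using K[of 1] abs_ge_zero[of "Zint 1 - 1 * ln 1"] by simp
  have ui: "integrable hl (\<lambda>u. u * exp (- u))" "(\<integral>u. u * exp (- u) \<partial>hl) = 1"
  proof -
    have v: "integrable hl (\<lambda>u. u powr 1 * exp (- u))" "(\<integral>u. u powr 1 * exp (- u) \<partial>hl) = Gamma (1 + 1)"
      by (rule powr_exp_hl_value; simp)+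
    show "integrable hl (\<lambda>u. u * exp (- u))"
      by (rule Bochner_Integration.integrable_cong[THEN iffD1, rotated -1, OF v(1)]) auto
    have "(\<integral>u. u * exp (- u) \<partial>hl) = (\<integral>u. u powr 1 * exp (- u) \<partial>hl)"
      by (intro Bochner_Integration.integral_cong refl) auto
    also have "\<dots> = 1" unfolding v(2) using Gamma_fact[of 1, where 'a=real] by simp
    finally show "(\<integral>u. u * exp (- u) \<partial>hl) = 1" .
  qed
  define g where "g = (\<lambda>n u. (Zint (Y n * u) / Y n - u * ln (Y n)) * exp (- u))"
  have gi: "integrable hl (g n)" "(\<integral>u. g n u \<partial>hl) = Zlap (Y n) / Y n - ln (Y n)" for n
  proof -
    have e: "g n u = Zint (Y n * u) * exp (- u) / Y n - ln (Y n) * (u * exp (- u))" for u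
      by (simp add: g_def left_diff_distrib)
    show "integrable hl (g n)" unfolding e[abs_def]
      by (intro Bochner_Integration.integrable_diff integrable_divide integrable_mult_right Zlap_eq(1) Y1 ui)
    have "(\<integral>u. g n u \<partial>hl) = (\<integral>u. Zint (Y n * u) * exp (- u) / Y n \<partial>hl) - (\<integral>u. ln (Y n) * (u * exp (- u)) \<partial>hl)"
      unfolding e by (intro Bochner_Integration.integral_diff integrable_divide integrable_mult_right Zlap_eq(1) Y1 ui)
    thus "(\<integral>u. g n u \<partial>hl) = Zlap (Y n) / Y n - ln (Y n)"
      using Zlap_eq(2)[OF Y1(2)[of n]] ui by simp
  qed
  have "(\<lambda>n. \<integral>u. g n u \<partial>hl) \<longlonglongrightarrow> (\<integral>u. u * ln u * exp (- u) + C * (u * exp (- u)) \<partial>hl)"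
  proof (rule integral_dominated_convergence[where w="\<lambda>u. K * (exp (- u) + u * exp (- u)) + \<bar>u * ln u * exp (- u)\<bar>"])
    show "integrable hl (\<lambda>u. K * (exp (- u) + u * exp (- u)) + \<bar>u * ln u * exp (- u)\<bar>)"
      by (intro Bochner_Integration.integrable_add integrable_mult_right integrable_abs exp_neg_integrable_hl ui integral_x_ln_x_exp)
    show "AE u in hl. (\<lambda>n. g n u) \<longlonglongrightarrow> u * ln u * exp (- u) + C * (u * exp (- u))"
    proof (rule AE_I2)
      fix u assume "u \<in> space hl"
      hence u: "u > 0" by simp
      have "filterlim (\<lambda>n. u * Y n) at_top sequentially"
        by (rule filterlim_tendsto_pos_mult_at_top[OF tendsto_const u Y])
      from filterlim_compose[OF C this]
      have "(\<lambda>n. (u * (Zint (u * Y n) / (u * Y n) - ln (u * Y n)) + u * ln u) * exp (- u)) \<longlonglongrightarrow> (u * C + u * ln u) * exp (- u)"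
        by (intro tendsto_intros)
      moreover have "(u * (Zint (u * Y n) / (u * Y n) - ln (u * Y n)) + u * ln u) * exp (- u) = g n u" for n
        using u Y1[of n] by (simp add: g_def ln_mult right_diff_distrib distrib_left mult.commute[of u])
      ultimately show "(\<lambda>n. g n u) \<longlonglongrightarrow> u * ln u * exp (- u) + C * (u * exp (- u))"
        by (simp add: algebra_simps)
    qed
    show "AE u in hl. norm (g n u) \<le> K * (exp (- u) + u * exp (- u)) + \<bar>u * ln u * exp (- u)\<bar>" for n
    proof (rule AE_I2)
      fix u assume "u \<in> space hl"
      hence u: "u > 0" by simp
      let ?x = "Y n * u"
      have x: "?x > 0" using u Y1[of n] by simp
      have "\<bar>Zint ?x / Y n - u * ln ?x\<bar> = \<bar>Zint ?x - ?x * ln ?x\<bar> / Y n"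
      proof -
        have "Zint ?x / Y n - u * ln ?x = (Zint ?x - ?x * ln ?x) / Y n" using Y1[of n] by (simp add: field_simps)
        thus ?thesis using Y1[of n] by (simp add: abs_divide)
      qed
      also have "\<dots> \<le> K * (1 + ?x) / Y n" using K[OF x] Y1[of n] by (intro divide_right_mono) auto
      also have "\<dots> = K * (1 / Y n + u)" using Y1[of n] by (simp add: field_simps)
      also have "\<dots> \<le> K * (1 + u)" using K0 Y1[of n] by (intro mult_left_mono) auto
      finally have b: "\<bar>Zint ?x / Y n - u * ln ?x\<bar> \<le> K * (1 + u)" .
      have "Zint ?x / Y n - u * ln (Y n) = (Zint ?x / Y n - u * ln ?x) + u * ln u"
        using u Y1[of n] by (simp add: ln_mult algebra_simps)
      hence "\<bar>Zint ?x / Y n - u * ln (Y n)\<bar> \<le> K * (1 + u) + \<bar>u * ln u\<bar>" using b by linarith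
      hence "\<bar>Zint ?x / Y n - u * ln (Y n)\<bar> * exp (- u) \<le> (K * (1 + u) + \<bar>u * ln u\<bar>) * exp (- u)"
        by (rule mult_right_mono) simp
      thus "norm (g n u) \<le> K * (exp (- u) + u * exp (- u)) + \<bar>u * ln u * exp (- u)\<bar>"
        unfolding g_def real_norm_def abs_mult[of _ "exp (- u)"] abs_exp_cancel by (simp only: distrib_left distrib_right mult_1 mult_1_right mult.assoc)
    qed
    show "(\<lambda>u. u * ln u * exp (- u) + C * (u * exp (- u))) \<in> borel_measurable hl"
      by (rule hl_measurable_borel) measurable
    show "g n \<in> borel_measurable hl" for n using gi(1)[of n] by auto
  qed
  also have "(\<integral>u. u * ln u * exp (- u) + C * (u * exp (- u)) \<partial>hl) = (1 - euler_mascheroni) + C"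
  proof -
    have "(\<integral>u. u * ln u * exp (- u) + C * (u * exp (- u)) \<partial>hl) = (\<integral>u. u * ln u * exp (- u) \<partial>hl) + (\<integral>u. C * (u * exp (- u)) \<partial>hl)"
      by (intro Bochner_Integration.integral_add integral_x_ln_x_exp integrable_mult_right ui)
    thus ?thesis by (simp add: integral_x_ln_x_exp ui)
  qed
  finally have "(\<lambda>n. Zlap (X (n + N)) / X (n + N) - ln (X (n + N))) \<longlonglongrightarrow> C + (1 - euler_mascheroni)"
    unfolding gi(2) Y_def by (simp add: add.commute)
  thus "(\<lambda>n. Zlap (X n) / X n - ln (X n)) \<longlonglongrightarrow> C + (1 - euler_mascheroni)" by (rule LIMSEQ_offset)
qed

section \<open>Jacob's ladder\<close>

text \<open>Compares the trivial zero at \<open>-2\<close> with the value at 2. The zeros are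
  therefore isolated, which later makes \<open>Zint\<close> strictly increasing.\<close>

lemma zeta_nonconstant: "\<not> zeta constant_on - {1}"
proof
  assume "zeta constant_on - {1}"
  then obtain c where c: "\<And>s. s \<noteq> 1 \<Longrightarrow> zeta s = c" by (auto simp: constant_on_def)
  have "zeta (1 - 3) = 0"
  proof -
    have "of_real pi * 3 / 2 = complex_of_real (3 / 2 * pi)" by simp
    hence "cos (of_real pi * 3 / 2 :: complex) = of_real (cos (3 / 2 * pi))" by (simp only: cos_of_real)
    also have "\<dots> = 0" by (simp only: cos_3over2_pi of_real_0)
    finally have "cos (of_real pi * 3 / 2 :: complex) = 0" .
    thus ?thesis using zeta_functional_equation[of 3] by simp
  qed
  moreover have "zeta 2 = of_real (pi\<^sup>2 / 6)"
  proof -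
    have "(\<lambda>n. complex_of_real (1 / real ((n + 1)\<^sup>2))) sums of_real (pi\<^sup>2 / 6)"
      using inverse_squares_sums by (rule sums_of_real)
    moreover have "complex_of_real (1 / real ((n + 1)\<^sup>2)) = 1 / of_nat (Suc n) powr 2" for n
    proof -
      have "(of_nat (Suc n) :: complex) powr 2 = of_nat (Suc n) ^ 2"
        using powr_nat'[of "of_nat (Suc n) :: complex" 2] by simp
      thus ?thesis by simp
    qed
    ultimately have "(\<lambda>n. 1 / of_nat (Suc n) powr 2 :: complex) sums of_real (pi\<^sup>2 / 6)" by (simp only:)
    moreover have "(\<lambda>n. 1 / of_nat (Suc n) powr 2 :: complex) sums zeta 2" by (rule zeta_sums) simp
    ultimately show ?thesis by (rule sums_unique2[symmetric])
  qed
  ultimately show False using c[of 2] c[of "1 - 3"] by simp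
qed

lemma Zsq_zeros_finite: "finite {t \<in> {a..b}. Zsq t = 0}"
proof -
  let ?K = "Complex (1/2) ` {a..b}"
  have "finite {z \<in> ?K. zeta z = 0}"
  proof (rule holomorphic_compact_finite_zeros[OF zeta_holomorphic])
    show "open (- {1 :: complex})" by auto
    show "connected (- {1 :: complex})" by (rule connected_minus_1)
    show "compact ?K" by (intro compact_continuous_image continuous_intros) auto
    show "?K \<subseteq> - {1}" by (auto simp: complex_eq_iff)
  qed (rule zeta_nonconstant)
  hence "finite (Im ` {z \<in> ?K. zeta z = 0})" by (rule finite_imageI)
  moreover have "{t \<in> {a..b}. Zsq t = 0} \<subseteq> Im ` {z \<in> ?K. zeta z = 0}"
    by (force simp: Zsq_def image_iff)
  ultimately show ?thesis by (rule finite_subset[rotated])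
qed

lemma integral_pos_of_continuous:
  fixes f :: "real \<Rightarrow> real"
  assumes "a < b" and c: "continuous_on {a..b} f" and n: "\<And>x. x \<in> {a..b} \<Longrightarrow> f x \<ge> 0"
    and x: "x \<in> {a..b}" "f x > 0"
  shows "integral {a..b} f > 0"
proof -
  have "integral {a..b} f \<ge> 0"
    using c n by (intro Henstock_Kurzweil_Integration.integral_nonneg integrable_continuous_real) auto
  moreover have "integral {a..b} f \<noteq> 0"
  proof
    assume z: "integral {a..b} f = 0"
    have "(f has_integral 0) (cbox a b)"
      using integrable_integral[OF integrable_continuous_real[OF c]] z by simp
    hence "f x = 0" using has_integral_0_cbox_imp_0[of a b f x] c n x assms(1) by auto
    thus False using x by simp
  qed
  ultimately show ?thesis by simp
qed

lemma integral_pos_of_zeros_finite: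
  fixes f :: "real \<Rightarrow> real"
  assumes "a < b" and c: "continuous_on {a..b} f" and n: "\<And>x. x \<in> {a..b} \<Longrightarrow> f x \<ge> 0"
    and fin: "finite {x \<in> {a..b}. f x = 0}"
  shows "integral {a..b} f > 0"
proof -
  have "{x \<in> {a..b}. f x = 0} \<noteq> {a..b}" using fin assms(1) infinite_Icc by metis
  then obtain x where "x \<in> {a..b}" "f x \<noteq> 0" by blast
  thus ?thesis using integral_pos_of_continuous[OF assms(1) c n] n[of x] by fastforce
qed

lemma Zint_strict_mono: "0 \<le> a \<Longrightarrow> a < b \<Longrightarrow> Zint a < Zint b"
  using integral_pos_of_zeros_finite[of a b Zsq] Zsq_continuous Zsq_zeros_finite Zint_diff[of a b] by simp

lemma Zint_inj: "0 \<le> a \<Longrightarrow> 0 \<le> b \<Longrightarrow> Zint a = Zint b \<Longrightarrow> a = b"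
  using Zint_strict_mono[of a b] Zint_strict_mono[of b a] by (cases a b rule: linorder_cases) auto

lemma Zint_at_top: "filterlim Zint at_top at_top"
proof -
  obtain C where C: "((\<lambda>T. Zint T / T - ln T) \<longlongrightarrow> C) at_top" using Zint_asymp by blast
  have "filterlim (\<lambda>T. (Zint T / T - ln T) + ln T) at_top at_top"
    by (rule filterlim_tendsto_add_at_top[OF C ln_at_top])
  hence "eventually (\<lambda>T. Zint T / T - ln T + ln T \<ge> 1) at_top" by (simp add: filterlim_at_top)
  hence "eventually (\<lambda>T. T \<le> Zint T) at_top"
    using eventually_gt_at_top[of 0] by eventually_elim (simp add: field_simps)
  thus ?thesis by (rule filterlim_at_top_mono[OF filterlim_ident])
qed

lemma Zint_surj:
  assumes "y > 0"
  obtains U where "U > 0" "Zint U = y"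
proof -
  have "eventually (\<lambda>T. Zint T \<ge> y) at_top" using Zint_at_top by (simp add: filterlim_at_top)
  hence "eventually (\<lambda>T. Zint T \<ge> y \<and> T > 0) at_top" using eventually_gt_at_top[of 0] by (rule eventually_conj)
  then obtain B where B: "Zint B \<ge> y" "B > 0" using eventually_happens'[OF trivial_limit_at_top_linorder] by blast
  have Z0: "Zint 0 = 0" by (simp add: Zint_def)
  have "\<exists>x\<ge>0. x \<le> B \<and> Zint x = y"
    by (rule IVT') (use assms B Z0 Zint_continuous in auto)
  then obtain U where "U \<ge> 0" "Zint U = y" by blast
  moreover from this have "U \<noteq> 0" using assms Z0 by auto
  ultimately show ?thesis using that[of U] by simp
qed

section \<open>The ladder equation and its inverse\<close>

definition ladder_lhs :: "(real \<Rightarrow> real) \<Rightarrow> real \<Rightarrow> real" where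
  "ladder_lhs \<mu> X = integral {0..\<mu> X} (\<lambda>t. Zsq t * exp (- 2 * t / X))"

lemma hl_cut:
  fixes f :: "real \<Rightarrow> real"
  assumes c: "continuous_on UNIV f"
  shows "integrable hl (\<lambda>t. indicator {..m} t * f t)" "(\<integral>t. indicator {..m} t * f t \<partial>hl) = integral {0..m} f"
proof -
  have si: "set_integrable lborel {0..m} f"
    unfolding set_integrable_def by (rule borel_integrable_compact[OF compact_Icc continuous_on_subset[OF c]]) simp
  have e: "(\<lambda>t. indicator {0<..} t *\<^sub>R (indicator {..m} t * f t)) = (\<lambda>t. indicator {0<..m} t *\<^sub>R f t)"
    by (auto simp: indicator_def)
  have si2: "set_integrable lborel {0<..m} f" by (rule set_integrable_subset[OF si]) auto
  show "integrable hl (\<lambda>t. indicator {..m} t * f t)"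
    unfolding hl_integrable_iff set_integrable_def e using si2 unfolding set_integrable_def .
  have "(\<integral>t. indicator {..m} t * f t \<partial>hl) = (LINT t:{0<..m}|lborel. f t)"
    unfolding hl_integral set_lebesgue_integral_def e ..
  also have "\<dots> = integral {0<..m} f" by (rule set_borel_integral_eq_integral(2)[OF si2])
  also have "\<dots> = integral {0..m} f"
    by (rule integral_spike_set) (auto intro: negligible_subset[of "{0}"])
  finally show "(\<integral>t. indicator {..m} t * f t \<partial>hl) = integral {0..m} f" .
qed

lemma ladder_integrand_continuous: "continuous_on A (\<lambda>t. Zsq t * exp (- 2 * t / X))"
  by (cases "X = 0") (auto intro!: continuous_intros Zsq_continuous)

text \<open>Both the range of integration and the weight grow with \<open>X\<close>. The growth of
  the weight is strict for \<open>t > 0\<close> and \<open>Zsq\<close> has finitely many zeros in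
  the range, so the integral grows strictly as soon as the range is nontrivial, which positivity
  guarantees.\<close>

lemma ladder_lhs_strict_mono:
  assumes X: "0 < X" "X < Y" and m: "\<mu> X \<le> \<mu> Y" and pos: "ladder_lhs \<mu> X > 0"
  shows "ladder_lhs \<mu> X < ladder_lhs \<mu> Y"
proof -
  have mp: "\<mu> X > 0"
  proof (rule ccontr)
    assume "\<not> \<mu> X > 0"
    hence "{0..\<mu> X} = {} \<or> {0..\<mu> X} = {0}" by auto
    hence "ladder_lhs \<mu> X = 0" by (auto simp: ladder_lhs_def)
    thus False using pos by simp
  qed
  let ?f = "\<lambda>X t. Zsq t * exp (- 2 * t / X)"
  have ii: "?f Z integrable_on {a..b}" for Z a b
    by (intro integrable_continuous_real ladder_integrand_continuous)
  have ex: "exp (- 2 * t / X) < exp (- 2 * t / Y)" if "t > 0" for t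
    using that X by (simp add: frac_less2)
  have "integral {0..\<mu> X} (\<lambda>t. ?f Y t - ?f X t) > 0"
  proof (rule integral_pos_of_zeros_finite[OF mp])
    show "continuous_on {0..\<mu> X} (\<lambda>t. ?f Y t - ?f X t)" by (intro continuous_on_diff ladder_integrand_continuous)
    show "?f Y t - ?f X t \<ge> 0" if "t \<in> {0..\<mu> X}" for t
      using ex[of t] that by (cases "t = 0") (auto intro!: mult_left_mono)
    have "{t \<in> {0..\<mu> X}. ?f Y t - ?f X t = 0} \<subseteq> insert 0 {t \<in> {0..\<mu> X}. Zsq t = 0}"
    proof
      fix t assume t: "t \<in> {t \<in> {0..\<mu> X}. ?f Y t - ?f X t = 0}"
      hence "Zsq t * (exp (- 2 * t / Y) - exp (- 2 * t / X)) = 0" by (simp add: right_diff_distrib)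
      moreover have "t = 0 \<or> t > 0" using t by auto
      ultimately show "t \<in> insert 0 {t \<in> {0..\<mu> X}. Zsq t = 0}" using ex[of t] t by auto
    qed
    thus "finite {t \<in> {0..\<mu> X}. ?f Y t - ?f X t = 0}"
      by (rule finite_subset) (intro finite.insertI Zsq_zeros_finite)
  qed
  also have "integral {0..\<mu> X} (\<lambda>t. ?f Y t - ?f X t) = integral {0..\<mu> X} (?f Y) - ladder_lhs \<mu> X"
    unfolding ladder_lhs_def by (rule Henstock_Kurzweil_Integration.integral_diff[OF ii ii])
  also have "integral {0..\<mu> X} (?f Y) \<le> ladder_lhs \<mu> Y"
    unfolding ladder_lhs_def by (rule integral_subset_le[OF _ ii ii]) (use m in auto)
  finally show ?thesis by simp
qed

text \<open>At \<open>X = 2 T\<close> the weight is \<open>exp (- t / T)\<close>, that of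
  \<open>Zlap T\<close>. On the part cut off, \<open>t >= 14 T ln (2 T)\<close>, so one half
  \<open>exp (- t / (2 T))\<close> of the weight is at most \<open>(2 T)^(-7)\<close>, and the other
  half leaves \<open>Zlap (2 T)\<close>, of order \<open>T ln T\<close>.\<close>

lemma ladder_lhs_asymp:
  assumes C: "((\<lambda>T. Zint T / T - ln T) \<longlongrightarrow> C) at_top"
    and \<mu>: "\<And>y. y > y0 \<Longrightarrow> \<mu> y \<ge> 7 * y * ln y"
  shows "((\<lambda>T. ladder_lhs \<mu> (2 * T) / T - ln T) \<longlongrightarrow> C + (1 - euler_mascheroni)) at_top"
proof -
  note Z = Zlap_asymp[OF C]
  have bd: "\<bar>Zlap T - ladder_lhs \<mu> (2 * T)\<bar> \<le> (2 * T) powr (-7) * Zlap (2 * T)" if T: "T > 0" "2 * T > y0" for T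
  proof -
    let ?f = "\<lambda>t. Zsq t * exp (- (t / T))"
    let ?g = "\<lambda>t. indicator {..\<mu> (2 * T)} t * (Zsq t * exp (- 2 * t / (2 * T)))"
    have g: "integrable hl ?g" "ladder_lhs \<mu> (2 * T) = (\<integral>t. ?g t \<partial>hl)"
      using hl_cut[OF ladder_integrand_continuous[of UNIV "2 * T"], of "\<mu> (2 * T)"] by (simp_all add: ladder_lhs_def)
    have eq: "- 2 * t / (2 * T) = - (t / T)" for t using T by (simp add: field_simps)
    have le: "norm (?f t - ?g t) \<le> (2 * T) powr (-7) * (Zsq t * exp (- (t / (2 * T))))" for t
    proof (cases "t \<le> \<mu> (2 * T)")
      case True
      thus ?thesis unfolding eq by simp
    next
      case False
      have "7 * (2 * T) * ln (2 * T) \<le> \<mu> (2 * T)" using \<mu>[OF T(2)] .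
      hence "7 * (2 * T) * ln (2 * T) \<le> t" using False by simp
      hence "7 * ln (2 * T) \<le> t / (2 * T)" using T by (simp add: field_simps)
      hence "exp (- (t / (2 * T))) \<le> exp (- 7 * ln (2 * T))" by simp
      also have "\<dots> = (2 * T) powr (-7)" using T by (simp add: powr_def)
      finally have "exp (- (t / (2 * T))) * exp (- (t / (2 * T))) \<le> (2 * T) powr (-7) * exp (- (t / (2 * T)))"
        by (rule mult_right_mono) simp
      moreover have "exp (- (t / (2 * T))) * exp (- (t / (2 * T))) = exp (- (t / T))" using T by (simp flip: exp_add)
      ultimately have "Zsq t * exp (- (t / T)) \<le> Zsq t * ((2 * T) powr (-7) * exp (- (t / (2 * T))))"
        by (intro mult_left_mono) auto
      thus ?thesis using False by (simp add: mult_ac abs_mult)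
    qed
    have fi: "integrable hl ?f" by (rule Zlap_integrable[OF T(1)])
    have hi: "integrable hl (\<lambda>t. (2 * T) powr (-7) * (Zsq t * exp (- (t / (2 * T)))))"
      using T by (intro integrable_mult_right Zlap_integrable) auto
    have "Zlap T - ladder_lhs \<mu> (2 * T) = (\<integral>t. ?f t - ?g t \<partial>hl)"
      unfolding Zlap_def g(2) by (rule Bochner_Integration.integral_diff[OF fi g(1), symmetric])
    hence "\<bar>Zlap T - ladder_lhs \<mu> (2 * T)\<bar> = norm (\<integral>t. ?f t - ?g t \<partial>hl)" by simp
    also have "\<dots> \<le> (\<integral>t. (2 * T) powr (-7) * (Zsq t * exp (- (t / (2 * T)))) \<partial>hl)"
    proof (rule order_trans[OF integral_norm_bound Bochner_Integration.integral_mono])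
      show "integrable hl (\<lambda>t. norm (?f t - ?g t))" by (rule integrable_norm[OF Bochner_Integration.integrable_diff[OF fi g(1)]])
      show "integrable hl (\<lambda>t. (2 * T) powr (-7) * (Zsq t * exp (- (t / (2 * T)))))" by (rule hi)
      show "norm (?f t - ?g t) \<le> (2 * T) powr (-7) * (Zsq t * exp (- (t / (2 * T))))" for t by (rule le)
    qed
    also have "\<dots> = (2 * T) powr (-7) * Zlap (2 * T)" unfolding Zlap_def by simp
    finally show ?thesis .
  qed
  have "((\<lambda>T. Zlap T / T - ladder_lhs \<mu> (2 * T) / T) \<longlongrightarrow> 0) at_top"
  proof (rule Lim_null_comparison)
    let ?b = "\<lambda>T. (Zlap (2 * T) / (2 * T) - ln (2 * T)) * (2 * (2 * T) powr (-7)) + 2 * (2 * T) powr (-7) * ln (2 * T)"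
    show "\<forall>\<^sub>F T in at_top. norm (Zlap T / T - ladder_lhs \<mu> (2 * T) / T) \<le> ?b T"
      using eventually_gt_at_top[of 0] eventually_gt_at_top[of "y0 / 2"]
    proof eventually_elim
      case (elim T)
      have "norm (Zlap T / T - ladder_lhs \<mu> (2 * T) / T) = \<bar>Zlap T - ladder_lhs \<mu> (2 * T)\<bar> / T"
        using elim by (simp add: abs_divide flip: diff_divide_distrib)
      also have "\<dots> \<le> (2 * T) powr (-7) * Zlap (2 * T) / T" using bd[of T] elim by (intro divide_right_mono) auto
      also have "\<dots> = ?b T" using elim by (simp add: algebra_simps)
      finally show ?case .
    qed
    have l: "filterlim (\<lambda>T::real. 2 * T) at_top at_top" by real_asymp
    have a: "((\<lambda>T::real. 2 * (2 * T) powr (-7)) \<longlongrightarrow> 0) at_top" by real_asymp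
    have b: "((\<lambda>T::real. 2 * (2 * T) powr (-7) * ln (2 * T)) \<longlongrightarrow> 0) at_top" by real_asymp
    show "(?b \<longlongrightarrow> 0) at_top"
      using tendsto_add[OF tendsto_mult[OF filterlim_compose[OF Z l] a] b] by simp
  qed
  from tendsto_diff[OF Z this] show ?thesis by simp
qed

lemma ladder_inverse:
  assumes y0: "y0 \<ge> 0" and adm: "admissible y0 \<mu>"
  shows "\<forall>\<^sub>F T in at_top. ladder_phi1_inv y0 \<mu> T > 0 \<and> Zint (ladder_phi1_inv y0 \<mu> T) = ladder_lhs \<mu> (2 * T)"
proof -
  obtain C where C: "((\<lambda>T. Zint T / T - ln T) \<longlongrightarrow> C) at_top" using Zint_asymp by blast
  have mono: "mono_on {y0<..} \<mu>" and mu: "\<And>y. y > y0 \<Longrightarrow> \<mu> y \<ge> 7 * y * ln y"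
    using adm by (auto simp: admissible_def)
  have phi: "ladder_phi y0 \<mu> U = (THE X. X > y0 \<and> ladder_lhs \<mu> X = Zint U)" for U
    unfolding ladder_phi_def ladder_lhs_def Zint_def hardy_Z_square Zsq_def[symmetric] ..
  have uniq: "X = Y" if "X > y0" "Y > y0" "ladder_lhs \<mu> X = ladder_lhs \<mu> Y" "ladder_lhs \<mu> X > 0" for X Y
  proof -
    have "\<not> X < Y" using ladder_lhs_strict_mono[of X Y \<mu>] mono_onD[OF mono, of X Y] that y0 by auto
    moreover have "\<not> Y < X" using ladder_lhs_strict_mono[of Y X \<mu>] mono_onD[OF mono, of Y X] that y0 by auto
    ultimately show ?thesis by simp
  qed
  \<comment> \<open>The value that the description in \<open>ladder_phi\<close> takes when the
    equation has no solution. For \<open>T > junk / 2\<close> no such argument can be mapped to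
    \<open>T\<close>.\<close>
  define junk where "junk = (THE X :: real. False)"
  have "filterlim (\<lambda>T. (ladder_lhs \<mu> (2 * T) / T - ln T) + ln T) at_top at_top"
    by (rule filterlim_tendsto_add_at_top[OF ladder_lhs_asymp[OF C mu] ln_at_top])
  hence "\<forall>\<^sub>F T in at_top. ladder_lhs \<mu> (2 * T) / T - ln T + ln T \<ge> 1" by (simp add: filterlim_at_top)
  thus ?thesis
    using eventually_gt_at_top[of 0] eventually_gt_at_top[of "y0 / 2"] eventually_gt_at_top[of "junk / 2"]
  proof eventually_elim
    case (elim T)
    have Fpos: "ladder_lhs \<mu> (2 * T) > 0" using elim by (simp add: field_simps)
    obtain U where U: "U > 0" "Zint U = ladder_lhs \<mu> (2 * T)" using Zint_surj[OF Fpos] by blast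
    have sol: "ladder_phi y0 \<mu> V = X" if "X > y0" "ladder_lhs \<mu> X = Zint V" "V > 0" for V X
      unfolding phi
    proof (rule the_equality)
      have "Zint V > 0" using Zint_strict_mono[of 0 V] that by (simp add: Zint_def)
      thus "Y = X" if "y0 < Y \<and> ladder_lhs \<mu> Y = Zint V" for Y
        using uniq[of Y X] that \<open>X > y0\<close> \<open>ladder_lhs \<mu> X = Zint V\<close> by auto
    qed (use that in auto)
    have "ladder_phi1_inv y0 \<mu> T = U"
      unfolding ladder_phi1_inv_def
    proof (rule the_equality)
      have "ladder_phi y0 \<mu> U = 2 * T" using elim U by (intro sol) auto
      thus "U > 0 \<and> ladder_phi1 y0 \<mu> U = T" using U by (simp add: ladder_phi1_def)
      fix V assume V: "V > 0 \<and> ladder_phi1 y0 \<mu> V = T"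
      hence pV: "ladder_phi y0 \<mu> V = 2 * T" by (simp add: ladder_phi1_def)
      show "V = U"
      proof (cases "\<exists>X. X > y0 \<and> ladder_lhs \<mu> X = Zint V")
        case True
        then obtain X where X: "X > y0" "ladder_lhs \<mu> X = Zint V" by blast
        hence "X = 2 * T" using sol[OF X] V pV by simp
        hence "Zint V = Zint U" using X U by simp
        thus ?thesis using V U Zint_inj[of V U] by simp
      next
        case False
        hence "(\<lambda>X. X > y0 \<and> ladder_lhs \<mu> X = Zint V) = (\<lambda>X. False)" by auto
        hence "ladder_phi y0 \<mu> V = junk" unfolding phi junk_def by (simp only:)
        thus ?thesis using pV elim by simp
      qed
    qed
    thus ?case using U by simp
  qed
qed

lemma ladder_mean_value:
  assumes y0: "y0 \<ge> 0" and adm: "admissible y0 \<mu>"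
  shows "((\<lambda>T. (Zint (ladder_phi1_inv y0 \<mu> T) - Zint T) / T) \<longlongrightarrow> 1 - euler_mascheroni) at_top"
proof -
  obtain C where C: "((\<lambda>T. Zint T / T - ln T) \<longlongrightarrow> C) at_top" using Zint_asymp by blast
  have mu: "\<And>y. y > y0 \<Longrightarrow> \<mu> y \<ge> 7 * y * ln y" using adm by (auto simp: admissible_def)
  have "((\<lambda>T. (ladder_lhs \<mu> (2 * T) / T - ln T) - (Zint T / T - ln T)) \<longlongrightarrow> C + (1 - euler_mascheroni) - C) at_top"
    by (intro tendsto_diff ladder_lhs_asymp[OF C mu] C)
  hence "((\<lambda>T. (ladder_lhs \<mu> (2 * T) - Zint T) / T) \<longlongrightarrow> 1 - euler_mascheroni) at_top"
    by (simp add: diff_divide_distrib)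
  moreover have "\<forall>\<^sub>F T in at_top. (ladder_lhs \<mu> (2 * T) - Zint T) / T = (Zint (ladder_phi1_inv y0 \<mu> T) - Zint T) / T"
    using ladder_inverse[OF assms] by eventually_elim simp
  ultimately show ?thesis by (rule Lim_transform_eventually)
qed

lemma Zint_window:
  "((\<lambda>T. (Zint (T + h) - Zint T) / T) \<longlongrightarrow> 0) at_top"
proof -
  obtain C where C: "((\<lambda>T. Zint T / T - ln T) \<longlongrightarrow> C) at_top" using Zint_asymp by blast
  have l: "filterlim (\<lambda>T::real. T + h) at_top at_top" by real_asymp
  have a: "((\<lambda>T. (T + h) / T) \<longlongrightarrow> 1) at_top" by real_asymp
  have b: "((\<lambda>T. (T + h) / T * ln (T + h) - ln T) \<longlongrightarrow> 0) at_top" by real_asymp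
  have "((\<lambda>T. (Zint (T + h) / (T + h) - ln (T + h)) * ((T + h) / T) + ((T + h) / T * ln (T + h) - ln T) - (Zint T / T - ln T)) \<longlongrightarrow> C * 1 + 0 - C) at_top"
    by (intro tendsto_diff[OF tendsto_add[OF tendsto_mult[OF filterlim_compose[OF C l] a] b] C])
  moreover have "\<forall>\<^sub>F T in at_top. (Zint (T + h) / (T + h) - ln (T + h)) * ((T + h) / T) + ((T + h) / T * ln (T + h) - ln T) - (Zint T / T - ln T) = (Zint (T + h) - Zint T) / T"
    using eventually_gt_at_top[of 0] eventually_gt_at_top[of "- h"]
    by eventually_elim (simp add: left_diff_distrib diff_divide_distrib)
  ultimately show ?thesis using Lim_transform_eventually by fastforce
qed

section \<open>Nonvanishing of zeta off the critical strip\<close>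

lemma zeta_abs_summable:
  assumes "Re s > 1"
  shows "summable (\<lambda>n. norm (of_nat n powr (- s) :: complex))"
proof -
  have "norm (of_nat n powr (- s) :: complex) = real n powr (- Re s)" for n
    by (simp add: norm_powr_real_powr)
  thus ?thesis using assms by (simp add: summable_real_powr_iff)
qed

lemma zeta_powr_sums:
  assumes "Re s > 1"
  shows "(\<lambda>n. of_nat n powr (- s)) sums zeta s"
proof -
  have "(\<lambda>n. of_nat (Suc n) powr (- s)) sums zeta s"
    using zeta_sums[OF assms] by (simp add: powr_minus field_simps del: of_nat_Suc)
  thus ?thesis by (subst (asm) sums_Suc_iff) simp
qed

text \<open>The sieve of Eratosthenes, one prime at a time: the multiples of \<open>p\<close> in the
  set sieved by the other primes are \<open>p\<close> times that set, so removing them multiplies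
  the sum by \<open>1 - p powr (- s)\<close>. The index 0 contributes nothing because
  \<open>0 powr w = 0\<close>.\<close>

lemma zeta_sieve:
  fixes P :: "nat set"
  assumes s: "Re s > 1" and P: "finite P" "\<And>p. p \<in> P \<Longrightarrow> prime p"
  shows "(\<Sum>\<^sub>\<infinity>n\<in>{n. \<forall>p\<in>P. \<not> p dvd n}. of_nat n powr (- s)) = zeta s * (\<Prod>p\<in>P. 1 - of_nat p powr (- s))"
  using P
proof (induction P rule: finite_induct)
  case empty
  have "((\<lambda>n. of_nat n powr (- s)) has_sum zeta s) UNIV"
    by (rule norm_summable_imp_has_sum[OF zeta_abs_summable[OF s] zeta_powr_sums[OF s]])
  thus ?case by (simp add: infsumI)
next
  case (insert p P)
  let ?f = "\<lambda>n. of_nat n powr (- s) :: complex"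
  let ?A = "{n. \<forall>q\<in>P. \<not> q dvd n}"
  have p: "prime p" using insert.prems by simp
  have sm: "?f summable_on X" for X
    by (rule summable_on_subset_banach[OF norm_summable_imp_summable_on[OF zeta_abs_summable[OF s]]]) simp
  have ndvd: "\<not> q dvd p" if "q \<in> P" for q
    using that insert.hyps insert.prems p primes_dvd_imp_eq[of q p] by auto
  have split: "?A = {n. \<forall>q\<in>insert p P. \<not> q dvd n} \<union> (\<lambda>n. p * n) ` ?A"
  proof (intro equalityI subsetI)
    fix n assume n: "n \<in> ?A"
    show "n \<in> {n. \<forall>q\<in>insert p P. \<not> q dvd n} \<union> (\<lambda>n. p * n) ` ?A"
    proof (cases "p dvd n")
      case True
      then obtain m where m: "n = p * m" by auto
      hence "m \<in> ?A" using n by auto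
      thus ?thesis using m by auto
    qed (use n in auto)
  next
    fix n assume "n \<in> {n. \<forall>q\<in>insert p P. \<not> q dvd n} \<union> (\<lambda>n. p * n) ` ?A"
    thus "n \<in> ?A"
    proof
      assume "n \<in> (\<lambda>n. p * n) ` ?A"
      then obtain m where m: "m \<in> ?A" "n = p * m" by auto
      have "\<not> q dvd p * m" if "q \<in> P" for q
        using ndvd[OF that] m(1) that insert.prems[of q] by (auto simp: prime_dvd_mult_iff)
      thus ?thesis using m by auto
    qed auto
  qed
  have "infsum ?f ?A = infsum ?f ({n. \<forall>q\<in>insert p P. \<not> q dvd n} \<union> (\<lambda>n. p * n) ` ?A)"
    using split by (rule arg_cong)
  also have "\<dots> = infsum ?f {n. \<forall>q\<in>insert p P. \<not> q dvd n} + infsum ?f ((\<lambda>n. p * n) ` ?A)"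
    by (rule infsum_Un_disjoint[OF sm sm]) auto
  also have "infsum ?f ((\<lambda>n. p * n) ` ?A) = infsum (\<lambda>n. ?f (p * n)) ?A"
    using p prime_gt_0_nat[OF p] by (subst infsum_reindex) (auto simp: inj_on_def o_def)
  also have "\<dots> = infsum (\<lambda>n. ?f p * ?f n) ?A"
    by (rule infsum_cong) (simp add: powr_times_real)
  also have "\<dots> = ?f p * infsum ?f ?A" by (rule infsum_cmult_right')
  finally have "infsum ?f {n. \<forall>q\<in>insert p P. \<not> q dvd n} = infsum ?f ?A * (1 - ?f p)" by (simp add: algebra_simps)
  also have "infsum ?f ?A = zeta s * (\<Prod>p\<in>P. 1 - ?f p)" using insert by auto
  finally show ?case using insert.hyps by (simp add: mult_ac)
qed

text \<open>The sieved sums tend to their term at \<open>n = 1\<close> by Tannery's theorem. With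
  \<open>zeta s\<close> kept as a factor, the limit 1 shows directly that \<open>zeta s\<close> is
  not 0.\<close>

lemma zeta_Euler_product:
  assumes s: "Re s > 1"
  shows "(\<lambda>N. zeta s * (\<Prod>p\<in>{p. prime p \<and> p \<le> N}. 1 - of_nat p powr (- s))) \<longlonglongrightarrow> 1"
proof -
  define f where "f = (\<lambda>n. of_nat n powr (- s) :: complex)"
  define A where "A = (\<lambda>N :: nat. {n. \<forall>p\<in>{p. prime p \<and> p \<le> N}. \<not> p dvd n})"
  define h where "h = (\<lambda>n N. if n \<in> A N then f n else 0)"
  have S: "zeta s * (\<Prod>p\<in>{p. prime p \<and> p \<le> N}. 1 - of_nat p powr (- s)) = (\<Sum>n. h n N)" for N
  proof -
    have sm: "summable (\<lambda>n. norm (h n N))"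
      by (rule summable_comparison_test'[OF zeta_abs_summable[OF s]]) (auto simp: h_def f_def)
    have "((\<lambda>n. h n N) has_sum (\<Sum>n. h n N)) UNIV"
      by (rule norm_summable_imp_has_sum[OF sm summable_sums[OF summable_norm_cancel[OF sm]]])
    hence "(\<Sum>n. h n N) = infsum (\<lambda>n. h n N) UNIV" by (simp add: infsumI)
    also have "\<dots> = infsum f (A N)" by (rule infsum_cong_neutral) (auto simp: h_def)
    also have "\<dots> = zeta s * (\<Prod>p\<in>{p. prime p \<and> p \<le> N}. 1 - of_nat p powr (- s))"
      unfolding A_def f_def by (rule zeta_sieve[OF s]) auto
    finally show ?thesis by simp
  qed
  have "(\<lambda>N. \<Sum>n. h n N) \<longlonglongrightarrow> (\<Sum>n. if n = 1 then 1 else 0)"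
  proof (rule tannerys_theorem[THEN conjunct2, THEN conjunct2])
    show "\<forall>\<^sub>F (k, n) in at_top \<times>\<^sub>F sequentially. norm (h k n) \<le> norm (f k)"
      by (intro always_eventually) (auto simp: h_def)
    show "summable (\<lambda>k. norm (f k))" unfolding f_def by (rule zeta_abs_summable[OF s])
    fix k
    show "(\<lambda>n. h k n) \<longlonglongrightarrow> (if k = 1 then 1 else 0)"
    proof (cases "k \<le> 1")
      case True
      \<comment> \<open>The index 0 survives the sieve as long as there are no primes up to
        \<open>N\<close>, but its term is 0.\<close>
      hence "k = 0 \<or> k = 1" by linarith
      hence "h k n = (if k = 1 then 1 else 0)" for n by (auto simp: h_def f_def A_def)
      thus ?thesis by simp
    next
      case False
      then obtain p where p: "prime p" "p dvd k" using prime_factor_nat[of k] by auto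
      have "eventually (\<lambda>n. h k n = 0) sequentially"
        using eventually_ge_at_top[of p] by eventually_elim (use p in \<open>auto simp: h_def A_def\<close>)
      thus ?thesis using False by (simp add: tendsto_eventually)
    qed
  qed simp
  moreover have "(\<Sum>n::nat. if n = 1 then 1 else 0 :: complex) = 1"
    using sums_single[of 1 "\<lambda>_. 1 :: complex"] by (simp add: sums_iff)
  ultimately show ?thesis by (simp add: S)
qed

lemma zeta_nonzero_Re_gt_1: "Re s > 1 \<Longrightarrow> zeta s \<noteq> 0"
  using zeta_Euler_product[of s] by (auto simp: LIMSEQ_const_iff)

text \<open>The reason is \<open>3 + 4 cos \<alpha> + cos 2\<alpha> \<ge> 0\<close>, applied to each term of the logarithmic series.\<close>

lemma three_four_one:
  fixes w :: complex and r :: real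
  assumes r: "0 \<le> r" "r < 1" and w: "norm w = 1"
  shows "norm ((1 - of_real r) ^ 3 * (1 - of_real r * w) ^ 4 * (1 - of_real r * w\<^sup>2)) \<le> 1"
proof -
  have log: "(\<lambda>n. - (of_real r ^ n * v ^ n) / of_nat n) sums ln (1 - of_real r * v)" if "norm v = 1" for v :: complex
    using Ln_series'[of "- (of_real r * v)"] r that by (simp add: norm_mult power_mult_distrib)
  define L where "L = 3 * ln (1 - of_real r) + 4 * ln (1 - of_real r * w) + ln (1 - of_real r * w\<^sup>2)"
  let ?t = "\<lambda>v n. - (of_real r ^ n * v ^ n) / of_nat n :: complex"
  have "(\<lambda>n. 3 * ?t 1 n + 4 * ?t w n + ?t (w\<^sup>2) n) sums L"
    unfolding L_def using log[of 1] log[of w] log[of "w\<^sup>2"] w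
    by (intro sums_add sums_mult) (auto simp: norm_power)
  hence "(\<lambda>n. Re (3 * ?t 1 n + 4 * ?t w n + ?t (w\<^sup>2) n)) sums Re L" by (rule sums_Re)
  moreover have "Re (3 * ?t 1 n + 4 * ?t w n + ?t (w\<^sup>2) n) \<le> 0" for n
  proof -
    define c where "c = w ^ n"
    have "norm c = 1" using w by (simp add: c_def norm_power)
    hence "(Re c)\<^sup>2 + (Im c)\<^sup>2 = 1" by (metis cmod_power2 one_power2)
    hence "3 + 4 * Re c + Re (c\<^sup>2) = 2 * (1 + Re c)\<^sup>2" by (simp add: power2_eq_square algebra_simps)
    hence nn: "3 + 4 * Re c + Re (c\<^sup>2) \<ge> 0" by simp
    have "3 * ?t 1 n + 4 * ?t w n + ?t (w\<^sup>2) n = of_real (- (r ^ n / real n)) * (3 + 4 * c + c\<^sup>2)"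
      by (simp add: c_def power_commutes flip: power_mult) (simp add: algebra_simps add_divide_distrib mult.commute)
    hence "Re (3 * ?t 1 n + 4 * ?t w n + ?t (w\<^sup>2) n) = - (r ^ n / real n) * (3 + 4 * Re c + Re (c\<^sup>2))" by simp
    also have "\<dots> \<le> 0" using nn r by (intro mult_nonpos_nonneg) auto
    finally show ?thesis .
  qed
  ultimately have "Re L \<le> 0" by (rule sums_le[OF _ _ sums_zero, rotated 1])
  have nz: "1 - of_real r * v \<noteq> 0" if "norm v = 1" for v :: complex
  proof
    assume "1 - of_real r * v = 0"
    hence "norm (of_real r * v) = 1" by simp
    thus False using that r by (simp add: norm_mult)
  qed
  have "exp L = (1 - of_real r) ^ 3 * (1 - of_real r * w) ^ 4 * (1 - of_real r * w\<^sup>2)"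
    using nz[of 1] nz[of w] nz[of "w\<^sup>2"] w exp_of_nat_mult[of 3 "ln (1 - of_real r :: complex)"] exp_of_nat_mult[of 4 "ln (1 - of_real r * w)"]
    by (simp add: L_def exp_add norm_power)
  thus ?thesis using \<open>Re L \<le> 0\<close> by (metis norm_exp_eq_Re exp_le_one_iff)
qed

text \<open>By \<open>three_four_one\<close> the sieving product \<open>F N\<close> never exceeds 1
  in norm, while its product with \<open>D\<close> tends to 1; so \<open>D\<close> has norm at least
  1.\<close>

lemma zeta_three_four_one:
  assumes \<sigma>: "\<sigma> > 1"
  shows "norm (zeta (of_real \<sigma>) ^ 3 * zeta (Complex \<sigma> t) ^ 4 * zeta (Complex \<sigma> (2 * t))) \<ge> 1"
proof -
  define D where "D = zeta (of_real \<sigma>) ^ 3 * zeta (Complex \<sigma> t) ^ 4 * zeta (Complex \<sigma> (2 * t))"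
  define E where "E = (\<lambda>s N. \<Prod>p\<in>{p::nat. prime p \<and> p \<le> N}. 1 - of_nat p powr (- s) :: complex)"
  define F where "F = (\<lambda>N. E (of_real \<sigma>) N ^ 3 * E (Complex \<sigma> t) N ^ 4 * E (Complex \<sigma> (2 * t)) N)"
  have "(\<lambda>N. (zeta (of_real \<sigma>) * E (of_real \<sigma>) N) ^ 3 * (zeta (Complex \<sigma> t) * E (Complex \<sigma> t) N) ^ 4 *
           (zeta (Complex \<sigma> (2 * t)) * E (Complex \<sigma> (2 * t)) N)) \<longlonglongrightarrow> 1 ^ 3 * 1 ^ 4 * 1"
    unfolding E_def using \<sigma> by (intro tendsto_mult tendsto_power zeta_Euler_product) auto
  hence lim: "(\<lambda>N. D * F N) \<longlonglongrightarrow> 1" by (simp add: D_def F_def power_mult_distrib mult_ac)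
  have factor: "norm ((1 - of_nat p powr (- of_real \<sigma>)) ^ 3 *
        (1 - of_nat p powr (- Complex \<sigma> t)) ^ 4 * (1 - of_nat p powr (- Complex \<sigma> (2 * t)))) \<le> 1" if p: "p > 1" for p :: nat
  proof -
      define r where "r = real p powr (- \<sigma>)"
      define w where "w = exp (- \<i> * of_real (t * ln p))"
      have r: "0 \<le> r" "r < 1" using p \<sigma> by (auto simp: r_def powr_less_one)
      have w: "norm w = 1" by (simp add: w_def)
      have a: "of_nat p powr (- Complex \<sigma> u) = of_real r * exp (- \<i> * of_real (u * ln p))" for u
      proof -
        have "of_nat p powr (- Complex \<sigma> u) = exp (- Complex \<sigma> u * of_real (ln p))"
        proof -
          have "ln (of_nat p :: complex) = of_real (ln (real p))" using p Ln_of_real[of "real p"] by simp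
          thus ?thesis using p by (simp add: powr_def)
        qed
        also have "- Complex \<sigma> u * of_real (ln p) = of_real (- \<sigma> * ln p) + - \<i> * of_real (u * ln p)"
          by (simp add: complex_eq_iff)
        also have "exp \<dots> = of_real (exp (- \<sigma> * ln p)) * exp (- \<i> * of_real (u * ln p))"
          by (simp only: exp_add exp_of_real)
        also have "exp (- \<sigma> * ln p) = r" using p by (simp add: r_def powr_def)
        finally show ?thesis .
      qed
      have "of_nat p powr (- of_real \<sigma>) = (of_real r :: complex)"
        using a[of 0] by (simp flip: complex_of_real_def)
      moreover have "of_nat p powr (- Complex \<sigma> t) = of_real r * w" by (simp only: a w_def)
      moreover have "of_nat p powr (- Complex \<sigma> (2 * t)) = of_real r * w\<^sup>2"
        by (simp only: a w_def exp_double[symmetric]) (simp add: mult_ac)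
      ultimately show ?thesis
        using three_four_one[OF r w] by simp
  qed
  have F: "norm (F N) \<le> 1" for N
  proof -
    have eq: "F N = (\<Prod>p\<in>{p::nat. prime p \<and> p \<le> N}. (1 - of_nat p powr (- of_real \<sigma>)) ^ 3 *
        (1 - of_nat p powr (- Complex \<sigma> t)) ^ 4 * (1 - of_nat p powr (- Complex \<sigma> (2 * t))))"
      by (simp add: F_def E_def prod.distrib prod_power_distrib)
    have "norm (F N) = (\<Prod>p\<in>{p::nat. prime p \<and> p \<le> N}. norm ((1 - of_nat p powr (- of_real \<sigma>)) ^ 3 *
        (1 - of_nat p powr (- Complex \<sigma> t)) ^ 4 * (1 - of_nat p powr (- Complex \<sigma> (2 * t)))))"
      by (simp only: eq prod_norm)
    also have "\<dots> \<le> 1"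
    proof (rule prod_le_1)
      fix p :: nat assume "p \<in> {p. prime p \<and> p \<le> N}"
      hence "p > 1" using prime_gt_1_nat by blast
      from conjI[OF norm_ge_zero factor[OF this]]
      show "0 \<le> norm ((1 - of_nat p powr (- of_real \<sigma>)) ^ 3 * (1 - of_nat p powr (- Complex \<sigma> t)) ^ 4 * (1 - of_nat p powr (- Complex \<sigma> (2 * t)))) \<and>
         norm ((1 - of_nat p powr (- of_real \<sigma>)) ^ 3 * (1 - of_nat p powr (- Complex \<sigma> t)) ^ 4 * (1 - of_nat p powr (- Complex \<sigma> (2 * t)))) \<le> 1" .
    qed
    finally show ?thesis .
  qed
  have "norm (D * F N) \<le> norm D" for N using F[of N] by (simp add: norm_mult mult_left_le)
  hence "norm (1 :: complex) \<le> norm D"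
    by (intro tendsto_upperbound[OF tendsto_norm[OF lim]]) auto
  thus ?thesis by (simp add: D_def)
qed

text \<open>Let \<open>\<sigma>\<close> tend to 1 from the right. A zero at \<open>1 + i t\<close>
  would contribute four factors \<open>\<sigma> - 1\<close>, the pole at 1 takes away only three,
  and \<open>zeta\<close> is finite at \<open>1 + 2 i t\<close>. The product would tend to 0,
  against the lower bound 1.\<close>

lemma zeta_nonzero_Re_eq_1:
  assumes t: "t \<noteq> 0"
  shows "zeta (Complex 1 t) \<noteq> 0"
proof
  assume z: "zeta (Complex 1 t) = 0"
  define a where "a = Complex 1 t"
  have hol: "zeta field_differentiable at u" if "u \<noteq> 1" for u
    using zeta_holomorphic that by (intro holomorphic_on_imp_differentiable_at[of _ "- {1}"]) auto
  have "a \<noteq> 1" using t by (simp add: a_def complex_eq_iff)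
  then obtain d where d: "(zeta has_field_derivative d) (at a)" using hol by (auto simp: field_differentiable_def)
  have sh: "filterlim (\<lambda>\<sigma>. Complex \<sigma> u) (at (Complex 1 u)) (at_right 1)" for u
  proof (rule filterlim_atI)
    have "((\<lambda>\<sigma>. Complex \<sigma> u) \<longlongrightarrow> Complex 1 u) (at_right 1)" by (intro tendsto_intros)
    thus "((\<lambda>\<sigma>. Complex \<sigma> u) \<longlongrightarrow> Complex 1 u) (at_right 1)" .
    show "\<forall>\<^sub>F \<sigma> in at_right 1. Complex \<sigma> u \<noteq> Complex 1 u"
      using eventually_at_right_less[of 1] by eventually_elim auto
  qed
  have l2: "((\<lambda>\<sigma>. zeta (Complex \<sigma> t) / (of_real \<sigma> - 1)) \<longlongrightarrow> d) (at_right 1)"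
  proof -
    have "((\<lambda>y. (zeta y - zeta a) / (y - a)) \<longlongrightarrow> d) (at a)" using d by (simp add: has_field_derivative_iff)
    from filterlim_compose[OF this sh[of t, folded a_def]]
    have "((\<lambda>\<sigma>. (zeta (Complex \<sigma> t) - zeta a) / (Complex \<sigma> t - a)) \<longlongrightarrow> d) (at_right 1)" .
    moreover have "Complex \<sigma> t - a = of_real \<sigma> - 1" for \<sigma> by (simp add: a_def complex_eq_iff)
    ultimately show ?thesis using z by (simp add: a_def)
  qed
  have l1: "((\<lambda>\<sigma>. (of_real \<sigma> - 1) * zeta (of_real \<sigma>)) \<longlongrightarrow> zeta_reg 1) (at_right 1)"
  proof (rule Lim_transform_eventually)
    have "isCont zeta_reg 1"
      using zeta_reg_holomorphic
      by (intro holomorphic_on_imp_continuous_on[THEN continuous_on_interior] holomorphic_on_imp_continuous_on)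
         (auto simp: interior_open open_halfspace_Re_gt intro: holomorphic_on_imp_continuous_on)
    moreover have "((\<lambda>\<sigma>. complex_of_real \<sigma>) \<longlongrightarrow> of_real 1) (at_right 1)" by (intro tendsto_intros)
    ultimately show "((\<lambda>\<sigma>. zeta_reg (of_real \<sigma>)) \<longlongrightarrow> zeta_reg 1) (at_right 1)"
      using isCont_tendsto_compose[of 1 zeta_reg] by simp
    show "\<forall>\<^sub>F \<sigma> in at_right 1. zeta_reg (of_real \<sigma>) = (of_real \<sigma> - 1) * zeta (of_real \<sigma>)"
      using eventually_at_right_less[of 1] by eventually_elim (auto simp: zeta_reg_eq)
  qed
  have l3: "((\<lambda>\<sigma>. zeta (Complex \<sigma> (2 * t))) \<longlongrightarrow> zeta (Complex 1 (2 * t))) (at_right 1)"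
  proof -
    have "isCont zeta (Complex 1 (2 * t))"
      using hol[of "Complex 1 (2 * t)"] t by (auto simp: complex_eq_iff intro: field_differentiable_imp_continuous_at)
    hence "(zeta \<longlongrightarrow> zeta (Complex 1 (2 * t))) (at (Complex 1 (2 * t)))" by (simp add: isCont_def)
    from filterlim_compose[OF this sh] show ?thesis .
  qed
  have l4: "((\<lambda>\<sigma>. complex_of_real \<sigma> - 1) \<longlongrightarrow> of_real 1 - 1) (at_right 1)" by (intro tendsto_intros)
  let ?G = "\<lambda>\<sigma>. zeta (of_real \<sigma>) ^ 3 * zeta (Complex \<sigma> t) ^ 4 * zeta (Complex \<sigma> (2 * t))"
  have "((\<lambda>\<sigma>. ((of_real \<sigma> - 1) * zeta (of_real \<sigma>)) ^ 3 * (zeta (Complex \<sigma> t) / (of_real \<sigma> - 1)) ^ 4 *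
      zeta (Complex \<sigma> (2 * t)) * (of_real \<sigma> - 1)) \<longlongrightarrow> zeta_reg 1 ^ 3 * d ^ 4 * zeta (Complex 1 (2 * t)) * (of_real 1 - 1)) (at_right 1)"
    by (intro tendsto_mult tendsto_power l1 l2 l3 l4)
  moreover have "\<forall>\<^sub>F \<sigma> in at_right 1. ((of_real \<sigma> - 1) * zeta (of_real \<sigma>)) ^ 3 * (zeta (Complex \<sigma> t) / (of_real \<sigma> - 1)) ^ 4 *
      zeta (Complex \<sigma> (2 * t)) * (of_real \<sigma> - 1) = ?G \<sigma>"
    using eventually_at_right_less[of 1]
  proof eventually_elim
    case (elim \<sigma>)
    hence "complex_of_real \<sigma> - 1 \<noteq> 0" by simp
    moreover have "(u * A) ^ 3 * (B / u) ^ 4 * C * u = A ^ 3 * B ^ 4 * C" if "u \<noteq> 0" for u A B C :: complex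
      using that by (simp add: field_simps eval_nat_numeral)
    ultimately show ?case by blast
  qed
  ultimately have "(?G \<longlongrightarrow> zeta_reg 1 ^ 3 * d ^ 4 * zeta (Complex 1 (2 * t)) * (of_real 1 - 1)) (at_right 1)"
    by (rule Lim_transform_eventually)
  hence "(?G \<longlongrightarrow> 0) (at_right 1)" by simp
  hence "((\<lambda>\<sigma>. norm (?G \<sigma>)) \<longlongrightarrow> 0) (at_right 1)" by (rule tendsto_norm_zero)
  hence "\<forall>\<^sub>F \<sigma> in at_right 1. norm (?G \<sigma>) < 1" by (rule order_tendstoD) simp
  hence "\<forall>\<^sub>F \<sigma> in at_right (1::real). False"
    using eventually_at_right_less[of 1] by eventually_elim (use zeta_three_four_one[of _ t] in force)
  thus False by simp
qed

lemma zeta_nonzero_Re_ge_1: "Re s \<ge> 1 \<Longrightarrow> Im s \<noteq> 0 \<Longrightarrow> zeta s \<noteq> 0"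
  using zeta_nonzero_Re_gt_1[of s] zeta_nonzero_Re_eq_1[of "Im s"] complex_surj[of s] by (cases "Re s = 1") auto

lemma cos_nonzero_off_real_axis:
  fixes z :: complex
  assumes "Im z \<noteq> 0"
  shows "cos z \<noteq> 0"
  using assms by (subst cos_eq_0) auto

text \<open>Under the functional equation the zeros on this side come from the cosine, which
  vanishes only at real arguments.\<close>

lemma zeta_nonzero_Re_le_0:
  assumes "Re s \<le> 0" "Im s \<noteq> 0"
  shows "zeta s \<noteq> 0"
proof -
  have "zeta (1 - (1 - s)) \<noteq> 0"
    using assms zeta_nonzero_Re_ge_1[of "1 - s"] Gamma_nonzero_Re_pos[of "1 - s"] cos_nonzero_off_real_axis[of "of_real pi * (1 - s) / 2"]
    by (subst zeta_functional_equation) (auto simp: Re_divide_numeral Im_divide_numeral)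
  thus ?thesis by simp
qed

section \<open>Zeros on the critical line under the Riemann hypothesis\<close>

lemma norm_cos_le_exp: "norm (cos z :: complex) \<le> exp \<bar>Im z\<bar>"
proof -
  have "norm (cos z) = norm (exp (\<i> * z) + exp (- (\<i> * z))) / 2" by (simp add: cos_exp_eq norm_divide)
  also have "\<dots> \<le> (exp (- Im z) + exp (Im z)) / 2"
    using norm_triangle_ineq[of "exp (\<i> * z)" "exp (- (\<i> * z))"] by simp
  also have "\<dots> \<le> (exp \<bar>Im z\<bar> + exp \<bar>Im z\<bar>) / 2" by (intro divide_right_mono add_mono) auto
  finally show ?thesis by simp
qed

lemma norm_sin_le_exp: "norm (sin z :: complex) \<le> exp \<bar>Im z\<bar>"
  using norm_cos_le_exp[of "of_real pi / 2 - z"] by (simp add: cos_diff)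

lemma norm_cos_ge_exp:
  assumes "\<bar>Im z\<bar> \<ge> 1"
  shows "norm (cos z :: complex) \<ge> exp \<bar>Im z\<bar> / 4"
proof -
  let ?y = "\<bar>Im z\<bar>"
  have "exp (- ?y) * 2 \<le> exp ?y"
  proof -
    have "2 \<le> exp (2 * ?y)" using exp_ge_add_one_self[of "2 * ?y"] assms by linarith
    hence "exp (- ?y) * 2 \<le> exp (- ?y) * exp (2 * ?y)" by simp
    also have "\<dots> = exp ?y" by (simp flip: exp_add)
    finally show ?thesis .
  qed
  moreover have "exp ?y - exp (- ?y) \<le> norm (exp (\<i> * z) + exp (- (\<i> * z)))"
    using norm_diff_ineq[of "exp (\<i> * z)" "exp (- (\<i> * z))"] norm_diff_ineq[of "exp (- (\<i> * z))" "exp (\<i> * z)"]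
    by (cases "Im z \<ge> 0") (auto simp: add.commute)
  moreover have "norm (cos z) = norm (exp (\<i> * z) + exp (- (\<i> * z))) / 2" by (simp add: cos_exp_eq norm_divide)
  ultimately show ?thesis by simp
qed

lemma sin_ge_half:
  fixes x :: real
  assumes "0 \<le> x" "x \<le> 1"
  shows "sin x \<ge> x / 2"
proof -
  have "sin x - x / 2 \<ge> sin 0 - 0 / 2"
  proof (rule DERIV_nonneg_imp_nondecreasing[OF assms(1)])
    fix u assume u: "0 \<le> u" "u \<le> x"
    have "cos u \<ge> cos (pi / 3)" using u assms pi_gt3 by (intro cos_monotone_0_pi_le) auto
    hence "cos u - 1 / 2 \<ge> 0" by (simp add: cos_60)
    moreover have "((\<lambda>x. sin x - x / 2) has_real_derivative cos u - 1 / 2) (at u)"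
      by (auto intro!: derivative_eq_intros)
    ultimately show "\<exists>y. ((\<lambda>x. sin x - x / 2) has_real_derivative y) (at u) \<and> 0 \<le> y" by blast
  qed
  thus ?thesis by simp
qed

text \<open>The angle \<open>\<pi>/2 - 1 / |Im s|\<close> in the rotated integral costs only a power of \<open>|Im s|\<close>.\<close>

lemma norm_Gamma_strip_le:
  "\<exists>K>0. \<forall>s. 1/2 \<le> Re s \<and> Re s \<le> 3 \<and> \<bar>Im s\<bar> \<ge> 1 \<longrightarrow>
     norm (Gamma s) \<le> K * \<bar>Im s\<bar> ^ 3 * exp (- pi / 2 * \<bar>Im s\<bar>)"
proof -
  have "continuous_on {1/2..3::real} Gamma" by (intro continuous_intros) (auto elim!: nonpos_Ints_cases)
  hence "compact (Gamma ` {1/2..3::real})" by (intro compact_continuous_image) auto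
  then obtain K where K: "\<And>u. 1/2 \<le> u \<Longrightarrow> u \<le> 3 \<Longrightarrow> \<bar>Gamma u :: real\<bar> \<le> K"
    using compact_imp_bounded[of "Gamma ` {1/2..3::real}"] unfolding bounded_iff by fastforce
  define K' where "K' = (\<bar>K\<bar> + 1) * (8 * exp 1)"
  have "norm (Gamma s) \<le> K' * \<bar>Im s\<bar> ^ 3 * exp (- pi / 2 * \<bar>Im s\<bar>)"
    if s: "1/2 \<le> Re s" "Re s \<le> 3" "\<bar>Im s\<bar> \<ge> 1" for s :: complex
  proof -
    define v where "v = \<bar>Im s\<bar>"
    have v: "v \<ge> 1" using s by (simp add: v_def)
    hence iv: "0 < 1 / v" "1 / v \<le> 1" by auto
    define \<phi> where "\<phi> = pi / 2 - 1 / v"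
    have \<phi>: "0 \<le> \<phi>" "\<phi> < pi / 2" using iv pi_gt3 unfolding \<phi>_def by linarith+
    have "cos \<phi> = sin (1 / v)" by (simp add: \<phi>_def cos_diff)
    hence c: "cos \<phi> \<ge> 1 / (2 * v)" using sin_ge_half[of "1 / v"] iv by (simp add: field_simps)
    have "cos \<phi> powr (- Re s) \<le> (1 / (2 * v)) powr (- Re s)" using c v s by (intro powr_mono2') auto
    also have "\<dots> = (2 * v) powr Re s" using v by (simp add: powr_minus powr_divide)
    also have "\<dots> \<le> (2 * v) powr 3" using v s by (intro powr_mono) auto
    also have "\<dots> = 8 * v ^ 3" using v by (simp add: powr_numeral power_mult_distrib)
    finally have c3: "cos \<phi> powr (- Re s) \<le> 8 * v ^ 3" .
    have e: "exp (- \<phi> * v) = exp 1 * exp (- pi / 2 * v)"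
      using v by (simp add: \<phi>_def algebra_simps flip: exp_add)
    have "norm (Gamma s) \<le> Gamma (Re s) * cos \<phi> powr (- Re s) * exp (- \<phi> * v)"
      unfolding v_def by (rule norm_Gamma_le_rotated) (use s \<phi> in auto)
    also have "\<dots> \<le> (\<bar>K\<bar> + 1) * (8 * v ^ 3) * exp (- \<phi> * v)"
      using K[of "Re s"] s c3 by (intro mult_right_mono mult_mono) auto
    also have "\<dots> = K' * v ^ 3 * exp (- pi / 2 * v)" unfolding e by (simp add: K'_def mult_ac)
    finally show ?thesis by (simp add: v_def)
  qed
  moreover have "K' > 0" by (simp add: K'_def)
  ultimately show ?thesis by blast
qed

text \<open>To the left of \<open>Re s = 1/2\<close> the functional equation is used: the growth
  \<open>exp (pi/2 * |Im s|)\<close> of the cosine cancels against the decay of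
  \<open>Gamma\<close>, leaving \<open>|Im s|^3\<close> from \<open>Gamma\<close> and
  \<open>|Im s|\<close> from \<open>zeta\<close> on the right. The exact power is immaterial to the
  normal family argument.\<close>

lemma zeta_polynomial_bound:
  "\<exists>C\<ge>1. \<forall>s. -2 \<le> Re s \<and> Re s \<le> 3 \<and> \<bar>Im s\<bar> \<ge> 1 \<longrightarrow> norm (zeta s) \<le> C * \<bar>Im s\<bar> ^ 4"
proof -
  obtain C where C: "C > 0" "\<And>s. 1/2 \<le> Re s \<Longrightarrow> Re s \<le> 3 \<Longrightarrow> norm (s - 1) \<ge> 1/2 \<Longrightarrow> norm (zeta s) \<le> C * (1 + \<bar>Im s\<bar>)"
    using zeta_bound_strip by blast
  obtain K where K: "K > 0" "\<And>s. 1/2 \<le> Re s \<Longrightarrow> Re s \<le> 3 \<Longrightarrow> \<bar>Im s\<bar> \<ge> 1 \<Longrightarrow>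
     norm (Gamma s) \<le> K * \<bar>Im s\<bar> ^ 3 * exp (- pi / 2 * \<bar>Im s\<bar>)"
    using norm_Gamma_strip_le by blast
  have right: "norm (zeta s) \<le> 2 * C * \<bar>Im s\<bar>" if s: "1/2 \<le> Re s" "Re s \<le> 3" "\<bar>Im s\<bar> \<ge> 1" for s
  proof -
    have "norm (s - 1) \<ge> 1" using abs_Im_le_cmod[of "s - 1"] s by simp
    hence "norm (zeta s) \<le> C * (1 + \<bar>Im s\<bar>)" using s by (intro C(2)) auto
    also have "\<dots> \<le> C * (2 * \<bar>Im s\<bar>)" using s C by (intro mult_left_mono) auto
    finally show ?thesis by (simp add: mult_ac)
  qed
  have left: "norm (zeta s) \<le> 4 * K * C * \<bar>Im s\<bar> ^ 4" if s: "-2 \<le> Re s" "Re s < 1/2" "\<bar>Im s\<bar> \<ge> 1" for s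
  proof -
    define w where "w = 1 - s"
    define v where "v = \<bar>Im s\<bar>"
    have w: "1/2 \<le> Re w" "Re w \<le> 3" "\<bar>Im w\<bar> = v" "v \<ge> 1" using s by (auto simp: w_def v_def)
    have "w \<noteq> 1" using w by auto
    have "zeta s = 2 * of_real (2 * pi) powr (- w) * cos (of_real pi * w / 2) * Gamma w * zeta w"
      using zeta_functional_equation[of w] w \<open>w \<noteq> 1\<close> by (simp add: w_def)
    hence "norm (zeta s) = 2 * (2 * pi) powr (- Re w) * norm (cos (of_real pi * w / 2)) * norm (Gamma w) * norm (zeta w)"
      by (simp add: norm_mult norm_powr_real_powr)
    also have "\<dots> \<le> 2 * 1 * exp (pi / 2 * v) * (K * v ^ 3 * exp (- pi / 2 * v)) * (2 * C * v)"
    proof (intro mult_mono)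
      have "(2 * pi) powr (- Re w) \<le> (2 * pi) powr 0" using w pi_gt3 by (intro powr_mono) auto
      thus "(2 * pi) powr (- Re w) \<le> 1" by simp
      show "norm (cos (of_real pi * w / 2)) \<le> exp (pi / 2 * v)"
        using norm_cos_le_exp[of "of_real pi * w / 2"] w by (simp add: abs_mult Im_divide_numeral)
      show "norm (Gamma w) \<le> K * v ^ 3 * exp (- pi / 2 * v)" using K(2)[of w] w by simp
      show "norm (zeta w) \<le> 2 * C * v" using right[of w] w by simp
    qed (use w K C in auto)
    also have "\<dots> = 4 * K * C * v ^ 4 * (exp (pi / 2 * v) * exp (- pi / 2 * v))" by (simp add: eval_nat_numeral)
    also have "exp (pi / 2 * v) * exp (- pi / 2 * v) = 1" by (simp flip: exp_add)
    finally show ?thesis by (simp add: v_def)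
  qed
  define C' where "C' = max 1 (max (2 * C) (4 * K * C))"
  have "norm (zeta s) \<le> C' * \<bar>Im s\<bar> ^ 4" if s: "-2 \<le> Re s" "Re s \<le> 3" "\<bar>Im s\<bar> \<ge> 1" for s
  proof (cases "Re s < 1/2")
    case True
    have "4 * K * C * \<bar>Im s\<bar> ^ 4 \<le> C' * \<bar>Im s\<bar> ^ 4" by (intro mult_right_mono) (auto simp: C'_def)
    thus ?thesis using left[of s] True s by linarith
  next
    case False
    have "2 * C * \<bar>Im s\<bar> \<le> C' * \<bar>Im s\<bar> ^ 4"
      using s C power_increasing[of 1 4 "\<bar>Im s\<bar>"] by (intro mult_mono) (auto simp: C'_def)
    thus ?thesis using right[of s] False s by linarith
  qed
  thus ?thesis by (intro exI[of _ C']) (auto simp: C'_def)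
qed

text \<open>The term \<open>n = 2\<close> gives at most 1/4, and the terms from \<open>n = 3\<close>
  on are dominated by a telescoping series with sum 1/2. That the total stays below 1 keeps
  \<open>zeta s\<close> away from 0.\<close>

lemma zeta_near_1:
  assumes "Re s \<ge> 2"
  shows "norm (zeta s - 1) \<le> 3/4"
proof -
  let ?f = "\<lambda>n. 1 / of_nat (Suc n) powr s :: complex"
  have "?f sums zeta s" using assms by (intro zeta_sums) auto
  hence "(\<lambda>n. ?f (Suc n)) sums (zeta s - ?f 0)" by (subst sums_Suc_iff) simp
  hence "(\<lambda>n. ?f (Suc (Suc n))) sums (zeta s - ?f 0 - ?f (Suc 0))" by (subst sums_Suc_iff) simp
  hence sums: "(\<lambda>n. ?f (Suc (Suc n))) sums (zeta s - 1 - ?f 1)" by simp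
  have nf: "norm (?f n) \<le> 1 / real (Suc n) ^ 2" for n
  proof -
    have "norm (?f n) = 1 / real (Suc n) powr Re s" by (simp add: norm_divide norm_powr_real_powr del: of_nat_Suc)
    also have "\<dots> \<le> 1 / real (Suc n) powr 2" using assms by (intro divide_left_mono powr_mono) auto
    also have "\<dots> = 1 / real (Suc n) ^ 2" by (simp add: powr_numeral del: of_nat_Suc)
    finally show ?thesis .
  qed
  let ?h = "\<lambda>n. 1 / real (Suc (Suc n))"
  have "(\<lambda>n. ?h n - ?h (Suc n)) sums (?h 0 - 0)" by (rule telescope_sums') real_asymp
  hence hs: "(\<lambda>n. ?h n - ?h (Suc n)) sums (1/2)" by simp
  have le: "norm (?f (Suc (Suc n))) \<le> ?h n - ?h (Suc n)" for n
  proof -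
    have "norm (?f (Suc (Suc n))) \<le> 1 / real (Suc (Suc (Suc n))) ^ 2" by (rule nf)
    also have "\<dots> \<le> 1 / (real (Suc (Suc n)) * real (Suc (Suc (Suc n))))"
      unfolding power2_eq_square by (intro divide_left_mono mult_right_mono) auto
    also have "\<dots> = ?h n - ?h (Suc n)" by (simp add: field_simps)
    finally show ?thesis .
  qed
  have "norm (\<Sum>n. ?f (Suc (Suc n))) \<le> (\<Sum>n. ?h n - ?h (Suc n))"
    by (rule norm_suminf_le[OF le sums_summable[OF hs]])
  hence "norm (zeta s - 1 - ?f 1) \<le> 1/2" using sums hs by (simp only: sums_iff)
  moreover have "norm (?f 1) \<le> 1/4" using nf[of 1] by simp
  moreover have "norm (zeta s - 1) \<le> norm (zeta s - 1 - ?f 1) + norm (?f 1)"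
    using norm_triangle_ineq[of "zeta s - 1 - ?f 1" "?f 1"] by simp
  ultimately show ?thesis by linarith
qed

text \<open>On the imaginary axis \<open>Gamma (- z)\<close> is the conjugate of
  \<open>Gamma z\<close>, so the reflection formula gives the norm of \<open>Gamma (i T)\<close>
  exactly. Two steps of the recursion lead to real part 2.\<close>

lemma norm_Gamma_2_ge:
  assumes T: "T \<ge> 1"
  shows "norm (Gamma (Complex 2 T)) \<ge> T * exp (- pi / 2 * T)"
proof -
  define z where "z = Complex 0 T"
  have z: "z \<noteq> 0" "1 + z \<noteq> 0" using T by (auto simp: z_def complex_eq_iff)
  have G: "Gamma (Complex 2 T) = (1 + z) * (z * Gamma z)"
  proof -
    have "Complex 2 T = (z + 1) + 1" by (simp add: z_def complex_eq_iff)
    also have "Gamma \<dots> = (z + 1) * Gamma (z + 1)" using z T by (intro Gamma_plus1) (auto simp: z_def nonpos_Ints_def complex_eq_iff)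
    also have "Gamma (z + 1) = z * Gamma z" using z T by (intro Gamma_plus1) (auto simp: z_def nonpos_Ints_def complex_eq_iff)
    finally show ?thesis by (simp add: add.commute)
  qed
  have nz: "norm z = T" using T by (simp add: z_def cmod_def)
  have "cnj z = - z" by (simp add: z_def complex_eq_iff)
  hence "norm (Gamma (- z)) = norm (Gamma z)" by (metis cnj_Gamma complex_mod_cnj)
  hence "norm (Gamma z) ^ 2 = norm (Gamma z * Gamma (- z))" by (simp add: norm_mult power2_eq_square)
  also have "\<dots> = pi / (T * norm (sin (of_real pi * z)))"
    unfolding Gamma_reflection_complex' by (simp only: norm_divide norm_mult nz norm_minus_cancel) simp
  finally have G2: "norm (Gamma z) ^ 2 = pi / (T * norm (sin (of_real pi * z)))" .
  have sn: "sin (of_real pi * z) \<noteq> 0"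
    using T by (subst sin_eq_0) (auto simp: z_def complex_eq_iff)
  have "norm (sin (of_real pi * z)) \<le> exp (pi * T)"
    using norm_sin_le_exp[of "of_real pi * z"] T by (simp add: z_def)
  hence "norm (Gamma z) ^ 2 \<ge> pi / (T * exp (pi * T))"
    unfolding G2 using T sn by (intro divide_left_mono mult_left_mono mult_pos_pos) auto
  moreover have "pi / (T * exp (pi * T)) \<ge> 1 / (T * exp (pi * T))" using T pi_gt3 by (intro divide_right_mono) auto
  moreover have "1 / (T * exp (pi * T)) = exp (- pi * T) / T" by (simp add: exp_minus divide_simps)
  ultimately have g: "norm (Gamma z) ^ 2 \<ge> exp (- pi * T) / T" by simp
  have "norm (1 + z) \<ge> T" using abs_Im_le_cmod[of "1 + z"] T by (simp add: z_def)
  hence "norm (Gamma (Complex 2 T)) \<ge> T * (T * norm (Gamma z))"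
    unfolding G norm_mult nz using T by (intro mult_mono) auto
  moreover have "(T * exp (- pi / 2 * T)) ^ 2 \<le> (T * (T * norm (Gamma z))) ^ 2"
  proof -
    have "(T * exp (- pi / 2 * T)) ^ 2 = T ^ 2 * exp (- pi * T)"
      by (simp add: power_mult_distrib flip: exp_double)
    also have "\<dots> = T ^ 3 * (exp (- pi * T) / T)" using T by (simp add: eval_nat_numeral)
    also have "\<dots> \<le> T ^ 4 * norm (Gamma z) ^ 2"
      using g T by (intro mult_mono power_increasing) auto
    also have "\<dots> = (T * (T * norm (Gamma z))) ^ 2" by (simp add: eval_nat_numeral)
    finally show ?thesis .
  qed
  hence "T * exp (- pi / 2 * T) \<le> T * (T * norm (Gamma z))" by (rule power2_le_imp_le) (use T in auto)
  ultimately show ?thesis by linarith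
qed

text \<open>The functional equation maps \<open>-1 + i T\<close> to \<open>2 - i T\<close>, where
  \<open>zeta\<close> is at least 1/4 in norm; the exponentials of cosine and \<open>Gamma\<close>
  cancel again. Growth by any positive power of \<open>T\<close> would do.\<close>

lemma norm_zeta_minus_1_ge:
  assumes T: "T \<ge> 1"
  shows "norm (zeta (Complex (-1) T)) \<ge> T / (32 * pi\<^sup>2)"
proof -
  define w where "w = Complex 2 (- T)"
  have w: "Re w > 0" "w \<noteq> 1" "Complex (-1) T = 1 - w" by (auto simp: w_def complex_eq_iff)
  have "zeta (Complex (-1) T) = 2 * of_real (2 * pi) powr (- w) * cos (of_real pi * w / 2) * Gamma w * zeta w"
    unfolding w(3) by (rule zeta_functional_equation[OF w(1,2)])
  hence "norm (zeta (Complex (-1) T)) = 2 * (2 * pi) powr (- 2) * norm (cos (of_real pi * w / 2)) * norm (Gamma w) * norm (zeta w)"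
    by (simp add: norm_mult norm_powr_real_powr w_def)
  also have "\<dots> \<ge> 2 * (1 / (4 * pi\<^sup>2)) * (exp (pi / 2 * T) / 4) * (T * exp (- pi / 2 * T)) * (1/4)"
  proof (intro mult_mono)
    show "1 / (4 * pi\<^sup>2) \<le> (2 * pi) powr (- 2)" using pi_gt_zero by (simp add: powr_minus powr_numeral power_mult_distrib field_simps)
    have "pi * T \<ge> 3 * 1" using pi_gt3 T by (intro mult_mono) auto
    hence "\<bar>Im (of_real pi * w / 2)\<bar> = pi / 2 * T" "\<bar>Im (of_real pi * w / 2)\<bar> \<ge> 1"
      using T by (auto simp: w_def Im_divide_numeral abs_mult)
    thus "exp (pi / 2 * T) / 4 \<le> norm (cos (of_real pi * w / 2))"
      using norm_cos_ge_exp[of "of_real pi * w / 2"] by simp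
    have "w = cnj (Complex 2 T)" by (simp add: w_def complex_eq_iff)
    hence "norm (Gamma w) = norm (Gamma (Complex 2 T))" by (metis cnj_Gamma complex_mod_cnj)
    thus "T * exp (- pi / 2 * T) \<le> norm (Gamma w)" using norm_Gamma_2_ge[OF T] by simp
    have "norm (zeta w - 1) \<le> 3/4" by (rule zeta_near_1) (simp add: w_def)
    moreover have "1 - norm (zeta w - 1) \<le> norm (zeta w)" using norm_triangle_ineq2[of 1 "1 - zeta w"] by (simp add: norm_minus_commute)
    ultimately show "1/4 \<le> norm (zeta w)" by linarith
  qed (use T in auto)
  also have "2 * (1 / (4 * pi\<^sup>2)) * (exp (pi / 2 * T) / 4) * (T * exp (- pi / 2 * T)) * (1/4) =
      T / (32 * pi\<^sup>2) * (exp (pi / 2 * T) * exp (- pi / 2 * T))" by (simp add: field_simps)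
  also have "exp (pi / 2 * T) * exp (- pi / 2 * T) = 1" by (simp flip: exp_add)
  finally show ?thesis by simp
qed

lemma zeta_zero_gap:
  assumes RH: riemann_hypothesis
  shows "\<forall>\<^sub>F T in at_top. \<exists>t. T - 1 < t \<and> t < T + 1 \<and> hardy_Z t = 0"
proof (rule ccontr)
  assume "\<not> ?thesis"
  hence "\<exists>\<^sub>F T in at_top. \<forall>t. T - 1 < t \<and> t < T + 1 \<longrightarrow> hardy_Z t \<noteq> 0"
    unfolding not_eventually by (rule frequently_elim1) blast
  hence "\<exists>T\<ge>b. \<forall>t. T - 1 < t \<and> t < T + 1 \<longrightarrow> hardy_Z t \<noteq> 0" for b :: real
    using frequently_eventually_frequently[OF _ eventually_ge_at_top[of b]] by (fastforce dest: frequently_ex)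
  \<comment> \<open>The bound 4 keeps the shifted rectangle above height 3, away from the pole and
    within the range of the growth bound, and gives \<open>ln T >= 1\<close>.\<close>
  hence "\<forall>k. \<exists>T\<ge>max 4 (real k). \<forall>t. T - 1 < t \<and> t < T + 1 \<longrightarrow> hardy_Z t \<noteq> 0" by blast
  then obtain T where "\<And>k. T k \<ge> max 4 (real k) \<and> (\<forall>t. T k - 1 < t \<and> t < T k + 1 \<longrightarrow> hardy_Z t \<noteq> 0)"
    by metis
  hence T: "\<And>k. T k \<ge> 4" "\<And>k. T k \<ge> real k"
    and nz: "\<And>k t. T k - 1 < t \<Longrightarrow> t < T k + 1 \<Longrightarrow> hardy_Z t \<noteq> 0" by auto
  \<comment> \<open>The height is that of the zero-free interval. The width covers both the point
    \<open>-1\<close> and a part with \<open>Re z > 2\<close>, where \<open>zeta\<close> is close to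
    1.\<close>
  define B where "B = box (Complex (-2) (-1)) (Complex 3 1)"
  have B: "z \<in> B \<longleftrightarrow> -2 < Re z \<and> Re z < 3 \<and> -1 < Im z \<and> Im z < 1" for z
    by (simp add: B_def in_box_complex_iff)
  have oB: "open B" and cB: "convex B" by (auto simp: B_def open_box)
  have lT: "ln (T k) \<ge> 1" for k
  proof -
    have "exp 1 \<le> T k" using exp_le T(1)[of k] by linarith
    thus ?thesis using T(1)[of k] by (subst ln_ge_iff) auto
  qed
  define f where "f = (\<lambda>k z. zeta (z + Complex 0 (T k)))"
  have fh: "f k holomorphic_on B" for k
  proof -
    have "(\<lambda>z. z + Complex 0 (T k)) ` B \<subseteq> - {1}" using T(1)[of k] by (auto simp: B complex_eq_iff)
    thus ?thesis unfolding f_def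
      by (intro holomorphic_on_compose_gen[OF _ zeta_holomorphic, unfolded o_def]) (auto intro!: holomorphic_intros)
  qed
  have fn: "f k z \<noteq> 0" if "z \<in> B" for k z
  proof
    assume z: "f k z = 0"
    define s where "s = z + Complex 0 (T k)"
    have s: "zeta s = 0" "Im s \<noteq> 0" "T k - 1 < Im s" "Im s < T k + 1"
      using z that T(1)[of k] by (auto simp: s_def f_def B)
    have "0 < Re s" "Re s < 1"
      using zeta_nonzero_Re_ge_1[of s] zeta_nonzero_Re_le_0[of s] s by force+
    hence "Re s = 1 / 2" using RH s unfolding riemann_hypothesis_def by blast
    hence "s = Complex (1/2) (Im s)" by (simp add: complex_eq_iff)
    hence "hardy_Z (Im s) = 0" using s(1) by (metis hardy_Z_eq_0_iff)
    thus False using nz s by blast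
  qed
  have "\<exists>L. L holomorphic_on B \<and> (\<forall>z\<in>B. exp (L z) = f k z)" for k
  proof -
    have "0 \<in> B" by (simp add: B)
    obtain L where "L holomorphic_on B" "\<And>z. z \<in> B \<Longrightarrow> exp (L z) = f k z"
      by (rule holomorphic_logarithm_exists[OF cB oB fh[of k] fn[where k = k] \<open>0 \<in> B\<close>]) auto
    thus ?thesis by blast
  qed
  then obtain L where L: "\<And>k. L k holomorphic_on B" "\<And>k z. z \<in> B \<Longrightarrow> exp (L k z) = f k z" by metis
  \<comment> \<open>A branch of \<open>f k z\<close> to the power \<open>1 / ln (T k)\<close>. Its
    modulus, the only thing that is estimated, does not depend on the chosen logarithm.\<close>
  define F where "F = (\<lambda>k z. exp (L k z / of_real (ln (T k))))"
  have Fh: "F k holomorphic_on B" for k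
    unfolding F_def using lT[of k] by (intro holomorphic_intros L) auto
  have Fn: "norm (F k z) = exp (ln (norm (f k z)) / ln (T k))" if "z \<in> B" for k z
    by (simp add: F_def flip: L(2)[OF that])
  obtain C where C: "C \<ge> 1" "\<And>s. -2 \<le> Re s \<Longrightarrow> Re s \<le> 3 \<Longrightarrow> \<bar>Im s\<bar> \<ge> 1 \<Longrightarrow> norm (zeta s) \<le> C * \<bar>Im s\<bar> ^ 4"
    using zeta_polynomial_bound by blast
  have Fb: "norm (F k z) \<le> exp (ln (16 * C) + 4)" if "z \<in> B" for k z
  proof -
    have zb: "-2 < Re z" "Re z < 3" "-1 < Im z" "Im z < 1" using that by (auto simp: B)
    have "norm (f k z) \<le> C * \<bar>Im z + T k\<bar> ^ 4"
      using C(2)[of "z + Complex 0 (T k)"] zb T(1)[of k] by (simp add: f_def)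
    also have "\<dots> \<le> C * (2 * T k) ^ 4"
      using zb T(1)[of k] C(1) by (intro mult_left_mono power_mono) auto
    finally have "norm (f k z) \<le> 16 * C * T k ^ 4" by (simp add: power_mult_distrib)
    hence "ln (norm (f k z)) \<le> ln (16 * C * T k ^ 4)"
      using fn[OF that, of k] C(1) T(1)[of k] by (subst ln_le_cancel_iff) auto
    also have "\<dots> = ln (16 * C) + 4 * ln (T k)" using C(1) T(1)[of k] by (simp add: ln_mult ln_realpow)
    also have "\<dots> \<le> ln (16 * C) * ln (T k) + 4 * ln (T k)"
      using mult_left_mono[OF lT[of k], of "ln (16 * C)"] C(1) by simp
    finally have "ln (norm (f k z)) / ln (T k) \<le> ln (16 * C) + 4" using lT[of k] by (simp add: field_simps)
    thus ?thesis using Fn[OF that] by simp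
  qed
  obtain g r where g: "g holomorphic_on B" "strict_mono (r :: nat \<Rightarrow> nat)" "\<And>z. z \<in> B \<Longrightarrow> (\<lambda>n. F (r n) z) \<longlonglongrightarrow> g z"
  proof (rule Montel[OF oB, of "range F" F])
    show "\<And>h. h \<in> range F \<Longrightarrow> h holomorphic_on B" using Fh by auto
    show "\<exists>M. \<forall>h\<in>range F. \<forall>z\<in>K. norm (h z) \<le> M" if "compact K" "K \<subseteq> B" for K
      using Fb that by (intro exI[of _ "exp (ln (16 * C) + 4)"]) auto
  qed (rule order_refl | blast)+
  have "filterlim (\<lambda>k. real (r k)) at_top sequentially"
    by (intro filterlim_compose[OF filterlim_real_sequentially] filterlim_subseq g)
  hence "filterlim (\<lambda>k. T (r k)) at_top sequentially"
    by (rule filterlim_at_top_mono) (use T(2) in auto)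
  hence lnT: "filterlim (\<lambda>k. ln (T (r k))) at_top sequentially" by (rule filterlim_compose[OF ln_at_top])
  have g1: "norm (g z) = 1" if z: "z \<in> B" "Re z \<ge> 2" for z
  proof -
    have bd: "\<bar>ln (norm (f k z))\<bar> \<le> ln 4" for k
    proof -
      have n: "norm (f k z - 1) \<le> 3/4" unfolding f_def using z by (intro zeta_near_1) simp
      have "1/4 \<le> norm (f k z)" using n norm_triangle_ineq2[of 1 "1 - f k z"] by (simp add: norm_minus_commute)
      moreover have "norm (f k z) \<le> 4" using n norm_triangle_ineq[of "f k z - 1" 1] by simp
      ultimately have "ln (1/4) \<le> ln (norm (f k z))" "ln (norm (f k z)) \<le> ln 4"
        using fn[OF z(1), of k] by (auto intro!: ln_mono)
      thus ?thesis by (simp add: ln_div)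
    qed
    have "(\<lambda>k. ln (norm (f (r k) z)) / ln (T (r k))) \<longlonglongrightarrow> 0"
    proof (rule Lim_null_comparison)
      show "\<forall>\<^sub>F k in sequentially. norm (ln (norm (f (r k) z)) / ln (T (r k))) \<le> ln 4 / ln (T (r k))"
      proof (intro always_eventually allI)
        fix k
        have "ln (T (r k)) > 0" using lT[of "r k"] by linarith
        thus "norm (ln (norm (f (r k) z)) / ln (T (r k))) \<le> ln 4 / ln (T (r k))"
          using bd[of "r k"] by (simp add: divide_right_mono)
      qed
      show "(\<lambda>k. ln 4 / ln (T (r k))) \<longlonglongrightarrow> 0" by (rule tendsto_divide_0[OF tendsto_const filterlim_at_top_imp_at_infinity[OF lnT]])
    qed
    hence "(\<lambda>k. norm (F (r k) z)) \<longlonglongrightarrow> exp 0" unfolding Fn[OF z(1)] by (rule tendsto_exp)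
    moreover have "(\<lambda>k. norm (F (r k) z)) \<longlonglongrightarrow> norm (g z)" by (rule tendsto_norm[OF g(3)[OF z(1)]])
    ultimately show ?thesis using LIMSEQ_unique by fastforce
  qed
  \<comment> \<open>On the open part with \<open>Re z > 2\<close> the modulus of \<open>g\<close> is
    1 everywhere, so each point there is a local maximum of the modulus.\<close>
  have "g constant_on B"
  proof (rule maximum_modulus_principle[OF g(1) oB convex_connected[OF cB]])
    show "open {z. Re z > 2 \<and> Re z < 3 \<and> Im z > -1 \<and> Im z < 1}"
      by (intro open_Collect_conj open_Collect_less continuous_intros)
    show "Complex (5/2) 0 \<in> {z. Re z > 2 \<and> Re z < 3 \<and> Im z > -1 \<and> Im z < 1}" by simp
    show "norm (g z) \<le> norm (g (Complex (5/2) 0))" if "z \<in> {z. Re z > 2 \<and> Re z < 3 \<and> Im z > -1 \<and> Im z < 1}" for z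
      using g1[of z] g1[of "Complex (5/2) 0"] that by (auto simp: B)
  qed (auto simp: B)
  moreover have m: "-1 \<in> B" "Complex (5/2) 0 \<in> B" by (auto simp: B)
  ultimately have "g (-1) = g (Complex (5/2) 0)" by (auto simp: constant_on_def)
  hence gm: "norm (g (-1)) = 1" using g1[of "Complex (5/2) 0"] m by simp
  define c where "c = 1 / (32 * pi\<^sup>2)"
  have c: "c > 0" by (simp add: c_def)
  \<comment> \<open>The lower bound \<open>c * T k\<close> for \<open>zeta\<close>, raised to the
    power \<open>1 / ln (T k)\<close>; it tends to \<open>exp 1\<close>.\<close>
  have low: "exp (ln c / ln (T k) + 1) \<le> norm (F k (-1))" for k
  proof -
    have "-1 + Complex 0 (T k) = Complex (-1) (T k)" by (simp add: complex_eq_iff)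
    hence "norm (f k (-1)) \<ge> T k * c" using norm_zeta_minus_1_ge[of "T k"] T(1)[of k] by (simp add: f_def c_def)
    hence "ln (T k * c) \<le> ln (norm (f k (-1)))" using T(1)[of k] c by (intro ln_mono) auto
    hence "ln (T k) + ln c \<le> ln (norm (f k (-1)))" using T(1)[of k] c by (simp add: ln_mult)
    hence "(ln c + ln (T k)) / ln (T k) \<le> ln (norm (f k (-1))) / ln (T k)"
      using lT[of k] by (intro divide_right_mono) auto
    moreover have "(ln c + ln (T k)) / ln (T k) = ln c / ln (T k) + 1" using lT[of k] by (simp add: add_divide_distrib)
    ultimately show ?thesis unfolding Fn[OF m(1)] by simp
  qed
  have "(\<lambda>k. exp (ln c / ln (T (r k)) + 1)) \<longlonglongrightarrow> exp (0 + 1)"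
    by (intro tendsto_exp tendsto_add tendsto_const tendsto_divide_0[OF tendsto_const filterlim_at_top_imp_at_infinity[OF lnT]])
  moreover have "(\<lambda>k. norm (F (r k) (-1))) \<longlonglongrightarrow> norm (g (-1))" by (rule tendsto_norm[OF g(3)[OF m(1)]])
  ultimately have "exp (0 + 1) \<le> norm (g (-1))" by (rule LIMSEQ_le) (use low in auto)
  thus False using gm exp_gt_one[of "1::real"] by simp
qed

section \<open>Bonnet points\<close>

lemma hardy_Z_square_eq_Zsq: "(hardy_Z t)\<^sup>2 = Zsq t"
  by (simp add: hardy_Z_square Zsq_def)

text \<open>The quotients \<open>I / M\<close> and \<open>J / M\<close> are the widths of rectangles
  of height \<open>M = Zsq m\<close> with the same area as the two halves of the gap. Each is
  smaller than its half because \<open>M - Zsq\<close> is nonnegative and positive at the end point,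
  where \<open>Z\<close> vanishes. The factor \<open>M\<close> then cancels the height and leaves
  the whole area \<open>I + J\<close>.\<close>

lemma bonnet_points:
  assumes a: "0 \<le> a" and z: "hardy_Z a = 0" "hardy_Z b = 0" and m: "is_max_point a b m"
  shows "a < bonnet_left a m" "bonnet_left a m < m" "m < bonnet_right m b" "bonnet_right m b < b"
    and "(hardy_Z m)\<^sup>2 * (bonnet_right m b - bonnet_left a m) = Zint b - Zint a"
proof -
  define M where "M = Zsq m"
  have ab: "a < m" "m < b" and mx: "\<And>s. a \<le> s \<Longrightarrow> s \<le> b \<Longrightarrow> Zsq s \<le> M"
    using m by (auto simp: is_max_point_def hardy_Z_square_eq_Zsq M_def)
  have z': "Zsq a = 0" "Zsq b = 0" using z by (simp_all flip: hardy_Z_square_eq_Zsq)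
  define I where "I = integral {a..m} Zsq"
  define J where "J = integral {m..b} Zsq"
  have I: "I = Zint m - Zint a" and J: "J = Zint b - Zint m"
    unfolding I_def J_def using a ab by (simp_all add: Zint_diff)
  have pos: "I > 0" "J > 0" using I J Zint_strict_mono[of a m] Zint_strict_mono[of m b] a ab by auto
  have le: "integral {u..v} (\<lambda>s. M - Zsq s) = M * (v - u) - integral {u..v} Zsq" if "u \<le> v" for u v
    using that Zsq_integrable_on
    by (subst Henstock_Kurzweil_Integration.integral_diff) (auto simp: mult.commute)
  have cont: "continuous_on X (\<lambda>s. M - Zsq s)" for X by (intro continuous_intros Zsq_continuous)
  have M: "M > 0"
  proof (rule ccontr)
    assume "\<not> M > 0"
    hence "Zsq s = 0" if "s \<in> {a..m}" for s
      using order_antisym[OF order_trans[OF mx[of s]] Zsq_nonneg[of s]] that ab by simp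
    hence "I = 0" unfolding I_def using integral_cong[of "{a..m}" Zsq "\<lambda>_. 0"] by simp
    thus False using pos by simp
  qed
  have "integral {a..m} (\<lambda>s. M - Zsq s) > 0"
    using ab mx M z' by (intro integral_pos_of_continuous[of _ _ _ a] cont) auto
  hence I2: "I < M * (m - a)" using le[of a m] ab by (simp add: I_def)
  have "integral {m..b} (\<lambda>s. M - Zsq s) > 0"
    using ab mx M z' by (intro integral_pos_of_continuous[of _ _ _ b] cont) auto
  hence J2: "J < M * (b - m)" using le[of m b] ab by (simp add: J_def)
  have L: "bonnet_left a m = m - I / M" and R: "bonnet_right m b = m + J / M"
    by (simp_all add: bonnet_left_def bonnet_right_def hardy_Z_square_eq_Zsq I_def J_def M_def)
  have "I / M < m - a" "J / M < b - m" "0 < I / M" "0 < J / M" using I2 J2 M pos by (auto simp: field_simps)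
  thus "a < bonnet_left a m" "bonnet_left a m < m" "m < bonnet_right m b" "bonnet_right m b < b"
    unfolding L R by linarith+
  have "(hardy_Z m)\<^sup>2 * (bonnet_right m b - bonnet_left a m) = M * (I / M + J / M)"
    unfolding L R by (simp add: hardy_Z_square_eq_Zsq M_def)
  also have "\<dots> = I + J" using M by (simp add: field_simps)
  finally show "(hardy_Z m)\<^sup>2 * (bonnet_right m b - bonnet_left a m) = Zint b - Zint a" using I J by simp
qed

section \<open>The zeros in the window and the summation over gaps\<close>

lemma Z_zeros_finite: "finite (Z_zeros y0 \<mu> T)"
  by (rule finite_subset[OF _ Zsq_zeros_finite[of T "ladder_phi1_inv y0 \<mu> T"]])
     (auto simp: Z_zeros_def simp flip: hardy_Z_square_eq_Zsq)

text \<open>The element \<open>t\<close> rules out an empty set of zeros, for which the truncated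
  \<open>card - 1\<close> would make \<open>num_gaps + 1\<close> exceed the number of zeros.\<close>

lemma Z_zero_mem:
  assumes "t \<in> Z_zeros y0 \<mu> T" "1 \<le> n" "n \<le> num_gaps y0 \<mu> T + 1"
  shows "Z_zero y0 \<mu> T n \<in> Z_zeros y0 \<mu> T"
proof -
  have "card (Z_zeros y0 \<mu> T) > 0" using assms Z_zeros_finite[of y0 \<mu> T] by (auto simp: card_gt_0_iff)
  hence "n - 1 < length (sorted_list_of_set (Z_zeros y0 \<mu> T))" using assms by (simp add: num_gaps_def)
  hence "Z_zero y0 \<mu> T n \<in> set (sorted_list_of_set (Z_zeros y0 \<mu> T))" unfolding Z_zero_def by (rule nth_mem)
  thus ?thesis using Z_zeros_finite[of y0 \<mu> T] by simp
qed

lemma Z_zero_first_last: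
  assumes "t \<in> Z_zeros y0 \<mu> T"
  shows "Z_zero y0 \<mu> T 1 \<le> t" "t \<le> Z_zero y0 \<mu> T (num_gaps y0 \<mu> T + 1)"
proof -
  let ?l = "sorted_list_of_set (Z_zeros y0 \<mu> T)"
  have "t \<in> set ?l" using assms Z_zeros_finite[of y0 \<mu> T] by simp
  then obtain i where i: "i < length ?l" "?l ! i = t" by (auto simp: in_set_conv_nth)
  have "sorted ?l" by simp
  thus "Z_zero y0 \<mu> T 1 \<le> t" "t \<le> Z_zero y0 \<mu> T (num_gaps y0 \<mu> T + 1)"
    using i sorted_nth_mono[of ?l 0 i] sorted_nth_mono[of ?l i "card (Z_zeros y0 \<mu> T) - 1"]
    by (auto simp: Z_zero_def num_gaps_def)
qed

text \<open>\<open>Zint\<close> grows by about \<open>(1 - c) T\<close> from \<open>T\<close> to the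
  inverse value, and \<open>1 - c > 0\<close>. That is more than the \<open>o(T)\<close> gained on
  an interval of fixed length, and less than the growth of order \<open>T ln T\<close> from
  \<open>T\<close> to \<open>2 T\<close>.\<close>

lemma ladder_phi1_inv_bounds:
  assumes y0: "y0 \<ge> 0" and adm: "admissible y0 \<mu>"
  shows "\<forall>\<^sub>F T in at_top. T + h < ladder_phi1_inv y0 \<mu> T \<and> ladder_phi1_inv y0 \<mu> T \<le> 2 * T"
proof -
  let ?U = "ladder_phi1_inv y0 \<mu>" and ?c = "1 - euler_mascheroni :: real"
  have c: "?c > 0" using euler_mascheroni_less_13_over_22 by simp
  have m: "((\<lambda>T. (Zint (?U T) - Zint T) / T) \<longlongrightarrow> ?c) at_top" by (rule ladder_mean_value[OF assms])
  have a: "\<forall>\<^sub>F T in at_top. (Zint (?U T) - Zint T) / T > ?c / 2" by (rule order_tendstoD(1)[OF m]) (use c in simp)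
  have b: "\<forall>\<^sub>F T in at_top. (Zint (T + h) - Zint T) / T < ?c / 2"
    by (rule order_tendstoD(2)[OF Zint_window]) (use c in simp)
  have d: "\<forall>\<^sub>F T in at_top. (Zint (?U T) - Zint T) / T < ?c + 1" by (rule order_tendstoD(2)[OF m]) simp
  obtain C where C: "((\<lambda>T. Zint T / T - ln T) \<longlongrightarrow> C) at_top" using Zint_asymp by blast
  have l: "filterlim (\<lambda>T::real. 2 * T) at_top at_top" by real_asymp
  have l2: "filterlim (\<lambda>T::real. 2 * ln (2 * T) - ln T) at_top at_top" by real_asymp
  have "filterlim (\<lambda>T. (2 * (Zint (2 * T) / (2 * T) - ln (2 * T)) - (Zint T / T - ln T)) + (2 * ln (2 * T) - ln T)) at_top at_top"
    by (rule filterlim_tendsto_add_at_top[OF tendsto_diff[OF tendsto_mult[OF tendsto_const filterlim_compose[OF C l]] C] l2])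
  hence "\<forall>\<^sub>F T in at_top. ?c + 1 \<le> (2 * (Zint (2 * T) / (2 * T) - ln (2 * T)) - (Zint T / T - ln T)) + (2 * ln (2 * T) - ln T)"
    unfolding filterlim_at_top by blast
  with a b d ladder_inverse[OF assms] show ?thesis
    using eventually_gt_at_top[of 0] eventually_gt_at_top[of "- h"]
  proof eventually_elim
    case (elim T)
    let ?V = "?U T"
    have "(Zint (T + h) - Zint T) / T < (Zint ?V - Zint T) / T" using elim by linarith
    hence "Zint (T + h) < Zint ?V" using elim by (simp add: divide_less_cancel)
    hence "\<not> ?V \<le> T + h" using Zint_mono[of ?V "T + h"] elim by auto
    moreover have "(Zint ?V - Zint T) / T < (Zint (2 * T) - Zint T) / T"
      using elim by (simp add: diff_divide_distrib)
    hence "Zint ?V < Zint (2 * T)" using elim by (simp add: divide_less_cancel)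
    hence "\<not> 2 * T \<le> ?V" using Zint_mono[of "2 * T" ?V] elim by auto
    ultimately show ?case by simp
  qed
qed

theorem theorem6:
  fixes y0 x :: real and \<mu> :: "real \<Rightarrow> real" and t0 \<xi>1 \<xi>2 :: "real \<Rightarrow> nat \<Rightarrow> real"
  assumes RH: "riemann_hypothesis"
    and y0: "y0 \<ge> 0"
    and mu: "admissible y0 \<mu>"
    and t0: "\<forall>\<^sub>F T in at_top. \<forall>n\<in>{1..num_gaps y0 \<mu> T}.
               is_max_point (Z_zero y0 \<mu> T n) (Z_zero y0 \<mu> T (n + 1)) (t0 T n)"
    and xi1: "\<And>T n. \<xi>1 T n = bonnet_left (Z_zero y0 \<mu> T n) (t0 T n)"
    and xi2: "\<And>T n. \<xi>2 T n = bonnet_right (t0 T n) (Z_zero y0 \<mu> T (n + 1))"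
    and x: "x > 0"
  shows "((\<lambda>\<tau>. let T = x / (1 - euler_mascheroni) * \<tau> in
            1 / \<tau> * (\<Sum>n = 1..num_gaps y0 \<mu> T. (hardy_Z (t0 T n))\<^sup>2 * (\<xi>2 T n - \<xi>1 T n)))
          \<longlongrightarrow> x) at_top
       \<and> (\<forall>\<^sub>F T in at_top. \<forall>n\<in>{1..num_gaps y0 \<mu> T}.
            Z_zero y0 \<mu> T n < \<xi>1 T n \<and> \<xi>1 T n < t0 T n \<and>
            t0 T n < \<xi>2 T n \<and> \<xi>2 T n < Z_zero y0 \<mu> T (n + 1))"
proof -
  let ?U = "ladder_phi1_inv y0 \<mu>" and ?c = "1 - euler_mascheroni :: real"
  let ?z = "Z_zero y0 \<mu>" and ?N = "num_gaps y0 \<mu>"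
  have c: "?c > 0" using euler_mascheroni_less_13_over_22 by simp
  define S where "S = (\<lambda>T. \<Sum>n = 1..?N T. (hardy_Z (t0 T n))\<^sup>2 * (\<xi>2 T n - \<xi>1 T n))"
  have bd: "\<forall>\<^sub>F T in at_top. T + 4 < ?U T \<and> ?U T \<le> 2 * T" by (rule ladder_phi1_inv_bounds[OF y0 mu])
  have Ut: "filterlim (\<lambda>T. ?U T - h) at_top at_top" if "h \<le> 4" for h
    by (rule filterlim_at_top_mono[OF filterlim_ident eventually_mono[OF bd]]) (use that in auto)
  have gap: "\<forall>\<^sub>F T in at_top. \<exists>t. T - 1 < t \<and> t < T + 1 \<and> hardy_Z t = 0" by (rule zeta_zero_gap[OF RH])
  have T1: "filterlim (\<lambda>T::real. T + 1) at_top at_top" by real_asymp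
  \<comment> \<open>The gap statement is centred, so it is applied at \<open>T + 1\<close> and at
    \<open>?U T - 1\<close> in order that the zeros fall inside the open window.\<close>
  have gap1: "\<forall>\<^sub>F T in at_top. \<exists>t. T < t \<and> t < T + 2 \<and> hardy_Z t = 0"
    using eventually_compose_filterlim[OF gap T1] by (simp add: add.assoc)
  have gap2: "\<forall>\<^sub>F T in at_top. \<exists>t. ?U T - 2 < t \<and> t < ?U T \<and> hardy_Z t = 0"
    using eventually_compose_filterlim[OF gap Ut[of 1]] by simp
  have inner: "\<forall>\<^sub>F T in at_top. \<forall>n\<in>{1..?N T}.
      (?z T n < \<xi>1 T n \<and> \<xi>1 T n < t0 T n \<and> t0 T n < \<xi>2 T n \<and> \<xi>2 T n < ?z T (n + 1)) \<and>
      (hardy_Z (t0 T n))\<^sup>2 * (\<xi>2 T n - \<xi>1 T n) = Zint (?z T (n + 1)) - Zint (?z T n)"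
    using t0 eventually_gt_at_top[of 0] bd gap1
  proof eventually_elim
    case (elim T)
    then obtain t where "T < t" "t < T + 2" "hardy_Z t = 0" by blast
    hence t: "t \<in> Z_zeros y0 \<mu> T" using elim by (simp add: Z_zeros_def)
    show ?case
    proof
      fix n assume n: "n \<in> {1..?N T}"
      have "?z T n \<in> Z_zeros y0 \<mu> T" "?z T (n + 1) \<in> Z_zeros y0 \<mu> T" using n by (auto intro!: Z_zero_mem[OF t])
      hence "0 \<le> ?z T n" "hardy_Z (?z T n) = 0" "hardy_Z (?z T (n + 1)) = 0" using elim by (auto simp: Z_zeros_def)
      from bonnet_points[OF this, of "t0 T n"] elim n
      show "(?z T n < \<xi>1 T n \<and> \<xi>1 T n < t0 T n \<and> t0 T n < \<xi>2 T n \<and> \<xi>2 T n < ?z T (n + 1)) \<and>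
        (hardy_Z (t0 T n))\<^sup>2 * (\<xi>2 T n - \<xi>1 T n) = Zint (?z T (n + 1)) - Zint (?z T n)"
        unfolding xi1 xi2 by blast
    qed
  qed
  have S: "\<forall>\<^sub>F T in at_top. Zint (?U T - 2) - Zint (T + 2) \<le> S T \<and> S T \<le> Zint (?U T) - Zint T"
    using inner eventually_gt_at_top[of 0] bd gap1 gap2
  proof eventually_elim
    case (elim T)
    then obtain s t where s: "T < s" "s < T + 2" "hardy_Z s = 0" and t: "?U T - 2 < t" "t < ?U T" "hardy_Z t = 0" by blast
    have mem: "s \<in> Z_zeros y0 \<mu> T" "t \<in> Z_zeros y0 \<mu> T" using s t elim by (auto simp: Z_zeros_def)
    have "S T = (\<Sum>n = 1..?N T. Zint (?z T (Suc n)) - Zint (?z T n))"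
      unfolding S_def using elim by (intro sum.cong) auto
    also have "\<dots> = Zint (?z T (Suc (?N T))) - Zint (?z T 1)" by (rule sum_Suc_diff) simp
    finally have ST: "S T = Zint (?z T (?N T + 1)) - Zint (?z T 1)" by simp
    have "?z T 1 \<in> Z_zeros y0 \<mu> T" "?z T (?N T + 1) \<in> Z_zeros y0 \<mu> T" by (auto intro!: Z_zero_mem[OF mem(1)])
    hence "T < ?z T 1" "?z T (?N T + 1) < ?U T" by (auto simp: Z_zeros_def)
    moreover have "?z T 1 < T + 2" "?U T - 2 < ?z T (?N T + 1)"
      using Z_zero_first_last[OF mem(1)] Z_zero_first_last[OF mem(2)] s t by auto
    ultimately show ?case
      unfolding ST using elim Zint_mono[of T "?z T 1"] Zint_mono[of "?z T 1" "T + 2"]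
        Zint_mono[of "?U T - 2" "?z T (?N T + 1)"] Zint_mono[of "?z T (?N T + 1)" "?U T"] by linarith
  qed
  have mv: "((\<lambda>T. (Zint (?U T) - Zint T) / T) \<longlongrightarrow> ?c) at_top" by (rule ladder_mean_value[OF y0 mu])
  have lim: "((\<lambda>T. S T / T) \<longlongrightarrow> ?c) at_top"
  proof (rule real_tendsto_sandwich)
    let ?e = "\<lambda>V. (Zint (V + 2) - Zint V) / V"
    show "((\<lambda>T. (Zint (?U T) - Zint T) / T - ?e T - 2 * ?e (?U T - 2)) \<longlongrightarrow> ?c) at_top"
      using tendsto_diff[OF tendsto_diff[OF mv Zint_window[of 2]]
        tendsto_mult[OF tendsto_const filterlim_compose[OF Zint_window[of 2] Ut[of 2]], of 2]] by simp
    show "((\<lambda>T. (Zint (?U T) - Zint T) / T) \<longlongrightarrow> ?c) at_top" by (rule mv)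
    show "\<forall>\<^sub>F T in at_top. S T / T \<le> (Zint (?U T) - Zint T) / T"
      using S eventually_gt_at_top[of 0] by eventually_elim (simp add: divide_right_mono)
    show "\<forall>\<^sub>F T in at_top. (Zint (?U T) - Zint T) / T - ?e T - 2 * ?e (?U T - 2) \<le> S T / T"
      using S eventually_gt_at_top[of 0] bd
    proof eventually_elim
      case (elim T)
      let ?d = "Zint (?U T) - Zint (?U T - 2)"
      have "?d \<ge> 0" using Zint_mono[of "?U T - 2" "?U T"] elim by simp
      \<comment> \<open>\<open>?U T <= 2 T\<close> exchanges the denominator \<open>T\<close> for
        \<open>?U T - 2\<close>, so that \<open>Zint_window\<close> applies at the point
        \<open>?U T - 2\<close>.\<close>
      hence "?d / T \<le> ?d / ((?U T - 2) / 2)" using elim by (intro divide_left_mono) auto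
      hence "?d / T \<le> 2 * ?e (?U T - 2)" by (simp add: mult.commute)
      moreover have "(Zint (?U T) - Zint T) / T - ?e T - ?d / T = (Zint (?U T - 2) - Zint (T + 2)) / T"
        by (simp add: diff_divide_distrib)
      moreover have "\<dots> \<le> S T / T" using elim by (intro divide_right_mono) auto
      ultimately show ?case by linarith
    qed
  qed
  have "filterlim (\<lambda>\<tau>. x / ?c * \<tau>) at_top at_top"
    using c x by (intro filterlim_tendsto_pos_mult_at_top[OF tendsto_const] filterlim_ident) auto
  from tendsto_mult[OF tendsto_const filterlim_compose[OF lim this], of "x / ?c"]
  have "((\<lambda>\<tau>. x / ?c * (S (x / ?c * \<tau>) / (x / ?c * \<tau>))) \<longlongrightarrow> x) at_top" using c by simp
  moreover have "x / ?c * (S (x / ?c * \<tau>) / (x / ?c * \<tau>)) = 1 / \<tau> * S (x / ?c * \<tau>)" for \<tau> using c x by simp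
  ultimately have "((\<lambda>\<tau>. 1 / \<tau> * S (x / ?c * \<tau>)) \<longlongrightarrow> x) at_top" by simp
  moreover have "\<forall>\<^sub>F T in at_top. \<forall>n\<in>{1..?N T}. ?z T n < \<xi>1 T n \<and> \<xi>1 T n < t0 T n \<and> t0 T n < \<xi>2 T n \<and> \<xi>2 T n < ?z T (n + 1)"
    using inner by eventually_elim blast
  ultimately show ?thesis unfolding S_def Let_def by blast
qed

end
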